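(* Let $p^1(x)=-x_1^2-x_2^2$ and $p^2(x)=x_1^2+x_2^2$ on $\mathbb{R}^2$, and let $u$ be a solution to the double obstacle problem with obstacles $p^1,p^2$ in a neighbourhood of the origin. Let $0<\phi_1,\phi_2<\pi$ and let $\mu=\mu_{\phi_1,\phi_2}$ be the double-cone solution given in polar coordinates by $$\mu(r,\theta)=\begin{cases} r^2, & -\phi_2\le2\theta\le\phi_1\\ r^2\cos(2\theta-\phi_1), & \phi_1\le2\theta\le\pi+\phi_1\\ r^2\cos(2\theta+\phi_2), & -\pi-\phi_2\le2\theta\le-\phi_2\\ -r^2, & \text{otherwise.}\end{cases}$$ Assume that $\mu$ is a blow-up of $u$ at the origin, that is, for a sequence $r_j\to0+$ the functions $u(r_jx)/r_j^2$ converge to $\mu$ in $C^{1,\gamma}(B_1)$. Then the blow-up of $u$ at the origin is unique: $$\frac{u(rx)}{r^2}\to\mu(x)\quad\text{as } r\to0+ .$$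
   Context: $B_r$ is the open ball of radius $r$ centred at the origin. A solution to the double obstacle problem in $\Omega$ with obstacles $p^1\le p^2$ is a minimiser of $\int_\Omega|\nabla v|^2dx$ among $v\in W^{1,2}(\Omega)$ with $p^1\le v\le p^2$ and prescribed boundary values; for these obstacles it is in $C^{1,1}_{loc}$ and satisfies $p^1\le u\le p^2$, $\Delta u=-4\chi_{\{u=p^1\}}+4\chi_{\{u=p^2\}}$ a.e. The final convergence may be understood in $L^2(B_1)$. *)

theory Defs
  imports "HOL-Analysis.Analysis"
begin

section \<open>Sobolev functions\<close>

text \<open>Functions on a domain are total functions; their values outside the domain are irrelevant.\<close>

definition gradient :: "('a::euclidean_space \<Rightarrow> real) \<Rightarrow> 'a \<Rightarrow> 'a" where
  "gradient f x = (\<Sum>i\<in>Basis. frechet_derivative f (at x) i *\<^sub>R i)"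

text \<open>\<open>Ck_on k S f\<close>, for open \<open>S\<close>: all partial derivatives of order up to \<open>k\<close> exist and are
  continuous. Total differentiability may be demanded at each step since functions with continuous
  partial derivatives are differentiable.\<close>

fun Ck_on :: "nat \<Rightarrow> 'a::euclidean_space set \<Rightarrow> ('a \<Rightarrow> real) \<Rightarrow> bool" where
  "Ck_on 0 S f \<longleftrightarrow> continuous_on S f"
| "Ck_on (Suc k) S f \<longleftrightarrow>
     (\<forall>x\<in>S. f differentiable at x) \<and> (\<forall>i\<in>Basis. Ck_on k S (\<lambda>x. gradient f x \<bullet> i))"

definition test_function :: "'a::euclidean_space set \<Rightarrow> ('a \<Rightarrow> real) \<Rightarrow> bool" where
  "test_function S \<phi> \<longleftrightarrow>
     (\<forall>k. Ck_on k UNIV \<phi>) \<and> compact (closure {x. \<phi> x \<noteq> 0}) \<and> closure {x. \<phi> x \<noteq> 0} \<subseteq> S"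

definition L2_on :: "'a::euclidean_space set \<Rightarrow> ('a \<Rightarrow> 'b::euclidean_space) \<Rightarrow> bool" where
  "L2_on S f \<longleftrightarrow>
     f \<in> borel_measurable (lebesgue_on S) \<and> integrable (lebesgue_on S) (\<lambda>x. (norm (f x))\<^sup>2)"

definition tendsto_L2 ::
    "'a::euclidean_space set \<Rightarrow> ('c \<Rightarrow> 'a \<Rightarrow> 'b::euclidean_space) \<Rightarrow> ('a \<Rightarrow> 'b) \<Rightarrow> 'c filter \<Rightarrow> bool" where
  "tendsto_L2 S f g F \<longleftrightarrow>
     L2_on S g \<and> (\<forall>\<^sub>F j in F. L2_on S (f j)) \<and>
     ((\<lambda>j. \<integral>x. (norm (f j x - g x))\<^sup>2 \<partial>lebesgue_on S) \<longlongrightarrow> 0) F"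

text \<open>\<open>f\<close> belongs to \<open>W\<^sup>1\<^sup>,\<^sup>2(S)\<close> and has weak gradient \<open>G\<close>.\<close>

definition has_W12_gradient ::
    "'a::euclidean_space set \<Rightarrow> ('a \<Rightarrow> real) \<Rightarrow> ('a \<Rightarrow> 'a) \<Rightarrow> bool" where
  "has_W12_gradient S f G \<longleftrightarrow>
     L2_on S f \<and> L2_on S G \<and>
     (\<forall>\<phi> i. test_function S \<phi> \<longrightarrow> i \<in> Basis \<longrightarrow>
        (\<integral>x. f x * (gradient \<phi> x \<bullet> i) \<partial>lebesgue_on S) = - (\<integral>x. (G x \<bullet> i) * \<phi> x \<partial>lebesgue_on S))"

definition W12 :: "'a::euclidean_space set \<Rightarrow> ('a \<Rightarrow> real) set" where
  "W12 S = {f. \<exists>G. has_W12_gradient S f G}"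

text \<open>The closure of the test functions in \<open>W\<^sup>1\<^sup>,\<^sup>2(S)\<close>.\<close>

definition W12_0 :: "'a::euclidean_space set \<Rightarrow> ('a \<Rightarrow> real) set" where
  "W12_0 S = {f. \<exists>G \<phi>. has_W12_gradient S f G \<and> (\<forall>n::nat. test_function S (\<phi> n)) \<and>
     tendsto_L2 S \<phi> f sequentially \<and> tendsto_L2 S (\<lambda>n. gradient (\<phi> n)) G sequentially}"


section \<open>The double obstacle problem\<close>

text \<open>Boundary values are prescribed, in the trace sense, by a function \<open>g\<close> in \<open>W\<^sup>1\<^sup>,\<^sup>2\<close>.\<close>

definition admissible ::
    "'a::euclidean_space set \<Rightarrow> ('a \<Rightarrow> real) \<Rightarrow> ('a \<Rightarrow> real) \<Rightarrow> ('a \<Rightarrow> real) \<Rightarrow> ('a \<Rightarrow> real) set" where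
  "admissible \<Omega> p1 p2 g =
     {v \<in> W12 \<Omega>. (AE x in lebesgue_on \<Omega>. p1 x \<le> v x \<and> v x \<le> p2 x) \<and> (\<lambda>x. v x - g x) \<in> W12_0 \<Omega>}"

text \<open>Weak gradients are unique up to null sets, so the Dirichlet integrals below do not depend
  on the choice of \<open>G\<close> and \<open>H\<close>.\<close>

definition double_obstacle_solution ::
    "'a::euclidean_space set \<Rightarrow> ('a \<Rightarrow> real) \<Rightarrow> ('a \<Rightarrow> real) \<Rightarrow> ('a \<Rightarrow> real) \<Rightarrow> bool" where
  "double_obstacle_solution \<Omega> p1 p2 u \<longleftrightarrow>
     (\<exists>g\<in>W12 \<Omega>. u \<in> admissible \<Omega> p1 p2 g \<and>
        (\<forall>v\<in>admissible \<Omega> p1 p2 g. \<forall>G H. has_W12_gradient \<Omega> u G \<longrightarrow> has_W12_gradient \<Omega> v H \<longrightarrow>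
           (\<integral>x. (norm (G x))\<^sup>2 \<partial>lebesgue_on \<Omega>) \<le> (\<integral>x. (norm (H x))\<^sup>2 \<partial>lebesgue_on \<Omega>)))"


section \<open>Blow-ups\<close>

definition C1_holder :: "real \<Rightarrow> 'a::euclidean_space set \<Rightarrow> ('a \<Rightarrow> real) set" where
  "C1_holder \<gamma> S = {f. (\<forall>x\<in>S. f differentiable at x) \<and>
     (\<exists>M. \<forall>x\<in>S. \<bar>f x\<bar> \<le> M \<and> norm (gradient f x) \<le> M \<and>
        (\<forall>y\<in>S. norm (gradient f x - gradient f y) \<le> M * dist x y powr \<gamma>))}"

text \<open>In the last supremum the pairs with \<open>x = y\<close> contribute \<open>0 / 0 = 0\<close>.\<close>

definition C1_holder_norm :: "real \<Rightarrow> 'a::euclidean_space set \<Rightarrow> ('a \<Rightarrow> real) \<Rightarrow> real" where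
  "C1_holder_norm \<gamma> S f =
     (SUP x\<in>S. \<bar>f x\<bar>) + (SUP x\<in>S. norm (gradient f x)) +
     (SUP (x, y)\<in>S \<times> S. norm (gradient f x - gradient f y) / dist x y powr \<gamma>)"

definition tendsto_C1_holder ::
    "real \<Rightarrow> 'a::euclidean_space set \<Rightarrow> ('c \<Rightarrow> 'a \<Rightarrow> real) \<Rightarrow> ('a \<Rightarrow> real) \<Rightarrow> 'c filter \<Rightarrow> bool" where
  "tendsto_C1_holder \<gamma> S f g F \<longleftrightarrow>
     g \<in> C1_holder \<gamma> S \<and> (\<forall>\<^sub>F j in F. f j \<in> C1_holder \<gamma> S) \<and>
     ((\<lambda>j. C1_holder_norm \<gamma> S (\<lambda>x. f j x - g x)) \<longlongrightarrow> 0) F"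

definition rescaling :: "('a::euclidean_space \<Rightarrow> real) \<Rightarrow> real \<Rightarrow> 'a \<Rightarrow> real" where
  "rescaling u r x = u (r *\<^sub>R x) / r\<^sup>2"

definition is_blowup_at_0 ::
    "real \<Rightarrow> ('a::euclidean_space \<Rightarrow> real) \<Rightarrow> ('a \<Rightarrow> real) \<Rightarrow> bool" where
  "is_blowup_at_0 \<gamma> u u0 \<longleftrightarrow>
     (\<exists>r::nat \<Rightarrow> real. filterlim r (at_right 0) sequentially \<and>
        tendsto_C1_holder \<gamma> (ball 0 1) (\<lambda>j. rescaling u (r j)) u0 sequentially)"


section \<open>The double-cone solutions\<close>

text \<open>The polar angle is normalised to lie in \<open>(- pi, pi]\<close>, so that \<open>2 \<theta>\<close> ranges over
  \<open>(- 2 pi, 2 pi]\<close>; where two cases overlap, the values agree.\<close>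

definition double_cone :: "real \<Rightarrow> real \<Rightarrow> real^2 \<Rightarrow> real" where
  "double_cone \<phi>1 \<phi>2 x =
     (let r = norm x; \<theta> = Arg (Complex (x $ 1) (x $ 2)) in
      if - \<phi>2 \<le> 2 * \<theta> \<and> 2 * \<theta> \<le> \<phi>1 then r\<^sup>2
      else if \<phi>1 \<le> 2 * \<theta> \<and> 2 * \<theta> \<le> pi + \<phi>1 then r\<^sup>2 * cos (2 * \<theta> - \<phi>1)
      else if - pi - \<phi>2 \<le> 2 * \<theta> \<and> 2 * \<theta> \<le> - \<phi>2 then r\<^sup>2 * cos (2 * \<theta> + \<phi>2)
      else - r\<^sup>2)"

end

theory Submission
  imports Defs
begin

text \<open>An epiperimetric inequality drives the proof. In polar coordinates the rescalings are the
  profiles \<open>f(r, \<theta>) = u(r e\<^sup>i\<^sup>\<theta>) / r\<^sup>2\<close>, which satisfy \<open>\<bar>f\<bar> \<le> 1\<close> because the obstacles are homogeneous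
  of degree two. Convexity of the constraint makes \<open>r\<^sup>2 ((1 - (r/R)\<^sup>\<alpha>) p + (r/R)\<^sup>\<alpha> f(R, \<cdot>))\<close> an admissible
  competitor in the disc of radius \<open>R\<close> for every double-cone profile \<open>p\<close>. With \<open>\<alpha> = 0\<close> it yields Weiss'
  monotonicity formula. If \<open>f(R, \<cdot>)\<close> is \<open>L\<^sup>2\<close>-close to a double cone, choosing the transition zones of
  \<open>p\<close> centred at zeros of \<open>f(R, \<cdot>)\<close> removes the kernel of the second variation, and a small \<open>\<alpha> > 0\<close>
  yields \<open>r W' \<ge> \<beta> W + \<parallel>r \<partial>\<^sub>r f\<parallel>\<^sup>2\<close> for the normalised Weiss energy \<open>W \<ge> 0\<close>. Hence
  \<open>\<parallel>f(r, \<cdot>) - f(s, \<cdot>)\<parallel>\<^sup>2 \<le> W(r) / \<beta>\<close> for \<open>s < r\<close> as long as \<open>f\<close> stays close to the cone. Since \<open>W\<close> tends to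
  \<open>0\<close> along the given sequence, a continuity argument shows that \<open>f\<close> never leaves the neighbourhood, and
  the profiles converge as \<open>r \<rightarrow> 0\<close>.\<close>

section \<open>Differentiation and smooth functions\<close>

text \<open>Two obstacles shape the analysis on the circle. Expanding the energy of a profile c = p
  + g about a cone profile p gives 2 A + Q with Q the integral of g'^2 - 4 g^2. This Q can be
  negative because of the contact zones, where p is 1 or -1, and it degenerates for rotations of
  each transition zone. The first variation A repairs the contact zones: |c| \<le> 1 fixes the sign
  of g there, so A is four times the L1 norm of g over them and beats a fixed multiple of g^2 once g
  is uniformly small. Uniform smallness is more than the L2 closeness that is propagated from radius
  to radius. Hence a dichotomy: either Q already dominates the L2 norm of g, or g' is bounded by g
  in L2 and a Sobolev estimate yields uniform smallness.

  Minimality enters as a variational inequality for C1 perturbations supported in annuli; the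
  cut-off in the radius is then removed by a limit. The C1 regularity of \<open>u\<close> near 0 is
  read off from a single rescaling of the convergent sequence, and the convergence of gradients
  makes the Weiss energy tend to 0 along it.\<close>

lemma gradient_eqI:
  assumes "(f has_derivative (\<lambda>h. v \<bullet> h)) (at x)"
  shows "gradient f x = v"
proof -
  have "frechet_derivative f (at x) = (\<lambda>h. v \<bullet> h)"
    using frechet_derivative_at[OF assms] by simp
  then show ?thesis
    by (simp add: gradient_def euclidean_representation)
qed

lemma has_derivative_gradient:
  assumes "f differentiable (at x)"
  shows "(f has_derivative (\<lambda>h. gradient f x \<bullet> h)) (at x)"
proof -
  let ?D = "frechet_derivative f (at x)"
  have D: "(f has_derivative ?D) (at x)"
    using assms frechet_derivative_works by blast
  then have lin: "linear ?D" by (rule has_derivative_linear)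
  have "?D h = gradient f x \<bullet> h" for h
  proof -
    have "?D h = ?D (\<Sum>i\<in>Basis. (h \<bullet> i) *\<^sub>R i)"
      by (simp add: euclidean_representation)
    also have "\<dots> = (\<Sum>i\<in>Basis. (h \<bullet> i) * ?D i)"
      by (simp add: linear_sum[OF lin] linear_cmul[OF lin])
    also have "\<dots> = gradient f x \<bullet> h"
      by (simp add: gradient_def inner_sum_left) (simp add: inner_commute mult.commute)
    finally show ?thesis .
  qed
  then have "?D = (\<lambda>h. gradient f x \<bullet> h)" by blast
  then show ?thesis using D by metis
qed

lemma gradient_inner_eqI:
  assumes "(f has_derivative D) (at x)"
  shows "gradient f x \<bullet> h = D h"
proof -
  have "(f has_derivative (\<lambda>h. gradient f x \<bullet> h)) (at x)"
    using assms has_derivative_gradient differentiableI by blast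
  from has_derivative_unique[OF this assms] show ?thesis by meson
qed

lemma gradient_add:
  assumes "f differentiable (at x)" "g differentiable (at x)"
  shows "gradient (\<lambda>x. f x + g x) x = gradient f x + gradient g x"
  by (rule gradient_eqI)
     (use has_derivative_add[OF has_derivative_gradient[OF assms(1)] has_derivative_gradient[OF assms(2)]]
       in \<open>simp add: inner_add_left\<close>)

lemma gradient_diff:
  assumes "f differentiable (at x)" "g differentiable (at x)"
  shows "gradient (\<lambda>x. f x - g x) x = gradient f x - gradient g x"
  by (rule gradient_eqI)
     (use has_derivative_diff[OF has_derivative_gradient[OF assms(1)] has_derivative_gradient[OF assms(2)]]
       in \<open>simp add: inner_diff_left\<close>)

lemma gradient_cmult:
  assumes "f differentiable (at x)"
  shows "gradient (\<lambda>x. c * f x) x = c *\<^sub>R gradient f x"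
  by (rule gradient_eqI)
     (use has_derivative_mult_right[OF has_derivative_gradient[OF assms], of c] in simp)

lemma gradient_mult:
  assumes "f differentiable (at x)" "g differentiable (at x)"
  shows "gradient (\<lambda>x. f x * g x) x = f x *\<^sub>R gradient g x + g x *\<^sub>R gradient f x"
  by (rule gradient_eqI)
     (use has_derivative_mult[OF has_derivative_gradient[OF assms(1)] has_derivative_gradient[OF assms(2)]]
       in \<open>simp add: inner_add_left mult.commute\<close>)

lemma gradient_cong:
  assumes "open S" "x \<in> S" "\<And>y. y \<in> S \<Longrightarrow> f y = g y"
  shows "gradient f x = gradient g x"
proof -
  have "(f has_derivative D) (at x) \<longleftrightarrow> (g has_derivative D) (at x)" for D
    using has_derivative_transform_within_open[of f D x UNIV S g]
      has_derivative_transform_within_open[of g D x UNIV S f] assms by auto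
  then show ?thesis
    unfolding gradient_def frechet_derivative_def by simp
qed

text \<open>The rules for gradients of sums and products hold only at points of differentiability,
  so gradients can be rewritten only on the open set \<open>S\<close>; the induction hands equality
  on \<open>S\<close> down to the gradients.\<close>

lemma Ck_on_cong:
  assumes "open S" "\<And>y. y \<in> S \<Longrightarrow> f y = g y"
  shows "Ck_on k S f \<longleftrightarrow> Ck_on k S g"
  using assms(2)
proof (induction k arbitrary: f g)
  case 0
  then show ?case by (simp cong: continuous_on_cong)
next
  case (Suc k)
  have "f differentiable (at x) \<longleftrightarrow> g differentiable (at x)" if "x \<in> S" for x
  proof -
    have "(f has_derivative D) (at x) \<longleftrightarrow> (g has_derivative D) (at x)" for D
      using has_derivative_transform_within_open[of f D x UNIV S g]
        has_derivative_transform_within_open[of g D x UNIV S f] assms(1) that Suc.prems by auto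
    then show ?thesis by (simp add: differentiable_def)
  qed
  moreover have "Ck_on k S (\<lambda>x. gradient f x \<bullet> i) \<longleftrightarrow> Ck_on k S (\<lambda>x. gradient g x \<bullet> i)" for i
    by (rule Suc.IH) (use gradient_cong[OF assms(1) _ Suc.prems] in auto)
  ultimately show ?case by simp
qed

lemma Ck_on_SucD:
  assumes "open S" "Ck_on (Suc k) S f"
  shows "Ck_on k S f"
  using assms(2)
proof (induction k arbitrary: f)
  case 0
  then show ?case
    by (auto intro!: continuous_at_imp_continuous_on differentiable_imp_continuous_within)
next
  case (Suc k)
  then show ?case by auto
qed

lemma Ck_on_add:
  assumes "open S" "Ck_on k S f" "Ck_on k S g"
  shows "Ck_on k S (\<lambda>x. f x + g x)"
  using assms(2,3)
proof (induction k arbitrary: f g)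
  case 0
  then show ?case by (auto intro: continuous_intros)
next
  case (Suc k)
  have "Ck_on k S (\<lambda>x. gradient (\<lambda>x. f x + g x) x \<bullet> i)" if "i \<in> Basis" for i
  proof -
    have "Ck_on k S (\<lambda>x. gradient f x \<bullet> i + gradient g x \<bullet> i)"
      using Suc that by auto
    then show ?thesis
      using Suc.prems
      by (subst Ck_on_cong[OF assms(1), of _ "\<lambda>x. gradient f x \<bullet> i + gradient g x \<bullet> i"])
         (auto simp: gradient_add inner_add_left)
  qed
  then show ?case using Suc.prems by auto
qed

lemma Ck_on_mult:
  assumes "open S" "Ck_on k S f" "Ck_on k S g"
  shows "Ck_on k S (\<lambda>x. f x * g x)"
  using assms(2,3)
proof (induction k arbitrary: f g)
  case 0
  then show ?case by (auto intro: continuous_intros)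
next
  case (Suc k)
  have "Ck_on k S (\<lambda>x. gradient (\<lambda>x. f x * g x) x \<bullet> i)" if "i \<in> Basis" for i
  proof -
    have "Ck_on k S (\<lambda>x. f x * (gradient g x \<bullet> i) + g x * (gradient f x \<bullet> i))"
      using Suc that Ck_on_SucD[OF assms(1)] by (intro Ck_on_add[OF assms(1)] Suc.IH) auto
    then show ?thesis
      using Suc.prems
      by (subst Ck_on_cong[OF assms(1), of _ "\<lambda>x. f x * (gradient g x \<bullet> i) + g x * (gradient f x \<bullet> i)"])
         (auto simp: gradient_mult inner_add_left)
  qed
  then show ?case using Suc.prems by auto
qed

lemma gradient_const [simp]: "gradient (\<lambda>x. c) x = 0"
  by (rule gradient_eqI) simp

lemma Ck_on_const: "Ck_on k S (\<lambda>x. c)"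
  by (induction k arbitrary: c) auto

lemma gradient_inner_left [simp]: "gradient (\<lambda>x. v \<bullet> x) x = v"
  by (rule gradient_eqI) (auto intro!: derivative_eq_intros)

lemma Ck_on_inner_left: "Ck_on k S (\<lambda>x. v \<bullet> x)"
  by (cases k) (auto intro!: continuous_intros simp: Ck_on_const)

section \<open>A smooth bump function\<close>

text \<open>The functions \<open>x\<^sup>-\<^sup>n exp (- 1 / x)\<close>, extended by \<open>0\<close>, are closed under differentiation up to
  linear combinations.\<close>

definition flat :: "nat \<Rightarrow> real \<Rightarrow> real" where
  "flat n x = (if x \<le> 0 then 0 else exp (- (1 / x)) / x ^ n)"

lemma flat_nonneg: "0 \<le> flat n x"
  by (simp add: flat_def)

text \<open>The substitution x = 1 / t turns this into the decay of t^n / exp t at infinity.\<close>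

lemma flat_tendsto: "((\<lambda>x. exp (- (1 / x)) / x ^ n) \<longlongrightarrow> 0) (at_right (0::real))"
proof -
  have "((\<lambda>x::real. x ^ n / exp x) \<longlongrightarrow> 0) at_top"
    by (rule tendsto_power_div_exp_0)
  then have "((\<lambda>x::real. (inverse x) ^ n / exp (inverse x)) \<longlongrightarrow> 0) (at_right 0)"
    by (rule filterlim_compose) (rule filterlim_inverse_at_top_right)
  then show ?thesis
    by (simp add: exp_minus field_simps inverse_eq_divide power_divide)
qed

lemma has_field_derivative_flat:
  "(flat n has_field_derivative (flat (n + 2) x - real n * flat (n + 1) x)) (at x)"
proof -
  consider "x < 0" | "x = 0" | "x > 0" by linarith
  then show ?thesis
  proof cases
    case 1
    have "(flat n has_field_derivative 0) (at x)"
      by (rule has_field_derivative_transform_within_open[of "\<lambda>x. 0" _ _ "{..<0}"])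
         (use 1 in \<open>auto simp: flat_def\<close>)
    then show ?thesis using 1 by (simp add: flat_def)
  next
    case 3
    have "((\<lambda>x. exp (- (1 / x)) / x ^ n) has_field_derivative (flat (n + 2) x - real n * flat (n + 1) x)) (at x)"
      using 3 apply (auto intro!: derivative_eq_intros simp: flat_def)
      apply (cases n)
       apply (auto simp: field_simps power2_eq_square)
      done
    then show ?thesis
      by (rule has_field_derivative_transform_within_open[of _ _ _ "{0<..}"])
         (use 3 in \<open>auto simp: flat_def\<close>)
  next
    case 2
    \<comment> \<open>For y > 0 the difference quotient at 0 is \<open>flat (Suc n) y\<close>; for y
      < 0 it is zero.\<close>
    have r: "((\<lambda>y. flat n y / y) \<longlongrightarrow> 0) (at_right 0)"
      by (rule Lim_transform_eventually[OF flat_tendsto[of "Suc n"]])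
         (auto simp: flat_def eventually_at_filter field_simps)
    have l: "((\<lambda>y. flat n y / y) \<longlongrightarrow> 0) (at_left 0)"
      by (rule Lim_transform_eventually[OF tendsto_const])
         (auto simp: flat_def eventually_at_filter)
    have "((\<lambda>y. flat n y / y) \<longlongrightarrow> 0) (at 0)"
      using r l filterlim_split_at by blast
    then show ?thesis
      using 2 by (simp add: has_field_derivative_iff flat_def)
  qed
qed

text \<open>The parameter is the square of the radius of the supporting ball, so that only the
  smooth function |x|^2 enters.\<close>

definition bump :: "real \<Rightarrow> 'a::euclidean_space \<Rightarrow> real" where
  "bump d x = flat 0 (d - x \<bullet> x)"

lemma has_derivative_flat_inner:
  "((\<lambda>x. flat n (d - x \<bullet> x)) has_derivative
     (\<lambda>h. (flat (n + 2) (d - x \<bullet> x) + (- real n) * flat (n + 1) (d - x \<bullet> x)) * ((-2 *\<^sub>R h) \<bullet> x))) (at x)"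
proof -
  have "((\<lambda>x. d - x \<bullet> x) has_derivative (\<lambda>h. (-2 *\<^sub>R h) \<bullet> x)) (at x)"
    by (auto intro!: derivative_eq_intros simp: inner_commute)
  from has_derivative_compose[OF this has_field_derivative_flat[unfolded has_field_derivative_def]]
  show ?thesis by simp
qed

text \<open>The induction runs over all \<open>n\<close> at once, since differentiation raises the
  exponent in \<open>flat\<close> by one or two.\<close>

lemma Ck_on_flat_inner: "Ck_on k UNIV (\<lambda>x. flat n (d - x \<bullet> x))"
proof (induction k arbitrary: n)
  case 0
  then show ?case
    using has_derivative_flat_inner[of n]
    by (auto intro!: continuous_at_imp_continuous_on has_derivative_continuous)
next
  case (Suc k)
  have "Ck_on k UNIV (\<lambda>x. (flat (n + 2) (d - x \<bullet> x) + (- real n) * flat (n + 1) (d - x \<bullet> x)) * ((-2 *\<^sub>R i) \<bullet> x))"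
    for i :: 'a
    by (intro Ck_on_mult Ck_on_add Suc.IH Ck_on_const Ck_on_inner_left open_UNIV)
  then show ?case
    using has_derivative_flat_inner[of n]
    unfolding Ck_on.simps by (subst gradient_inner_eqI[OF has_derivative_flat_inner]) (auto simp: differentiable_def)
qed

lemma Ck_on_bump: "Ck_on k UNIV (bump d :: 'a::euclidean_space \<Rightarrow> real)"
  unfolding bump_def[abs_def] by (rule Ck_on_flat_inner)

lemma bump_nonneg: "0 \<le> bump d x"
  by (simp add: bump_def flat_nonneg)

lemma bump_minus: "bump d (x - y) = bump d (y - x)"
  by (simp add: bump_def inner_diff_left inner_diff_right inner_commute algebra_simps)

lemma bump_eq_0: "norm x \<ge> r \<Longrightarrow> 0 \<le> r \<Longrightarrow> bump (r\<^sup>2) x = 0"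
  by (simp add: bump_def flat_def dot_square_norm power_mono)

lemma bump_pos: "norm x < r \<Longrightarrow> 0 < bump (r\<^sup>2) x"
  using power_strict_mono[of "norm x" r 2] by (simp add: bump_def flat_def dot_square_norm)

section \<open>Mollification\<close>

definition C1_on :: "'a::euclidean_space set \<Rightarrow> ('a \<Rightarrow> real) \<Rightarrow> bool" where
  "C1_on S f \<longleftrightarrow> (\<forall>x\<in>S. f differentiable (at x)) \<and> continuous_on S (gradient f)"

lemma C1_onI:
  assumes "\<And>x. x \<in> S \<Longrightarrow> (f has_derivative (\<lambda>h. D x \<bullet> h)) (at x)" "continuous_on S D"
  shows "C1_on S f"
proof -
  have "gradient f x = D x" if "x \<in> S" for x
    using gradient_eqI assms(1) that by blast
  then have "continuous_on S (gradient f)"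
    using assms(2) by (simp cong: continuous_on_cong)
  then show ?thesis
    using assms(1) unfolding C1_on_def differentiable_def by blast
qed

lemma C1_on_subset: "C1_on S f \<Longrightarrow> T \<subseteq> S \<Longrightarrow> C1_on T f"
  unfolding C1_on_def using continuous_on_subset by blast

lemma C1_on_continuous_on: "C1_on S f \<Longrightarrow> continuous_on S f"
  unfolding C1_on_def
  by (auto intro!: continuous_at_imp_continuous_on differentiable_imp_continuous_within)

lemma C1_on_mult: "C1_on S f \<Longrightarrow> C1_on S g \<Longrightarrow> C1_on S (\<lambda>x. f x * g x)"
  using C1_on_continuous_on[of S f] C1_on_continuous_on[of S g]
  unfolding C1_on_def by (auto intro!: continuous_intros simp: gradient_mult cong: continuous_on_cong)

lemma C1_on_add: "C1_on S f \<Longrightarrow> C1_on S g \<Longrightarrow> C1_on S (\<lambda>x. f x + g x)"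
  unfolding C1_on_def by (auto intro!: continuous_intros simp: gradient_add cong: continuous_on_cong)

lemma C1_on_diff: "C1_on S f \<Longrightarrow> C1_on S g \<Longrightarrow> C1_on S (\<lambda>x. f x - g x)"
  unfolding C1_on_def by (auto intro!: continuous_intros simp: gradient_diff cong: continuous_on_cong)

lemma C1_on_cmult: "C1_on S f \<Longrightarrow> C1_on S (\<lambda>x. c * f x)"
  unfolding C1_on_def by (auto intro!: continuous_intros simp: gradient_cmult cong: continuous_on_cong)

lemma C1_on_const: "C1_on S (\<lambda>x. c)"
  by (simp add: C1_on_def)

lemma C1_on_cong:
  assumes "open S" "\<And>x. x \<in> S \<Longrightarrow> f x = g x" "C1_on S f"
  shows "C1_on S g"
proof (rule C1_onI)
  show "continuous_on S (gradient f)" using assms(3) by (simp add: C1_on_def)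
  fix x assume "x \<in> S"
  then show "(g has_derivative (\<lambda>h. gradient f x \<bullet> h)) (at x)"
    using has_derivative_transform_within_open[OF has_derivative_gradient[of f x]] assms
    unfolding C1_on_def by blast
qed

lemma C1_on_Un:
  assumes "open S" "open T" "C1_on S f" "C1_on T f"
  shows "C1_on (S \<union> T) f"
  using continuous_on_open_Un[OF assms(1,2)] assms(3,4) unfolding C1_on_def by blast

lemma Ck_on_imp_C1_on:
  assumes "open S" "Ck_on 1 S f"
  shows "C1_on S f"
proof -
  have "continuous_on S (gradient f)"
    by (subst continuous_on_componentwise) (use assms(2) in auto)
  then show ?thesis using assms(2) by (simp add: C1_on_def)
qed

lemma gradient_eq_0_outside:
  assumes "closed K" "\<And>x. x \<notin> K \<Longrightarrow> f x = 0" "x \<notin> K"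
  shows "gradient f x = 0"
  using gradient_cong[of "- K" x f "\<lambda>x. 0"] assms by (auto simp: closed_def)

section \<open>Integration by parts for compactly supported functions\<close>

lemma bounded_compact_support:
  fixes f :: "'a::euclidean_space \<Rightarrow> 'b::real_normed_vector"
  assumes "continuous_on UNIV f" "compact K" "\<And>x. x \<notin> K \<Longrightarrow> f x = 0"
  obtains B where "B > 0" "\<And>x. norm (f x) \<le> B"
proof -
  have "compact (f ` K)" using assms by (meson compact_continuous_image continuous_on_subset subset_UNIV)
  then obtain B where "B > 0" "\<forall>y\<in>f ` K. norm y \<le> B"
    using compact_imp_bounded bounded_pos by blast
  then have "norm (f x) \<le> B" for x using assms(3)[of x] by (cases "x \<in> K") auto
  then show ?thesis using that \<open>B > 0\<close> by blast
qed

lemma integrable_compact_support: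
  fixes f :: "'a::euclidean_space \<Rightarrow> real"
  assumes "continuous_on UNIV f" "compact K" "\<And>x. x \<notin> K \<Longrightarrow> f x = 0"
  shows "integrable lborel f"
proof -
  have "integrable lborel (\<lambda>x. indicator K x *\<^sub>R f x)"
    using assms by (intro borel_integrable_compact) (auto intro: continuous_on_subset)
  moreover have "(\<lambda>x. indicator K x *\<^sub>R f x) = f"
    using assms(3) by (force simp: indicator_def fun_eq_iff)
  ultimately show ?thesis by simp
qed

lemma lborel_integral_translation:
  fixes f :: "'a::euclidean_space \<Rightarrow> real"
  assumes "f \<in> borel_measurable borel"
  shows "(\<integral>x. f (x + c) \<partial>lborel) = (\<integral>x. f x \<partial>lborel)"
proof -
  have "(\<integral>x. f x \<partial>lborel) = (\<integral>x. f x \<partial>distr lborel borel ((+) c))"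
    by (simp add: lborel_distr_plus)
  also have "\<dots> = (\<integral>x. f (c + x) \<partial>lborel)"
    using assms by (intro integral_distr) auto
  finally show ?thesis by (simp add: add.commute)
qed

lemma compact_fattening:
  fixes K :: "'a::euclidean_space set"
  assumes "compact K"
  shows "compact (\<Union>x\<in>K. cball x e)"
proof -
  have "(\<Union>x\<in>K. cball x e) = {x + y |x y. x \<in> K \<and> y \<in> cball 0 e}"
    apply (auto simp: dist_norm)
    subgoal for x y by (rule exI[of _ y], rule exI[of _ "x - y"]) (simp add: norm_minus_commute)
    done
  then show ?thesis using compact_sums[OF assms compact_cball[of 0 e]] by simp
qed

text \<open>Translation invariance makes the integral of every difference quotient in direction
  \<open>i\<close> vanish; dominated convergence carries this over to the derivative.\<close>

lemma integral_partial_derivative_eq_0: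
  fixes F :: "'a::euclidean_space \<Rightarrow> real"
  assumes F: "C1_on UNIV F" and K: "compact K" and z: "\<And>x. x \<notin> K \<Longrightarrow> F x = 0"
  shows "(\<integral>x. gradient F x \<bullet> i \<partial>lborel) = 0"
proof -
  have contF: "continuous_on UNIV F" using F by (rule C1_on_continuous_on)
  have contG: "continuous_on UNIV (gradient F)" using F by (simp add: C1_on_def)
  have dF: "(F has_derivative (\<lambda>h. gradient F x \<bullet> h)) (at x)" for x
    using F by (simp add: C1_on_def has_derivative_gradient)
  have zG: "gradient F x = 0" if "x \<notin> K" for x
    using gradient_eq_0_outside[OF compact_imp_closed[OF K] z that] .
  obtain B where B: "B > 0" "\<And>x. norm (gradient F x) \<le> B"
    using bounded_compact_support[OF contG K zG] by blast
  \<comment> \<open>Steps of length at most |i| keep the supports of all difference quotients inside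
    this set, which makes the dominating function integrable.\<close>
  define K' where "K' = (\<Union>x\<in>K. cball x (norm i))"
  have K': "compact K'" unfolding K'_def using K by (rule compact_fattening)
  define t where "t n = 1 / real (Suc n)" for n
  have t: "t n > 0" "t n \<le> 1" for n by (auto simp: t_def)
  define s where "s n x = (F (x + t n *\<^sub>R i) - F x) / t n" for n x
  have intF: "integrable lborel F" by (rule integrable_compact_support[OF contF K z])
  have intFt: "integrable lborel (\<lambda>x. F (x + c))" for c
  proof -
    have "continuous_on UNIV (\<lambda>x. F (x + c))"
      by (intro continuous_on_compose2[OF contF] continuous_intros) auto
    moreover have "compact ((\<lambda>x. x - c) ` K)"
      by (intro compact_continuous_image continuous_intros K)
    moreover have "F (x + c) = 0" if "x \<notin> (\<lambda>x. x - c) ` K" for x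
      using that by (intro z) (metis add_diff_cancel_right' image_eqI)
    ultimately show ?thesis by (rule integrable_compact_support)
  qed
  have "(\<integral>x. s n x \<partial>lborel) = 0" for n
    unfolding s_def using lborel_integral_translation[of F "t n *\<^sub>R i"]
      borel_measurable_continuous_onI[OF contF] intF intFt by simp
  moreover have "(\<lambda>n. \<integral>x. s n x \<partial>lborel) \<longlonglongrightarrow> (\<integral>x. gradient F x \<bullet> i \<partial>lborel)"
  proof (rule integral_dominated_convergence[where w="\<lambda>x. B * norm i * indicator K' x"])
    show "(\<lambda>x. gradient F x \<bullet> i) \<in> borel_measurable lborel"
      using borel_measurable_continuous_onI[OF contG] by simp
    show "s n \<in> borel_measurable lborel" for n
      unfolding s_def using intF intFt by (intro borel_measurable_divide borel_measurable_diff) auto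
    have "emeasure lborel K' < \<infinity>" using K' by (rule emeasure_compact_finite)
    then show "integrable lborel (\<lambda>x. B * norm i * indicator K' x)"
      using compact_imp_closed[OF K'] by (intro integrable_mult_right) (auto intro!: integrable_real_indicator)
    show "AE x in lborel. (\<lambda>n. s n x) \<longlonglongrightarrow> gradient F x \<bullet> i"
    proof (rule AE_I2)
      fix x
      have "((\<lambda>h. x + h *\<^sub>R i) has_derivative (\<lambda>h. h *\<^sub>R i)) (at 0)"
        by (auto intro!: derivative_eq_intros)
      then have "((\<lambda>h. F (x + h *\<^sub>R i)) has_derivative (\<lambda>h. gradient F x \<bullet> (h *\<^sub>R i))) (at 0)"
        using has_derivative_compose[of _ _ "0::real" UNIV F] dF[of x] by fastforce
      then have "((\<lambda>h. F (x + h *\<^sub>R i)) has_field_derivative (gradient F x \<bullet> i)) (at 0)"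
        unfolding has_field_derivative_def by (rule has_derivative_eq_rhs) (auto simp: mult.commute)
      then have "((\<lambda>h. (F (x + h *\<^sub>R i) - F x) / h) \<longlongrightarrow> gradient F x \<bullet> i) (at 0)"
        by (simp add: has_field_derivative_iff)
      moreover have "filterlim t (at 0) sequentially"
        unfolding filterlim_at t_def by (auto simp del: of_nat_Suc intro!: LIMSEQ_Suc[OF lim_1_over_n])
      ultimately show "(\<lambda>n. s n x) \<longlonglongrightarrow> gradient F x \<bullet> i"
        unfolding s_def by (rule filterlim_compose)
    qed
    fix n
    show "AE x in lborel. norm (s n x) \<le> B * norm i * indicator K' x"
    proof (rule AE_I2)
      fix x
      have lip: "norm (F (x + t n *\<^sub>R i) - F x) \<le> B * norm (x + t n *\<^sub>R i - x)"
      proof (rule differentiable_bound[of UNIV F "\<lambda>x h. gradient F x \<bullet> h"])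
        show "onorm ((\<bullet>) (gradient F y)) \<le> B" for y
          using B(1) order_trans[OF Cauchy_Schwarz_ineq2 mult_right_mono[OF B(2)]]
          by (intro onorm_bound) auto
      qed (auto intro: has_derivative_at_withinI dF)
      show "norm (s n x) \<le> B * norm i * indicator K' x"
      proof (cases "x \<in> K'")
        case True
        then show ?thesis using lip t(1)[of n] by (simp add: s_def field_simps)
      next
        case False
        have "x \<notin> K" using False by (auto simp: K'_def)
        moreover have "x + t n *\<^sub>R i \<notin> K"
        proof
          assume *: "x + t n *\<^sub>R i \<in> K"
          have "x \<in> cball (x + t n *\<^sub>R i) (norm i)"
            using t[of n] by (simp add: dist_norm mult_left_le_one_le)
          then show False using False * by (auto simp: K'_def)
        qed
        ultimately show ?thesis using B(1) by (simp add: s_def z)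
      qed
    qed
  qed
  ultimately show ?thesis using LIMSEQ_unique[OF _ tendsto_const] by fastforce
qed

text \<open>The factor \<open>g\<close> is controlled only on \<open>B\<close>; off \<open>K\<close>
  the product is zero, and the open sets \<open>B\<close> and \<open>- K\<close> cover the
  space.\<close>

lemma continuous_on_mult_cutoff:
  fixes f g :: "'a::euclidean_space \<Rightarrow> real"
  assumes "continuous_on UNIV f" "closed K" "\<And>x. x \<notin> K \<Longrightarrow> f x = 0" "open B" "K \<subseteq> B" "continuous_on B g"
  shows "continuous_on UNIV (\<lambda>x. f x * g x)"
proof -
  have "continuous_on (- K) (\<lambda>x. f x * g x)"
    by (subst continuous_on_cong[OF refl, of _ _ "\<lambda>x. 0"]) (use assms(3) in auto)
  moreover have "continuous_on B (\<lambda>x. f x * g x)"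
    by (intro continuous_intros assms(6) continuous_on_subset[OF assms(1)]) auto
  moreover have "B \<union> - K = UNIV" using assms(5) by auto
  ultimately show ?thesis
    using continuous_on_open_Un[of B "- K"] assms(2,4) by (metis open_Compl)
qed

lemma C1_on_mult_cutoff:
  fixes f g :: "'a::euclidean_space \<Rightarrow> real"
  assumes "C1_on UNIV f" "closed K" "\<And>x. x \<notin> K \<Longrightarrow> f x = 0" "open B" "K \<subseteq> B" "C1_on B g"
  shows "C1_on UNIV (\<lambda>x. f x * g x)"
proof -
  have "C1_on (- K) (\<lambda>x. f x * g x)"
    by (rule C1_on_cong[OF _ _ C1_on_const[of _ 0]]) (use assms(2,3) in auto)
  moreover have "C1_on B (\<lambda>x. f x * g x)"
    by (intro C1_on_mult assms(6) C1_on_subset[OF assms(1)]) auto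
  moreover have "B \<union> - K = UNIV" using assms(5) by auto
  ultimately show ?thesis
    using C1_on_Un[of B "- K"] assms(2,4) by (metis open_Compl)
qed

text \<open>The product rule turns \<open>integral_partial_derivative_eq_0\<close>, applied to f g,
  into integration by parts. The values of \<open>g\<close> off \<open>B\<close> are harmless
  because \<open>f\<close> vanishes there.\<close>

lemma integration_by_parts_compact_support:
  fixes f g :: "'a::euclidean_space \<Rightarrow> real"
  assumes f: "C1_on UNIV f" and g: "C1_on B g" and "open B" "compact K" "K \<subseteq> B" and z: "\<And>x. x \<notin> K \<Longrightarrow> f x = 0"
  shows "(\<integral>x. f x * (gradient g x \<bullet> i) \<partial>lborel) = - (\<integral>x. (gradient f x \<bullet> i) * g x \<partial>lborel)"
proof -
  note K = compact_imp_closed[OF assms(4)]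
  have zG: "gradient f x = 0" if "x \<notin> K" for x
    using gradient_eq_0_outside[OF K z that] .
  have eq: "gradient (\<lambda>x. f x * g x) x \<bullet> i = f x * (gradient g x \<bullet> i) + (gradient f x \<bullet> i) * g x" for x
  proof (cases "x \<in> K")
    case True
    then have "f differentiable (at x)" "g differentiable (at x)" using f g assms(5) by (auto simp: C1_on_def)
    then show ?thesis by (simp add: gradient_mult inner_add_left)
  next
    case False
    have "gradient (\<lambda>x. f x * g x) x = 0"
      by (rule gradient_eq_0_outside[OF K _ False]) (simp add: z)
    then show ?thesis using False by (simp add: zG z)
  qed
  have c: "continuous_on UNIV f" "continuous_on B g" "continuous_on UNIV (gradient f)" "continuous_on B (gradient g)"
    using f g by (auto simp: C1_on_continuous_on) (auto simp: C1_on_def)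
  have i1: "integrable lborel (\<lambda>x. f x * (gradient g x \<bullet> i))"
    by (rule integrable_compact_support[OF continuous_on_mult_cutoff[OF c(1) K _ assms(3,5)] assms(4)])
       (use z in \<open>auto intro!: continuous_intros c\<close>)
  have i2: "integrable lborel (\<lambda>x. (gradient f x \<bullet> i) * g x)"
    by (rule integrable_compact_support[OF continuous_on_mult_cutoff[OF _ K _ assms(3,5)] assms(4)])
       (use zG in \<open>auto intro!: continuous_intros c\<close>)
  have "0 = (\<integral>x. gradient (\<lambda>x. f x * g x) x \<bullet> i \<partial>lborel)"
    using integral_partial_derivative_eq_0[OF C1_on_mult_cutoff[OF f K z assms(3,5) g] assms(4)] z by simp
  also have "\<dots> = (\<integral>x. f x * (gradient g x \<bullet> i) \<partial>lborel) + (\<integral>x. (gradient f x \<bullet> i) * g x \<partial>lborel)"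
    unfolding eq by (rule Bochner_Integration.integral_add[OF i1 i2])
  finally show ?thesis by simp
qed

section \<open>Convolution with a smooth kernel\<close>

lemma has_derivative_convolution:
  fixes \<psi> h :: "'a::euclidean_space \<Rightarrow> real"
  assumes \<psi>: "C1_on UNIV \<psi>" and h: "continuous_on (cbox a b) h"
  shows "((\<lambda>x. integral (cbox a b) (\<lambda>y. h y * \<psi> (x - y))) has_derivative
    (\<lambda>v. integral (cbox a b) (\<lambda>y. h y * (gradient \<psi> (x - y) \<bullet> v)))) (at x)"
proof -
  have cG: "continuous_on UNIV (gradient \<psi>)" and c: "continuous_on UNIV \<psi>"
    using \<psi> by (simp_all add: C1_on_continuous_on) (simp add: C1_on_def)
  define D where "D x y = h y *\<^sub>R blinfun_inner_right (gradient \<psi> (x - y))" for x y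
  have cD: "continuous_on (UNIV \<times> cbox a b) (\<lambda>(x, y). D x y)"
    unfolding D_def split_beta
    by (intro continuous_intros continuous_on_compose2[OF cG] continuous_on_compose2[OF h]
        bounded_linear.continuous_on[OF bounded_linear_blinfun_inner_right]) auto
  have "((\<lambda>x. integral (cbox a b) (\<lambda>y. h y * \<psi> (x - y))) has_derivative
    blinfun_apply (integral (cbox a b) (D x))) (at x within UNIV)"
  proof (rule leibniz_rule[OF _ _ cD])
    fix x y :: 'a
    have "((\<lambda>x. x - y) has_derivative (\<lambda>h. h)) (at x)" by (auto intro!: derivative_eq_intros)
    from has_derivative_compose[OF this, of \<psi> "\<lambda>v. gradient \<psi> (x - y) \<bullet> v"]
    have "((\<lambda>x. \<psi> (x - y)) has_derivative (\<lambda>v. gradient \<psi> (x - y) \<bullet> v)) (at x)"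
      using \<psi> by (simp add: C1_on_def has_derivative_gradient)
    from has_derivative_mult_right[OF this, of "h y"]
    show "((\<lambda>x. h y * \<psi> (x - y)) has_derivative blinfun_apply (D x y)) (at x within UNIV)"
      by (simp add: D_def scaleR_blinfun.rep_eq inner_commute)
  next
    fix x :: 'a
    show "(\<lambda>y. h y * \<psi> (x - y)) integrable_on cbox a b"
      by (intro integrable_continuous continuous_intros h continuous_on_compose2[OF c]) auto
  qed auto
  moreover have "D x integrable_on cbox a b"
    by (rule integrable_continuous) (use cD in \<open>auto intro!: continuous_on_compose2[OF cD, where f="\<lambda>y. (x, y)", simplified] continuous_intros\<close>)
  then have "blinfun_apply (integral (cbox a b) (D x)) = (\<lambda>v. integral (cbox a b) (\<lambda>y. h y * (gradient \<psi> (x - y) \<bullet> v)))"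
    by (auto simp: blinfun_apply_integral D_def scaleR_blinfun.rep_eq inner_commute)
  ultimately show ?thesis by simp
qed

text \<open>Each derivative falls on the kernel, so the induction replaces \<psi> by its partial
  derivatives while the continuous factor \<open>h\<close> stays as it is.\<close>

lemma Ck_on_convolution:
  fixes \<psi> h :: "'a::euclidean_space \<Rightarrow> real"
  assumes "\<And>k. Ck_on k UNIV \<psi>" and h: "continuous_on (cbox a b) h"
  shows "Ck_on k UNIV (\<lambda>x. integral (cbox a b) (\<lambda>y. h y * \<psi> (x - y)))"
  using assms(1)
proof (induction k arbitrary: \<psi>)
  case 0
  have C1: "C1_on UNIV \<psi>" using 0[of 1] Ck_on_imp_C1_on by blast
  show ?case
    using has_derivative_convolution[OF C1 h]
    by (auto intro!: continuous_at_imp_continuous_on has_derivative_continuous)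
next
  case (Suc k)
  have C1: "C1_on UNIV \<psi>" using Suc.prems[of 1] Ck_on_imp_C1_on by blast
  have "Ck_on k UNIV (\<lambda>x. integral (cbox a b) (\<lambda>y. h y * (gradient \<psi> (x - y) \<bullet> i)))" if "i \<in> Basis" for i
    by (rule Suc.IH) (use Suc.prems[of "Suc _"] that in auto)
  then show ?case
    using has_derivative_convolution[OF C1 h]
    by (auto simp: gradient_inner_eqI[OF has_derivative_convolution[OF C1 h]] differentiable_def)
qed


text \<open>Perturbations built in polar coordinates are only C1, whereas \<open>W12_0\<close> and
  weak gradients are defined through smooth functions. Mollification bridges the gap: by integration
  by parts the gradient of the mollified function is the mollified gradient, so both converge
  uniformly, with supports in one compact set.\<close>

lemma C1_imp_test_function_limit:
  fixes \<zeta> :: "'a::euclidean_space \<Rightarrow> real"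
  assumes "open S" "compact K" "K \<subseteq> S" and \<zeta>: "C1_on UNIV \<zeta>" and z: "\<And>x. x \<notin> K \<Longrightarrow> \<zeta> x = 0"
  obtains K' \<phi> where "compact K'" "K' \<subseteq> S" "\<And>n::nat. test_function S (\<phi> n)" "\<And>n x. x \<notin> K' \<Longrightarrow> \<phi> n x = 0"
    "uniform_limit UNIV \<phi> \<zeta> sequentially"
    "uniform_limit UNIV (\<lambda>n. gradient (\<phi> n)) (gradient \<zeta>) sequentially"
proof -
  obtain e where e: "e > 0" "(\<Union>x\<in>K. cball x e) \<subseteq> S"
    using compact_subset_open_imp_cball_epsilon_subset[OF assms(2,1,3)] by blast
  define K' where "K' = (\<Union>x\<in>K. cball x e)"
  have K': "compact K'" "K' \<subseteq> S" unfolding K'_def using compact_fattening assms(2) e(2) by auto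
  obtain a where a: "K \<subseteq> cbox (-a) a"
    using bounded_subset_cbox_symmetric[OF compact_imp_bounded[OF assms(2)]] by blast
  have c\<zeta>: "continuous_on UNIV \<zeta>" and cG: "continuous_on UNIV (gradient \<zeta>)"
    using \<zeta> by (simp_all add: C1_on_continuous_on) (simp add: C1_on_def)
  have zG: "gradient \<zeta> x = 0" if "x \<notin> K" for x
    using gradient_eq_0_outside[OF compact_imp_closed[OF assms(2)] z that] .
  \<comment> \<open>Mollification radii at most \<open>e\<close>, so that supports stay in the
    fattening of \<open>K\<close>.\<close>
  define t where "t n = e / real (Suc n)" for n
  have t: "0 < t n" "t n \<le> e" for n using e(1) by (auto simp: t_def field_simps)
  have t0: "t \<longlonglongrightarrow> 0"
    unfolding t_def using tendsto_mult_right[OF LIMSEQ_Suc[OF lim_1_over_n], of e] by (simp del: of_nat_Suc)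
  have cb: "continuous_on UNIV (bump d :: 'a \<Rightarrow> real)" for d
    using Ck_on_bump[of 0 d] by simp
  have C1b: "C1_on UNIV (bump d :: 'a \<Rightarrow> real)" for d
    using Ck_on_bump[of 1 d] Ck_on_imp_C1_on by blast
  have b0: "bump ((t n)\<^sup>2) x = 0" if "x \<notin> cball 0 (t n)" for n and x :: 'a
    using that t(1)[of n] by (intro bump_eq_0) auto
  have bint: "integrable lborel (bump ((t n)\<^sup>2) :: 'a \<Rightarrow> real)" for n
    by (rule integrable_compact_support[OF cb compact_cball b0])
  define m where "m n = (\<integral>x. bump ((t n)\<^sup>2) (x::'a) \<partial>lborel)" for n
  \<comment> \<open>A zero integral would force the bump to vanish almost everywhere, although it is
    positive on a ball.\<close>
  have m: "m n > 0" for n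
  proof -
    have "m n \<noteq> 0"
    proof
      assume "m n = 0"
      then have "AE x in lborel. bump ((t n)\<^sup>2) (x::'a) = 0"
        unfolding m_def by (subst (asm) integral_nonneg_eq_0_iff_AE[OF bint]) (auto simp: bump_nonneg)
      then have "AE x in lborel. (x::'a) \<notin> ball 0 (t n)"
      proof eventually_elim
        case (elim x)
        then show ?case using bump_pos[of x "t n"] by auto
      qed
      then have "ball (0::'a) (t n) \<in> null_sets lborel"
        by (subst AE_iff_null_sets) auto
      then have "negligible (ball (0::'a) (t n))"
        using negligible_iff_null_sets null_sets_completionI by blast
      then show False using t(1)[of n] by (simp add: open_not_negligible)
    qed
    moreover have "m n \<ge> 0" unfolding m_def by (intro integral_nonneg_AE) (auto simp: bump_nonneg)
    ultimately show ?thesis by simp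
  qed
  define \<psi> where "\<psi> n x = bump ((t n)\<^sup>2) x / m n" for n and x :: 'a
  have \<psi>': "\<psi> n = (\<lambda>x. (1 / m n) * bump ((t n)\<^sup>2) x)" for n by (auto simp: \<psi>_def)
  have Ck\<psi>: "Ck_on k UNIV (\<psi> n)" for k n
    unfolding \<psi>' by (intro Ck_on_mult Ck_on_const Ck_on_bump) auto
  have C1\<psi>: "C1_on UNIV (\<psi> n)" for n using Ck\<psi>[of 1] Ck_on_imp_C1_on by blast
  have c\<psi>: "continuous_on UNIV (\<psi> n)" for n using C1\<psi> C1_on_continuous_on by blast
  have \<psi>0: "\<psi> n x = 0" if "t n \<le> norm x" for n x
    using that t(1)[of n] by (simp add: \<psi>_def bump_eq_0)
  have \<psi>_nonneg: "0 \<le> \<psi> n x" for n x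
    using m[of n] by (simp add: \<psi>_def bump_nonneg)
  have \<psi>int: "integrable lborel (\<lambda>y. \<psi> n (x - y))" and \<psi>1: "(\<integral>y. \<psi> n (x - y) \<partial>lborel) = 1" for n x
  proof -
    show "integrable lborel (\<lambda>y. \<psi> n (x - y))"
      by (rule integrable_compact_support[of _ "cball x (t n)"])
         (auto intro!: \<psi>0 continuous_intros continuous_on_compose2[OF c\<psi>] simp: dist_norm)
    have "(\<integral>y. \<psi> n (x - y) \<partial>lborel) = (\<integral>y. \<psi> n (y + (- x)) \<partial>lborel)"
      by (simp add: \<psi>_def bump_minus[of _ x])
    also have "\<dots> = (\<integral>y. \<psi> n y \<partial>lborel)"
      using lborel_integral_translation borel_measurable_continuous_onI[OF c\<psi>] by blast
    also have "\<dots> = 1" using m[of n] by (simp add: \<psi>_def m_def)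
    finally show "(\<integral>y. \<psi> n (x - y) \<partial>lborel) = 1" .
  qed
  \<comment> \<open>The Leibniz rule works with gauge integrals over a box; as \<open>h\<close>
    vanishes off \<open>K\<close>, which lies in the box, they agree with Lebesgue integrals over
    the whole space.\<close>
  have conv_eq: "integral (cbox (-a) a) (\<lambda>y. h y * k y) = (\<integral>y. h y * k y \<partial>lborel)"
    if "continuous_on UNIV h" "continuous_on UNIV k" "\<And>x. x \<notin> K \<Longrightarrow> h x = 0" for h k :: "'a \<Rightarrow> real"
  proof -
    have "integrable lborel (\<lambda>y. h y * k y)"
      by (rule integrable_compact_support[OF _ assms(2)]) (auto intro!: continuous_intros that)
    then have "((\<lambda>y. h y * k y) has_integral (\<integral>y. h y * k y \<partial>lborel)) UNIV"
      by (rule has_integral_integral_lborel)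
    then have "integral UNIV (\<lambda>y. h y * k y) = (\<integral>y. h y * k y \<partial>lborel)"
      by (rule integral_unique)
    moreover have "integral UNIV (\<lambda>y. h y * k y) = integral (cbox (-a) a) (\<lambda>y. h y * k y)"
    proof -
      have "(\<lambda>y. if y \<in> cbox (-a) a then h y * k y else 0) = (\<lambda>y. h y * k y)"
        using a that(3) by force
      then show ?thesis
        using Henstock_Kurzweil_Integration.integral_restrict_UNIV[of "cbox (-a) a" "\<lambda>y. h y * k y"] by metis
    qed
    ultimately show ?thesis by simp
  qed
  define \<phi> where "\<phi> n x = integral (cbox (-a) a) (\<lambda>y. \<zeta> y * \<psi> n (x - y))" for n x
  have c\<psi>': "continuous_on UNIV (\<lambda>y. \<psi> n (x - y))" for n x
    by (intro continuous_on_compose2[OF c\<psi>] continuous_intros) auto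
  have \<phi>_eq: "\<phi> n x = (\<integral>y. \<zeta> y * \<psi> n (x - y) \<partial>lborel)" for n x
    unfolding \<phi>_def by (rule conv_eq[OF c\<zeta> c\<psi>' z])
  have der: "(\<phi> n has_derivative (\<lambda>v. integral (cbox (-a) a) (\<lambda>y. \<zeta> y * (gradient (\<psi> n) (x - y) \<bullet> v)))) (at x)" for n x
    unfolding \<phi>_def[abs_def] by (rule has_derivative_convolution[OF C1\<psi>]) (auto intro: continuous_on_subset c\<zeta>)
  have grad_eq: "gradient (\<phi> n) x \<bullet> i = (\<integral>y. (gradient \<zeta> y \<bullet> i) * \<psi> n (x - y) \<partial>lborel)" for n x i
  proof -
    have d: "((\<lambda>y. \<psi> n (x - y)) has_derivative (\<lambda>h. - gradient (\<psi> n) (x - y) \<bullet> h)) (at y)" for y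
    proof -
      have 1: "((\<lambda>y. x - y) has_derivative (\<lambda>h. - h)) (at y)" by (auto intro!: derivative_eq_intros)
      have 2: "(\<psi> n has_derivative (\<lambda>h. gradient (\<psi> n) (x - y) \<bullet> h)) (at (x - y))"
        using C1\<psi>[of n] by (simp add: C1_on_def has_derivative_gradient)
      show ?thesis using has_derivative_compose[OF 1 2] by simp
    qed
    have C: "C1_on UNIV (\<lambda>y. \<psi> n (x - y))"
    proof (rule C1_onI[OF d])
      have "continuous_on UNIV (gradient (\<psi> n))" using C1\<psi>[of n] by (simp add: C1_on_def)
      then show "continuous_on UNIV (\<lambda>y. - gradient (\<psi> n) (x - y))"
        by (auto intro!: continuous_intros continuous_on_compose2[of UNIV "gradient (\<psi> n)"])
    qed
    have cg: "continuous_on UNIV (\<lambda>y. gradient (\<psi> n) (x - y) \<bullet> i)"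
    proof -
      have "continuous_on UNIV (gradient (\<psi> n))" using C1\<psi>[of n] by (simp add: C1_on_def)
      then show ?thesis
        by (auto intro!: continuous_intros continuous_on_compose2[of UNIV "gradient (\<psi> n)"])
    qed
    have "gradient (\<phi> n) x \<bullet> i = (\<integral>y. \<zeta> y * (gradient (\<psi> n) (x - y) \<bullet> i) \<partial>lborel)"
      using gradient_inner_eqI[OF der] conv_eq[OF c\<zeta> cg z] by metis
    also have "\<dots> = - (\<integral>y. \<zeta> y * (gradient (\<lambda>y. \<psi> n (x - y)) y \<bullet> i) \<partial>lborel)"
      by (simp add: gradient_eqI[OF d])
    also have "\<dots> = (\<integral>y. (gradient \<zeta> y \<bullet> i) * \<psi> n (x - y) \<partial>lborel)"
      using integration_by_parts_compact_support[OF \<zeta> C open_UNIV assms(2) subset_UNIV z] by simp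
    finally show ?thesis .
  qed
  \<comment> \<open>The kernel is a probability density concentrated on the ball of radius
    \<open>t n\<close>, so the convolution is an average of values of \<open>h\<close> at distance
    less than \<open>t n\<close>.\<close>
  have approx: "\<bar>(\<integral>y. h y * \<psi> n (x - y) \<partial>lborel) - h x\<bar> \<le> \<epsilon>"
    if h: "continuous_on UNIV h" "\<And>x. x \<notin> K \<Longrightarrow> h x = 0" and \<epsilon>: "\<And>y. dist y x < t n \<Longrightarrow> \<bar>h y - h x\<bar> \<le> \<epsilon>" for h n x \<epsilon>
  proof -
    have i1: "integrable lborel (\<lambda>y. h y * \<psi> n (x - y))"
      by (rule integrable_compact_support[OF _ assms(2)]) (auto intro!: continuous_intros h c\<psi>')
    have "(\<integral>y. h y * \<psi> n (x - y) \<partial>lborel) - h x = (\<integral>y. h y * \<psi> n (x - y) - h x * \<psi> n (x - y) \<partial>lborel)"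
      using i1 \<psi>int \<psi>1 by (subst Bochner_Integration.integral_diff) auto
    also have "\<bar>\<dots>\<bar> \<le> (\<integral>y. \<epsilon> * \<psi> n (x - y) \<partial>lborel)"
    proof (rule integral_abs_bound_integral)
      show "integrable lborel (\<lambda>y. h y * \<psi> n (x - y) - h x * \<psi> n (x - y))" using i1 \<psi>int by auto
      show "integrable lborel (\<lambda>y. \<epsilon> * \<psi> n (x - y))" using \<psi>int by auto
      fix y
      show "\<bar>h y * \<psi> n (x - y) - h x * \<psi> n (x - y)\<bar> \<le> \<epsilon> * \<psi> n (x - y)"
      proof (cases "dist y x < t n")
        case True
        then show ?thesis using \<epsilon>[OF True] \<psi>_nonneg[of n "x - y"]
          by (simp flip: left_diff_distrib add: abs_mult mult_right_mono)
      next
        case False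
        then show ?thesis by (simp add: \<psi>0 dist_norm norm_minus_commute)
      qed
    qed
    also have "\<dots> = \<epsilon>" using \<psi>1 by simp
    finally show ?thesis .
  qed
  have unif: "\<forall>\<^sub>F n in sequentially. \<forall>x. \<bar>(\<integral>y. h y * \<psi> n (x - y) \<partial>lborel) - h x\<bar> \<le> \<epsilon>"
    if h: "continuous_on UNIV h" "\<And>x. x \<notin> K \<Longrightarrow> h x = 0" and "\<epsilon> > 0" for h \<epsilon>
  proof -
    have "\<exists>d>0. \<forall>x y. dist y x < d \<longrightarrow> \<bar>h y - h x\<bar> \<le> \<epsilon>"
    proof -
      \<comment> \<open>Enlarged by 1 so that two points at distance less than 1 both belong to it
        as soon as one of them lies in \<open>K\<close>.\<close>
      let ?K = "\<Union>x\<in>K. cball x 1"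
      have "uniformly_continuous_on ?K h"
        by (intro compact_uniformly_continuous compact_fattening assms continuous_on_subset[OF h(1)]) auto
      then obtain d where d: "d > 0" "\<And>x y. x \<in> ?K \<Longrightarrow> y \<in> ?K \<Longrightarrow> dist y x < d \<Longrightarrow> dist (h y) (h x) < \<epsilon>"
        using \<open>\<epsilon> > 0\<close> unfolding uniformly_continuous_on_def by metis
      have "\<bar>h y - h x\<bar> \<le> \<epsilon>" if xy: "dist y x < min d 1" for x y
      proof (cases "x \<in> K \<or> y \<in> K")
        case True
        then have "x \<in> ?K" "y \<in> ?K" using xy
          by (auto intro: bexI[of _ x] bexI[of _ y] simp: dist_commute)
        then show ?thesis using d(2)[of x y] xy by (simp add: dist_real_def)
      next
        case False
        then show ?thesis using h(2) \<open>\<epsilon> > 0\<close> by simp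
      qed
      then show ?thesis using d(1) by (intro exI[of _ "min d 1"]) auto
    qed
    then obtain d where d: "d > 0" "\<And>x y. dist y x < d \<Longrightarrow> \<bar>h y - h x\<bar> \<le> \<epsilon>" by blast
    have "\<forall>\<^sub>F n in sequentially. t n < d" using t0 d(1) by (rule order_tendstoD)
    then show ?thesis
      by eventually_elim (use approx[OF h] d(2) in \<open>meson order_less_trans\<close>)
  qed
  show ?thesis
  proof (rule that[OF K'])
    show van: "\<phi> n x = 0" if "x \<notin> K'" for n x
    proof -
      have "\<zeta> y * \<psi> n (x - y) = 0" for y
      proof (cases "y \<in> K")
        case True
        then have "e < dist y x" using that by (force simp: K'_def)
        then have "t n \<le> norm (x - y)" using t(2)[of n] by (simp add: dist_norm norm_minus_commute)
        then show ?thesis by (simp add: \<psi>0)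
      qed (simp add: z)
      then have "(\<lambda>y. \<zeta> y * \<psi> n (x - y)) = (\<lambda>y. 0)" by (rule ext)
      then show ?thesis by (simp add: \<phi>_def)
    qed
    show "test_function S (\<phi> n)" for n
    proof -
      have "closure {x. \<phi> n x \<noteq> 0} \<subseteq> K'"
        using van compact_imp_closed[OF K'(1)] by (intro closure_minimal) auto
      moreover have "compact (closure {x. \<phi> n x \<noteq> 0})"
        using calculation K'(1) compact_Int_closed[of K' "closure {x. \<phi> n x \<noteq> 0}"] by (simp add: Int_absorb1)
      moreover have "Ck_on k UNIV (\<phi> n)" for k
        unfolding \<phi>_def[abs_def] by (rule Ck_on_convolution[OF Ck\<psi>]) (auto intro: continuous_on_subset c\<zeta>)
      ultimately show ?thesis using K'(2) by (auto simp: test_function_def)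
    qed
    show "uniform_limit UNIV \<phi> \<zeta> sequentially"
    proof (rule uniform_limitI)
      fix \<epsilon> :: real assume "\<epsilon> > 0"
      then have "\<forall>\<^sub>F n in sequentially. \<forall>x. \<bar>(\<integral>y. \<zeta> y * \<psi> n (x - y) \<partial>lborel) - \<zeta> x\<bar> \<le> \<epsilon> / 2"
        by (intro unif c\<zeta> z) auto
      then show "\<forall>\<^sub>F n in sequentially. \<forall>x\<in>UNIV. dist (\<phi> n x) (\<zeta> x) < \<epsilon>"
      proof eventually_elim
        case (elim n)
        then have "\<bar>\<phi> n x - \<zeta> x\<bar> \<le> \<epsilon> / 2" for x by (simp only: \<phi>_eq)
        from le_less_trans[OF this] show ?case using \<open>\<epsilon> > 0\<close> by (simp add: dist_real_def)
      qed
    qed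
    show "uniform_limit UNIV (\<lambda>n. gradient (\<phi> n)) (gradient \<zeta>) sequentially"
    proof (rule uniform_limitI)
      fix \<epsilon> :: real assume "\<epsilon> > 0"
      \<comment> \<open>Half of \<epsilon> is shared among the coordinates, because the norm is
        bounded by the sum of the components.\<close>
      define \<epsilon>' where "\<epsilon>' = \<epsilon> / (2 * real (DIM('a)))"
      have "\<epsilon>' > 0" using \<open>\<epsilon> > 0\<close> by (simp add: \<epsilon>'_def)
      have "\<forall>\<^sub>F n in sequentially. \<forall>i\<in>Basis. \<forall>x. \<bar>(\<integral>y. (gradient \<zeta> y \<bullet> i) * \<psi> n (x - y) \<partial>lborel) - gradient \<zeta> x \<bullet> i\<bar> \<le> \<epsilon>'"
        using \<open>\<epsilon>' > 0\<close> by (intro eventually_ball_finite ballI unif continuous_intros cG) (auto simp: zG)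
      then show "\<forall>\<^sub>F n in sequentially. \<forall>x\<in>UNIV. dist (gradient (\<phi> n) x) (gradient \<zeta> x) < \<epsilon>"
      proof eventually_elim
        case (elim n)
        have "dist (gradient (\<phi> n) x) (gradient \<zeta> x) < \<epsilon>" for x
        proof -
          have "norm (gradient (\<phi> n) x - gradient \<zeta> x) \<le> (\<Sum>i\<in>Basis. \<bar>(gradient (\<phi> n) x - gradient \<zeta> x) \<bullet> i\<bar>)"
            by (rule norm_le_l1)
          also have "\<dots> \<le> (\<Sum>i\<in>(Basis::'a set). \<epsilon>')"
            by (rule sum_mono) (use elim in \<open>auto simp: inner_diff_left grad_eq\<close>)
          also have "\<dots> = \<epsilon> / 2" by (simp add: \<epsilon>'_def)
          also have "\<dots> < \<epsilon>" using \<open>\<epsilon> > 0\<close> by simp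
          finally show ?thesis by (simp add: dist_norm)
        qed
        then show ?case by blast
      qed
    qed
  qed
qed

section \<open>The variational inequality\<close>

lemma norm_add_squared_le: "(norm (a + b))\<^sup>2 \<le> 2 * (norm a)\<^sup>2 + 2 * (norm (b::'a::real_normed_vector))\<^sup>2"
proof -
  have "(norm (a + b))\<^sup>2 \<le> (norm a + norm b)\<^sup>2"
    by (intro power_mono norm_triangle_ineq) auto
  also have "\<dots> \<le> 2 * (norm a)\<^sup>2 + 2 * (norm b)\<^sup>2"
    using sum_squares_ge_zero[of "norm a - norm b" 0] by (simp add: power2_eq_square algebra_simps)
  finally show ?thesis .
qed

lemma L2_on_add:
  assumes "L2_on S f" "L2_on S g"
  shows "L2_on S (\<lambda>x. f x + g x)"
proof -
  have m: "(\<lambda>x. f x + g x) \<in> borel_measurable (lebesgue_on S)"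
    using assms by (intro borel_measurable_add) (auto simp: L2_on_def)
  have "integrable (lebesgue_on S) (\<lambda>x. (norm (f x + g x))\<^sup>2)"
  proof (rule Bochner_Integration.integrable_bound)
    show "integrable (lebesgue_on S) (\<lambda>x. 2 * (norm (f x))\<^sup>2 + 2 * (norm (g x))\<^sup>2)"
      using assms by (auto simp: L2_on_def)
    show "(\<lambda>x. (norm (f x + g x))\<^sup>2) \<in> borel_measurable (lebesgue_on S)" using m by measurable
    show "AE x in lebesgue_on S. norm ((norm (f x + g x))\<^sup>2) \<le> norm (2 * (norm (f x))\<^sup>2 + 2 * (norm (g x))\<^sup>2)"
      using norm_add_squared_le by auto
  qed
  then show ?thesis using m by (simp add: L2_on_def)
qed

lemma L2_on_integrable_inner:
  assumes "L2_on S f" "L2_on S g"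
  shows "integrable (lebesgue_on S) (\<lambda>x. f x \<bullet> g x)"
proof (rule Bochner_Integration.integrable_bound)
  show "integrable (lebesgue_on S) (\<lambda>x. (norm (f x))\<^sup>2 + (norm (g x))\<^sup>2)"
    using assms by (auto simp: L2_on_def)
  show "(\<lambda>x. f x \<bullet> g x) \<in> borel_measurable (lebesgue_on S)"
    using assms by (intro borel_measurable_inner) (auto simp: L2_on_def)
  have "\<bar>a \<bullet> b\<bar> \<le> (norm a)\<^sup>2 + (norm b)\<^sup>2" for a b :: 'b
  proof -
    have "\<bar>a \<bullet> b\<bar> \<le> norm a * norm b" by (rule Cauchy_Schwarz_ineq2)
    also have "\<dots> \<le> (norm a)\<^sup>2 + (norm b)\<^sup>2"
      using sum_squares_bound[of "norm a" "norm b"] mult_nonneg_nonneg[of "norm a" "norm b"] norm_ge_zero[of a] norm_ge_zero[of b]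
      by linarith
    finally show ?thesis .
  qed
  then show "AE x in lebesgue_on S. norm (f x \<bullet> g x) \<le> norm ((norm (f x))\<^sup>2 + (norm (g x))\<^sup>2)"
    by auto
qed

lemma lebesgue_on_integral_eq_lborel:
  fixes f :: "'a::euclidean_space \<Rightarrow> real"
  assumes "S \<in> sets lebesgue" "f \<in> borel_measurable borel" "\<And>x. x \<notin> S \<Longrightarrow> f x = 0"
  shows "(\<integral>x. f x \<partial>lebesgue_on S) = (\<integral>x. f x \<partial>lborel)"
proof -
  have "(\<integral>x. f x \<partial>lebesgue_on S) = (\<integral>x. indicator S x *\<^sub>R f x \<partial>lebesgue)"
    using assms(1) by (intro integral_restrict_space) auto
  also have "(\<lambda>x. indicator S x *\<^sub>R f x) = f" using assms(3) by (force simp: indicator_def fun_eq_iff)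
  also have "(\<integral>x. f x \<partial>lebesgue) = (\<integral>x. f x \<partial>lborel)"
    using assms(2) by (intro integral_completion) auto
  finally show ?thesis .
qed

lemma integrable_lebesgue_on_lborel:
  fixes f :: "'a::euclidean_space \<Rightarrow> real"
  assumes "S \<in> sets lebesgue" "integrable lborel f"
  shows "integrable (lebesgue_on S) f"
proof -
  have "integrable lebesgue f" using assms(2) integrable_completion by blast
  then have "integrable lebesgue (\<lambda>x. indicator S x *\<^sub>R f x)"
    using integrable_mult_indicator[OF assms(1)] by blast
  then show ?thesis using assms(1) by (simp add: integrable_restrict_space)
qed

lemma L2_on_compact_support:
  fixes f :: "'a::euclidean_space \<Rightarrow> 'b::euclidean_space"
  assumes "S \<in> sets lebesgue" "continuous_on UNIV f" "compact K" "\<And>x. x \<notin> K \<Longrightarrow> f x = 0"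
  shows "L2_on S f"
proof -
  have "f \<in> borel_measurable borel" using assms(2) by (rule borel_measurable_continuous_onI)
  then have "f \<in> borel_measurable lborel" by simp
  then have "f \<in> borel_measurable lebesgue" by (rule measurable_completion)
  then have "f \<in> borel_measurable (lebesgue_on S)" by (rule measurable_restrict_space1)
  moreover have "integrable lborel (\<lambda>x. (norm (f x))\<^sup>2)"
    by (rule integrable_compact_support[OF _ assms(3)]) (use assms(2,4) in \<open>auto intro!: continuous_intros\<close>)
  ultimately show ?thesis using integrable_lebesgue_on_lborel[OF assms(1)] by (auto simp: L2_on_def)
qed

lemma tendsto_L2_add:
  fixes f f' :: "'c \<Rightarrow> 'a::euclidean_space \<Rightarrow> 'b::euclidean_space"
  assumes "tendsto_L2 S f g F" "tendsto_L2 S f' g' F"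
  shows "tendsto_L2 S (\<lambda>j x. f j x + f' j x) (\<lambda>x. g x + g' x) F"
proof -
  have L: "L2_on S (\<lambda>x. g x + g' x)" using assms by (auto simp: tendsto_L2_def intro: L2_on_add)
  have neg: "L2_on S (\<lambda>x. - h x)" if "L2_on S h" for h :: "'a \<Rightarrow> 'b"
    using that by (auto simp: L2_on_def)
  have diff: "integrable (lebesgue_on S) (\<lambda>x. (norm (h x - k x))\<^sup>2)" if "L2_on S h" "L2_on S k" for h k :: "'a \<Rightarrow> 'b"
    using L2_on_add[OF that(1) neg[OF that(2)]] by (simp add: L2_on_def)
  have ev: "\<forall>\<^sub>F j in F. L2_on S (f j) \<and> L2_on S (f' j)"
    using assms by (auto simp: tendsto_L2_def eventually_conj_iff)
  have "((\<lambda>j. \<integral>x. (norm ((f j x + f' j x) - (g x + g' x)))\<^sup>2 \<partial>lebesgue_on S) \<longlongrightarrow> 0) F"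
  proof (rule tendsto_sandwich[OF _ _ tendsto_const])
    show "\<forall>\<^sub>F j in F. 0 \<le> (\<integral>x. (norm ((f j x + f' j x) - (g x + g' x)))\<^sup>2 \<partial>lebesgue_on S)"
      by (auto intro!: always_eventually)
    show "\<forall>\<^sub>F j in F. (\<integral>x. (norm ((f j x + f' j x) - (g x + g' x)))\<^sup>2 \<partial>lebesgue_on S)
      \<le> 2 * (\<integral>x. (norm (f j x - g x))\<^sup>2 \<partial>lebesgue_on S) + 2 * (\<integral>x. (norm (f' j x - g' x))\<^sup>2 \<partial>lebesgue_on S)"
      using ev
    proof eventually_elim
      case (elim j)
      have i: "integrable (lebesgue_on S) (\<lambda>x. (norm (f j x - g x))\<^sup>2)"
        "integrable (lebesgue_on S) (\<lambda>x. (norm (f' j x - g' x))\<^sup>2)"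
        using elim assms by (auto intro!: diff simp: tendsto_L2_def)
      have "(\<integral>x. (norm ((f j x + f' j x) - (g x + g' x)))\<^sup>2 \<partial>lebesgue_on S)
        \<le> (\<integral>x. 2 * (norm (f j x - g x))\<^sup>2 + 2 * (norm (f' j x - g' x))\<^sup>2 \<partial>lebesgue_on S)"
      proof (rule integral_mono)
        show "integrable (lebesgue_on S) (\<lambda>x. (norm ((f j x + f' j x) - (g x + g' x)))\<^sup>2)"
          using elim L by (intro diff) (auto intro: L2_on_add)
        show "integrable (lebesgue_on S) (\<lambda>x. 2 * (norm (f j x - g x))\<^sup>2 + 2 * (norm (f' j x - g' x))\<^sup>2)"
          using i by auto
        show "(norm ((f j x + f' j x) - (g x + g' x)))\<^sup>2 \<le> 2 * (norm (f j x - g x))\<^sup>2 + 2 * (norm (f' j x - g' x))\<^sup>2" for x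
          using norm_add_squared_le[of "f j x - g x" "f' j x - g' x"] by (simp add: algebra_simps)
      qed
      then show ?case using i by simp
    qed
    show "((\<lambda>j. 2 * (\<integral>x. (norm (f j x - g x))\<^sup>2 \<partial>lebesgue_on S) + 2 * (\<integral>x. (norm (f' j x - g' x))\<^sup>2 \<partial>lebesgue_on S)) \<longlongrightarrow> 0) F"
      using assms by (auto simp: tendsto_L2_def intro!: tendsto_eq_intros)
  qed
  then show ?thesis
    using L ev by (auto simp: tendsto_L2_def intro: L2_on_add elim!: eventually_mono)
qed

text \<open>The common compact support has finite measure, so uniform closeness bounds the L2
  distance; taking \<epsilon> \<le> 1 allows \<epsilon>^2 to be replaced by \<epsilon>.\<close>

lemma tendsto_L2_uniform_limit:
  fixes f :: "nat \<Rightarrow> 'a::euclidean_space \<Rightarrow> 'b::euclidean_space"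
  assumes S: "S \<in> sets lebesgue" and "uniform_limit UNIV f g sequentially"
    and c: "\<And>n. continuous_on UNIV (f n)" "continuous_on UNIV g"
    and K: "compact K" "\<And>n x. x \<notin> K \<Longrightarrow> f n x = 0" "\<And>x. x \<notin> K \<Longrightarrow> g x = 0"
  shows "tendsto_L2 S f g sequentially"
proof -
  have L: "L2_on S (f n)" "L2_on S g" for n
    using L2_on_compact_support[OF S] c K by blast+
  have i: "integrable (lebesgue_on S) (\<lambda>x. (norm (f n x - g x))\<^sup>2)" for n
    by (intro integrable_lebesgue_on_lborel[OF S] integrable_compact_support[OF _ K(1)])
       (auto intro!: continuous_intros c simp: K)
  have iK: "integrable (lebesgue_on S) (indicator K :: 'a \<Rightarrow> real)"
    using emeasure_compact_finite[OF K(1)] compact_imp_closed[OF K(1)]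
    by (intro integrable_lebesgue_on_lborel[OF S] integrable_real_indicator) auto
  define m where "m = (\<integral>x. indicator K x \<partial>lebesgue_on S :: real)"
  have m: "m \<ge> 0" unfolding m_def by (intro integral_nonneg_AE) auto
  have "(\<lambda>n. \<integral>x. (norm (f n x - g x))\<^sup>2 \<partial>lebesgue_on S) \<longlonglongrightarrow> 0"
  proof (rule tendstoI)
    fix e :: real assume "e > 0"
    define \<epsilon> where "\<epsilon> = min 1 (e / (m + 1))"
    have \<epsilon>: "0 < \<epsilon>" "\<epsilon> \<le> 1" "\<epsilon> * (m + 1) \<le> e"
    proof -
      have "\<epsilon> * (m + 1) \<le> (e / (m + 1)) * (m + 1)"
        using m by (intro mult_right_mono) (auto simp: \<epsilon>_def)
      then show "\<epsilon> * (m + 1) \<le> e" using m by simp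
    qed (use \<open>e > 0\<close> m in \<open>auto simp: \<epsilon>_def\<close>)
    have "\<forall>\<^sub>F n in sequentially. \<forall>x\<in>UNIV. dist (f n x) (g x) < \<epsilon>"
      using uniform_limitD[OF assms(2) \<epsilon>(1)] .
    then show "\<forall>\<^sub>F n in sequentially. dist (\<integral>x. (norm (f n x - g x))\<^sup>2 \<partial>lebesgue_on S) 0 < e"
    proof eventually_elim
      case (elim n)
      have "(\<integral>x. (norm (f n x - g x))\<^sup>2 \<partial>lebesgue_on S) \<le> (\<integral>x. \<epsilon> * indicator K x \<partial>lebesgue_on S)"
      proof (rule integral_mono[OF i])
        show "integrable (lebesgue_on S) (\<lambda>x. \<epsilon> * indicator K x)" using iK by simp
        fix x
        show "(norm (f n x - g x))\<^sup>2 \<le> \<epsilon> * indicator K x"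
        proof (cases "x \<in> K")
          case True
          have "norm (f n x - g x) \<le> \<epsilon>" using elim[rule_format, of x] by (simp add: dist_norm)
          then have "(norm (f n x - g x))\<^sup>2 \<le> \<epsilon>\<^sup>2" by (intro power_mono) auto
          also have "\<dots> \<le> \<epsilon>" using \<epsilon> by (simp add: power2_eq_square mult_left_le)
          finally show ?thesis using True by simp
        qed (simp add: K)
      qed
      also have "\<dots> = \<epsilon> * m" by (simp add: m_def)
      also have "\<dots> < e" using \<epsilon> by (simp add: algebra_simps)
      finally show ?case by (simp add: integral_nonneg_AE)
    qed
  qed
  then show ?thesis using L by (simp add: tendsto_L2_def)
qed

text \<open>On the common support |G| \<le> |G|^2 + 1, an integrable weight against which the
  uniform distance of \<open>f n\<close> and \<open>g\<close> is integrated.\<close>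

lemma tendsto_integral_inner_uniform_limit:
  fixes f :: "nat \<Rightarrow> 'a::euclidean_space \<Rightarrow> 'b::euclidean_space"
  assumes S: "S \<in> sets lebesgue" and G: "L2_on S G" and "uniform_limit UNIV f g sequentially"
    and c: "\<And>n. continuous_on UNIV (f n)" "continuous_on UNIV g"
    and K: "compact K" "\<And>n x. x \<notin> K \<Longrightarrow> f n x = 0" "\<And>x. x \<notin> K \<Longrightarrow> g x = 0"
  shows "(\<lambda>n. \<integral>x. G x \<bullet> f n x \<partial>lebesgue_on S) \<longlonglongrightarrow> (\<integral>x. G x \<bullet> g x \<partial>lebesgue_on S)"
proof -
  have L: "L2_on S (f n)" "L2_on S g" for n
    using L2_on_compact_support[OF S] c K by blast+
  note i = L2_on_integrable_inner[OF G L(1)] L2_on_integrable_inner[OF G L(2)]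
  have iK: "integrable (lebesgue_on S) (indicator K :: 'a \<Rightarrow> real)"
    using emeasure_compact_finite[OF K(1)] compact_imp_closed[OF K(1)]
    by (intro integrable_lebesgue_on_lborel[OF S] integrable_real_indicator) auto
  have iG: "integrable (lebesgue_on S) (\<lambda>x. (norm (G x))\<^sup>2 + indicator K x)"
    using G iK by (auto simp: L2_on_def)
  define m where "m = (\<integral>x. (norm (G x))\<^sup>2 + indicator K x \<partial>lebesgue_on S)"
  have m: "m \<ge> 0" unfolding m_def by (intro integral_nonneg_AE) auto
  show ?thesis
  proof (rule tendstoI)
    fix e :: real assume "e > 0"
    define \<epsilon> where "\<epsilon> = e / (m + 1)"
    have \<epsilon>: "0 < \<epsilon>" "\<epsilon> * (m + 1) = e"
      using \<open>e > 0\<close> m by (auto simp: \<epsilon>_def field_simps)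
    have "\<forall>\<^sub>F n in sequentially. \<forall>x\<in>UNIV. dist (f n x) (g x) < \<epsilon>"
      using uniform_limitD[OF assms(3) \<epsilon>(1)] .
    then show "\<forall>\<^sub>F n in sequentially. dist (\<integral>x. G x \<bullet> f n x \<partial>lebesgue_on S) (\<integral>x. G x \<bullet> g x \<partial>lebesgue_on S) < e"
    proof eventually_elim
      case (elim n)
      have "dist (\<integral>x. G x \<bullet> f n x \<partial>lebesgue_on S) (\<integral>x. G x \<bullet> g x \<partial>lebesgue_on S)
        = \<bar>\<integral>x. G x \<bullet> f n x - G x \<bullet> g x \<partial>lebesgue_on S\<bar>"
        using i by (simp add: dist_real_def)
      also have "\<dots> \<le> (\<integral>x. \<epsilon> * ((norm (G x))\<^sup>2 + indicator K x) \<partial>lebesgue_on S)"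
      proof (rule integral_abs_bound_integral)
        show "integrable (lebesgue_on S) (\<lambda>x. G x \<bullet> f n x - G x \<bullet> g x)" using i by auto
        show "integrable (lebesgue_on S) (\<lambda>x. \<epsilon> * ((norm (G x))\<^sup>2 + indicator K x))"
          using iG by (rule integrable_mult_right)
        fix x
        show "\<bar>G x \<bullet> f n x - G x \<bullet> g x\<bar> \<le> \<epsilon> * ((norm (G x))\<^sup>2 + indicator K x)"
        proof (cases "x \<in> K")
          case True
          have "\<bar>G x \<bullet> f n x - G x \<bullet> g x\<bar> \<le> norm (G x) * norm (f n x - g x)"
            by (simp flip: inner_diff_right add: Cauchy_Schwarz_ineq2)
          also have "\<dots> \<le> norm (G x) * \<epsilon>"
            using elim by (intro mult_left_mono) (auto simp: dist_norm intro: less_imp_le)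
          also have "\<dots> \<le> ((norm (G x))\<^sup>2 + 1) * \<epsilon>"
            using \<epsilon>(1) sum_squares_ge_zero[of "norm (G x) - 1" 0] 
            by (intro mult_right_mono) (simp_all add: power2_eq_square algebra_simps, smt (verit) norm_ge_zero)
          finally show ?thesis using True by (simp add: mult.commute)
        next
          case False
          then show ?thesis using \<epsilon>(1) by (simp add: K)
        qed
      qed
      also have "\<dots> = \<epsilon> * m" by (simp add: m_def)
      also have "\<dots> < e" using \<epsilon> by (simp add: algebra_simps)
      finally show ?case .
    qed
  qed
qed

section \<open>Perturbation of admissible functions by C1 functions\<close>

lemma test_function_C1_on: "test_function S \<phi> \<Longrightarrow> C1_on UNIV \<phi>"
  unfolding test_function_def using Ck_on_imp_C1_on by blast

lemma test_function_compact_support: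
  assumes "test_function S \<phi>"
  obtains K where "compact K" "K \<subseteq> S" "\<And>x. x \<notin> K \<Longrightarrow> \<phi> x = 0"
proof (rule that)
  show "\<phi> x = 0" if "x \<notin> closure {x. \<phi> x \<noteq> 0}" for x
    using that closure_subset[of "{x. \<phi> x \<noteq> 0}"] by blast
qed (use assms in \<open>auto simp: test_function_def\<close>)

lemma test_function_gradient_inner:
  assumes "test_function S \<phi>" "i \<in> Basis"
  shows "test_function S (\<lambda>x. gradient \<phi> x \<bullet> i)"
proof -
  let ?K = "closure {x. \<phi> x \<noteq> 0}"
  have "gradient \<phi> x = 0" if "x \<notin> ?K" for x
    by (rule gradient_eq_0_outside[OF closed_closure _ that]) (use closure_subset[of "{x. \<phi> x \<noteq> 0}"] in auto)
  then have "{x. gradient \<phi> x \<bullet> i \<noteq> 0} \<subseteq> ?K"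
    by (metis (mono_tags, lifting) inner_zero_left mem_Collect_eq subsetI)
  then have "closure {x. gradient \<phi> x \<bullet> i \<noteq> 0} \<subseteq> ?K"
    by (intro closure_minimal) auto
  moreover from this have "compact (closure {x. gradient \<phi> x \<bullet> i \<noteq> 0})"
    using assms(1) compact_Int_closed[of ?K "closure {x. gradient \<phi> x \<bullet> i \<noteq> 0}"]
    by (simp add: Int_absorb1 test_function_def)
  moreover have "Ck_on k UNIV (\<lambda>x. gradient \<phi> x \<bullet> i)" for k
  proof -
    have "Ck_on (Suc k) UNIV \<phi>" using assms(1) unfolding test_function_def by blast
    then show ?thesis using assms(2) by simp
  qed
  ultimately show ?thesis using assms(1) unfolding test_function_def by blast
qed

lemma test_function_add:
  assumes "test_function S \<phi>" "test_function S \<psi>"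
  shows "test_function S (\<lambda>x. \<phi> x + \<psi> x)"
proof -
  let ?K = "closure {x. \<phi> x \<noteq> 0} \<union> closure {x. \<psi> x \<noteq> 0}"
  have "closure {x. \<phi> x + \<psi> x \<noteq> 0} \<subseteq> ?K"
  proof (rule closure_minimal)
    have "{x. \<phi> x + \<psi> x \<noteq> 0} \<subseteq> {x. \<phi> x \<noteq> 0} \<union> {x. \<psi> x \<noteq> 0}" by auto
    then show "{x. \<phi> x + \<psi> x \<noteq> 0} \<subseteq> ?K"
      using closure_subset[of "{x. \<phi> x \<noteq> 0}"] closure_subset[of "{x. \<psi> x \<noteq> 0}"] by blast
  qed auto
  moreover from this have "compact (closure {x. \<phi> x + \<psi> x \<noteq> 0})"
    using assms compact_Int_closed[of ?K "closure {x. \<phi> x + \<psi> x \<noteq> 0}"]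
    by (simp add: Int_absorb1 test_function_def compact_Un)
  ultimately show ?thesis using assms unfolding test_function_def by (auto intro: Ck_on_add)
qed

lemma has_W12_gradient_add:
  fixes f g :: "'a::euclidean_space \<Rightarrow> real"
  assumes S: "S \<in> sets lebesgue" and f: "has_W12_gradient S f F" and g: "has_W12_gradient S g G"
  shows "has_W12_gradient S (\<lambda>x. f x + g x) (\<lambda>x. F x + G x)"
proof -
  have "(\<integral>x. (f x + g x) * (gradient \<phi> x \<bullet> i) \<partial>lebesgue_on S) = - (\<integral>x. ((F x + G x) \<bullet> i) * \<phi> x \<partial>lebesgue_on S)"
    if \<phi>: "test_function S \<phi>" and i: "i \<in> Basis" for \<phi> i
  proof -
    have L: "L2_on S \<phi>" if \<phi>: "test_function S \<phi>" for \<phi> :: "'a \<Rightarrow> real"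
    proof -
      obtain K where K: "compact K" "K \<subseteq> S" "\<And>x. x \<notin> K \<Longrightarrow> \<phi> x = 0"
        using test_function_compact_support[OF \<phi>] by blast
      then show ?thesis using L2_on_compact_support[OF S C1_on_continuous_on[OF test_function_C1_on[OF \<phi>]]] by blast
    qed
    have Li: "L2_on S (\<lambda>x. \<phi> x *\<^sub>R i)"
    proof -
      obtain K where K: "compact K" "K \<subseteq> S" "\<And>x. x \<notin> K \<Longrightarrow> \<phi> x = 0"
        using test_function_compact_support[OF \<phi>] by blast
      then show ?thesis
        by (intro L2_on_compact_support[OF S, of _ K] continuous_intros C1_on_continuous_on[OF test_function_C1_on[OF \<phi>]]) auto
    qed
    have 1: "integrable (lebesgue_on S) (\<lambda>x. h x * (gradient \<phi> x \<bullet> i))" if "L2_on S h" for h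
      using L2_on_integrable_inner[OF that L[OF test_function_gradient_inner[OF \<phi> i]]] by simp
    have 2: "integrable (lebesgue_on S) (\<lambda>x. (H x \<bullet> i) * \<phi> x)" if "L2_on S H" for H
      using L2_on_integrable_inner[OF that Li] by (simp add: mult.commute)
    have "(\<integral>x. (f x + g x) * (gradient \<phi> x \<bullet> i) \<partial>lebesgue_on S) =
        (\<integral>x. f x * (gradient \<phi> x \<bullet> i) \<partial>lebesgue_on S) + (\<integral>x. g x * (gradient \<phi> x \<bullet> i) \<partial>lebesgue_on S)"
      using f g by (subst Bochner_Integration.integral_add[symmetric]) (auto simp: has_W12_gradient_def distrib_right intro!: 1)
    moreover have "(\<integral>x. ((F x + G x) \<bullet> i) * \<phi> x \<partial>lebesgue_on S) =
        (\<integral>x. (F x \<bullet> i) * \<phi> x \<partial>lebesgue_on S) + (\<integral>x. (G x \<bullet> i) * \<phi> x \<partial>lebesgue_on S)"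
      using f g by (subst Bochner_Integration.integral_add[symmetric]) (auto simp: has_W12_gradient_def distrib_right inner_add_left intro!: 2)
    ultimately show ?thesis using f g \<phi> i by (simp add: has_W12_gradient_def)
  qed
  then show ?thesis using f g by (auto simp: has_W12_gradient_def intro: L2_on_add)
qed

lemma has_W12_gradient_C1:
  fixes \<zeta> :: "'a::euclidean_space \<Rightarrow> real"
  assumes "open S" "C1_on UNIV \<zeta>" "compact K" "K \<subseteq> S" "\<And>x. x \<notin> K \<Longrightarrow> \<zeta> x = 0"
  shows "has_W12_gradient S \<zeta> (gradient \<zeta>)"
proof -
  have S: "S \<in> sets lebesgue" using assms(1) by auto
  have c: "continuous_on UNIV \<zeta>" "continuous_on UNIV (gradient \<zeta>)"
    using assms(2) by (auto simp: C1_on_continuous_on) (auto simp: C1_on_def)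
  have zG: "gradient \<zeta> x = 0" if "x \<notin> K" for x
    using gradient_eq_0_outside[OF compact_imp_closed[OF assms(3)] assms(5) that] .
  have "(\<integral>x. \<zeta> x * (gradient \<phi> x \<bullet> i) \<partial>lebesgue_on S) = - (\<integral>x. (gradient \<zeta> x \<bullet> i) * \<phi> x \<partial>lebesgue_on S)"
    if \<phi>: "test_function S \<phi>" for \<phi> i
  proof -
    have C: "C1_on UNIV \<phi>" using \<phi> by (rule test_function_C1_on)
    have c\<phi>: "continuous_on UNIV \<phi>" "continuous_on UNIV (gradient \<phi>)"
      using C by (auto simp: C1_on_continuous_on) (auto simp: C1_on_def)
    have "(\<integral>x. \<zeta> x * (gradient \<phi> x \<bullet> i) \<partial>lebesgue_on S) = (\<integral>x. \<zeta> x * (gradient \<phi> x \<bullet> i) \<partial>lborel)"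
      using assms(4,5) by (intro lebesgue_on_integral_eq_lborel[OF S] borel_measurable_continuous_onI continuous_intros c c\<phi>) auto
    moreover have "(\<integral>x. (gradient \<zeta> x \<bullet> i) * \<phi> x \<partial>lebesgue_on S) = (\<integral>x. (gradient \<zeta> x \<bullet> i) * \<phi> x \<partial>lborel)"
    proof (intro lebesgue_on_integral_eq_lborel[OF S] borel_measurable_continuous_onI continuous_intros c c\<phi>)
      show "(gradient \<zeta> x \<bullet> i) * \<phi> x = 0" if "x \<notin> S" for x
      proof -
        have "x \<notin> K" using that assms(4) by auto
        then show ?thesis by (simp add: zG)
      qed
    qed
    ultimately show ?thesis
      using integration_by_parts_compact_support[OF assms(2) C open_UNIV assms(3) subset_UNIV assms(5)] by simp
  qed
  then show ?thesis
    using L2_on_compact_support[OF S c(1) assms(3,5)] L2_on_compact_support[OF S c(2) assms(3) zG]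
    by (simp add: has_W12_gradient_def)
qed

text \<open>Compactly supported C1 functions keep the boundary values: approximations of u - g by
  test functions and mollifications of \<zeta> add up to approximations of the sum.\<close>

lemma admissible_add:
  fixes \<zeta> :: "'a::euclidean_space \<Rightarrow> real"
  assumes S: "open S" and u: "u \<in> admissible S p1 p2 g"
    and \<zeta>: "C1_on UNIV \<zeta>" "compact K" "K \<subseteq> S" "\<And>x. x \<notin> K \<Longrightarrow> \<zeta> x = 0"
    and ae: "AE x in lebesgue_on S. p1 x \<le> u x + \<zeta> x \<and> u x + \<zeta> x \<le> p2 x"
  shows "(\<lambda>x. u x + \<zeta> x) \<in> admissible S p1 p2 g"
proof -
  have Sl: "S \<in> sets lebesgue" using S by auto
  note W = has_W12_gradient_C1[OF S \<zeta>]
  have "(\<lambda>x. u x + \<zeta> x) \<in> W12 S"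
    using u has_W12_gradient_add[OF Sl _ W] by (auto simp: admissible_def W12_def)
  moreover have "(\<lambda>x. u x + \<zeta> x - g x) \<in> W12_0 S"
  proof -
    obtain G \<phi> where G: "has_W12_gradient S (\<lambda>x. u x - g x) G" "\<And>n::nat. test_function S (\<phi> n)"
      "tendsto_L2 S \<phi> (\<lambda>x. u x - g x) sequentially" "tendsto_L2 S (\<lambda>n. gradient (\<phi> n)) G sequentially"
      using u by (auto simp: admissible_def W12_0_def)
    obtain K' \<psi> where K': "compact K'" "K' \<subseteq> S" "\<And>n::nat. test_function S (\<psi> n)" "\<And>n x. x \<notin> K' \<Longrightarrow> \<psi> n x = 0"
      and lim: "uniform_limit UNIV \<psi> \<zeta> sequentially" "uniform_limit UNIV (\<lambda>n. gradient (\<psi> n)) (gradient \<zeta>) sequentially"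
      using C1_imp_test_function_limit[OF S \<zeta>(2,3,1,4)] by blast
    have C\<psi>: "C1_on UNIV (\<psi> n)" for n using K'(3) by (rule test_function_C1_on)
    have cont: "continuous_on UNIV (\<psi> n)" "continuous_on UNIV (gradient (\<psi> n))"
      "continuous_on UNIV \<zeta>" "continuous_on UNIV (gradient \<zeta>)" for n
      using C\<psi> \<zeta>(1) by (auto simp: C1_on_continuous_on) (auto simp: C1_on_def)
    let ?K = "K \<union> K'"
    have K: "compact ?K" using \<zeta>(2) K'(1) by (rule compact_Un)
    have z: "\<psi> n x = 0" "\<zeta> x = 0" "gradient (\<psi> n) x = 0" "gradient \<zeta> x = 0" if "x \<notin> ?K" for n x
      using that K'(4) \<zeta>(4) gradient_eq_0_outside[OF compact_imp_closed[OF K'(1)] K'(4)]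
        gradient_eq_0_outside[OF compact_imp_closed[OF \<zeta>(2)] \<zeta>(4)] by auto
    have "tendsto_L2 S \<psi> \<zeta> sequentially"
      by (rule tendsto_L2_uniform_limit[OF Sl lim(1) cont(1,3) K z(1,2)])
    moreover have "tendsto_L2 S (\<lambda>n. gradient (\<psi> n)) (gradient \<zeta>) sequentially"
      by (rule tendsto_L2_uniform_limit[OF Sl lim(2) cont(2,4) K z(3,4)])
    moreover have "gradient (\<lambda>x. \<phi> n x + \<psi> n x) = (\<lambda>x. gradient (\<phi> n) x + gradient (\<psi> n) x)" for n
      using test_function_C1_on[OF G(2)] C\<psi> by (auto simp: C1_on_def gradient_add)
    ultimately have "has_W12_gradient S (\<lambda>x. (u x - g x) + \<zeta> x) (\<lambda>x. G x + gradient \<zeta> x)"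
      "\<And>n. test_function S (\<lambda>x. \<phi> n x + \<psi> n x)"
      "tendsto_L2 S (\<lambda>n x. \<phi> n x + \<psi> n x) (\<lambda>x. (u x - g x) + \<zeta> x) sequentially"
      "tendsto_L2 S (\<lambda>n. gradient (\<lambda>x. \<phi> n x + \<psi> n x)) (\<lambda>x. G x + gradient \<zeta> x) sequentially"
      using has_W12_gradient_add[OF Sl G(1) W] test_function_add[OF G(2) K'(3)]
        tendsto_L2_add[OF G(3)] tendsto_L2_add[OF G(4)] by auto
    moreover have "(\<lambda>x. u x + \<zeta> x - g x) = (\<lambda>x. (u x - g x) + \<zeta> x)" by auto
    ultimately show ?thesis unfolding W12_0_def mem_Collect_eq
      by (intro exI[of _ "\<lambda>x. G x + gradient \<zeta> x"] exI[of _ "\<lambda>n x. \<phi> n x + \<psi> n x"]) auto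
  qed
  ultimately show ?thesis using ae by (auto simp: admissible_def)
qed

text \<open>One-sided first variation. The constraints are convex, so
  \<open>u + \<epsilon> \<zeta>\<close> competes for 0 < \<epsilon> \<le> 1; dividing the expansion
  of its energy by \<epsilon> and letting \<epsilon> tend to 0 leaves the linear term.\<close>

lemma double_obstacle_weak_inequality:
  fixes \<zeta> :: "'a::euclidean_space \<Rightarrow> real"
  assumes S: "open S" and u: "double_obstacle_solution S p1 p2 u" and G: "has_W12_gradient S u G"
    and \<zeta>: "C1_on UNIV \<zeta>" "compact K" "K \<subseteq> S" "\<And>x. x \<notin> K \<Longrightarrow> \<zeta> x = 0"
    and ae: "AE x in lebesgue_on S. p1 x \<le> u x + \<zeta> x \<and> u x + \<zeta> x \<le> p2 x"
  shows "0 \<le> (\<integral>x. G x \<bullet> gradient \<zeta> x \<partial>lebesgue_on S)"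
proof -
  have Sl: "S \<in> sets lebesgue" using S by auto
  obtain g where g: "u \<in> admissible S p1 p2 g"
    and min: "\<And>v H. v \<in> admissible S p1 p2 g \<Longrightarrow> has_W12_gradient S v H \<Longrightarrow>
      (\<integral>x. (norm (G x))\<^sup>2 \<partial>lebesgue_on S) \<le> (\<integral>x. (norm (H x))\<^sup>2 \<partial>lebesgue_on S)"
    using u G unfolding double_obstacle_solution_def by blast
  have aeu: "AE x in lebesgue_on S. p1 x \<le> u x \<and> u x \<le> p2 x" using g by (simp add: admissible_def)
  have LG: "L2_on S G" using G by (simp add: has_W12_gradient_def)
  have LZ: "L2_on S (gradient \<zeta>)" using has_W12_gradient_C1[OF S \<zeta>] by (simp add: has_W12_gradient_def)
  define I where "I = (\<integral>x. G x \<bullet> gradient \<zeta> x \<partial>lebesgue_on S)"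
  define Z where "Z = (\<integral>x. (norm (gradient \<zeta> x))\<^sup>2 \<partial>lebesgue_on S)"
  have *: "0 \<le> 2 * I + \<epsilon> * Z" if \<epsilon>: "0 < \<epsilon>" "\<epsilon> \<le> 1" for \<epsilon>
  proof -
    have C: "C1_on UNIV (\<lambda>x. \<epsilon> * \<zeta> x)" using \<zeta>(1) by (rule C1_on_cmult)
    have z: "\<epsilon> * \<zeta> x = 0" if "x \<notin> K" for x using \<zeta>(4)[OF that] by simp
    have ae': "AE x in lebesgue_on S. p1 x \<le> u x + \<epsilon> * \<zeta> x \<and> u x + \<epsilon> * \<zeta> x \<le> p2 x"
      using ae aeu
    proof eventually_elim
      case (elim x)
      have "u x + \<epsilon> * \<zeta> x = (1 - \<epsilon>) * u x + \<epsilon> * (u x + \<zeta> x)" by (simp add: algebra_simps)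
      moreover have "(1 - \<epsilon>) * p1 x + \<epsilon> * p1 x \<le> (1 - \<epsilon>) * u x + \<epsilon> * (u x + \<zeta> x)"
        "(1 - \<epsilon>) * u x + \<epsilon> * (u x + \<zeta> x) \<le> (1 - \<epsilon>) * p2 x + \<epsilon> * p2 x"
        using elim \<epsilon> by (intro add_mono mult_left_mono; simp)+
      ultimately show ?case by (simp add: algebra_simps)
    qed
    have "has_W12_gradient S (\<lambda>x. u x + \<epsilon> * \<zeta> x) (\<lambda>x. G x + gradient (\<lambda>x. \<epsilon> * \<zeta> x) x)"
      by (rule has_W12_gradient_add[OF Sl G has_W12_gradient_C1[OF S C \<zeta>(2,3) z]])
    moreover have "gradient (\<lambda>x. \<epsilon> * \<zeta> x) x = \<epsilon> *\<^sub>R gradient \<zeta> x" for x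
      using \<zeta>(1) by (simp add: C1_on_def gradient_cmult)
    ultimately have H: "has_W12_gradient S (\<lambda>x. u x + \<epsilon> * \<zeta> x) (\<lambda>x. G x + \<epsilon> *\<^sub>R gradient \<zeta> x)" by simp
    have i: "integrable (lebesgue_on S) (\<lambda>x. (norm (G x))\<^sup>2)" "integrable (lebesgue_on S) (\<lambda>x. (norm (gradient \<zeta> x))\<^sup>2)"
      "integrable (lebesgue_on S) (\<lambda>x. G x \<bullet> gradient \<zeta> x)"
      using LG LZ L2_on_integrable_inner[OF LG LZ] by (auto simp: L2_on_def)
    have "(\<integral>x. (norm (G x))\<^sup>2 \<partial>lebesgue_on S) \<le> (\<integral>x. (norm (G x + \<epsilon> *\<^sub>R gradient \<zeta> x))\<^sup>2 \<partial>lebesgue_on S)"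
      by (rule min[OF admissible_add[OF S g C \<zeta>(2,3) z ae'] H])
    also have "\<dots> = (\<integral>x. (norm (G x))\<^sup>2 + (2 * \<epsilon> * (G x \<bullet> gradient \<zeta> x) + \<epsilon>\<^sup>2 * (norm (gradient \<zeta> x))\<^sup>2) \<partial>lebesgue_on S)"
      by (intro Bochner_Integration.integral_cong refl)
         (simp only: power2_norm_eq_inner, simp add: inner_add_left inner_add_right inner_commute power2_eq_square algebra_simps)
    also have "\<dots> = (\<integral>x. (norm (G x))\<^sup>2 \<partial>lebesgue_on S) + (2 * \<epsilon> * I + \<epsilon>\<^sup>2 * Z)"
      unfolding I_def Z_def using i by simp
    finally have "0 \<le> \<epsilon> * (2 * I + \<epsilon> * Z)" by (simp add: power2_eq_square algebra_simps)
    then show ?thesis using \<epsilon>(1) by (simp add: zero_le_mult_iff)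
  qed
  have "((\<lambda>\<epsilon>. 2 * I + \<epsilon> * Z) \<longlongrightarrow> 2 * I + 0 * Z) (at_right 0)"
    by (intro tendsto_intros)
  moreover have "\<forall>\<^sub>F \<epsilon> in at_right 0. 0 \<le> 2 * I + \<epsilon> * Z"
    unfolding eventually_at_right_field by (intro exI[of _ 1]) (auto intro: *)
  ultimately have "0 \<le> 2 * I + 0 * Z"
    by (intro tendsto_lowerbound[of _ _ "at_right 0"]) auto
  then show ?thesis by (simp add: I_def)
qed

text \<open>For smooth \<psi> the partial derivatives of \<psi> are test functions themselves, so an
  integration by parts can be done weakly on one side and undone classically on the other, where
  \<open>u\<close> is C1. Mollification extends the identity from \<psi> to \<zeta>.\<close>

lemma weak_gradient_eq_gradient:
  fixes \<zeta> :: "'a::euclidean_space \<Rightarrow> real"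
  assumes S: "open S" and G: "has_W12_gradient S u G"
    and B: "open B" "B \<subseteq> S" "C1_on B u"
    and \<zeta>: "C1_on UNIV \<zeta>" "compact K" "K \<subseteq> B" "\<And>x. x \<notin> K \<Longrightarrow> \<zeta> x = 0"
  shows "(\<integral>x. G x \<bullet> gradient \<zeta> x \<partial>lebesgue_on S) = (\<integral>x. gradient u x \<bullet> gradient \<zeta> x \<partial>lebesgue_on B)"
proof -
  have Sl: "S \<in> sets lebesgue" and Bl: "B \<in> sets lebesgue" using S B by auto
  obtain K' \<psi> where K': "compact K'" "K' \<subseteq> B" "\<And>n::nat. test_function B (\<psi> n)" "\<And>n x. x \<notin> K' \<Longrightarrow> \<psi> n x = 0"
    and lim: "uniform_limit UNIV (\<lambda>n. gradient (\<psi> n)) (gradient \<zeta>) sequentially"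
    by (rule C1_imp_test_function_limit[OF B(1) \<zeta>(2,3,1)]) (erule \<zeta>(4), rule that)
  have t: "test_function S (\<psi> n)" for n using K'(3)[of n] B(2) by (auto simp: test_function_def)
  have C\<psi>: "C1_on UNIV (\<psi> n)" for n using K'(3) by (rule test_function_C1_on)
  have cont: "continuous_on UNIV (gradient (\<psi> n))" "continuous_on UNIV (gradient \<zeta>)" for n
    using C\<psi> \<zeta>(1) by (auto simp: C1_on_def)
  let ?K = "K \<union> K'"
  have K: "compact ?K" "?K \<subseteq> B" using \<zeta>(2,3) K'(1,2) by (auto intro: compact_Un)
  have z: "gradient (\<psi> n) x = 0" "gradient \<zeta> x = 0" if "x \<notin> ?K" for n x
    using that gradient_eq_0_outside[OF compact_imp_closed[OF K'(1)] K'(4)]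
      gradient_eq_0_outside[OF compact_imp_closed[OF \<zeta>(2)] \<zeta>(4)] by auto
  have LG: "L2_on S G" using G by (simp add: has_W12_gradient_def)
  have cu: "continuous_on B u" "continuous_on B (gradient u)"
    using B(3) by (auto simp: C1_on_continuous_on) (auto simp: C1_on_def)
  \<comment> \<open>The classical gradient need not be square integrable up to the boundary of
    \<open>B\<close>; its restriction to a compact set containing all supports is.\<close>
  define U where "U x = indicator ?K x *\<^sub>R gradient u x" for x
  have LU: "L2_on B U"
  proof -
    have "continuous_on ?K (gradient u)" using cu(2) K(2) by (rule continuous_on_subset)
    then have "U \<in> borel_measurable borel"
      unfolding U_def using compact_imp_closed[OF K(1)] by (intro borel_measurable_continuous_on_indicator) auto
    then have "U \<in> borel_measurable lborel" by simp
    then have "U \<in> borel_measurable (lebesgue_on B)"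
      by (intro measurable_restrict_space1 measurable_completion)
    moreover have "integrable lborel (\<lambda>x. indicator ?K x *\<^sub>R (norm (gradient u x))\<^sup>2)"
      using K(1) \<open>continuous_on ?K (gradient u)\<close> by (intro borel_integrable_compact continuous_intros)
    moreover have "(\<lambda>x. (norm (U x))\<^sup>2) = (\<lambda>x. indicator ?K x *\<^sub>R (norm (gradient u x))\<^sup>2)"
      by (auto simp: U_def indicator_def fun_eq_iff)
    ultimately show ?thesis
      using integrable_lebesgue_on_lborel[OF Bl] by (simp add: L2_on_def)
  qed
  have U_eq: "U x \<bullet> v = gradient u x \<bullet> v" if "x \<notin> ?K \<Longrightarrow> v = 0" for x v
    using that by (cases "x \<in> ?K") (auto simp: U_def)
  have eq: "(\<integral>x. G x \<bullet> gradient (\<psi> n) x \<partial>lebesgue_on S) = (\<integral>x. U x \<bullet> gradient (\<psi> n) x \<partial>lebesgue_on B)" for n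
  proof -
    note K'c = compact_imp_closed[OF K'(1)]
    define f where "f i x = gradient (\<psi> n) x \<bullet> i" for i x
    have f: "C1_on UNIV (f i)" "\<And>x. x \<notin> K' \<Longrightarrow> f i x = 0" "test_function S (f i)" if "i \<in> Basis" for i
      using test_function_gradient_inner[OF t[of n] that] test_function_C1_on gradient_eq_0_outside[OF K'c K'(4)]
      unfolding f_def by auto
    have zf: "gradient (f i) x = 0" if "i \<in> Basis" "x \<notin> K'" for i x
      using gradient_eq_0_outside[OF K'c f(2)[OF that(1)] that(2)] .
    have "(\<integral>x. (G x \<bullet> i) * f i x \<partial>lebesgue_on S) = (\<integral>x. f i x * (gradient u x \<bullet> i) \<partial>lborel)" if i: "i \<in> Basis" for i
    proof -
      have "(\<integral>x. (G x \<bullet> i) * f i x \<partial>lebesgue_on S) = - (\<integral>x. u x * (gradient (f i) x \<bullet> i) \<partial>lebesgue_on S)"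
        using G f(3)[OF i] i by (simp add: has_W12_gradient_def)
      also have "(\<integral>x. u x * (gradient (f i) x \<bullet> i) \<partial>lebesgue_on S) = (\<integral>x. (gradient (f i) x \<bullet> i) * u x \<partial>lborel)"
        unfolding mult.commute[of "u _"]
      proof (rule lebesgue_on_integral_eq_lborel[OF Sl])
        show "(\<lambda>x. (gradient (f i) x \<bullet> i) * u x) \<in> borel_measurable borel"
          using f(1)[OF i]
          by (intro borel_measurable_continuous_onI continuous_on_mult_cutoff[OF _ K'c _ B(1) K'(2) cu(1)] continuous_intros)
             (auto simp: zf[OF i] C1_on_def)
        show "(gradient (f i) x \<bullet> i) * u x = 0" if "x \<notin> S" for x
        proof -
          have "x \<notin> K'" using that K'(2) B(2) by auto
          then show ?thesis by (simp add: zf[OF i])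
        qed
      qed
      finally show ?thesis
        using integration_by_parts_compact_support[OF f(1)[OF i] B(3,1) K'(1,2) f(2)[OF i]] by simp
    qed
    note 1 = this
    have sum_eq: "v \<bullet> gradient (\<psi> n) x = (\<Sum>i\<in>Basis. (v \<bullet> i) * f i x)" for v x
      unfolding f_def by (rule euclidean_inner)
    have iG: "integrable (lebesgue_on S) (\<lambda>x. (G x \<bullet> i) * f i x)" if "i \<in> Basis" for i
    proof -
      have "L2_on S (\<lambda>x. f i x *\<^sub>R i)"
        using f(2)[OF that] C1_on_continuous_on[OF f(1)[OF that]]
        by (intro L2_on_compact_support[OF Sl _ K'(1)] continuous_intros) auto
      from L2_on_integrable_inner[OF LG this] show ?thesis by (simp add: mult.commute)
    qed
    have cf: "continuous_on UNIV (\<lambda>x. f i x * (gradient u x \<bullet> i))" if "i \<in> Basis" for i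
      using f(2)[OF that] C1_on_continuous_on[OF f(1)[OF that]] cu(2)
      by (intro continuous_on_mult_cutoff[OF _ K'c _ B(1) K'(2)] continuous_intros) auto
    have iu: "integrable lborel (\<lambda>x. f i x * (gradient u x \<bullet> i))" if "i \<in> Basis" for i
      by (rule integrable_compact_support[OF cf[OF that] K'(1)]) (simp add: f(2)[OF that])
    have "(\<integral>x. G x \<bullet> gradient (\<psi> n) x \<partial>lebesgue_on S) = (\<Sum>i\<in>Basis. \<integral>x. (G x \<bullet> i) * f i x \<partial>lebesgue_on S)"
      unfolding sum_eq by (rule Bochner_Integration.integral_sum) (rule iG)
    also have "\<dots> = (\<Sum>i\<in>Basis. \<integral>x. f i x * (gradient u x \<bullet> i) \<partial>lborel)"
      by (rule sum.cong) (simp_all add: 1)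
    also have "\<dots> = (\<integral>x. (\<Sum>i\<in>Basis. f i x * (gradient u x \<bullet> i)) \<partial>lborel)"
      by (rule Bochner_Integration.integral_sum[symmetric]) (rule iu)
    also have "\<dots> = (\<integral>x. (\<Sum>i\<in>Basis. f i x * (gradient u x \<bullet> i)) \<partial>lebesgue_on B)"
    proof (rule lebesgue_on_integral_eq_lborel[OF Bl, symmetric])
      show "(\<lambda>x. \<Sum>i\<in>Basis. f i x * (gradient u x \<bullet> i)) \<in> borel_measurable borel"
        by (intro borel_measurable_sum borel_measurable_continuous_onI cf)
      show "(\<Sum>i\<in>Basis. f i x * (gradient u x \<bullet> i)) = 0" if "x \<notin> B" for x
        using that K'(2) f(2) by (intro sum.neutral) auto
    qed
    also have "\<dots> = (\<integral>x. U x \<bullet> gradient (\<psi> n) x \<partial>lebesgue_on B)"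
    proof (intro Bochner_Integration.integral_cong refl)
      fix x
      have "U x \<bullet> gradient (\<psi> n) x = gradient u x \<bullet> gradient (\<psi> n) x"
        by (rule U_eq) (rule z)
      then show "(\<Sum>i\<in>Basis. f i x * (gradient u x \<bullet> i)) = U x \<bullet> gradient (\<psi> n) x"
        by (simp add: sum_eq mult.commute)
    qed
    finally show ?thesis .
  qed
  have "(\<lambda>n. \<integral>x. G x \<bullet> gradient (\<psi> n) x \<partial>lebesgue_on S) \<longlonglongrightarrow> (\<integral>x. G x \<bullet> gradient \<zeta> x \<partial>lebesgue_on S)"
    by (rule tendsto_integral_inner_uniform_limit[OF Sl LG lim cont K(1) z])
  moreover have "(\<lambda>n. \<integral>x. U x \<bullet> gradient (\<psi> n) x \<partial>lebesgue_on B) \<longlonglongrightarrow> (\<integral>x. U x \<bullet> gradient \<zeta> x \<partial>lebesgue_on B)"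
    by (rule tendsto_integral_inner_uniform_limit[OF Bl LU lim cont K(1) z])
  ultimately have "(\<integral>x. G x \<bullet> gradient \<zeta> x \<partial>lebesgue_on S) = (\<integral>x. U x \<bullet> gradient \<zeta> x \<partial>lebesgue_on B)"
    using LIMSEQ_unique unfolding eq by blast
  also have "\<dots> = (\<integral>x. gradient u x \<bullet> gradient \<zeta> x \<partial>lebesgue_on B)"
    by (intro Bochner_Integration.integral_cong refl U_eq) (rule z)
  finally show ?thesis .
qed

section \<open>Polar coordinates\<close>

definition er :: "real \<Rightarrow> real^2" where "er \<theta> = vector [cos \<theta>, sin \<theta>]"
definition et :: "real \<Rightarrow> real^2" where "et \<theta> = vector [- sin \<theta>, cos \<theta>]"

lemma er_et_component [simp]:
  "er \<theta> $ 1 = cos \<theta>" "er \<theta> $ 2 = sin \<theta>" "et \<theta> $ 1 = - sin \<theta>" "et \<theta> $ 2 = cos \<theta>"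
  by (simp_all add: er_def et_def)

lemma inner_real2: "(a::real^2) \<bullet> b = a $ 1 * b $ 1 + a $ 2 * b $ 2"
  by (simp add: inner_vec_def sum_2)

lemma norm_real2: "norm (x::real^2) = sqrt ((x $ 1)\<^sup>2 + (x $ 2)\<^sup>2)"
  by (simp add: norm_eq_sqrt_inner inner_real2 power2_eq_square)

lemma norm_squared_real2: "(norm (x::real^2))\<^sup>2 = (x $ 1)\<^sup>2 + (x $ 2)\<^sup>2"
  by (simp add: norm_real2)

lemma vec_eq2_iff: "(a::real^2) = b \<longleftrightarrow> a $ 1 = b $ 1 \<and> a $ 2 = b $ 2"
  by (simp add: vec_eq_iff forall_2)

lemma er_inner [simp]: "er \<theta> \<bullet> er \<theta> = 1" "et \<theta> \<bullet> et \<theta> = 1" "er \<theta> \<bullet> et \<theta> = 0" "et \<theta> \<bullet> er \<theta> = 0"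
  by (simp_all add: inner_real2 flip: power2_eq_square)

lemma norm_er [simp]: "norm (er \<theta>) = 1" "norm (et \<theta>) = 1"
  by (simp_all add: norm_eq_sqrt_inner)

lemma inner_polar_frame: "(a::real^2) \<bullet> b = (a \<bullet> er \<theta>) * (b \<bullet> er \<theta>) + (a \<bullet> et \<theta>) * (b \<bullet> et \<theta>)"
proof -
  have "(a1 * c + a2 * s) * (b1 * c + b2 * s) + (a1 * - s + a2 * c) * (b1 * - s + b2 * c)
      = (a1 * b1 + a2 * b2) * (s\<^sup>2 + c\<^sup>2)" for a1 a2 b1 b2 c s :: real
    by algebra
  from this[of "a $ 1" "cos \<theta>" "a $ 2" "sin \<theta>" "b $ 1" "b $ 2"] show ?thesis by (simp add: inner_real2)
qed

lemma has_vector_derivative_er: "(er has_vector_derivative et \<theta>) (at \<theta> within S)"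
proof -
  have e: "er = (\<lambda>t. cos t *\<^sub>R axis 1 1 + sin t *\<^sub>R axis 2 1)"
    by (auto simp: fun_eq_iff vec_eq2_iff axis_def)
  have "((\<lambda>t. cos t *\<^sub>R axis 1 1 + sin t *\<^sub>R axis 2 1 :: real^2) has_vector_derivative
      (- sin \<theta>) *\<^sub>R axis 1 1 + cos \<theta> *\<^sub>R axis 2 1) (at \<theta> within S)"
    by (auto intro!: derivative_eq_intros)
  moreover have "(- sin \<theta>) *\<^sub>R axis 1 1 + cos \<theta> *\<^sub>R axis 2 1 = et \<theta>"
    by (auto simp: vec_eq2_iff axis_def)
  ultimately show ?thesis unfolding e by metis
qed

lemma continuous_on_er [continuous_intros]:
  assumes "continuous_on S f"
  shows "continuous_on S (\<lambda>x. er (f x))"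
proof -
  have "continuous_on UNIV er"
    by (intro continuous_at_imp_continuous_on ballI has_vector_derivative_continuous[OF has_vector_derivative_er])
  then show ?thesis using assms by (rule continuous_on_compose2) auto
qed

lemma continuous_on_et [continuous_intros]:
  assumes "continuous_on S f"
  shows "continuous_on S (\<lambda>x. et (f x))"
proof -
  have "et t = er (t + pi / 2)" for t by (simp add: vec_eq2_iff sin_add cos_add)
  then show ?thesis using assms by (simp add: continuous_intros)
qed

definition arg :: "real^2 \<Rightarrow> real" where
  "arg x = Arg (Complex (x $ 1) (x $ 2))"

lemma arg_bounded: "- pi < arg x" "arg x \<le> pi"
  using Arg_bounded by (auto simp: arg_def)

lemma polar_decomposition: "norm x *\<^sub>R er (arg x) = x"
proof -
  let ?z = "Complex (x $ 1) (x $ 2)"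
  have "rcis (cmod ?z) (Arg ?z) = ?z" by (rule rcis_cmod_Arg)
  moreover have "cmod ?z = norm x" by (simp add: norm_real2 complex_norm)
  ultimately have "Re (rcis (norm x) (arg x)) = x $ 1" "Im (rcis (norm x) (arg x)) = x $ 2"
    by (simp_all add: arg_def)
  then show ?thesis by (simp add: vec_eq2_iff)
qed

lemma arg_polar:
  assumes "0 < r" "- pi < \<theta>" "\<theta> \<le> pi"
  shows "arg (r *\<^sub>R er \<theta>) = \<theta>"
proof -
  have "Complex (r * cos \<theta>) (r * sin \<theta>) = rcis r \<theta>" by (simp add: complex_eq_iff)
  moreover have "sgn (rcis r \<theta>) = cis \<theta>"
    using assms(1) by (simp add: sgn_div_norm rcis_def scaleR_conv_of_real norm_mult field_simps)
  ultimately show ?thesis unfolding arg_def using assms by (auto intro: cis_Arg_unique)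
qed

text \<open>The cut along which \<open>arg\<close> jumps, together with the origin, so that
  \<open>arg\<close> is smooth on the open complement.\<close>

definition slit :: "(real^2) set" where "slit = {x. x $ 2 = 0 \<and> x $ 1 \<le> 0}"

lemma closed_slit: "closed slit"
proof -
  have "slit = {x. x $ 2 = 0} \<inter> {x. x $ 1 \<le> 0}" by (auto simp: slit_def)
  moreover have "closed {x::real^2. x $ 2 = 0}" "closed {x::real^2. x $ 1 \<le> 0}"
    by (intro closed_Collect_eq closed_Collect_le continuous_intros)+
  ultimately show ?thesis by (metis closed_Int)
qed

lemma arg_less_pi: "x \<notin> slit \<Longrightarrow> arg x < pi"
proof (rule ccontr)
  assume "x \<notin> slit" "\<not> arg x < pi"
  then have "arg x = pi" using arg_bounded[of x] by simp
  then have "x = norm x *\<^sub>R er pi" using polar_decomposition[of x] by simp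
  then have "x $ 1 = - norm x" "x $ 2 = 0" by (metis vector_scaleR_component er_et_component(1) cos_pi mult_minus1_right real_scaleR_def,
      metis vector_scaleR_component er_et_component(2) sin_pi mult_zero_right real_scaleR_def)
  then show False using \<open>x \<notin> slit\<close> by (simp add: slit_def)
qed

lemma polar_notin_slit: "0 < r \<Longrightarrow> - pi < \<theta> \<Longrightarrow> \<theta> < pi \<Longrightarrow> r *\<^sub>R er \<theta> \<notin> slit"
proof
  assume *: "0 < r" "- pi < \<theta>" "\<theta> < pi" "r *\<^sub>R er \<theta> \<in> slit"
  then have s: "sin \<theta> = 0" and c: "cos \<theta> \<le> 0" by (auto simp: slit_def mult_le_0_iff)
  have "\<theta> = 0" using sin_eq_0_pi[of \<theta>] * s by auto
  then show False using c by simp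
qed

text \<open>Off the slit \<open>arg\<close> is the imaginary part of the complex logarithm, whose
  derivative at z is 1 / z.\<close>

lemma has_derivative_arg:
  assumes "x \<notin> slit"
  shows "(arg has_derivative (\<lambda>h. ((1 / (norm x)\<^sup>2) *\<^sub>R vector [- x $ 2, x $ 1]) \<bullet> h)) (at x)"
proof -
  let ?z = "Complex (x $ 1) (x $ 2)"
  let ?c = "\<lambda>x::real^2. Complex (x $ 1) (x $ 2)"
  have z: "?z \<notin> \<real>\<^sub>\<le>\<^sub>0" using assms by (auto simp: slit_def complex_nonpos_Reals_iff)
  have c: "?c = (\<lambda>x. complex_of_real (x $ 1) + \<i> * complex_of_real (x $ 2))"
    by (auto simp: fun_eq_iff complex_eq_iff)
  have "(?c has_derivative ?c) (at x)"
    unfolding c by (auto intro!: derivative_eq_intros bounded_linear.has_derivative[OF bounded_linear_vec_nth])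
  from has_derivative_compose[OF this has_field_derivative_Ln[OF z, unfolded has_field_derivative_def]]
  have "((\<lambda>x. Im (Ln (?c x))) has_derivative (\<lambda>h. Im (inverse ?z * ?c h))) (at x)"
    by (rule bounded_linear.has_derivative[OF bounded_linear_Im])
  moreover have "Im (inverse ?z * ?c h) = ((1 / (norm x)\<^sup>2) *\<^sub>R vector [- x $ 2, x $ 1]) \<bullet> h" for h
  proof -
    have "inverse ?z * ?c h = ?c h / ?z" by (simp add: divide_inverse mult.commute)
    then show ?thesis
      by (simp add: Im_divide inner_real2 norm_squared_real2 diff_divide_distrib mult.commute)
  qed
  ultimately have "((\<lambda>x. Im (Ln (?c x))) has_derivative (\<lambda>h. ((1 / (norm x)\<^sup>2) *\<^sub>R vector [- x $ 2, x $ 1]) \<bullet> h)) (at x)"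
    by simp
  then show ?thesis
  proof (rule has_derivative_transform_within_open[of _ _ _ _ "- slit"])
    show "Im (Ln (?c y)) = arg y" if "y \<in> - slit" for y
    proof -
      have "?c y \<noteq> 0" using that by (auto simp: slit_def complex_eq_iff)
      then show ?thesis by (simp add: arg_def Arg_eq_Im_Ln)
    qed
  qed (use assms closed_slit in auto)
qed

text \<open>Fubini's theorem is applied to pairs; the identification of \<open>real^2\<close> with
  pairs preserves boxes and their volumes, hence integrals.\<close>

lemma integral_real2_cbox:
  fixes F :: "real^2 \<Rightarrow> real"
  assumes "continuous_on (cbox (vector [a, c]) (vector [b, d])) F"
  shows "integral (cbox (vector [a, c]) (vector [b, d])) F
    = integral {a..b} (\<lambda>x. integral {c..d} (\<lambda>y. F (vector [x, y])))"
proof -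
  define g :: "real \<times> real \<Rightarrow> real^2" where "g p = vector [fst p, snd p]" for p
  define h :: "real^2 \<Rightarrow> real \<times> real" where "h v = (v $ 1, v $ 2)" for v
  have hg: "h (g p) = p" for p by (simp add: h_def g_def)
  have gh: "g (h v) = v" for v by (simp add: h_def g_def vec_eq2_iff)
  have g_eq: "g = (\<lambda>p. fst p *\<^sub>R axis 1 1 + snd p *\<^sub>R axis 2 1)"
    by (auto simp: fun_eq_iff vec_eq2_iff axis_def g_def)
  have cg: "continuous_on S g" for S
    unfolding g_eq by (intro continuous_intros)
  have gc: "g ` cbox u v = cbox (g u) (g v)" for u v
  proof -
    have "g ` cbox u v = h -` cbox u v" using hg gh by (auto simp: image_iff) (metis gh)
    also have "\<dots> = cbox (g u) (g v)"
      by (cases u; cases v) (auto simp: h_def g_def mem_box_cart forall_2 cbox_Pair_eq)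
    finally show ?thesis .
  qed
  have hc: "h ` cbox w z = cbox (h w) (h z)" for w z
  proof -
    have "cbox w z = g ` cbox (h w) (h z)" using gc gh by simp
    then show ?thesis by (simp add: image_image hg)
  qed
  have "(F has_integral integral (cbox (vector [a, c]) (vector [b, d])) F) (cbox (vector [a, c]) (vector [b, d]))"
    using assms by (intro integrable_integral integrable_continuous)
  from has_integral_twiddle[of 1 h g, OF _ hg gh _ _ _ _ this]
  have "((\<lambda>p. F (g p)) has_integral (1 / 1) *\<^sub>R integral (cbox (vector [a, c]) (vector [b, d])) F) (h ` cbox (vector [a, c]) (vector [b, d]))"
  proof -
    have 1: "continuous (at p) g" for p using cg[of UNIV] continuous_on_eq_continuous_at[OF open_UNIV] by blast
    have 4: "measure lborel (g ` cbox u v) = 1 * measure lborel (cbox u v)" for u v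
    proof -
      obtain a c b d where uv: "u = (a, c)" "v = (b, d)" by (cases u; cases v)
      have exists_2: "(\<exists>i::2. Q i) \<longleftrightarrow> Q 1 \<or> Q 2" for Q
        using forall_2[of "\<lambda>i. \<not> Q i"] by auto
      have "measure lborel (cbox (g u) (g v)) = measure lborel (cbox a b) * measure lborel (cbox c d)"
        by (auto simp: content_cbox_if_cart prod.distrib UNIV_2 uv g_def interval_eq_empty_cart exists_2 content_real_if)
      then show ?thesis unfolding gc by (simp add: uv content_Pair)
    qed
    show ?thesis
      by (rule has_integral_twiddle[of 1 h g, OF _ hg gh 1 _ _ 4 \<open>(F has_integral _) _\<close>])
         (simp, use gc in blast, use hc in blast)
  qed
  then have "integral (cbox (a, c) (b, d)) (\<lambda>p. F (g p)) = integral (cbox (vector [a, c]) (vector [b, d])) F"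
    unfolding hc by (auto simp: h_def intro: integral_unique)
  moreover have "integral (cbox (a, c) (b, d)) (\<lambda>p. F (g p)) = integral (cbox a b) (\<lambda>x. integral (cbox c d) (\<lambda>y. F (g (x, y))))"
  proof (rule integral_prod_continuous)
    show "continuous_on (cbox (a, c) (b, d)) (\<lambda>p. F (g p))"
      using gc[of "(a, c)" "(b, d)"] by (intro continuous_on_compose2[OF assms cg]) (auto simp: g_def)
  qed
  ultimately show ?thesis by (simp add: g_def)
qed

text \<open>Polar coordinates map an open rectangle injectively onto the open disc without the slit,
  with Jacobian r; the slit and the bounding circle are null sets.\<close>

lemma integral_cball_polar:
  fixes F :: "real^2 \<Rightarrow> real"
  assumes F: "continuous_on (cball 0 R) F" and "0 < R"
  shows "integral (cball 0 R) F = integral {0..R} (\<lambda>r. r * integral {-pi..pi} (\<lambda>\<theta>. F (r *\<^sub>R er \<theta>)))"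
proof -
  define S :: "(real^2) set" where "S = box (vector [0, -pi]) (vector [R, pi])"
  define g :: "real^2 \<Rightarrow> real^2" where "g v = v $ 1 *\<^sub>R er (v $ 2)" for v
  define g' :: "real^2 \<Rightarrow> real^2 \<Rightarrow> real^2" where "g' v h = h $ 1 *\<^sub>R er (v $ 2) + (v $ 1 * h $ 2) *\<^sub>R et (v $ 2)" for v h
  have S_iff: "v \<in> S \<longleftrightarrow> 0 < v $ 1 \<and> v $ 1 < R \<and> - pi < v $ 2 \<and> v $ 2 < pi" for v
    by (auto simp: S_def mem_box_cart forall_2)
  have der: "(g has_derivative g' v) (at v within S)" for v
  proof -
    have 1: "((\<lambda>v::real^2. v $ 2) has_derivative (\<lambda>h. h $ 2)) (at v within S)"
      by (rule bounded_linear.has_derivative[OF bounded_linear_vec_nth has_derivative_ident])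
    have 2: "((\<lambda>v::real^2. v $ 1) has_derivative (\<lambda>h. h $ 1)) (at v within S)"
      by (rule bounded_linear.has_derivative[OF bounded_linear_vec_nth has_derivative_ident])
    have "((\<lambda>v. er (v $ 2)) has_derivative (\<lambda>h. h $ 2 *\<^sub>R et (v $ 2))) (at v within S)"
      using has_derivative_compose[OF 1 has_vector_derivative_er[unfolded has_vector_derivative_def]] by simp
    from has_derivative_scaleR[OF 2 this] show ?thesis
      unfolding g_def[abs_def] g'_def by (simp add: add.commute)
  qed
  have det: "\<bar>det (matrix (g' v))\<bar> = v $ 1" if "v \<in> S" for v
  proof -
    have "det (matrix (g' v)) = cos (v $ 2) * (v $ 1 * cos (v $ 2)) + v $ 1 * sin (v $ 2) * sin (v $ 2)"
      unfolding det_2 matrix_def g'_def by (simp add: axis_def)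
    also have "\<dots> = v $ 1 * ((cos (v $ 2))\<^sup>2 + (sin (v $ 2))\<^sup>2)" by algebra
    finally show ?thesis using that by (simp add: S_iff)
  qed
  have inj: "inj_on g S"
  proof (rule inj_onI)
    fix v w assume vw: "v \<in> S" "w \<in> S" "g v = g w"
    have "norm (g v) = v $ 1" "norm (g w) = w $ 1" using vw(1,2) by (auto simp: g_def S_iff)
    moreover have "arg (g v) = v $ 2" "arg (g w) = w $ 2" unfolding g_def using vw(1,2) by (auto simp: S_iff intro!: arg_polar)
    ultimately have "v $ 1 = w $ 1" "v $ 2 = w $ 2" using vw(3) by metis+
    then show "v = w" by (simp add: vec_eq2_iff)
  qed
  have img: "g ` S = ball 0 R - slit"
  proof (intro set_eqI iffI)
    fix x assume "x \<in> g ` S"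
    then show "x \<in> ball 0 R - slit" using polar_notin_slit by (auto simp: g_def S_iff)
  next
    fix x :: "real^2" assume x: "x \<in> ball 0 R - slit"
    have "g (vector [norm x, arg x]) = x" by (simp add: g_def polar_decomposition)
    moreover have "vector [norm x, arg x] \<in> S"
      using x arg_bounded[of x] arg_less_pi[of x] by (auto simp: S_iff slit_def)
    ultimately show "x \<in> g ` S" by (metis image_eqI)
  qed
  have Fi: "F absolutely_integrable_on cball 0 R"
  proof -
    have "integrable lborel (\<lambda>x. indicator (cball 0 R) x *\<^sub>R F x)"
      using F by (intro borel_integrable_compact) auto
    then have "integrable lebesgue (\<lambda>x. indicator (cball 0 R) x *\<^sub>R F x)"
      using integrable_completion by blast
    then show ?thesis by (simp add: set_integrable_def)
  qed
  have neg: "negligible (cball 0 R - g ` S)" "negligible (g ` S - cball 0 R)"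
  proof -
    have "negligible {x::real^2. axis 2 1 \<bullet> x = 0}" by (rule negligible_hyperplane) (simp add: axis_eq_0_iff)
    moreover have "negligible (sphere (0::real^2) R)" by (rule negligible_sphere)
    ultimately have "negligible ({x::real^2. axis 2 1 \<bullet> x = 0} \<union> sphere 0 R)" by (rule negligible_Un)
    then show "negligible (cball 0 R - g ` S)"
      by (rule negligible_subset) (auto simp: img slit_def inner_axis' dist_norm)
    show "negligible (g ` S - cball 0 R)" by (rule negligible_subset[of "{}"]) (auto simp: img)
  qed
  have Fg: "F absolutely_integrable_on g ` S"
    by (rule absolutely_integrable_spike_set[OF Fi]) (auto intro: negligible_subset[OF neg(1)] negligible_subset[OF neg(2)])
  have Ieq: "integral (g ` S) F = integral (cball 0 R) F"
  proof (rule integral_spike_set)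
    show "negligible {x \<in> g ` S - cball 0 R. F x \<noteq> 0}"
      by (rule negligible_subset[OF neg(2)]) auto
    show "negligible {x \<in> cball 0 R - g ` S. F x \<noteq> 0}"
      by (rule negligible_subset[OF neg(1)]) auto
  qed
  \<comment> \<open>Values are wrapped into \<open>real^1\<close> because the change of variables
    formula speaks of \<open>real^n\<close>-valued functions.\<close>
  have "(\<lambda>x. vec (F x) :: real^1) absolutely_integrable_on (g ` S) \<and> integral (g ` S) (\<lambda>x. vec (F x) :: real^1) = vec (integral (cball 0 R) F)"
    using Fg Ieq by (simp add: absolutely_integrable_on_1_iff integral_on_1_eq)
  then have "(\<lambda>v. \<bar>det (matrix (g' v))\<bar> *\<^sub>R (vec (F (g v)) :: real^1)) absolutely_integrable_on S \<and>
    integral S (\<lambda>v. \<bar>det (matrix (g' v))\<bar> *\<^sub>R (vec (F (g v)) :: real^1)) = vec (integral (cball 0 R) F)"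
    by (subst has_absolute_integral_change_of_variables[OF _ der inj]) (auto simp: S_def)
  then have "integral S (\<lambda>v. \<bar>det (matrix (g' v))\<bar> * F (g v)) = integral (cball 0 R) F"
    by (simp add: absolutely_integrable_on_1_iff integral_on_1_eq)
  moreover have "integral S (\<lambda>v. \<bar>det (matrix (g' v))\<bar> * F (g v)) = integral S (\<lambda>v. v $ 1 * F (g v))"
    by (rule integral_cong) (simp add: det)
  moreover have "integral S (\<lambda>v. v $ 1 * F (g v)) = integral (cbox (vector [0, -pi]) (vector [R, pi])) (\<lambda>v. v $ 1 * F (g v))"
    unfolding S_def by (rule integral_open_interval)
  moreover have "\<dots> = integral {0..R} (\<lambda>r. integral {-pi..pi} (\<lambda>\<theta>. r * F (r *\<^sub>R er \<theta>)))"
  proof (subst integral_real2_cbox)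
    have "continuous_on (cbox (vector [0, -pi]) (vector [R, pi])) g"
      unfolding g_def[abs_def] by (intro continuous_intros)
    moreover have "g ` cbox (vector [0, -pi]) (vector [R, pi]) \<subseteq> cball 0 R"
      by (auto simp: g_def mem_box_cart forall_2)
    ultimately show "continuous_on (cbox (vector [0, -pi]) (vector [R, pi])) (\<lambda>v. v $ 1 * F (g v))"
      by (intro continuous_intros continuous_on_compose2[OF F]) auto
  qed (simp add: g_def)
  ultimately show ?thesis by simp
qed


section \<open>C1 functions in polar form\<close>

lemma C1_on_radial:
  fixes k :: "real \<Rightarrow> real"
  assumes k: "\<And>r. 0 < r \<Longrightarrow> (k has_field_derivative k' r) (at r)" and k': "continuous_on {0<..} k'"
  shows "C1_on (- {0}) (\<lambda>x::'a::euclidean_space. k (norm x))"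
proof (rule C1_onI)
  fix x :: 'a assume "x \<in> - {0}"
  then have x: "x \<noteq> 0" by simp
  have "(norm has_derivative (\<lambda>h. h \<bullet> sgn x)) (at x)"
    using has_derivative_norm[OF x] .
  from has_derivative_compose[OF this k[unfolded has_field_derivative_def, of "norm x"]] x
  show "((\<lambda>x. k (norm x)) has_derivative (\<lambda>h. (k' (norm x) / norm x) *\<^sub>R x \<bullet> h)) (at x)"
    by (simp add: sgn_div_norm inner_commute divide_inverse mult.assoc)
next
  show "continuous_on (- {0}) (\<lambda>x::'a. (k' (norm x) / norm x) *\<^sub>R x)"
    by (intro continuous_intros continuous_on_compose2[OF k']) auto
qed

text \<open>Chain rule for the radial projection onto the sphere of radius \<open>R\<close>: the
  gradient is R / |x| times the tangential part of the gradient of \<open>u\<close> at the projected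
  point.\<close>

lemma C1_on_zero_homogeneous:
  fixes u :: "'a::euclidean_space \<Rightarrow> real"
  assumes u: "C1_on B u" and R: "sphere 0 R \<subseteq> B" "0 < R"
  shows "C1_on (- {0}) (\<lambda>x. u ((R / norm x) *\<^sub>R x))"
proof -
  define q :: "'a \<Rightarrow> 'a" where "q x = (R / norm x) *\<^sub>R x" for x
  have qB: "q x \<in> B" if "x \<noteq> 0" for x
    using that R by (auto simp: q_def intro!: subsetD[OF R(1)])
  show ?thesis
  proof (rule C1_onI)
    fix x :: 'a assume "x \<in> - {0}"
    then have x: "x \<noteq> 0" by simp
    have n: "(norm has_derivative (\<lambda>h. h \<bullet> sgn x)) (at x)"
      using has_derivative_norm[OF x] .
    have "((\<lambda>t. R / t) has_field_derivative - R / (norm x)\<^sup>2) (at (norm x))"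
      using x by (auto intro!: derivative_eq_intros simp: power2_eq_square)
    from has_derivative_compose[OF n this[unfolded has_field_derivative_def]]
    have "((\<lambda>x. R / norm x) has_derivative (\<lambda>h. - R / (norm x)\<^sup>2 * (h \<bullet> sgn x))) (at x)" by simp
    from has_derivative_scaleR[OF this has_derivative_ident]
    have "(q has_derivative (\<lambda>h. (R / norm x) *\<^sub>R h + (- R / (norm x)\<^sup>2 * (h \<bullet> sgn x)) *\<^sub>R x)) (at x)"
      by (simp add: q_def[abs_def])
    from has_derivative_compose[OF this has_derivative_gradient[of u "q x"]]
    have "((\<lambda>x. u (q x)) has_derivative
      (\<lambda>h. gradient u (q x) \<bullet> ((R / norm x) *\<^sub>R h + (- R / (norm x)\<^sup>2 * (h \<bullet> sgn x)) *\<^sub>R x))) (at x)"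
      using u qB[OF x] by (simp add: C1_on_def)
    moreover have "gradient u (q x) \<bullet> ((R / norm x) *\<^sub>R h + (- R / (norm x)\<^sup>2 * (h \<bullet> sgn x)) *\<^sub>R x)
      = ((R / norm x) *\<^sub>R (gradient u (q x) - ((gradient u (q x) \<bullet> x) / (norm x)\<^sup>2) *\<^sub>R x)) \<bullet> h" for h
      using x by (simp add: inner_simps sgn_div_norm inner_commute[of h x] field_simps power2_eq_square)
    ultimately show "((\<lambda>x. u ((R / norm x) *\<^sub>R x)) has_derivative
       (\<lambda>h. ((R / norm x) *\<^sub>R (gradient u (q x) - ((gradient u (q x) \<bullet> x) / (norm x)\<^sup>2) *\<^sub>R x)) \<bullet> h)) (at x)"
      by (simp add: q_def)
  next
    have G: "continuous_on B (gradient u)" using u by (simp add: C1_on_def)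
    have "continuous_on (- {0}) (\<lambda>x. gradient u (q x))"
      by (intro continuous_on_compose2[OF G]) (auto simp: q_def[abs_def] intro!: continuous_intros qB[unfolded q_def])
    then show "continuous_on (- {0})
      (\<lambda>x. (R / norm x) *\<^sub>R (gradient u (q x) - ((gradient u (q x) \<bullet> x) / (norm x)\<^sup>2) *\<^sub>R x))"
      by (intro continuous_intros) auto
  qed
qed

text \<open>Constancy near the negative axis makes the jump of \<open>arg\<close> there invisible.\<close>

lemma C1_on_angular:
  assumes p: "\<And>\<theta>. (p has_field_derivative p' \<theta>) (at \<theta>)" and p': "continuous_on UNIV p'"
    and c: "\<And>\<theta>. \<theta>0 \<le> \<bar>\<theta>\<bar> \<Longrightarrow> \<bar>\<theta>\<bar> \<le> pi \<Longrightarrow> p \<theta> = c" and \<theta>0: "0 \<le> \<theta>0" "\<theta>0 < pi"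
  shows "C1_on (- {0}) (\<lambda>x. p (arg x))"
proof -
  \<comment> \<open>The sector |arg x| > \<theta>0 written without \<open>arg\<close>, so that
    openness is evident. It contains the slit except for the origin.\<close>
  define T where "T = {x::real^2. x $ 1 < cos \<theta>0 * norm x}"
  have T: "open T" unfolding T_def by (intro open_Collect_less continuous_intros)
  have ev: "p (arg x) = c" if "x \<in> T" for x
  proof (rule c)
    show "\<bar>arg x\<bar> \<le> pi" using arg_bounded[of x] by auto
    show "\<theta>0 \<le> \<bar>arg x\<bar>"
    proof (rule ccontr)
      assume "\<not> \<theta>0 \<le> \<bar>arg x\<bar>"
      then have "cos \<theta>0 \<le> cos \<bar>arg x\<bar>" using \<theta>0 by (intro cos_monotone_0_pi_le) auto
      then have "cos \<theta>0 * norm x \<le> norm x * cos (arg x)" by (simp add: mult.commute mult_left_mono)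
      also have "norm x * cos (arg x) = x $ 1"
        using arg_cong[OF polar_decomposition[of x], of "\<lambda>v. v $ 1"] by simp
      finally show False using that by (simp add: T_def)
    qed
  qed
  have "C1_on T (\<lambda>x. p (arg x))"
    by (rule C1_on_cong[OF T _ C1_on_const[of _ c]]) (simp add: ev)
  moreover have "C1_on (- slit) (\<lambda>x. p (arg x))"
  proof (rule C1_onI)
    fix x assume "x \<in> - slit"
    then have "x \<notin> slit" by simp
    from has_derivative_compose[OF has_derivative_arg[OF this] p[unfolded has_field_derivative_def]]
    show "((\<lambda>x. p (arg x)) has_derivative
        (\<lambda>h. (p' (arg x) *\<^sub>R ((1 / (norm x)\<^sup>2) *\<^sub>R vector [- x $ 2, x $ 1])) \<bullet> h)) (at x)" by simp
  next
    have a: "continuous_on (- slit) arg"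
      by (intro continuous_at_imp_continuous_on ballI has_derivative_continuous[OF has_derivative_arg]) auto
    have v: "(\<lambda>x::real^2. vector [- x $ 2, x $ 1] :: real^2) = (\<lambda>x. (- x $ 2) *\<^sub>R axis 1 1 + (x $ 1) *\<^sub>R axis 2 1)"
      by (auto simp: fun_eq_iff vec_eq2_iff axis_def)
    have "continuous_on (- slit) (\<lambda>x::real^2. vector [- x $ 2, x $ 1] :: real^2)"
      unfolding v by (intro continuous_intros)
    then show "continuous_on (- slit) (\<lambda>x. p' (arg x) *\<^sub>R ((1 / (norm x)\<^sup>2) *\<^sub>R (vector [- x $ 2, x $ 1] :: real^2)))"
      by (intro continuous_intros continuous_on_compose2[OF p' a]) (auto simp: slit_def)
  qed
  moreover have "- {0} \<subseteq> T \<union> - slit"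
  proof
    fix x :: "real^2" assume "x \<in> - {0}"
    show "x \<in> T \<union> - slit"
    proof (cases "x \<in> slit")
      case True
      then have "norm x = - x $ 1" by (simp add: slit_def norm_real2)
      moreover have "- 1 < cos \<theta>0" using cos_monotone_0_pi[of \<theta>0 pi] \<theta>0 by simp
      moreover have "norm x > 0" using \<open>x \<in> - {0}\<close> by simp
      ultimately have "- 1 * norm x < cos \<theta>0 * norm x" by (intro mult_strict_right_mono)
      then show ?thesis using \<open>norm x = - x $ 1\<close> by (simp add: T_def)
    qed simp
  qed
  ultimately show ?thesis
    using C1_on_Un[OF T _ ] closed_slit C1_on_subset by (metis open_Compl)
qed

lemma has_field_derivative_along_ray:
  assumes "f differentiable (at (r *\<^sub>R er \<theta>))"
  shows "((\<lambda>r. f (r *\<^sub>R er \<theta>)) has_field_derivative gradient f (r *\<^sub>R er \<theta>) \<bullet> er \<theta>) (at r within S)"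
proof -
  have "((\<lambda>r. r *\<^sub>R er \<theta>) has_derivative (\<lambda>h. h *\<^sub>R er \<theta>)) (at r within S)"
    by (auto intro!: derivative_eq_intros)
  from has_derivative_compose[OF this has_derivative_gradient[OF assms]]
  show ?thesis unfolding has_field_derivative_def by (rule has_derivative_eq_rhs) auto
qed

lemma has_field_derivative_along_circle:
  assumes "f differentiable (at (r *\<^sub>R er \<theta>))"
  shows "((\<lambda>\<theta>. f (r *\<^sub>R er \<theta>)) has_field_derivative r * (gradient f (r *\<^sub>R er \<theta>) \<bullet> et \<theta>)) (at \<theta> within S)"
proof -
  have "((\<lambda>\<theta>. r *\<^sub>R er \<theta>) has_derivative (\<lambda>h. r *\<^sub>R (h *\<^sub>R et \<theta>))) (at \<theta> within S)"
    using has_vector_derivative_er[unfolded has_vector_derivative_def] by (intro has_derivative_scaleR_right)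
  from has_derivative_compose[OF this has_derivative_gradient[OF assms]]
  show ?thesis unfolding has_field_derivative_def by (rule has_derivative_eq_rhs) auto
qed

section \<open>One-dimensional inequalities\<close>

lemma integral_Cauchy_Schwarz:
  fixes f g :: "real \<Rightarrow> real"
  assumes f: "continuous_on {s..t} f" and g: "continuous_on {s..t} g" and pos: "0 < integral {s..t} (\<lambda>x. (g x)\<^sup>2)"
  shows "(integral {s..t} (\<lambda>x. f x * g x))\<^sup>2 \<le> integral {s..t} (\<lambda>x. (f x)\<^sup>2) * integral {s..t} (\<lambda>x. (g x)\<^sup>2)"
proof -
  define F G I where "F = integral {s..t} (\<lambda>x. (f x)\<^sup>2)" and "G = integral {s..t} (\<lambda>x. (g x)\<^sup>2)"
    and "I = integral {s..t} (\<lambda>x. f x * g x)"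
  \<comment> \<open>The minimiser of the integral of (f - m g)^2 over all real m.\<close>
  define m where "m = I / G"
  have i: "(\<lambda>x. (f x)\<^sup>2) integrable_on {s..t}" "(\<lambda>x. (g x)\<^sup>2) integrable_on {s..t}" "(\<lambda>x. f x * g x) integrable_on {s..t}"
    by (intro integrable_continuous_interval continuous_intros f g)+
  have "((\<lambda>x. (f x)\<^sup>2 - 2 * m * (f x * g x) + m\<^sup>2 * (g x)\<^sup>2) has_integral F - 2 * m * I + m\<^sup>2 * G) {s..t}"
    unfolding F_def G_def I_def using i
    by (intro has_integral_add has_integral_diff has_integral_mult_right integrable_integral)
  moreover have "(\<lambda>x. (f x)\<^sup>2 - 2 * m * (f x * g x) + m\<^sup>2 * (g x)\<^sup>2) = (\<lambda>x. (f x - m * g x)\<^sup>2)"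
    by (auto simp: fun_eq_iff power2_eq_square algebra_simps)
  ultimately have "((\<lambda>x. (f x - m * g x)\<^sup>2) has_integral F - 2 * m * I + m\<^sup>2 * G) {s..t}" by simp
  then have "0 \<le> F - 2 * m * I + m\<^sup>2 * G" by (rule has_integral_nonneg) simp
  also have "\<dots> = F - I\<^sup>2 / G"
    using pos by (simp add: m_def G_def[symmetric] power2_eq_square field_simps)
  finally show ?thesis using pos by (simp add: F_def G_def I_def field_simps)
qed

lemma has_integral_FTC:
  fixes f :: "real \<Rightarrow> real"
  assumes "s \<le> t" "\<And>x. x \<in> {s..t} \<Longrightarrow> (f has_field_derivative f' x) (at x)"
  shows "(f' has_integral f t - f s) {s..t}"
  using assms
  by (intro fundamental_theorem_of_calculus)
     (auto simp: has_real_derivative_iff_has_vector_derivative[symmetric] intro: has_field_derivative_at_within)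

text \<open>The weight 1 - (x - e) / l is 1 at \<open>e\<close> and 0 at \<open>e + l\<close>;
  integrating the derivative of the weight times g^2 expresses the point value through an integral
  over the interval.\<close>

lemma trace_inequality:
  fixes g :: "real \<Rightarrow> real"
  assumes l: "0 < l" and g: "\<And>x. (g has_field_derivative g' x) (at x)" and g': "continuous_on UNIV g'"
  shows "(g e)\<^sup>2 \<le> (1 + 1 / l) * integral {e..e + l} (\<lambda>x. (g' x)\<^sup>2 + (g x)\<^sup>2)"
proof -
  have cg: "continuous_on UNIV g"
    using g by (auto intro!: continuous_at_imp_continuous_on DERIV_isCont)
  have i: "(\<lambda>x. (g' x)\<^sup>2 + (g x)\<^sup>2) integrable_on {e..e + l}"
    by (intro integrable_continuous_interval continuous_intros continuous_on_subset[OF cg] continuous_on_subset[OF g']) auto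
  have "((\<lambda>x. (1 / l) * (g x)\<^sup>2 - (1 - (x - e) / l) * (2 * g x * g' x)) has_integral
     (- (1 - (e + l - e) / l) * (g (e + l))\<^sup>2) - (- (1 - (e - e) / l) * (g e)\<^sup>2)) {e..e + l}"
    by (rule has_integral_FTC) (use l in \<open>auto intro!: derivative_eq_intros g simp: field_simps power2_eq_square\<close>)
  then have "((\<lambda>x. (1 / l) * (g x)\<^sup>2 - (1 - (x - e) / l) * (2 * g x * g' x)) has_integral (g e)\<^sup>2) {e..e + l}"
    using l by simp
  moreover have "((\<lambda>x. (1 + 1 / l) * ((g' x)\<^sup>2 + (g x)\<^sup>2)) has_integral (1 + 1 / l) * integral {e..e + l} (\<lambda>x. (g' x)\<^sup>2 + (g x)\<^sup>2)) {e..e + l}"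
    by (intro has_integral_mult_right integrable_integral i)
  ultimately show ?thesis
  proof (rule has_integral_le)
    fix x assume x: "x \<in> {e..e + l}"
    define s where "s = 1 - (x - e) / l"
    have s: "0 \<le> s" "s \<le> 1" using x l by (auto simp: s_def field_simps)
    have "- (s * (2 * g x * g' x)) \<le> s * ((g x)\<^sup>2 + (g' x)\<^sup>2)"
      using s(1) mult_left_mono[OF _ s(1), of "- (2 * g x * g' x)" "(g x)\<^sup>2 + (g' x)\<^sup>2"] zero_le_power2[of "g x + g' x"]
      by (simp add: power2_sum)
    also have "\<dots> \<le> 1 * ((g x)\<^sup>2 + (g' x)\<^sup>2)" using s by (intro mult_right_mono) auto
    finally have "- (s * (2 * g x * g' x)) \<le> (g x)\<^sup>2 + (g' x)\<^sup>2" by simp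
    moreover have "(1 / l) * (g x)\<^sup>2 \<le> (1 / l) * ((g' x)\<^sup>2 + (g x)\<^sup>2)" using l by (intro mult_left_mono) auto
    ultimately show "(1 / l) * (g x)\<^sup>2 - (1 - (x - e) / l) * (2 * g x * g' x) \<le> (1 + 1 / l) * ((g' x)\<^sup>2 + (g x)\<^sup>2)"
      unfolding s_def[symmetric] distrib_right by simp
  qed
qed

text \<open>Riccati argument: \<open>v = - 2 \<kappa> cot (2 \<kappa> (x - z) + \<tau>)\<close> satisfies \<open>v' - v\<^sup>2 = 4 \<kappa>\<^sup>2\<close>, and expanding
  \<open>0 \<le> (g' + v g)\<^sup>2\<close> gives the eigenvalue bound up to a small boundary term.\<close>

lemma quarter_period_inequality:
  fixes g :: "real \<Rightarrow> real"
  assumes t: "0 < \<tau>" "\<tau> * (pi / 2 + 1) < pi / 2"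
    and g: "\<And>x. (g has_field_derivative g' x) (at x)" and g': "continuous_on UNIV g'" and z: "g z = 0"
  shows "4 * (1 + \<tau>)\<^sup>2 * integral {z..z + pi / 4} (\<lambda>x. (g x)\<^sup>2) - 2 * (1 + \<tau>) * tan (\<tau> * (pi / 2 + 1)) * (g (z + pi / 4))\<^sup>2
    \<le> integral {z..z + pi / 4} (\<lambda>x. (g' x)\<^sup>2)"
proof -
  have cg: "continuous_on UNIV g"
    using g by (auto intro!: continuous_at_imp_continuous_on DERIV_isCont)
  have i: "(\<lambda>x. (g' x)\<^sup>2) integrable_on {z..z + pi / 4}" "(\<lambda>x. (g x)\<^sup>2) integrable_on {z..z + pi / 4}"
    by (intro integrable_continuous_interval continuous_intros continuous_on_subset[OF cg] continuous_on_subset[OF g'], auto)+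
  define k where "k = 1 + \<tau>"
  define \<phi> where "\<phi> x = 2 * k * (x - z) + \<tau>" for x
  define v where "v x = - 2 * k * cos (\<phi> x) / sin (\<phi> x)" for x
  have sp: "sin (\<phi> x) > 0" if "x \<in> {z..z + pi / 4}" for x
  proof (rule sin_gt_zero)
    have k: "k > 0" using t by (simp add: k_def)
    then have "0 \<le> 2 * k * (x - z)" using that by simp
    then show "0 < \<phi> x" using t unfolding \<phi>_def by linarith
    have "2 * k * (x - z) \<le> 2 * k * (pi / 4)" using that k by (intro mult_left_mono) auto
    then have "\<phi> x \<le> pi / 2 + \<tau> * (pi / 2 + 1)" by (simp add: \<phi>_def k_def algebra_simps)
    then show "\<phi> x < pi" using t by simp
  qed
  have d\<phi>: "(\<phi> has_field_derivative 2 * k) (at x)" for x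
    unfolding \<phi>_def by (auto intro!: derivative_eq_intros)
  have dv: "(v has_field_derivative 4 * k\<^sup>2 + (v x)\<^sup>2) (at x)" if "x \<in> {z..z + pi / 4}" for x
  proof -
    have "(v has_field_derivative (- 2 * k * (- sin (\<phi> x) * (2 * k)) * sin (\<phi> x) - (- 2 * k * cos (\<phi> x)) * (cos (\<phi> x) * (2 * k))) / (sin (\<phi> x) * sin (\<phi> x))) (at x)"
      unfolding v_def using sp[OF that] by (auto intro!: derivative_eq_intros d\<phi> simp: divide_simps algebra_simps)
    also have "(- 2 * k * (- sin (\<phi> x) * (2 * k)) * sin (\<phi> x) - (- 2 * k * cos (\<phi> x)) * (cos (\<phi> x) * (2 * k))) / (sin (\<phi> x) * sin (\<phi> x)) = 4 * k\<^sup>2 + (v x)\<^sup>2"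
      using sp[OF that] by (simp add: v_def field_simps power2_eq_square)
    finally show ?thesis .
  qed
  let ?e = "z + pi / 4"
  have "((\<lambda>x. (4 * k\<^sup>2 + (v x)\<^sup>2) * (g x)\<^sup>2 + v x * (2 * g x * g' x)) has_integral v ?e * (g ?e)\<^sup>2 - v z * (g z)\<^sup>2) {z..?e}"
    by (rule has_integral_FTC) (auto intro!: derivative_eq_intros g dv)
  then have I: "((\<lambda>x. (4 * k\<^sup>2 + (v x)\<^sup>2) * (g x)\<^sup>2 + v x * (2 * g x * g' x)) has_integral v ?e * (g ?e)\<^sup>2) {z..?e}"
    using z by simp
  have "((\<lambda>x. 4 * k\<^sup>2 * (g x)\<^sup>2 - ((4 * k\<^sup>2 + (v x)\<^sup>2) * (g x)\<^sup>2 + v x * (2 * g x * g' x)))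
     has_integral 4 * k\<^sup>2 * integral {z..?e} (\<lambda>x. (g x)\<^sup>2) - v ?e * (g ?e)\<^sup>2) {z..?e}"
    by (intro has_integral_diff I has_integral_mult_right integrable_integral i)
  moreover have "((\<lambda>x. (g' x)\<^sup>2) has_integral integral {z..?e} (\<lambda>x. (g' x)\<^sup>2)) {z..?e}"
    by (intro integrable_integral i)
  ultimately have "4 * k\<^sup>2 * integral {z..?e} (\<lambda>x. (g x)\<^sup>2) - v ?e * (g ?e)\<^sup>2 \<le> integral {z..?e} (\<lambda>x. (g' x)\<^sup>2)"
  proof (rule has_integral_le)
    fix x
    show "4 * k\<^sup>2 * (g x)\<^sup>2 - ((4 * k\<^sup>2 + (v x)\<^sup>2) * (g x)\<^sup>2 + v x * (2 * g x * g' x)) \<le> (g' x)\<^sup>2"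
      using zero_le_power2[of "g' x + v x * g x"] by (simp add: power2_eq_square algebra_simps)
  qed
  \<comment> \<open>The angle exceeds pi / 2 by \<tau> (pi / 2 + 1), and the cotangent becomes minus
    the tangent of the excess.\<close>
  moreover have "v ?e = 2 * (1 + \<tau>) * tan (\<tau> * (pi / 2 + 1))"
  proof -
    have "\<phi> ?e = \<tau> * (pi / 2 + 1) + pi / 2" by (simp add: \<phi>_def k_def algebra_simps)
    then have "cos (\<phi> ?e) = - sin (\<tau> * (pi / 2 + 1))" "sin (\<phi> ?e) = cos (\<tau> * (pi / 2 + 1))"
      by (simp_all add: cos_add sin_add)
    moreover have "- 2 * k * (- S) / C = 2 * k * (S / C)" for S C :: real by simp
    ultimately show ?thesis by (simp only: v_def tan_def k_def)
  qed
  ultimately show ?thesis by (simp add: k_def)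
qed

text \<open>On half a transition zone, with a zero at \<open>z\<close> and a free end, the first
  eigenvalue is exactly 4, so g'^2 - 4 g^2 leaves no room. A slightly larger eigenvalue is bought
  with a boundary term at \<open>z + pi / 4\<close>, which the trace inequality charges to the
  adjacent contact zone of length at least \<open>l\<close>. The coefficient there is 6 = 10 - 4,
  the 10 being what \<open>second_variation_coercive\<close> adds.\<close>

lemma half_coercive:
  assumes l: "0 < (l::real)"
  obtains k where "k > 0" "k \<le> 1"
    "\<And>z L (g::real \<Rightarrow> real) g'. z + pi / 4 + l \<le> L \<Longrightarrow> (\<And>x. (g has_field_derivative g' x) (at x)) \<Longrightarrow>
       continuous_on UNIV g' \<Longrightarrow> g z = 0 \<Longrightarrow>
       k * integral {z..L} (\<lambda>x. (g x)\<^sup>2) \<le> integral {z..z + pi / 4} (\<lambda>x. (g' x)\<^sup>2 - 4 * (g x)\<^sup>2)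
         + integral {z + pi / 4..L} (\<lambda>x. (g' x)\<^sup>2 + 6 * (g x)\<^sup>2)"
proof -
  \<comment> \<open>The inverse of the trace constant: a boundary term with coefficient below K
    costs at most the integral of g'^2 + g^2 over the contact zone.\<close>
  define K where "K = 1 / (1 + 1 / l)"
  have K: "K > 0" "K * (1 + 1 / l) = 1" 
  proof -
    have "1 + 1 / l > 0" using l by (simp add: add_pos_pos)
    then show "K > 0" "K * (1 + 1 / l) = 1" by (simp_all add: K_def)
  qed
  have "((\<lambda>t. 2 * (1 + t) * tan (t * (pi / 2 + 1))) \<longlongrightarrow> 2 * (1 + 0) * tan (0 * (pi / 2 + 1))) (at_right 0)"
    by (intro tendsto_intros) auto
  then have "\<forall>\<^sub>F t in at_right 0. 2 * (1 + t) * tan (t * (pi / 2 + 1)) < K"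
    using K(1) by (auto dest: order_tendstoD(2)[of _ _ _ K])
  moreover have "((\<lambda>t. t * (pi / 2 + 1)) \<longlongrightarrow> 0 * (pi / 2 + 1)) (at_right 0)"
    by (intro tendsto_intros)
  then have "\<forall>\<^sub>F t in at_right 0. t * (pi / 2 + 1) < pi / 2"
    using pi_gt_zero by (auto dest: order_tendstoD(2)[of _ _ _ "pi / 2"])
  moreover have "\<forall>\<^sub>F t in at_right (0::real). 0 < t" by (simp add: eventually_at_right_less)
  ultimately have "\<forall>\<^sub>F t in at_right 0. 2 * (1 + t) * tan (t * (pi / 2 + 1)) < K \<and> t * (pi / 2 + 1) < pi / 2 \<and> 0 < t"
    by eventually_elim auto
  then obtain \<tau> where \<tau>: "2 * (1 + \<tau>) * tan (\<tau> * (pi / 2 + 1)) < K" "\<tau> * (pi / 2 + 1) < pi / 2" "0 < \<tau>"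
    using eventually_happens[of _ "at_right (0::real)"] by (auto simp: trivial_limit_at_right_real)
  \<comment> \<open>8 \<tau> is a lower bound for the gain 4 (1 + \<tau>)^2 - 4 in the transition
    zone; in the contact zone five of the six copies of g^2 survive the trace term, more than the
    one required.\<close>
  define k where "k = min 1 (8 * \<tau>)"
  have k: "k > 0" "k \<le> 1" "k \<le> 8 * \<tau>" using \<tau> by (auto simp: k_def)
  show ?thesis
  proof (rule that[OF k(1,2)])
    fix z L :: real and g g' :: "real \<Rightarrow> real"
    assume L: "z + pi / 4 + l \<le> L" and g: "\<And>x. (g has_field_derivative g' x) (at x)"
      and g': "continuous_on UNIV g'" and z: "g z = 0"
    let ?e = "z + pi / 4"
    have cg: "continuous_on UNIV g"
      using g by (auto intro!: continuous_at_imp_continuous_on DERIV_isCont)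
    have i: "(\<lambda>x. (g' x)\<^sup>2) integrable_on {s..t}" "(\<lambda>x. (g x)\<^sup>2) integrable_on {s..t}" for s t
      by (intro integrable_continuous_interval continuous_intros continuous_on_subset[OF cg] continuous_on_subset[OF g'], auto)+
    define A A' B B' where "A = integral {z..?e} (\<lambda>x. (g x)\<^sup>2)" and "A' = integral {z..?e} (\<lambda>x. (g' x)\<^sup>2)"
      and "B = integral {?e..L} (\<lambda>x. (g x)\<^sup>2)" and "B' = integral {?e..L} (\<lambda>x. (g' x)\<^sup>2)"
    have nn: "0 \<le> A" "0 \<le> B" unfolding A_def B_def by (intro integral_nonneg i; simp)+
    have 1: "4 * (1 + \<tau>)\<^sup>2 * A - 2 * (1 + \<tau>) * tan (\<tau> * (pi / 2 + 1)) * (g ?e)\<^sup>2 \<le> A'"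
      unfolding A_def A'_def by (rule quarter_period_inequality[OF \<tau>(3,2) g g' z])
    have 2: "2 * (1 + \<tau>) * tan (\<tau> * (pi / 2 + 1)) * (g ?e)\<^sup>2 \<le> K * (g ?e)\<^sup>2"
      using \<tau>(1) by (intro mult_right_mono) auto
    have "(g ?e)\<^sup>2 \<le> (1 + 1 / l) * integral {?e..?e + l} (\<lambda>x. (g' x)\<^sup>2 + (g x)\<^sup>2)"
      by (rule trace_inequality[OF l g g'])
    also have "\<dots> \<le> (1 + 1 / l) * integral {?e..L} (\<lambda>x. (g' x)\<^sup>2 + (g x)\<^sup>2)"
      using l L by (intro mult_left_mono integral_subset_le integrable_add i) auto
    also have "\<dots> = (1 + 1 / l) * (B' + B)"
      by (simp add: B_def B'_def Henstock_Kurzweil_Integration.integral_add i)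
    finally have "K * (g ?e)\<^sup>2 \<le> K * ((1 + 1 / l) * (B' + B))" using K(1) by simp
    also have "\<dots> = B' + B" using K(2) by (simp flip: mult.assoc)
    finally have 3: "K * (g ?e)\<^sup>2 \<le> B' + B" .
    have "k * (A + B) \<le> 8 * \<tau> * A + B"
      using mult_right_mono[OF k(3) nn(1)] mult_right_mono[OF k(2) nn(2)] by (simp add: distrib_left)
    also have "8 * \<tau> * A \<le> 4 * (1 + \<tau>)\<^sup>2 * A - 4 * A"
      using nn(1) by (simp add: power2_eq_square algebra_simps)
    finally have 4: "k * (A + B) \<le> 4 * (1 + \<tau>)\<^sup>2 * A - 4 * A + B" by simp
    have "integral {z..L} (\<lambda>x. (g x)\<^sup>2) = A + B"
      unfolding A_def B_def using l L by (intro Henstock_Kurzweil_Integration.integral_combine[symmetric] i) auto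
    moreover have "integral {z..?e} (\<lambda>x. (g' x)\<^sup>2 - 4 * (g x)\<^sup>2) = A' - 4 * A"
      unfolding A_def A'_def by (subst Henstock_Kurzweil_Integration.integral_diff) (auto intro!: i integrable_on_mult_right)
    moreover have "integral {?e..L} (\<lambda>x. (g' x)\<^sup>2 + 6 * (g x)\<^sup>2) = B' + 6 * B"
      unfolding B_def B'_def by (subst Henstock_Kurzweil_Integration.integral_add) (auto intro!: i integrable_on_mult_right)
    ultimately show "k * integral {z..L} (\<lambda>x. (g x)\<^sup>2) \<le> integral {z..?e} (\<lambda>x. (g' x)\<^sup>2 - 4 * (g x)\<^sup>2)
         + integral {?e..L} (\<lambda>x. (g' x)\<^sup>2 + 6 * (g x)\<^sup>2)"
      using 1 2 3 4 nn by simp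
  qed
qed

text \<open>The sine frozen at its extreme values outside one half period: monotone and C1, but not
  C2. It is the transition of a double cone and, rescaled, the edge of a cut-off.\<close>

definition csin :: "real \<Rightarrow> real" where
  "csin x = (if x \<le> - (pi / 2) then - 1 else if x < pi / 2 then sin x else 1)"

definition csin' :: "real \<Rightarrow> real" where
  "csin' x = (if \<bar>x\<bar> < pi / 2 then cos x else 0)"

lemma csin_minus: "csin (- x) = - csin x"
proof -
  define h where "h = pi / 2"
  have "h > 0" by (simp add: h_def)
  then show ?thesis unfolding csin_def h_def[symmetric] by auto
qed

lemma csin_ge: "pi / 2 \<le> x \<Longrightarrow> csin x = 1"
proof -
  assume x: "pi / 2 \<le> x"
  define h where "h = pi / 2"
  have "h > 0" by (simp add: h_def)
  then show ?thesis using x unfolding csin_def h_def[symmetric] by auto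
qed

lemma has_field_derivative_csin: "(csin has_field_derivative csin' x) (at x)"
proof -
  \<comment> \<open>At the joining point both one-sided difference quotients tend to 0, since the
    cosine vanishes there; the other joining point follows by oddness.\<close>
  have half: "(csin has_field_derivative 0) (at (pi / 2))"
  proof -
    have "((\<lambda>y. (sin y - sin (pi / 2)) / (y - pi / 2)) \<longlongrightarrow> cos (pi / 2)) (at (pi / 2))"
      using DERIV_sin[of "pi / 2"] by (simp add: has_field_derivative_iff)
    then have "((\<lambda>y. (sin y - 1) / (y - pi / 2)) \<longlongrightarrow> 0) (at_left (pi / 2))"
      by (simp add: filterlim_at_split)
    moreover have "\<forall>\<^sub>F y in at_left (pi / 2). (sin y - 1) / (y - pi / 2) = (csin y - csin (pi / 2)) / (y - pi / 2)"
    proof -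
      have "\<forall>\<^sub>F y in at_left (pi / 2). y \<in> {0<..<pi / 2}" by (rule eventually_at_left_real) simp
      then show ?thesis by eventually_elim (auto simp: csin_def)
    qed
    ultimately have l: "((\<lambda>y. (csin y - csin (pi / 2)) / (y - pi / 2)) \<longlongrightarrow> 0) (at_left (pi / 2))"
      by (rule Lim_transform_eventually)
    have r: "((\<lambda>y. (csin y - csin (pi / 2)) / (y - pi / 2)) \<longlongrightarrow> 0) (at_right (pi / 2))"
    proof (rule Lim_transform_eventually[OF tendsto_const])
      have "\<forall>\<^sub>F y in at_right (pi / 2). y \<in> {pi / 2<..<pi}" by (rule eventually_at_right_real) simp
      then show "\<forall>\<^sub>F y in at_right (pi / 2). 0 = (csin y - csin (pi / 2)) / (y - pi / 2)"
        by eventually_elim (auto simp: csin_def)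
    qed
    show ?thesis unfolding has_field_derivative_iff using l r filterlim_split_at by blast
  qed
  consider "x < - pi / 2" | "x = - pi / 2" | "- pi / 2 < x" "x < pi / 2" | "x = pi / 2" | "pi / 2 < x" by linarith
  then show ?thesis
  proof cases
    case 1
    have "(csin has_field_derivative 0) (at x)"
      by (rule has_field_derivative_transform_within_open[of "\<lambda>x. - 1" _ _ "{..<- pi / 2}"]) (use 1 in \<open>auto simp: csin_def\<close>)
    moreover have "\<not> \<bar>x\<bar> < pi / 2" using 1 pi_gt_zero by linarith
    ultimately show ?thesis by (simp add: csin'_def)
  next
    case 2
    have "((\<lambda>x. csin (- x)) has_field_derivative 0 * - 1) (at (- pi / 2))"
      by (rule DERIV_chain2[of csin]) (use half in \<open>auto intro!: derivative_eq_intros\<close>)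
    then have "((\<lambda>x. - csin (- x)) has_field_derivative 0) (at (- pi / 2))"
      by (auto dest: DERIV_minus)
    then show ?thesis using 2 by (simp add: csin_minus csin'_def)
  next
    case 3
    have "(csin has_field_derivative cos x) (at x)"
      by (rule has_field_derivative_transform_within_open[of sin _ _ "{- pi / 2<..<pi / 2}"]) (use 3 in \<open>auto simp: csin_def\<close>)
    moreover have "\<bar>x\<bar> < pi / 2" using 3 by linarith
    ultimately show ?thesis by (simp add: csin'_def)
  next
    case 4
    show ?thesis unfolding 4 using half by (simp add: csin'_def)
  next
    case 5
    have "(csin has_field_derivative 0) (at x)"
      by (rule has_field_derivative_transform_within_open[of "\<lambda>x. 1" _ _ "{pi / 2<..}"]) (use 5 in \<open>auto simp: csin_ge\<close>)
    moreover have "\<not> \<bar>x\<bar> < pi / 2" using 5 by linarith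
    ultimately show ?thesis by (simp add: csin'_def)
  qed
qed

text \<open>As the cosine of a clipped argument the derivative is visibly continuous.\<close>

lemma csin'_eq: "csin' x = cos (max (- pi / 2) (min (pi / 2) x))"
  proof (cases "x = - pi / 2")
  case True
  then show ?thesis by (simp add: csin'_def)
next
  case False
  then show ?thesis by (auto simp: csin'_def max_def min_def abs_if)
qed

lemma continuous_on_csin': "continuous_on UNIV csin'"
  unfolding csin'_eq[abs_def] by (intro continuous_intros)

lemma abs_csin'_le: "\<bar>csin' x\<bar> \<le> 1"
  by (simp add: csin'_def)

lemma csin'_nonneg: "0 \<le> csin' x"
proof (cases "\<bar>x\<bar> < pi / 2")
  case True
  then have "0 \<le> cos x" by (intro cos_ge_zero) linarith+
  then show ?thesis by (simp add: csin'_def)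
qed (simp add: csin'_def)

lemma csin_Lipschitz: "\<bar>csin x - csin y\<bar> \<le> \<bar>x - y\<bar>"
proof -
  have "norm (csin x - csin y) \<le> 1 * norm (x - y)"
    by (rule field_differentiable_bound[of UNIV csin csin'])
       (auto intro: has_field_derivative_at_within has_field_derivative_csin abs_csin'_le)
  then show ?thesis by simp
qed

lemma abs_csin_le: "\<bar>csin x\<bar> \<le> 1"
  by (simp add: csin_def)


section \<open>Profiles of double cones\<close>

text \<open>The angular part of a double cone: the transition zones, of width \<open>pi / 2\<close>, are centred at the
  zeros \<open>a < b\<close>. Only \<open>\<theta>\<close> in \<open>{- pi..pi}\<close> is meaningful, and the value near both ends is \<open>- 1\<close>.\<close>

definition cone_profile :: "real \<Rightarrow> real \<Rightarrow> real \<Rightarrow> real" where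
  "cone_profile a b \<theta> = csin (2 * (\<theta> - a)) + csin (2 * (b - \<theta>)) - 1"

definition cone_profile' :: "real \<Rightarrow> real \<Rightarrow> real \<Rightarrow> real" where
  "cone_profile' a b \<theta> = 2 * csin' (2 * (\<theta> - a)) - 2 * csin' (2 * (b - \<theta>))"

text \<open>The two transition zones leave contact zones of lengths at least l, 2 l and l. The
  middle one gets 2 l because it is later halved between its two neighbours.\<close>

definition separated :: "real \<Rightarrow> real \<Rightarrow> real \<Rightarrow> bool" where
  "separated l a b \<longleftrightarrow> 0 < l \<and> - pi + l \<le> a - pi / 4 \<and> a + pi / 4 + 2 * l \<le> b - pi / 4 \<and> b + pi / 4 \<le> pi - l"

lemma has_field_derivative_cone_profile: "(cone_profile a b has_field_derivative cone_profile' a b \<theta>) (at \<theta>)"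
proof -
  have 1: "((\<lambda>\<theta>. csin (2 * (\<theta> - a))) has_field_derivative csin' (2 * (\<theta> - a)) * 2) (at \<theta>)"
    by (rule DERIV_chain2[OF has_field_derivative_csin]) (auto intro!: derivative_eq_intros)
  have 2: "((\<lambda>\<theta>. csin (2 * (b - \<theta>))) has_field_derivative csin' (2 * (b - \<theta>)) * - 2) (at \<theta>)"
    by (rule DERIV_chain2[OF has_field_derivative_csin]) (auto intro!: derivative_eq_intros)
  have "((\<lambda>\<theta>. csin (2 * (\<theta> - a)) + csin (2 * (b - \<theta>)) - 1) has_field_derivative
      csin' (2 * (\<theta> - a)) * 2 + csin' (2 * (b - \<theta>)) * - 2 - 0) (at \<theta>)"
    by (intro DERIV_diff DERIV_add 1 2 DERIV_const)
  then show ?thesis unfolding cone_profile_def[abs_def] cone_profile'_def by (simp add: mult.commute)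
qed

lemma continuous_on_cone_profile': "continuous_on S (cone_profile' a b)"
  unfolding cone_profile'_def[abs_def]
  by (intro continuous_intros continuous_on_compose2[OF continuous_on_csin']) auto

lemma continuous_on_cone_profile: "continuous_on S (cone_profile a b)"
  by (auto intro!: continuous_at_imp_continuous_on DERIV_isCont has_field_derivative_cone_profile)

lemma cone_profile_pieces:
  assumes "separated l a b"
  shows "\<theta> \<le> a - pi / 4 \<Longrightarrow> cone_profile a b \<theta> = - 1" "\<theta> \<le> a - pi / 4 \<Longrightarrow> cone_profile' a b \<theta> = 0"
    "b + pi / 4 \<le> \<theta> \<Longrightarrow> cone_profile a b \<theta> = - 1" "b + pi / 4 \<le> \<theta> \<Longrightarrow> cone_profile' a b \<theta> = 0"
    "a + pi / 4 \<le> \<theta> \<Longrightarrow> \<theta> \<le> b - pi / 4 \<Longrightarrow> cone_profile a b \<theta> = 1"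
    "a + pi / 4 \<le> \<theta> \<Longrightarrow> \<theta> \<le> b - pi / 4 \<Longrightarrow> cone_profile' a b \<theta> = 0"
    "a - pi / 4 \<le> \<theta> \<Longrightarrow> \<theta> \<le> a + pi / 4 \<Longrightarrow> cone_profile a b \<theta> = sin (2 * (\<theta> - a))"
    "a - pi / 4 \<le> \<theta> \<Longrightarrow> \<theta> \<le> a + pi / 4 \<Longrightarrow> cone_profile' a b \<theta> = 2 * cos (2 * (\<theta> - a))"
    "b - pi / 4 \<le> \<theta> \<Longrightarrow> \<theta> \<le> b + pi / 4 \<Longrightarrow> cone_profile a b \<theta> = sin (2 * (b - \<theta>))"
    "b - pi / 4 \<le> \<theta> \<Longrightarrow> \<theta> \<le> b + pi / 4 \<Longrightarrow> cone_profile' a b \<theta> = - 2 * cos (2 * (b - \<theta>))"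
proof -
  define h where "h = pi / 2"
  have h: "h > 0" by (simp add: h_def)
  have s1: "csin x = - 1" "csin' x = 0" if "x \<le> - (pi / 2)" for x
    using that h unfolding h_def[symmetric] csin_def csin'_def by auto
  have s2: "csin x = 1" "csin' x = 0" if "pi / 2 \<le> x" for x
    using that h unfolding h_def[symmetric] csin_def csin'_def by auto
  have s3: "csin x = sin x" "csin' x = cos x" if x: "- (pi / 2) \<le> x" "x \<le> pi / 2" for x
  proof -
    have "csin x = sin x \<and> csin' x = cos x"
    proof (cases "\<bar>x\<bar> < pi / 2")
      case True
      then show ?thesis unfolding h_def[symmetric] csin_def csin'_def by auto
    next
      case False
      then have "x = pi / 2 \<or> x = - (pi / 2)" using x by linarith
      then show ?thesis
        by (elim disjE) (hypsubst, simp add: s1 s2)+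
    qed
    then show "csin x = sin x" "csin' x = cos x" by auto
  qed
  have l: "0 < l" "- pi + l \<le> a - pi / 4" "a + pi / 4 + 2 * l \<le> b - pi / 4" "b + pi / 4 \<le> pi - l"
    using assms by (auto simp: separated_def)
  note d = cone_profile_def cone_profile'_def
  show "\<theta> \<le> a - pi / 4 \<Longrightarrow> cone_profile a b \<theta> = - 1" "\<theta> \<le> a - pi / 4 \<Longrightarrow> cone_profile' a b \<theta> = 0"
    unfolding d using l pi_gt_zero by (simp_all add: s1 s2)
  show "b + pi / 4 \<le> \<theta> \<Longrightarrow> cone_profile a b \<theta> = - 1" "b + pi / 4 \<le> \<theta> \<Longrightarrow> cone_profile' a b \<theta> = 0"
    unfolding d using l pi_gt_zero by (simp_all add: s1 s2)
  show "a + pi / 4 \<le> \<theta> \<Longrightarrow> \<theta> \<le> b - pi / 4 \<Longrightarrow> cone_profile a b \<theta> = 1"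
    "a + pi / 4 \<le> \<theta> \<Longrightarrow> \<theta> \<le> b - pi / 4 \<Longrightarrow> cone_profile' a b \<theta> = 0"
    unfolding d using l pi_gt_zero by (simp_all add: s2)
  show "a - pi / 4 \<le> \<theta> \<Longrightarrow> \<theta> \<le> a + pi / 4 \<Longrightarrow> cone_profile a b \<theta> = sin (2 * (\<theta> - a))"
    "a - pi / 4 \<le> \<theta> \<Longrightarrow> \<theta> \<le> a + pi / 4 \<Longrightarrow> cone_profile' a b \<theta> = 2 * cos (2 * (\<theta> - a))"
    unfolding d using l pi_gt_zero by (simp_all add: s2 s3)
  show "b - pi / 4 \<le> \<theta> \<Longrightarrow> \<theta> \<le> b + pi / 4 \<Longrightarrow> cone_profile a b \<theta> = sin (2 * (b - \<theta>))"
    "b - pi / 4 \<le> \<theta> \<Longrightarrow> \<theta> \<le> b + pi / 4 \<Longrightarrow> cone_profile' a b \<theta> = - 2 * cos (2 * (b - \<theta>))"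
    unfolding d using l pi_gt_zero by (simp_all add: s2 s3)
qed

lemma abs_cone_profile_le:
  assumes "separated l a b"
  shows "\<bar>cone_profile a b \<theta>\<bar> \<le> 1"
proof -
  note p = cone_profile_pieces[OF assms, of \<theta>]
  consider "\<theta> \<le> a - pi / 4" | "b + pi / 4 \<le> \<theta>" | "a + pi / 4 \<le> \<theta>" "\<theta> \<le> b - pi / 4"
    | "a - pi / 4 \<le> \<theta>" "\<theta> \<le> a + pi / 4" | "b - pi / 4 \<le> \<theta>" "\<theta> \<le> b + pi / 4" by linarith
  then show ?thesis by cases (simp_all add: p)
qed

lemma integral_five_pieces:
  fixes f :: "real \<Rightarrow> real"
  assumes "separated l a b" and f: "continuous_on UNIV f"
  shows "integral {-pi..pi} f = integral {-pi..a - pi / 4} f + integral {a - pi / 4..a + pi / 4} f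
    + integral {a + pi / 4..b - pi / 4} f + integral {b - pi / 4..b + pi / 4} f + integral {b + pi / 4..pi} f"
proof -
  have i: "f integrable_on {s..t}" for s t
    by (intro integrable_continuous_interval continuous_on_subset[OF f]) auto
  have c: "integral {s..t} f = integral {s..r} f + integral {r..t} f" if "s \<le> r" "r \<le> t" for s r t
    using Henstock_Kurzweil_Integration.integral_combine[OF that i] by simp
  have l: "0 < l" "- pi + l \<le> a - pi / 4" "a + pi / 4 + 2 * l \<le> b - pi / 4" "b + pi / 4 \<le> pi - l"
    using assms by (auto simp: separated_def)
  have "a - pi / 4 \<le> a + pi / 4" "b - pi / 4 \<le> b + pi / 4" using pi_gt_zero by linarith+
  then show ?thesis
    using l c[of "-pi" "a - pi / 4" pi] c[of "a - pi / 4" "a + pi / 4" pi] c[of "a + pi / 4" "b - pi / 4" pi]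
      c[of "b - pi / 4" "b + pi / 4" pi] by simp
qed

text \<open>For a profile p, on the transition zones p'' = -4 p and p' vanishes at both ends, so
  integration by parts leaves nothing. On the contact zones p' = 0 and p is 1 or -1, so that only
  integrals of \<open>h\<close> remain.\<close>

lemma cone_profile_first_variation:
  assumes "separated l a b" and h: "\<And>x. (h has_field_derivative h' x) (at x)" and h': "continuous_on UNIV h'"
  shows "integral {-pi..pi} (\<lambda>x. cone_profile' a b x * h' x - 4 * cone_profile a b x * h x)
    = 4 * integral {-pi..a - pi / 4} h - 4 * integral {a + pi / 4..b - pi / 4} h + 4 * integral {b + pi / 4..pi} h"
proof -
  let ?f = "\<lambda>x. cone_profile' a b x * h' x - 4 * cone_profile a b x * h x"
  have ch: "continuous_on UNIV h"
    using h by (auto intro!: continuous_at_imp_continuous_on DERIV_isCont)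
  have cf: "continuous_on UNIV ?f"
    by (intro continuous_intros continuous_on_cone_profile continuous_on_cone_profile' ch h')
  note p = cone_profile_pieces[OF assms(1)]
  have 1: "integral {-pi..a - pi / 4} ?f = integral {-pi..a - pi / 4} (\<lambda>x. 4 * h x)"
    by (rule integral_cong) (simp add: p)
  have 3: "integral {a + pi / 4..b - pi / 4} ?f = integral {a + pi / 4..b - pi / 4} (\<lambda>x. - 4 * h x)"
    by (rule integral_cong) (simp add: p)
  have 5: "integral {b + pi / 4..pi} ?f = integral {b + pi / 4..pi} (\<lambda>x. 4 * h x)"
    by (rule integral_cong) (simp add: p)
  have 2: "integral {a - pi / 4..a + pi / 4} ?f = 0"
  proof -
    have "((\<lambda>x. 2 * cos (2 * (x - a)) * h' x - 4 * sin (2 * (x - a)) * h x) has_integral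
        2 * cos (2 * (a + pi / 4 - a)) * h (a + pi / 4) - 2 * cos (2 * (a - pi / 4 - a)) * h (a - pi / 4)) {a - pi / 4..a + pi / 4}"
      by (rule has_integral_FTC) (use pi_gt_zero in \<open>auto intro!: derivative_eq_intros h\<close>)
    then have "integral {a - pi / 4..a + pi / 4} (\<lambda>x. 2 * cos (2 * (x - a)) * h' x - 4 * sin (2 * (x - a)) * h x) = 0"
      by (auto dest: integral_unique)
    moreover have "integral {a - pi / 4..a + pi / 4} ?f = integral {a - pi / 4..a + pi / 4} (\<lambda>x. 2 * cos (2 * (x - a)) * h' x - 4 * sin (2 * (x - a)) * h x)"
      by (rule integral_cong) (simp add: p)
    ultimately show ?thesis by simp
  qed
  have 4: "integral {b - pi / 4..b + pi / 4} ?f = 0"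
  proof -
    have "((\<lambda>x. - 2 * cos (2 * (b - x)) * h' x - 4 * sin (2 * (b - x)) * h x) has_integral
        - 2 * cos (2 * (b - (b + pi / 4))) * h (b + pi / 4) - - 2 * cos (2 * (b - (b - pi / 4))) * h (b - pi / 4)) {b - pi / 4..b + pi / 4}"
      by (rule has_integral_FTC) (use pi_gt_zero in \<open>auto intro!: derivative_eq_intros h\<close>)
    then have "integral {b - pi / 4..b + pi / 4} (\<lambda>x. - 2 * cos (2 * (b - x)) * h' x - 4 * sin (2 * (b - x)) * h x) = 0"
      by (auto dest: integral_unique)
    moreover have "integral {b - pi / 4..b + pi / 4} ?f = integral {b - pi / 4..b + pi / 4} (\<lambda>x. - 2 * cos (2 * (b - x)) * h' x - 4 * sin (2 * (b - x)) * h x)"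
      by (rule integral_cong) (simp add: p)
    ultimately show ?thesis by simp
  qed
  show ?thesis
    using integral_five_pieces[OF assms(1) cf] 1 2 3 4 5 by simp
qed

text \<open>Tested with the profile itself, the first variation is -4 times the total length of the
  contact zones, and that length is always pi, since each transition zone has width pi / 2. All
  double cones thus share one energy.\<close>

lemma cone_profile_energy:
  assumes "separated l a b"
  shows "integral {-pi..pi} (\<lambda>x. (cone_profile' a b x)\<^sup>2 - 4 * (cone_profile a b x)\<^sup>2) = - 4 * pi"
proof -
  note p = cone_profile_pieces[OF assms]
  have l: "0 < l" "- pi + l \<le> a - pi / 4" "a + pi / 4 + 2 * l \<le> b - pi / 4" "b + pi / 4 \<le> pi - l"
    using assms by (auto simp: separated_def)
  have "integral {-pi..a - pi / 4} (cone_profile a b) = integral {-pi..a - pi / 4} (\<lambda>x. - 1)"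
    by (rule integral_cong) (simp add: p)
  moreover have "integral {a + pi / 4..b - pi / 4} (cone_profile a b) = integral {a + pi / 4..b - pi / 4} (\<lambda>x. 1)"
    by (rule integral_cong) (simp add: p)
  moreover have "integral {b + pi / 4..pi} (cone_profile a b) = integral {b + pi / 4..pi} (\<lambda>x. - 1)"
    by (rule integral_cong) (simp add: p)
  ultimately show ?thesis
    using cone_profile_first_variation[OF assms has_field_derivative_cone_profile continuous_on_cone_profile'] l
    by (simp add: power2_eq_square mult.assoc)
qed

section \<open>Coercivity of the second variation\<close>

lemma integral_reflect':
  fixes f :: "real \<Rightarrow> real"
  shows "integral {s..t} f = integral {-t..-s} (\<lambda>x. f (- x))"
  using integral_reflect_real[of t s f] by simp

text \<open>The kernel of the second variation consists of rotations of the two transition zones, which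
  are excluded by placing the zeros of the profile at zeros of \<open>c\<close>.\<close>

lemma second_variation_coercive:
  assumes l: "0 < (l::real)"
  obtains k where "k > 0"
    "\<And>a b g g'. separated l a b \<Longrightarrow> (\<And>x. (g has_field_derivative g' x) (at x)) \<Longrightarrow>
       continuous_on UNIV g' \<Longrightarrow> g a = 0 \<Longrightarrow> g b = 0 \<Longrightarrow>
       k * integral {-pi..pi} (\<lambda>x. (g x)\<^sup>2) \<le> integral {-pi..pi} (\<lambda>x. (g' x)\<^sup>2 - 4 * (g x)\<^sup>2)
         + 10 * (integral {-pi..a - pi / 4} (\<lambda>x. (g x)\<^sup>2) + integral {a + pi / 4..b - pi / 4} (\<lambda>x. (g x)\<^sup>2)
            + integral {b + pi / 4..pi} (\<lambda>x. (g x)\<^sup>2))"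
proof -
  obtain k where k: "k > 0" "k \<le> 1"
    and right: "\<And>z L (g::real \<Rightarrow> real) g'. z + pi / 4 + l \<le> L \<Longrightarrow> (\<And>x. (g has_field_derivative g' x) (at x)) \<Longrightarrow>
       continuous_on UNIV g' \<Longrightarrow> g z = 0 \<Longrightarrow>
       k * integral {z..L} (\<lambda>x. (g x)\<^sup>2) \<le> integral {z..z + pi / 4} (\<lambda>x. (g' x)\<^sup>2 - 4 * (g x)\<^sup>2)
         + integral {z + pi / 4..L} (\<lambda>x. (g' x)\<^sup>2 + 6 * (g x)\<^sup>2)"
    apply (rule half_coercive[OF l])
    subgoal premises prems for k by (rule prems(1)[OF prems(2,3)]) (rule prems(4))
    done
  \<comment> \<open>The mirror image of \<open>right\<close>, for a contact zone to the left of the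
    zero.\<close>
  have left: "k * integral {L..z} (\<lambda>x. (g x)\<^sup>2) \<le> integral {z - pi / 4..z} (\<lambda>x. (g' x)\<^sup>2 - 4 * (g x)\<^sup>2)
         + integral {L..z - pi / 4} (\<lambda>x. (g' x)\<^sup>2 + 6 * (g x)\<^sup>2)"
    if "L \<le> z - pi / 4 - l" and g: "\<And>x. (g has_field_derivative g' x) (at x)" "continuous_on UNIV g'" "g z = 0"
    for z L and g g' :: "real \<Rightarrow> real"
  proof -
    have d: "((\<lambda>x. g (- x)) has_field_derivative - g' (- x)) (at x)" for x
    proof -
      have "((\<lambda>x. g (- x)) has_field_derivative g' (- x) * - 1) (at x)"
        by (rule DERIV_chain2[of g]) (auto intro!: derivative_eq_intros g)
      then show ?thesis by simp
    qed
    have c: "continuous_on UNIV (\<lambda>x. - g' (- x))"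
      by (intro continuous_intros continuous_on_compose2[OF g(2)]) auto
    show ?thesis
      using right[of "- z" "- L", OF _ d c] that
      by (subst (1 2 3) integral_reflect') simp
  qed
  show ?thesis
  proof (rule that[OF k(1)])
    fix a b :: real and g g' :: "real \<Rightarrow> real"
    assume ab: "separated l a b" and g: "\<And>x. (g has_field_derivative g' x) (at x)" "continuous_on UNIV g'"
      and z: "g a = 0" "g b = 0"
    have cg: "continuous_on UNIV g"
      using g by (auto intro!: continuous_at_imp_continuous_on DERIV_isCont)
    have i: "(\<lambda>x. (g' x)\<^sup>2) integrable_on {s..t}" "(\<lambda>x. (g x)\<^sup>2) integrable_on {s..t}" for s t
      by (intro integrable_continuous_interval continuous_intros continuous_on_subset[OF cg] continuous_on_subset[OF g(2)], auto)+
    define G H where "G s t = integral {s..t} (\<lambda>x. (g x)\<^sup>2)" and "H s t = integral {s..t} (\<lambda>x. (g' x)\<^sup>2)" for s t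
    have GH: "integral {s..t} (\<lambda>x. (g' x)\<^sup>2 - 4 * (g x)\<^sup>2) = H s t - 4 * G s t"
      "integral {s..t} (\<lambda>x. (g' x)\<^sup>2 + 6 * (g x)\<^sup>2) = H s t + 6 * G s t" for s t
      unfolding G_def H_def
      by (subst Henstock_Kurzweil_Integration.integral_diff Henstock_Kurzweil_Integration.integral_add;
          auto intro!: i integrable_on_mult_right)+
    have G: "G s t = G s r + G r t" and H: "H s t = H s r + H r t" if "s \<le> r" "r \<le> t" for s r t
      unfolding G_def H_def using Henstock_Kurzweil_Integration.integral_combine[OF that i(1)]
        Henstock_Kurzweil_Integration.integral_combine[OF that i(2)] by simp_all
    have s: "0 < l" "- pi + l \<le> a - pi / 4" "a + pi / 4 + 2 * l \<le> b - pi / 4" "b + pi / 4 \<le> pi - l"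
      using ab by (auto simp: separated_def)
    \<comment> \<open>Halving the middle contact zone leaves at least \<open>l\<close> on each side,
      so each of the four half transition zones has a contact zone of its own to draw on.\<close>
    define m where "m = (a + b) / 2"
    have m: "a + pi / 4 + l \<le> m" "m \<le> b - pi / 4 - l" using s by (auto simp: m_def)
    have R: "k * G a m \<le> H a (a + pi / 4) - 4 * G a (a + pi / 4) + (H (a + pi / 4) m + 6 * G (a + pi / 4) m)"
      using right[of a m g g'] m g z by (simp add: GH flip: G_def)
    have R': "k * G b pi \<le> H b (b + pi / 4) - 4 * G b (b + pi / 4) + (H (b + pi / 4) pi + 6 * G (b + pi / 4) pi)"
      using right[of b pi g g'] s g z by (simp add: GH flip: G_def)
    have L: "k * G (-pi) a \<le> H (a - pi / 4) a - 4 * G (a - pi / 4) a + (H (-pi) (a - pi / 4) + 6 * G (-pi) (a - pi / 4))"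
      using left[of "-pi" a g g'] s g z by (simp add: GH flip: G_def)
    have L': "k * G m b \<le> H (b - pi / 4) b - 4 * G (b - pi / 4) b + (H m (b - pi / 4) + 6 * G m (b - pi / 4))"
      using left[of m b g g'] m g z by (simp add: GH flip: G_def)
    have "0 < pi" by simp
    note combine = G[of "-pi" a pi] G[of a m pi] G[of m b pi] H[of "-pi" a pi] H[of a m pi] H[of m b pi]
      G[of a "a + pi / 4" m] H[of a "a + pi / 4" m] G[of b "b + pi / 4" pi] H[of b "b + pi / 4" pi]
      G[of "-pi" "a - pi / 4" a] H[of "-pi" "a - pi / 4" a] G[of m "b - pi / 4" b] H[of m "b - pi / 4" b]
      G[of "a + pi / 4" m "b - pi / 4"]
    have total: "k * G (-pi) pi = k * G (-pi) a + k * G a m + k * G m b + k * G b pi"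
      using combine(1-3) s m \<open>0 < pi\<close> by (simp add: distrib_left)
    \<comment> \<open>Adding 10 G raises the coefficient -4 to 6 on the contact zones, which is the
      form in which the four half estimates are available.\<close>
    have "k * G (-pi) pi \<le> H (-pi) pi - 4 * G (-pi) pi + 10 * (G (-pi) (a - pi / 4) + G (a + pi / 4) (b - pi / 4) + G (b + pi / 4) pi)"
      using R R' L L' total combine s m \<open>0 < pi\<close> by simp
    then show "k * integral {-pi..pi} (\<lambda>x. (g x)\<^sup>2) \<le> integral {-pi..pi} (\<lambda>x. (g' x)\<^sup>2 - 4 * (g x)\<^sup>2)
         + 10 * (integral {-pi..a - pi / 4} (\<lambda>x. (g x)\<^sup>2) + integral {a + pi / 4..b - pi / 4} (\<lambda>x. (g x)\<^sup>2)
            + integral {b + pi / 4..pi} (\<lambda>x. (g x)\<^sup>2))"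
      by (simp add: GH flip: G_def)
  qed
qed


text \<open>One-dimensional Sobolev estimate: g(x)^2 \<le> 2 g(y)^2 + 2 (g(x) - g(y))^2, with the
  last square bounded by 2 pi times the integral of g'^2, is averaged over y in an interval of
  length 2 pi.\<close>

lemma sup_bound_interval:
  fixes g :: "real \<Rightarrow> real"
  assumes g: "\<And>x. (g has_field_derivative g' x) (at x)" and g': "continuous_on UNIV g'" and x: "x \<in> {-pi..pi}"
  shows "(g x)\<^sup>2 \<le> integral {-pi..pi} (\<lambda>x. (g x)\<^sup>2) / pi + 4 * pi * integral {-pi..pi} (\<lambda>x. (g' x)\<^sup>2)"
proof -
  have cg: "continuous_on UNIV g"
    using g by (auto intro!: continuous_at_imp_continuous_on DERIV_isCont)
  have i: "(\<lambda>x. (g' x)\<^sup>2) integrable_on {s..t}" "(\<lambda>x. (g x)\<^sup>2) integrable_on {s..t}" for s t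
    by (intro integrable_continuous_interval continuous_intros continuous_on_subset[OF cg] continuous_on_subset[OF g'], auto)+
  define H where "H = integral {-pi..pi} (\<lambda>x. (g' x)\<^sup>2)"
  define N where "N = integral {-pi..pi} (\<lambda>x. (g x)\<^sup>2)"
  have step: "(g t - g s)\<^sup>2 \<le> 2 * pi * H" if st: "- pi \<le> s" "s < t" "t \<le> pi" for s t
  proof -
    have "(g' has_integral g t - g s) {s..t}" by (rule has_integral_FTC) (use st g in auto)
    then have "(g t - g s)\<^sup>2 = (integral {s..t} (\<lambda>x. g' x * 1))\<^sup>2" by (simp add: integral_unique)
    also have "\<dots> \<le> integral {s..t} (\<lambda>x. (g' x)\<^sup>2) * integral {s..t} (\<lambda>x. 1\<^sup>2)"
      by (rule integral_Cauchy_Schwarz) (use st in \<open>auto intro: continuous_on_subset[OF g']\<close>)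
    also have "\<dots> = integral {s..t} (\<lambda>x. (g' x)\<^sup>2) * (t - s)" using st by simp
    also have "\<dots> \<le> H * (2 * pi)"
      unfolding H_def using st by (intro mult_mono integral_subset_le i integral_nonneg) auto
    finally show ?thesis by (simp add: mult.commute)
  qed
  have H: "0 \<le> H" unfolding H_def by (intro integral_nonneg i) auto
  have diff: "(g x - g y)\<^sup>2 \<le> 2 * pi * H" if "y \<in> {-pi..pi}" for y
    using step[of x y] step[of y x] that x H by (cases x y rule: linorder_cases) (auto simp: power2_commute)
  have "((\<lambda>y. (g x)\<^sup>2) has_integral (2 * pi) * (g x)\<^sup>2) {-pi..pi}"
    using has_integral_const_real[of "(g x)\<^sup>2" "-pi" pi] by simp
  moreover have "((\<lambda>y. 2 * (g y)\<^sup>2 + 4 * pi * H) has_integral 2 * N + (2 * pi) * (4 * pi * H)) {-pi..pi}"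
    using has_integral_const_real[of "4 * pi * H" "-pi" pi]
    by (intro has_integral_add has_integral_mult_right) (auto simp: N_def intro: integrable_integral i)
  ultimately have "(2 * pi) * (g x)\<^sup>2 \<le> 2 * N + (2 * pi) * (4 * pi * H)"
  proof (rule has_integral_le)
    fix y assume "y \<in> {-pi..pi}"
    have "(g x)\<^sup>2 \<le> 2 * (g y)\<^sup>2 + 2 * (g x - g y)\<^sup>2"
      using zero_le_power2[of "g x - 2 * g y"] by (simp add: power2_eq_square algebra_simps)
    then show "(g x)\<^sup>2 \<le> 2 * (g y)\<^sup>2 + 4 * pi * H" using diff[OF \<open>y \<in> _\<close>] by simp
  qed
  then have "(g x)\<^sup>2 \<le> (2 * N + (2 * pi) * (4 * pi * H)) / (2 * pi)" by (simp add: pos_le_divide_eq mult.commute)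
  also have "\<dots> = N / pi + 4 * pi * H" by (simp add: field_simps)
  finally show ?thesis by (simp add: N_def H_def)
qed

text \<open>The bound |c| \<le> 1 makes c - p nonnegative where p = -1 and nonpositive where p = 1,
  so the first variation is four times the L1 norm of c - p over the contact zones. With |c - p| at
  most 1 / K this dominates 4 K times the squared L2 norm there. The value K = 0 gives mere
  nonnegativity.\<close>

lemma cone_profile_first_variation_ge:
  assumes ab: "separated l a b" and c: "\<And>x. (c has_field_derivative c' x) (at x)" and c': "continuous_on UNIV c'"
    and bd: "\<And>x. x \<in> {-pi..pi} \<Longrightarrow> \<bar>c x\<bar> \<le> 1"
    and K: "\<And>x. x \<in> {-pi..pi} \<Longrightarrow> K * \<bar>c x - cone_profile a b x\<bar> \<le> 1" "0 \<le> K"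
  shows "4 * K * (integral {-pi..a - pi / 4} (\<lambda>x. (c x - cone_profile a b x)\<^sup>2)
      + integral {a + pi / 4..b - pi / 4} (\<lambda>x. (c x - cone_profile a b x)\<^sup>2)
      + integral {b + pi / 4..pi} (\<lambda>x. (c x - cone_profile a b x)\<^sup>2))
    \<le> integral {-pi..pi} (\<lambda>x. cone_profile' a b x * (c' x - cone_profile' a b x) - 4 * cone_profile a b x * (c x - cone_profile a b x))"
proof -
  let ?g = "\<lambda>x. c x - cone_profile a b x"
  have cc: "continuous_on UNIV c"
    using c by (auto intro!: continuous_at_imp_continuous_on DERIV_isCont)
  have cg: "continuous_on UNIV ?g" by (intro continuous_intros cc continuous_on_cone_profile)
  have i: "?g integrable_on {s..t}" "(\<lambda>x. (?g x)\<^sup>2) integrable_on {s..t}"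
    "(\<lambda>x. cone_profile a b x - c x) integrable_on {s..t}" for s t
    by (intro integrable_continuous_interval continuous_intros continuous_on_subset[OF cc] continuous_on_cone_profile, auto)+
  have s: "0 < l" "- pi + l \<le> a - pi / 4" "a + pi / 4 + 2 * l \<le> b - pi / 4" "b + pi / 4 \<le> pi - l"
    using ab by (auto simp: separated_def)
  have pos: "0 < pi" by simp
  have sq: "K * (?g x)\<^sup>2 \<le> \<bar>?g x\<bar>" if "x \<in> {-pi..pi}" for x
    using mult_right_mono[OF K(1)[OF that], of "\<bar>?g x\<bar>"] by (simp add: power2_eq_square mult.assoc flip: abs_mult)
  note p = cone_profile_pieces[OF ab]
  have 1: "K * integral {-pi..a - pi / 4} (\<lambda>x. (?g x)\<^sup>2) \<le> integral {-pi..a - pi / 4} ?g"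
    unfolding integral_mult_right[symmetric]
  proof (rule integral_le)
    fix x assume x: "x \<in> {-pi..a - pi / 4}"
    then have xx: "x \<in> {-pi..pi}" using s pos by auto
    have "\<bar>?g x\<bar> = ?g x" using bd[OF xx] x by (simp add: p)
    then show "K * (?g x)\<^sup>2 \<le> ?g x" using sq[OF xx] by simp
  qed (auto intro!: i integrable_on_mult_right)
  have 5: "K * integral {b + pi / 4..pi} (\<lambda>x. (?g x)\<^sup>2) \<le> integral {b + pi / 4..pi} ?g"
    unfolding integral_mult_right[symmetric]
  proof (rule integral_le)
    fix x assume x: "x \<in> {b + pi / 4..pi}"
    then have xx: "x \<in> {-pi..pi}" using s pos by auto
    have "\<bar>?g x\<bar> = ?g x" using bd[OF xx] x by (simp add: p)
    then show "K * (?g x)\<^sup>2 \<le> ?g x" using sq[OF xx] by simp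
  qed (auto intro!: i integrable_on_mult_right)
  have 3: "K * integral {a + pi / 4..b - pi / 4} (\<lambda>x. (?g x)\<^sup>2) \<le> integral {a + pi / 4..b - pi / 4} (\<lambda>x. - ?g x)"
    unfolding integral_mult_right[symmetric]
  proof (rule integral_le)
    fix x assume x: "x \<in> {a + pi / 4..b - pi / 4}"
    then have xx: "x \<in> {-pi..pi}" using s pos by auto
    have "\<bar>?g x\<bar> = - ?g x" using bd[OF xx] x by (simp add: p)
    then show "K * (?g x)\<^sup>2 \<le> - ?g x" using sq[OF xx] by simp
  qed (auto intro!: i integrable_on_mult_right integrable_neg)
  have d: "(?g has_field_derivative c' x - cone_profile' a b x) (at x)" for x
    by (intro DERIV_diff c has_field_derivative_cone_profile)
  have d': "continuous_on UNIV (\<lambda>x. c' x - cone_profile' a b x)"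
    by (intro continuous_intros c' continuous_on_cone_profile')
  show ?thesis
    unfolding cone_profile_first_variation[OF ab d d'] using 1 3[unfolded integral_neg] 5
    unfolding mult.assoc distrib_left by linarith
qed

lemma cone_profile_first_variation_nonneg:
  assumes ab: "separated l a b" and c: "\<And>x. (c has_field_derivative c' x) (at x)" "continuous_on UNIV c'"
    and bd: "\<And>x. x \<in> {-pi..pi} \<Longrightarrow> \<bar>c x\<bar> \<le> 1"
  shows "0 \<le> integral {-pi..pi} (\<lambda>x. cone_profile' a b x * (c' x - cone_profile' a b x) - 4 * cone_profile a b x * (c x - cone_profile a b x))"
  using cone_profile_first_variation_ge[OF assms, of 0] by simp

text \<open>If the second variation Q at (\<open>a0\<close>, \<open>b0\<close>) is at least the
  squared L2 norm N, that profile is kept. Otherwise the derivative of the difference is controlled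
  by the difference, L2 closeness becomes uniform closeness, \<open>c\<close> changes sign near
  \<open>a0\<close> and \<open>b0\<close>, and moving the centres to zeros of \<open>c\<close> makes
  the second variation coercive. The weights 5 \<alpha> and 3/2 are those required by
  \<open>epiperimetric\<close>.\<close>

lemma cone_profile_selection:
  assumes sep: "separated l a0 b0"
  obtains \<delta> \<alpha> where "\<delta> > 0" "0 < \<alpha>" "\<alpha> \<le> 1"
    "\<And>c c'. (\<And>x. (c has_field_derivative c' x) (at x)) \<Longrightarrow> continuous_on UNIV c' \<Longrightarrow>
      (\<And>x. x \<in> {-pi..pi} \<Longrightarrow> \<bar>c x\<bar> \<le> 1) \<Longrightarrow>
      integral {-pi..pi} (\<lambda>x. (c x - cone_profile a0 b0 x)\<^sup>2) \<le> \<delta>\<^sup>2 \<Longrightarrow>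
      \<exists>a b. separated (l / 2) a b \<and>
        5 * \<alpha> * integral {-pi..pi} (\<lambda>x. (c x - cone_profile a b x)\<^sup>2)
        \<le> integral {-pi..pi} (\<lambda>x. cone_profile' a b x * (c' x - cone_profile' a b x) - 4 * cone_profile a b x * (c x - cone_profile a b x))
          + 3 / 2 * integral {-pi..pi} (\<lambda>x. (c' x - cone_profile' a b x)\<^sup>2 - 4 * (c x - cone_profile a b x)\<^sup>2)"
proof -
  have s: "0 < l" "- pi + l \<le> a0 - pi / 4" "a0 + pi / 4 + 2 * l \<le> b0 - pi / 4" "b0 + pi / 4 \<le> pi - l"
    using sep by (auto simp: separated_def)
  obtain k where k: "k > 0"
    and coercive: "\<And>a b g g'. separated (l / 2) a b \<Longrightarrow> (\<And>x. (g has_field_derivative g' x) (at x)) \<Longrightarrow>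
       continuous_on UNIV g' \<Longrightarrow> g a = 0 \<Longrightarrow> g b = 0 \<Longrightarrow>
       k * integral {-pi..pi} (\<lambda>x. (g x)\<^sup>2) \<le> integral {-pi..pi} (\<lambda>x. (g' x)\<^sup>2 - 4 * (g x)\<^sup>2)
         + 10 * (integral {-pi..a - pi / 4} (\<lambda>x. (g x)\<^sup>2) + integral {a + pi / 4..b - pi / 4} (\<lambda>x. (g x)\<^sup>2)
            + integral {b + pi / 4..pi} (\<lambda>x. (g x)\<^sup>2))"
    apply (rule second_variation_coercive[of "l / 2"])
    using s apply simp
    subgoal premises prems for k by (rule prems(1)[OF prems(2)]) (rule prems(3))
    done
  \<comment> \<open>How far the centres may move: at most l / 4, to stay separated with l / 2, and
    at most 1/32, since the profile changes by at most 4 \<tau>.\<close>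
  define \<tau> where "\<tau> = min (l / 4) (1 / 32)"
  have \<tau>: "0 < \<tau>" "\<tau> \<le> l / 4" "\<tau> \<le> 1 / 32" using s(1) by (auto simp: \<tau>_def)
  have \<tau>pi: "\<tau> < pi / 4" using \<tau>(3) pi_gt3 by simp
  have sin\<tau>: "0 < sin (2 * \<tau>)" using \<tau> \<tau>pi by (intro sin_gt_zero) auto
  \<comment> \<open>Smaller than the value sin (2 \<tau>) of the profile at distance \<tau> from its
    zeros, which forces sign changes of \<open>c\<close>; and at most 1/8, so that together with the
    shift 4 \<tau> the distance stays below 1/4.\<close>
  define \<epsilon> where "\<epsilon> = min (1 / 8) (sin (2 * \<tau>) / 2)"
  have \<epsilon>: "0 < \<epsilon>" "\<epsilon> \<le> 1 / 8" "\<epsilon> < sin (2 * \<tau>)" using sin\<tau> by (auto simp: \<epsilon>_def)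
  \<comment> \<open>The Sobolev estimate with H < 5 N, 1 \<le> pi and pi \<le> 4 bounds the square
    of the difference by (1 + 80) N, and 81 is the square of 9.\<close>
  define \<delta> where "\<delta> = \<epsilon> / 9"
  \<comment> \<open>The first case of the dichotomy requires 5 \<alpha> \<le> 1, the second 5
    \<alpha> \<le> 3 k / 2.\<close>
  define \<alpha> where "\<alpha> = min (1 / 5) (3 * k / 10)"
  have \<alpha>: "0 < \<alpha>" "\<alpha> \<le> 1" "5 * \<alpha> \<le> 1" "5 * \<alpha> \<le> 3 / 2 * k" using k by (auto simp: \<alpha>_def)
  show ?thesis
  proof (rule that[of \<delta> \<alpha>])
    fix c c' :: "real \<Rightarrow> real"
    assume c: "\<And>x. (c has_field_derivative c' x) (at x)" "continuous_on UNIV c'"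
      and bd: "\<And>x. x \<in> {-pi..pi} \<Longrightarrow> \<bar>c x\<bar> \<le> 1"
      and close: "integral {-pi..pi} (\<lambda>x. (c x - cone_profile a0 b0 x)\<^sup>2) \<le> \<delta>\<^sup>2"
    have cc: "continuous_on S c" for S
      using c(1) by (auto intro!: continuous_at_imp_continuous_on DERIV_isCont)
    have d: "((\<lambda>x. c x - cone_profile a b x) has_field_derivative c' x - cone_profile' a b x) (at x)" for x a b
      by (intro DERIV_diff c has_field_derivative_cone_profile)
    have d': "continuous_on UNIV (\<lambda>x. c' x - cone_profile' a b x)" for a b
      by (intro continuous_intros c continuous_on_cone_profile')
    have i: "(\<lambda>x. (c x - cone_profile a b x)\<^sup>2) integrable_on {s..t}"
      "(\<lambda>x. (c' x - cone_profile' a b x)\<^sup>2) integrable_on {s..t}" for s t a b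
      by (intro integrable_continuous_interval continuous_intros cc continuous_on_cone_profile
          continuous_on_cone_profile' continuous_on_subset[OF c(2)]; simp)+
    define N where "N a b = integral {-pi..pi} (\<lambda>x. (c x - cone_profile a b x)\<^sup>2)" for a b
    define Q where "Q a b = integral {-pi..pi} (\<lambda>x. (c' x - cone_profile' a b x)\<^sup>2 - 4 * (c x - cone_profile a b x)\<^sup>2)" for a b
    define A where "A a b = integral {-pi..pi} (\<lambda>x. cone_profile' a b x * (c' x - cone_profile' a b x) - 4 * cone_profile a b x * (c x - cone_profile a b x))" for a b
    define H where "H a b = integral {-pi..pi} (\<lambda>x. (c' x - cone_profile' a b x)\<^sup>2)" for a b
    have QH: "Q a b = H a b - 4 * N a b" for a b
      unfolding Q_def H_def N_def
      by (subst Henstock_Kurzweil_Integration.integral_diff) (auto intro!: i integrable_on_mult_right)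
    have N: "0 \<le> N a b" for a b unfolding N_def by (intro integral_nonneg i) auto
    have "\<exists>a b. separated (l / 2) a b \<and> 5 * \<alpha> * N a b \<le> A a b + 3 / 2 * Q a b"
    proof (cases "N a0 b0 \<le> Q a0 b0")
      case True
      have "separated (l / 2) a0 b0" using s by (auto simp: separated_def)
      moreover have "0 \<le> A a0 b0" unfolding A_def by (rule cone_profile_first_variation_nonneg[OF sep c bd])
      moreover have "5 * \<alpha> * N a0 b0 \<le> 1 * N a0 b0" using \<alpha>(3) N by (intro mult_right_mono) auto
      ultimately show ?thesis using True N[of a0 b0] by (intro exI[of _ a0] exI[of _ b0]) auto
    next
      case False
      have sup: "\<bar>c x - cone_profile a0 b0 x\<bar> \<le> \<epsilon>" if x: "x \<in> {-pi..pi}" for x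
      proof -
        have "(c x - cone_profile a0 b0 x)\<^sup>2 \<le> N a0 b0 / pi + 4 * pi * H a0 b0"
          unfolding N_def H_def by (rule sup_bound_interval[OF d d' x])
        also have "\<dots> \<le> N a0 b0 / 1 + 4 * 4 * (5 * N a0 b0)"
        proof (intro add_mono mult_mono divide_left_mono)
          show "1 \<le> pi" "pi \<le> 4" using pi_gt3 pi_less_4 by auto
          show "H a0 b0 \<le> 5 * N a0 b0" using False QH by simp
          show "0 \<le> H a0 b0" unfolding H_def by (intro integral_nonneg i) auto
        qed (use N[of a0 b0] in auto)
        also have "\<dots> = 81 * N a0 b0" by simp
        also have "\<dots> \<le> 81 * \<delta>\<^sup>2" using close by (simp add: N_def)
        also have "\<dots> = \<epsilon>\<^sup>2" by (simp add: \<delta>_def power2_eq_square)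
        finally show ?thesis using \<epsilon>(1) by (simp add: power2_le_iff_abs_le)
      qed
      note p0 = cone_profile_pieces[OF sep]
      have pos: "0 < pi" by simp
      have "\<exists>a. a0 - \<tau> \<le> a \<and> a \<le> a0 + \<tau> \<and> c a = 0"
      proof (rule IVT')
        have "cone_profile a0 b0 (a0 - \<tau>) = - sin (2 * \<tau>)" using p0(7)[of "a0 - \<tau>"] \<tau> \<tau>pi by simp
        moreover have "a0 - \<tau> \<in> {-pi..pi}" using s \<tau> \<tau>pi pos by auto
        ultimately show "c (a0 - \<tau>) \<le> 0" using sup[of "a0 - \<tau>"] \<epsilon>(3) by (simp add: abs_le_iff)
        have "cone_profile a0 b0 (a0 + \<tau>) = sin (2 * \<tau>)" using p0(7)[of "a0 + \<tau>"] \<tau> \<tau>pi by simp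
        moreover have "a0 + \<tau> \<in> {-pi..pi}" using s \<tau> \<tau>pi pos by auto
        ultimately show "0 \<le> c (a0 + \<tau>)" using sup[of "a0 + \<tau>"] \<epsilon>(3) by (simp add: abs_le_iff)
      qed (use \<tau> cc in auto)
      then obtain a where a: "a0 - \<tau> \<le> a" "a \<le> a0 + \<tau>" "c a = 0" by blast
      have "\<exists>b. b0 - \<tau> \<le> b \<and> b \<le> b0 + \<tau> \<and> c b = 0"
      proof (rule IVT2')
        have "cone_profile a0 b0 (b0 + \<tau>) = - sin (2 * \<tau>)" using p0(9)[of "b0 + \<tau>"] \<tau> \<tau>pi by simp
        moreover have "b0 + \<tau> \<in> {-pi..pi}" using s \<tau> \<tau>pi pos by auto
        ultimately show "c (b0 + \<tau>) \<le> 0" using sup[of "b0 + \<tau>"] \<epsilon>(3) by (simp add: abs_le_iff)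
        have "cone_profile a0 b0 (b0 - \<tau>) = sin (2 * \<tau>)" using p0(9)[of "b0 - \<tau>"] \<tau> \<tau>pi by simp
        moreover have "b0 - \<tau> \<in> {-pi..pi}" using s \<tau> \<tau>pi pos by auto
        ultimately show "0 \<le> c (b0 - \<tau>)" using sup[of "b0 - \<tau>"] \<epsilon>(3) by (simp add: abs_le_iff)
      qed (use \<tau> cc in auto)
      then obtain b where b: "b0 - \<tau> \<le> b" "b \<le> b0 + \<tau>" "c b = 0" by blast
      have ab: "separated (l / 2) a b" using s a b \<tau> by (auto simp: separated_def)
      have near: "\<bar>cone_profile a0 b0 x - cone_profile a b x\<bar> \<le> 4 * \<tau>" for x
      proof -
        have "\<bar>csin (2 * (x - a0)) - csin (2 * (x - a))\<bar> \<le> 2 * \<tau>"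
          by (rule order_trans[OF csin_Lipschitz]) (use a in \<open>simp add: abs_le_iff algebra_simps\<close>)
        moreover have "\<bar>csin (2 * (b0 - x)) - csin (2 * (b - x))\<bar> \<le> 2 * \<tau>"
          by (rule order_trans[OF csin_Lipschitz]) (use b in \<open>simp add: abs_le_iff algebra_simps\<close>)
        ultimately show ?thesis unfolding cone_profile_def by linarith
      qed
      have quarter: "4 * \<bar>c x - cone_profile a b x\<bar> \<le> 1" if "x \<in> {-pi..pi}" for x
        using sup[OF that] near[of x] \<epsilon>(2) \<tau>(3)
          abs_triangle_ineq[of "c x - cone_profile a0 b0 x" "cone_profile a0 b0 x - cone_profile a b x"] by simp
      note pab = cone_profile_pieces[OF ab]
      have za: "c a - cone_profile a b a = 0" using pab(7)[of a] a(3) pos by simp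
      have zb: "c b - cone_profile a b b = 0" using pab(9)[of b] b(3) pos by simp
      define G where "G = integral {-pi..a - pi / 4} (\<lambda>x. (c x - cone_profile a b x)\<^sup>2)
        + integral {a + pi / 4..b - pi / 4} (\<lambda>x. (c x - cone_profile a b x)\<^sup>2)
        + integral {b + pi / 4..pi} (\<lambda>x. (c x - cone_profile a b x)\<^sup>2)"
      have "0 \<le> G" unfolding G_def by (intro add_nonneg_nonneg integral_nonneg i) auto
      \<comment> \<open>The distance bound 1/4 gives K = 4. The resulting 16 G outweigh the 15 G
        lost when the coercivity estimate is multiplied by 3/2.\<close>
      moreover have "4 * 4 * G \<le> A a b"
        unfolding A_def G_def by (rule cone_profile_first_variation_ge[OF ab c bd quarter]) auto
      moreover have "k * N a b \<le> Q a b + 10 * G"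
        unfolding N_def Q_def G_def by (rule coercive[OF ab d d' za zb])
      moreover have "5 * \<alpha> * N a b \<le> 3 / 2 * k * N a b" using \<alpha>(4) N by (intro mult_right_mono) auto
      ultimately show ?thesis using ab by (intro exI[of _ a] exI[of _ b]) auto
    qed
    then show "\<exists>a b. separated (l / 2) a b \<and>
        5 * \<alpha> * integral {-pi..pi} (\<lambda>x. (c x - cone_profile a b x)\<^sup>2)
        \<le> integral {-pi..pi} (\<lambda>x. cone_profile' a b x * (c' x - cone_profile' a b x) - 4 * cone_profile a b x * (c x - cone_profile a b x))
          + 3 / 2 * integral {-pi..pi} (\<lambda>x. (c' x - cone_profile' a b x)\<^sup>2 - 4 * (c x - cone_profile a b x)\<^sup>2)"
      by (simp add: N_def Q_def A_def)
  qed (use \<epsilon> \<alpha> in \<open>auto simp: \<delta>_def\<close>)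
qed


section \<open>Removing a cut-off in the radius\<close>

text \<open>Integrating the first term by parts, everything becomes a difference of averages of a continuous
  function near the end points.\<close>

lemma cutoff_limit:
  fixes \<Theta> \<Xi> :: "real \<Rightarrow> real"
  assumes R: "0 < R" and \<Theta>: "continuous_on {0..R} \<Theta>" and \<Xi>: "continuous_on {0..R} \<Xi>" "\<Xi> 0 = 0" "\<Xi> R = 0"
    and weak: "\<And>\<eta> \<eta>' \<epsilon>. (\<And>r. (\<eta> has_field_derivative \<eta>' r) (at r)) \<Longrightarrow> continuous_on UNIV \<eta>' \<Longrightarrow>
      (\<And>r. 0 \<le> \<eta> r \<and> \<eta> r \<le> 1) \<Longrightarrow> 0 < \<epsilon> \<Longrightarrow> (\<And>r. r < \<epsilon> \<or> R - \<epsilon> < r \<Longrightarrow> \<eta> r = 0) \<Longrightarrow>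
      0 \<le> integral {0..R} (\<lambda>r. \<eta> r * \<Theta> r + \<eta>' r * \<Xi> r)"
  shows "0 \<le> integral {0..R} \<Theta>"
proof -
  define \<Phi> where "\<Phi> r = integral {0..r} \<Theta>" for r
  have d\<Phi>: "(\<Phi> has_field_derivative \<Theta> r) (at r within {0..R})" if "r \<in> {0..R}" for r
    unfolding \<Phi>_def by (rule integral_has_real_derivative[OF \<Theta> that])
  have c\<Phi>: "continuous_on {0..R} \<Phi>"
    using d\<Phi> by (rule DERIV_continuous_on)
  define \<Psi> where "\<Psi> r = \<Xi> r - \<Phi> r" for r
  have c\<Psi>: "continuous_on {0..R} \<Psi>" unfolding \<Psi>_def by (intro continuous_intros \<Xi> c\<Phi>)
  have ends: "\<Psi> 0 = 0" "\<Psi> R = - \<Phi> R" using \<Xi> by (simp_all add: \<Psi>_def \<Phi>_def)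
  have "0 \<le> \<Phi> R + 2 * e" if "0 < e" for e
  proof -
    have "uniformly_continuous_on {0..R} \<Psi>" using c\<Psi> by (intro compact_uniformly_continuous) auto
    then obtain d where d: "d > 0" "\<And>x y. x \<in> {0..R} \<Longrightarrow> y \<in> {0..R} \<Longrightarrow> dist y x < d \<Longrightarrow> dist (\<Psi> y) (\<Psi> x) < e"
      using \<open>0 < e\<close> unfolding uniformly_continuous_on_def by metis
    define \<epsilon> where "\<epsilon> = min (R / 4) (d / 3)"
    have \<epsilon>: "0 < \<epsilon>" "4 * \<epsilon> \<le> R" "2 * \<epsilon> < d" using R d(1) by (auto simp: \<epsilon>_def)
    define a where "a r = (pi / \<epsilon>) * (r - \<epsilon>) - pi / 2" for r
    \<comment> \<open>A probability density concentrated on [\<epsilon>, 2 \<epsilon>]: half the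
      derivative of the clipped sine, whose argument runs from -pi / 2 to pi / 2 on that
      interval.\<close>
    define B where "B r = (pi / (2 * \<epsilon>)) * csin' (a r)" for r
    have B0: "0 \<le> B r" for r using \<epsilon>(1) by (simp add: B_def csin'_nonneg)
    have a1: "csin (a r) = - 1" if "r \<le> \<epsilon>" for r
    proof -
      have "(pi / \<epsilon>) * (r - \<epsilon>) \<le> 0" using that \<epsilon>(1) by (intro mult_nonneg_nonpos) auto
      then have "a r \<le> - (pi / 2)" by (simp add: a_def)
      then show ?thesis by (simp add: csin_def)
    qed
    have a2: "csin (a r) = 1" if "2 * \<epsilon> \<le> r" for r
    proof (rule csin_ge)
      have "(pi / \<epsilon>) * \<epsilon> \<le> (pi / \<epsilon>) * (r - \<epsilon>)" using that \<epsilon>(1) by (intro mult_left_mono) auto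
      then have "pi \<le> (pi / \<epsilon>) * (r - \<epsilon>)" using \<epsilon>(1) by simp
      then show "pi / 2 \<le> a r" unfolding a_def by linarith
    qed
    have Bz: "B r = 0" if "r \<le> \<epsilon> \<or> 2 * \<epsilon> \<le> r" for r
    proof -
      have "\<not> \<bar>a r\<bar> < pi / 2"
        using that
      proof
        assume "r \<le> \<epsilon>"
        then have "(pi / \<epsilon>) * (r - \<epsilon>) \<le> 0" using \<epsilon>(1) by (intro mult_nonneg_nonpos) auto
        then have "a r \<le> - (pi / 2)" by (simp add: a_def)
        then show ?thesis by linarith
      next
        assume "2 * \<epsilon> \<le> r"
        then have "(pi / \<epsilon>) * \<epsilon> \<le> (pi / \<epsilon>) * (r - \<epsilon>)" using \<epsilon>(1) by (intro mult_left_mono) auto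
        then have "pi \<le> (pi / \<epsilon>) * (r - \<epsilon>)" using \<epsilon>(1) by simp
      then have "pi / 2 \<le> a r" unfolding a_def by linarith
        then show ?thesis by linarith
      qed
      then show ?thesis by (simp add: B_def csin'_def)
    qed
    define s where "s r = csin (a r) / 2" for r
    have ds: "(s has_field_derivative B r) (at r)" for r
    proof -
      have "((\<lambda>r. csin (a r)) has_field_derivative csin' (a r) * (pi / \<epsilon>)) (at r)"
        by (rule DERIV_chain2[OF has_field_derivative_csin]) (use \<epsilon>(1) in \<open>auto simp: a_def intro!: derivative_eq_intros\<close>)
      from DERIV_cdivide[OF this, of 2] show ?thesis unfolding s_def by (simp add: B_def mult.commute)
    qed
    have ds': "((\<lambda>r. s (R - r)) has_field_derivative - B (R - r)) (at r)" for r
    proof -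
      have "((\<lambda>r. s (R - r)) has_field_derivative B (R - r) * - 1) (at r)"
        by (rule DERIV_chain2[OF ds]) (auto intro!: derivative_eq_intros)
      then show ?thesis by simp
    qed
    have cB: "continuous_on S B" for S
      unfolding B_def a_def by (intro continuous_intros continuous_on_compose2[OF continuous_on_csin']) auto
    have cB': "continuous_on S (\<lambda>r. B (R - r))" for S
      by (intro continuous_on_compose2[OF cB[of UNIV]] continuous_intros) auto
    \<comment> \<open>Zero near both ends and 1 on [2 \<epsilon>, R - 2 \<epsilon>]; the derivative
      is the density near 0 minus its mirror image near \<open>R\<close>.\<close>
    define \<eta> where "\<eta> r = s r + s (R - r)" for r
    have d\<eta>: "(\<eta> has_field_derivative B r - B (R - r)) (at r)" for r
      unfolding \<eta>_def using DERIV_add[OF ds ds'] by simp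
    have \<eta>0: "\<eta> r = 0" if "r \<le> \<epsilon> \<or> R - \<epsilon> \<le> r" for r
      using that a1[of r] a1[of "R - r"] a2[of r] a2[of "R - r"] \<epsilon> by (auto simp: \<eta>_def s_def)
    have \<eta>01: "0 \<le> \<eta> r \<and> \<eta> r \<le> 1" for r
    proof (cases "2 * \<epsilon> \<le> r")
      case True
      then show ?thesis using a2[OF True] abs_csin_le[of "a (R - r)"] by (auto simp: \<eta>_def s_def abs_le_iff)
    next
      case False
      then show ?thesis using a2[of "R - r"] \<epsilon> abs_csin_le[of "a r"] by (auto simp: \<eta>_def s_def abs_le_iff)
    qed
    have "0 \<le> integral {0..R} (\<lambda>r. \<eta> r * \<Theta> r + (B r - B (R - r)) * \<Xi> r)"
      by (rule weak[OF d\<eta> _ \<eta>01 \<epsilon>(1)]) (use \<eta>0 in \<open>auto intro!: continuous_intros cB cB'\<close>)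
    also have "\<dots> = integral {0..R} (\<lambda>r. B r * \<Psi> r - B (R - r) * \<Psi> r)"
    proof -
      have "((\<lambda>r. (B r - B (R - r)) * \<Phi> r + \<Theta> r * \<eta> r) has_integral \<eta> R * \<Phi> R - \<eta> 0 * \<Phi> 0) {0..R}"
        by (intro fundamental_theorem_of_calculus)
           (use R in \<open>auto simp: has_real_derivative_iff_has_vector_derivative[symmetric]
              intro!: DERIV_mult d\<Phi> has_field_derivative_at_within[OF d\<eta>]\<close>)
      then have z: "((\<lambda>r. (B r - B (R - r)) * \<Phi> r + \<Theta> r * \<eta> r) has_integral 0) {0..R}"
        using \<eta>0[of 0] \<eta>0[of R] \<epsilon>(1) by simp
      have "(\<lambda>r. B r * \<Psi> r - B (R - r) * \<Psi> r) integrable_on {0..R}"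
        by (intro integrable_continuous_interval continuous_intros cB cB' c\<Psi>)
      from has_integral_add[OF z integrable_integral[OF this]]
      have "((\<lambda>r. \<eta> r * \<Theta> r + (B r - B (R - r)) * \<Xi> r) has_integral integral {0..R} (\<lambda>r. B r * \<Psi> r - B (R - r) * \<Psi> r)) {0..R}"
        by (simp add: \<Psi>_def algebra_simps)
      then show ?thesis by (rule integral_unique)
    qed
    also have "\<dots> \<le> \<Phi> R + 2 * e"
    proof -
      have 1: "(B has_integral 1) {0..R}"
      proof -
        have "(B has_integral s R - s 0) {0..R}" by (rule has_integral_FTC) (use R ds in auto)
        then show ?thesis using a1[of 0] a2[of R] \<epsilon> by (simp add: s_def)
      qed
      have 2: "((\<lambda>r. B (R - r)) has_integral 1) {0..R}"
      proof -
        have "((\<lambda>r. - B (R - r)) has_integral s (R - R) - s (R - 0)) {0..R}"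
          by (rule has_integral_FTC) (use R ds' in auto)
        from has_integral_neg[OF this] show ?thesis using a1[of 0] a2[of R] \<epsilon> by (simp add: s_def)
      qed
      have "((\<lambda>r. B r * \<Psi> r - B (R - r) * \<Psi> r) has_integral integral {0..R} (\<lambda>r. B r * \<Psi> r - B (R - r) * \<Psi> r)) {0..R}"
        by (intro integrable_integral integrable_continuous_interval continuous_intros cB cB' c\<Psi>)
      moreover have "((\<lambda>r. B r * e + B (R - r) * (\<Phi> R + e)) has_integral 1 * e + 1 * (\<Phi> R + e)) {0..R}"
        by (intro has_integral_add has_integral_mult_left 1 2)
      ultimately have "integral {0..R} (\<lambda>r. B r * \<Psi> r - B (R - r) * \<Psi> r) \<le> 1 * e + 1 * (\<Phi> R + e)"
      proof (rule has_integral_le)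
        fix r assume r: "r \<in> {0..R}"
        have "B r * \<Psi> r \<le> B r * e"
        proof (cases "r \<le> \<epsilon> \<or> 2 * \<epsilon> \<le> r")
          case False
          then have "dist (\<Psi> r) (\<Psi> 0) < e" using d(2)[of 0 r] r R \<epsilon> by (simp add: dist_real_def)
          then show ?thesis using B0 ends by (intro mult_left_mono) (auto simp: dist_real_def)
        qed (simp add: Bz)
        moreover have "B (R - r) * (- \<Psi> r) \<le> B (R - r) * (\<Phi> R + e)"
        proof (cases "R - r \<le> \<epsilon> \<or> 2 * \<epsilon> \<le> R - r")
          case False
          then have "dist (\<Psi> r) (\<Psi> R) < e" using d(2)[of R r] r R \<epsilon> by (simp add: dist_real_def)
          then show ?thesis using B0 ends by (intro mult_left_mono) (auto simp: dist_real_def)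
        qed (simp add: Bz)
        ultimately show "B r * \<Psi> r - B (R - r) * \<Psi> r \<le> B r * e + B (R - r) * (\<Phi> R + e)" by simp
      qed
      then show ?thesis by simp
    qed
    finally show ?thesis .
  qed
  then have "0 \<le> \<Phi> R + e" if "0 < e" for e using that by (metis field_sum_of_halves half_gt_zero mult_2)
  then have "0 \<le> \<Phi> R" by (rule field_le_epsilon)
  then show ?thesis by (simp add: \<Phi>_def)
qed

section \<open>Comparison with interpolated competitors\<close>

text \<open>A competitor with parts of degrees 2 and 2 + \<alpha> has a squared gradient with
  exponents 2, 2 + \<alpha> and 2 + 2 \<alpha>; the polar weight r adds one, so \<gamma> will be 0,
  \<alpha> and 2 \<alpha>.\<close>

lemma has_integral_powr_moment:
  fixes R \<gamma> :: real
  assumes "0 < R" "0 \<le> \<gamma>"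
  shows "((\<lambda>r. R ^ 3 * (r / R) powr (3 + \<gamma>)) has_integral R ^ 4 / (4 + \<gamma>)) {0..R}"
proof -
  have "((\<lambda>r. R ^ 3 * (r / R) powr (3 + \<gamma>)) has_integral
      R ^ 4 / (4 + \<gamma>) * (R / R) powr (4 + \<gamma>) - R ^ 4 / (4 + \<gamma>) * (0 / R) powr (4 + \<gamma>)) {0..R}"
  proof (rule fundamental_theorem_of_calculus_interior)
    show "continuous_on {0..R} (\<lambda>r. R ^ 4 / (4 + \<gamma>) * (r / R) powr (4 + \<gamma>))"
      using assms by (intro continuous_intros continuous_on_powr') auto
    fix r assume r: "r \<in> {0<..<R}"
    have "((\<lambda>r. (r / R) powr (4 + \<gamma>)) has_field_derivative ((4 + \<gamma>) * (r / R) powr (4 + \<gamma> - 1)) * (1 / R)) (at r)"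
      by (rule DERIV_chain2[OF has_real_derivative_powr]) (use r assms in \<open>auto intro!: derivative_eq_intros\<close>)
    from DERIV_cmult[OF this, of "R ^ 4 / (4 + \<gamma>)"]
    have "((\<lambda>r. R ^ 4 / (4 + \<gamma>) * (r / R) powr (4 + \<gamma>)) has_field_derivative R ^ 3 * (r / R) powr (3 + \<gamma>)) (at r)"
    proof (rule DERIV_cong)
      have "R ^ 4 / (4 + \<gamma>) * ((4 + \<gamma>) * Z * (1 / R)) = (R ^ 4 / R) * ((4 + \<gamma>) / (4 + \<gamma>)) * Z" for Z by simp
      then show "R ^ 4 / (4 + \<gamma>) * ((4 + \<gamma>) * (r / R) powr (4 + \<gamma> - 1) * (1 / R)) = R ^ 3 * (r / R) powr (3 + \<gamma>)"
        using assms by (simp add: power4_eq_xxxx power3_eq_cube add.commute)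
    qed
    then show "((\<lambda>r. R ^ 4 / (4 + \<gamma>) * (r / R) powr (4 + \<gamma>)) has_vector_derivative R ^ 3 * (r / R) powr (3 + \<gamma>)) (at r)"
      by (simp add: has_real_derivative_iff_has_vector_derivative)
  qed (use assms in auto)
  then show ?thesis using assms by simp
qed

lemma continuous_on_integral_param:
  fixes f :: "real \<Rightarrow> real \<Rightarrow> real"
  assumes "continuous_on (S \<times> {a..b}) (\<lambda>x. f (fst x) (snd x))"
  shows "continuous_on S (\<lambda>r. integral {a..b} (f r))"
  using integral_continuous_on_param[of S a b f] assms by (simp add: split_beta)

text \<open>The angles -pi and pi are left out because the polar formulas in terms of
  \<open>arg\<close> are available only off the slit.\<close>

lemma integral_cong_open:
  fixes f g :: "real \<Rightarrow> real"
  assumes "\<And>x. a < x \<Longrightarrow> x < b \<Longrightarrow> f x = g x"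
  shows "integral {a..b} f = integral {a..b} g"
  unfolding integral_open_interval_real by (rule integral_cong) (simp add: assms)

text \<open>What is retained of the obstacle problem: C1 regularity near the origin, the pointwise
  obstacle bound and the variational inequality. The analysis inside the locale is free of weak
  derivatives.\<close>

locale conical_minimizer =
  fixes u :: "real^2 \<Rightarrow> real" and \<rho> :: real
  assumes \<rho>: "0 < \<rho>" and C1: "C1_on (ball 0 \<rho>) u"
    and bound: "\<And>x. x \<in> ball 0 \<rho> \<Longrightarrow> \<bar>u x\<bar> \<le> (norm x)\<^sup>2"
    and weak: "\<And>\<zeta> K. C1_on UNIV \<zeta> \<Longrightarrow> compact K \<Longrightarrow> K \<subseteq> ball 0 \<rho> \<Longrightarrow> (\<And>x. x \<notin> K \<Longrightarrow> \<zeta> x = 0) \<Longrightarrow>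
      (\<And>x. x \<in> ball 0 \<rho> \<Longrightarrow> \<bar>u x + \<zeta> x\<bar> \<le> (norm x)\<^sup>2) \<Longrightarrow>
      0 \<le> (\<integral>x. gradient u x \<bullet> gradient \<zeta> x \<partial>lebesgue_on (ball 0 \<rho>))"
begin

abbreviation ur :: "real \<Rightarrow> real \<Rightarrow> real" where "ur r \<theta> \<equiv> gradient u (r *\<^sub>R er \<theta>) \<bullet> er \<theta>"
abbreviation ut :: "real \<Rightarrow> real \<Rightarrow> real" where "ut r \<theta> \<equiv> gradient u (r *\<^sub>R er \<theta>) \<bullet> et \<theta>"
abbreviation prof :: "real \<Rightarrow> real \<Rightarrow> real" where "prof r \<theta> \<equiv> u (r *\<^sub>R er \<theta>) / r\<^sup>2"
abbreviation prof' :: "real \<Rightarrow> real \<Rightarrow> real" where "prof' r \<theta> \<equiv> ut r \<theta> / r"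

lemma differentiable_polar: "\<bar>r\<bar> < \<rho> \<Longrightarrow> u differentiable (at (r *\<^sub>R er \<theta>))"
  using C1 by (simp add: C1_on_def)

lemma continuous_on_u_polar [continuous_intros]:
  assumes "continuous_on S a" "continuous_on S b" "\<And>x. x \<in> S \<Longrightarrow> \<bar>a x\<bar> < \<rho>"
  shows "continuous_on S (\<lambda>x. u (a x *\<^sub>R er (b x)))"
  by (rule continuous_on_compose2[OF C1_on_continuous_on[OF C1]]) (use assms in \<open>auto intro!: continuous_intros\<close>)

lemma continuous_on_gradient_polar [continuous_intros]:
  assumes "continuous_on S a" "continuous_on S b" "\<And>x. x \<in> S \<Longrightarrow> \<bar>a x\<bar> < \<rho>"
  shows "continuous_on S (\<lambda>x. gradient u (a x *\<^sub>R er (b x)))"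
  by (rule continuous_on_compose2[of "ball 0 \<rho>"]) (use assms C1 in \<open>auto intro!: continuous_intros simp: C1_on_def\<close>)

lemma abs_prof_le:
  assumes "0 < r" "r < \<rho>"
  shows "\<bar>prof r \<theta>\<bar> \<le> 1"
  using bound[of "r *\<^sub>R er \<theta>"] assms by (simp add: field_simps)

lemma has_field_derivative_prof:
  assumes "0 < r" "r < \<rho>"
  shows "(prof r has_field_derivative prof' r \<theta>) (at \<theta> within S)"
proof -
  have "((\<lambda>\<theta>. u (r *\<^sub>R er \<theta>) / r\<^sup>2) has_field_derivative (r * ut r \<theta>) / r\<^sup>2) (at \<theta> within S)"
    by (intro DERIV_cdivide has_field_derivative_along_circle differentiable_polar) (use assms in auto)
  then show ?thesis using assms by (simp add: power2_eq_square)
qed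

lemma continuous_on_prof': "0 < r \<Longrightarrow> r < \<rho> \<Longrightarrow> continuous_on S (prof' r)"
  by (intro continuous_intros) auto

text \<open>The perturbation is \<eta>(|x|) (w - u). Added to u it gives a convex combination of u
  and w, which respects the obstacles, and its support avoids the origin, where w need not be C1.
  \<open>Wr\<close> and \<open>Wt\<close> are the radial and tangential components of the gradient
  of w, hence the factor r in the angular derivative.\<close>

lemma weak_annulus:
  assumes R: "0 < R" "R < \<rho>" and w: "C1_on (- {0}) w"
    and wb: "\<And>x. x \<noteq> 0 \<Longrightarrow> norm x \<le> R \<Longrightarrow> \<bar>w x\<bar> \<le> (norm x)\<^sup>2"
    and W: "\<And>r \<theta>. 0 < r \<Longrightarrow> - pi < \<theta> \<Longrightarrow> \<theta> < pi \<Longrightarrow> w (r *\<^sub>R er \<theta>) = W r \<theta>"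
    and Wr: "\<And>r \<theta>. 0 < r \<Longrightarrow> ((\<lambda>r. W r \<theta>) has_field_derivative Wr r \<theta>) (at r)"
    and Wt: "\<And>r \<theta>. 0 < r \<Longrightarrow> (W r has_field_derivative r * Wt r \<theta>) (at \<theta>)"
    and \<eta>: "\<And>r. (\<eta> has_field_derivative \<eta>' r) (at r)" "continuous_on UNIV \<eta>'" "\<And>r. 0 \<le> \<eta> r \<and> \<eta> r \<le> 1"
    and \<epsilon>: "0 < \<epsilon>" "\<And>r. r < \<epsilon> \<or> R - \<epsilon> < r \<Longrightarrow> \<eta> r = 0"
  shows "0 \<le> integral {0..R} (\<lambda>r. r * integral {-pi..pi} (\<lambda>\<theta>.
      ur r \<theta> * (\<eta>' r * (W r \<theta> - u (r *\<^sub>R er \<theta>)) + \<eta> r * (Wr r \<theta> - ur r \<theta>)) + ut r \<theta> * (\<eta> r * (Wt r \<theta> - ut r \<theta>))))"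
proof -
  define K where "K = {x::real^2. \<epsilon> \<le> norm x \<and> norm x \<le> R - \<epsilon>}"
  have "K = cball 0 (R - \<epsilon>) - ball 0 \<epsilon>" by (auto simp: K_def)
  then have K: "compact K" by (simp add: compact_diff)
  have KB: "K \<subseteq> ball 0 \<rho> - {0}" using R \<epsilon>(1) by (auto simp: K_def)
  define \<zeta> where "\<zeta> x = \<eta> (norm x) * (w x - u x)" for x
  have \<eta>K: "\<eta> (norm x) = 0" if "x \<notin> K" for x using that \<epsilon>(2)[of "norm x"] by (auto simp: K_def)
  have "C1_on (- {0}) (\<lambda>x::real^2. \<eta> (norm x))"
    by (rule C1_on_radial[OF \<eta>(1)]) (use \<eta>(2) in \<open>auto intro: continuous_on_subset\<close>)
  moreover have "C1_on (ball 0 \<epsilon>) (\<lambda>x::real^2. \<eta> (norm x))"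
    by (rule C1_on_cong[OF _ _ C1_on_const[of _ 0]]) (use \<epsilon>(2) in auto)
  ultimately have "C1_on (- {0} \<union> ball 0 \<epsilon>) (\<lambda>x::real^2. \<eta> (norm x))"
    by (intro C1_on_Un) auto
  moreover have "- {0} \<union> ball 0 \<epsilon> = (UNIV :: (real^2) set)" using \<epsilon>(1) by auto
  ultimately have C\<eta>: "C1_on UNIV (\<lambda>x::real^2. \<eta> (norm x))" by metis
  have Cwu: "C1_on (ball 0 \<rho> - {0}) (\<lambda>x. w x - u x)"
    by (intro C1_on_diff C1_on_subset[OF w] C1_on_subset[OF C1]) auto
  have oB: "open (ball 0 \<rho> - {0} :: (real^2) set)" by auto
  have C\<zeta>: "C1_on UNIV \<zeta>"
    unfolding \<zeta>_def by (rule C1_on_mult_cutoff[OF C\<eta> compact_imp_closed[OF K] \<eta>K oB KB Cwu])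
  have z\<zeta>: "\<zeta> x = 0" if "x \<notin> K" for x using \<eta>K[OF that] by (simp add: \<zeta>_def)
  have bd: "\<bar>u x + \<zeta> x\<bar> \<le> (norm x)\<^sup>2" if x: "x \<in> ball 0 \<rho>" for x
  proof (cases "x \<in> K")
    case False
    then show ?thesis using z\<zeta> bound[OF x] by simp
  next
    case True
    let ?e = "\<eta> (norm x)"
    have "x \<noteq> 0" "norm x \<le> R" using True \<epsilon>(1) by (auto simp: K_def)
    then have "\<bar>w x\<bar> \<le> (norm x)\<^sup>2" by (rule wb)
    have "u x + \<zeta> x = (1 - ?e) * u x + ?e * w x" by (simp add: \<zeta>_def algebra_simps)
    also have "\<bar>\<dots>\<bar> \<le> (1 - ?e) * \<bar>u x\<bar> + ?e * \<bar>w x\<bar>"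
      using \<eta>(3)[of "norm x"] abs_triangle_ineq[of "(1 - ?e) * u x" "?e * w x"] by (simp add: abs_mult)
    also have "\<dots> \<le> (1 - ?e) * (norm x)\<^sup>2 + ?e * (norm x)\<^sup>2"
      using \<eta>(3)[of "norm x"] bound[OF x] \<open>\<bar>w x\<bar> \<le> _\<close> by (intro add_mono mult_left_mono) auto
    finally show ?thesis by (simp add: algebra_simps)
  qed
  define F where "F x = gradient u x \<bullet> gradient \<zeta> x" for x
  have zF: "F x = 0" if "x \<notin> K" for x
    using gradient_eq_0_outside[OF compact_imp_closed[OF K] z\<zeta> that] by (simp add: F_def)
  have cF: "continuous_on UNIV F"
  proof -
    have "continuous_on (ball 0 \<rho>) F"
      unfolding F_def using C1 C1_on_subset[OF C\<zeta>, of "ball 0 \<rho>"] by (intro continuous_intros) (auto simp: C1_on_def)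
    moreover have "continuous_on (- K) F"
      by (subst continuous_on_cong[OF refl, of _ _ "\<lambda>x. 0"]) (use zF in auto)
    moreover have "ball 0 \<rho> \<union> - K = UNIV" using KB by auto
    ultimately show ?thesis
      using continuous_on_open_Un[of "ball 0 \<rho>" "- K"] compact_imp_closed[OF K] by (metis open_Compl open_ball)
  qed
  have "0 \<le> (\<integral>x. F x \<partial>lebesgue_on (ball 0 \<rho>))"
    unfolding F_def by (rule weak[OF C\<zeta> K _ z\<zeta> bd]) (use KB in auto)
  also have "\<dots> = (\<integral>x. F x \<partial>lborel)"
    by (rule lebesgue_on_integral_eq_lborel) (use KB borel_measurable_continuous_onI[OF cF] in \<open>auto intro!: zF\<close>)
  also have "\<dots> = integral UNIV F"
    by (intro integral_unique[symmetric] has_integral_integral_lborel integrable_compact_support[OF cF K zF])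
  also have "\<dots> = integral (cball 0 R) F"
  proof -
    have "(\<lambda>x. if x \<in> cball 0 R then F x else 0) = F" using zF \<epsilon>(1) by (force simp: K_def fun_eq_iff)
    then show ?thesis using Henstock_Kurzweil_Integration.integral_restrict_UNIV[of "cball 0 R" F] by metis
  qed
  also have "\<dots> = integral {0..R} (\<lambda>r. r * integral {-pi..pi} (\<lambda>\<theta>. F (r *\<^sub>R er \<theta>)))"
    by (rule integral_cball_polar[OF continuous_on_subset[OF cF] R(1)]) auto
  also have "\<dots> = integral {0..R} (\<lambda>r. r * integral {-pi..pi} (\<lambda>\<theta>.
      ur r \<theta> * (\<eta>' r * (W r \<theta> - u (r *\<^sub>R er \<theta>)) + \<eta> r * (Wr r \<theta> - ur r \<theta>)) + ut r \<theta> * (\<eta> r * (Wt r \<theta> - ut r \<theta>))))"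
  proof (rule integral_cong)
    fix r assume r: "r \<in> {0..R}"
    show "r * integral {-pi..pi} (\<lambda>\<theta>. F (r *\<^sub>R er \<theta>)) = r * integral {-pi..pi} (\<lambda>\<theta>.
      ur r \<theta> * (\<eta>' r * (W r \<theta> - u (r *\<^sub>R er \<theta>)) + \<eta> r * (Wr r \<theta> - ur r \<theta>)) + ut r \<theta> * (\<eta> r * (Wt r \<theta> - ut r \<theta>)))"
    proof (cases "r = 0")
      case False
      then have r0: "0 < r" "r < \<rho>" using r R by auto
      have d\<zeta>: "\<zeta> differentiable (at x)" for x using C\<zeta> by (simp add: C1_on_def)
      have \<zeta>eq: "\<zeta> (s *\<^sub>R er t) = \<eta> s * (W s t - u (s *\<^sub>R er t))" if "0 < s" "- pi < t" "t < pi" for s t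
        using W[OF that] that by (simp add: \<zeta>_def)
      have "F (r *\<^sub>R er \<theta>) = ur r \<theta> * (\<eta>' r * (W r \<theta> - u (r *\<^sub>R er \<theta>)) + \<eta> r * (Wr r \<theta> - ur r \<theta>)) + ut r \<theta> * (\<eta> r * (Wt r \<theta> - ut r \<theta>))"
        if \<theta>: "- pi < \<theta>" "\<theta> < pi" for \<theta>
      proof -
        have 1: "((\<lambda>s. u (s *\<^sub>R er \<theta>)) has_field_derivative ur r \<theta>) (at r)"
          by (intro has_field_derivative_along_ray differentiable_polar) (use r0 in auto)
        have 2: "((\<lambda>t. u (r *\<^sub>R er t)) has_field_derivative r * ut r \<theta>) (at \<theta>)"
          by (intro has_field_derivative_along_circle differentiable_polar) (use r0 in auto)
        have "((\<lambda>s. \<eta> s * (W s \<theta> - u (s *\<^sub>R er \<theta>))) has_field_derivative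
            \<eta>' r * (W r \<theta> - u (r *\<^sub>R er \<theta>)) + (Wr r \<theta> - ur r \<theta>) * \<eta> r) (at r)"
          by (intro DERIV_mult DERIV_diff 1 \<eta>(1) Wr r0)
        then have "((\<lambda>s. \<zeta> (s *\<^sub>R er \<theta>)) has_field_derivative
            \<eta>' r * (W r \<theta> - u (r *\<^sub>R er \<theta>)) + (Wr r \<theta> - ur r \<theta>) * \<eta> r) (at r)"
          by (rule has_field_derivative_transform_within_open[of _ _ _ "{0<..}"]) (use r0 \<theta> \<zeta>eq in auto)
        then have a: "gradient \<zeta> (r *\<^sub>R er \<theta>) \<bullet> er \<theta> = \<eta>' r * (W r \<theta> - u (r *\<^sub>R er \<theta>)) + (Wr r \<theta> - ur r \<theta>) * \<eta> r"
          using DERIV_unique has_field_derivative_along_ray[OF d\<zeta>] by blast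
        have "((\<lambda>t. \<eta> r * (W r t - u (r *\<^sub>R er t))) has_field_derivative \<eta> r * (r * Wt r \<theta> - r * ut r \<theta>)) (at \<theta>)"
          by (intro DERIV_cmult DERIV_diff 2 Wt r0)
        then have "((\<lambda>t. \<zeta> (r *\<^sub>R er t)) has_field_derivative \<eta> r * (r * Wt r \<theta> - r * ut r \<theta>)) (at \<theta>)"
          by (rule has_field_derivative_transform_within_open[of _ _ _ "{-pi<..<pi}"]) (use r0 \<theta> \<zeta>eq in auto)
        then have "r * (gradient \<zeta> (r *\<^sub>R er \<theta>) \<bullet> et \<theta>) = \<eta> r * (r * Wt r \<theta> - r * ut r \<theta>)"
          using DERIV_unique has_field_derivative_along_circle[OF d\<zeta>] by blast
        also have "\<dots> = r * (\<eta> r * (Wt r \<theta> - ut r \<theta>))" by (simp add: algebra_simps)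
        finally have b: "gradient \<zeta> (r *\<^sub>R er \<theta>) \<bullet> et \<theta> = \<eta> r * (Wt r \<theta> - ut r \<theta>)"
          using r0(1) by (subst (asm) mult_left_cancel) auto
        have "F (r *\<^sub>R er \<theta>) = ur r \<theta> * (gradient \<zeta> (r *\<^sub>R er \<theta>) \<bullet> er \<theta>) + ut r \<theta> * (gradient \<zeta> (r *\<^sub>R er \<theta>) \<bullet> et \<theta>)"
          unfolding F_def by (rule inner_polar_frame)
        then show ?thesis unfolding a b by (simp add: mult.commute)
      qed
      then show ?thesis by (intro arg_cong[of _ _ "(*) r"] integral_cong_open) auto
    qed simp
  qed
  finally show ?thesis .
qed

text \<open>The competitor extends p with degree 2 and the difference g with degree 2 + \<alpha>, so
  that its trace on the circle of radius R is u. The variational inequality in the direction of w -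
  u, with x (y - x) \<le> (y^2 - x^2) / 2, becomes a comparison of Dirichlet energies; the
  denominators 4, 4 + \<alpha> and 4 + 2 \<alpha> come from the radial integrals.\<close>

lemma competitor:
  assumes R: "0 < R" "R < \<rho>" and \<alpha>: "0 \<le> \<alpha>"
    and p: "\<And>\<theta>. (p has_field_derivative p' \<theta>) (at \<theta>)" "continuous_on UNIV p'" "\<And>\<theta>. \<bar>p \<theta>\<bar> \<le> 1"
    and pc: "\<And>\<theta>. \<theta>0 \<le> \<bar>\<theta>\<bar> \<Longrightarrow> \<bar>\<theta>\<bar> \<le> pi \<Longrightarrow> p \<theta> = c0" "0 \<le> \<theta>0" "\<theta>0 < pi"
  defines "g \<equiv> \<lambda>\<theta>. prof R \<theta> - p \<theta>" and "g' \<equiv> \<lambda>\<theta>. prof' R \<theta> - p' \<theta>"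
  shows "integral {0..R} (\<lambda>r. r * integral {-pi..pi} (\<lambda>\<theta>. (ur r \<theta>)\<^sup>2 + (ut r \<theta>)\<^sup>2))
    \<le> R ^ 4 * (integral {-pi..pi} (\<lambda>\<theta>. 4 * (p \<theta>)\<^sup>2 + (p' \<theta>)\<^sup>2) / 4
      + 2 * integral {-pi..pi} (\<lambda>\<theta>. 2 * (2 + \<alpha>) * (p \<theta> * g \<theta>) + p' \<theta> * g' \<theta>) / (4 + \<alpha>)
      + integral {-pi..pi} (\<lambda>\<theta>. (2 + \<alpha>)\<^sup>2 * (g \<theta>)\<^sup>2 + (g' \<theta>)\<^sup>2) / (4 + 2 * \<alpha>))"
proof -
  \<comment> \<open>This is k r / r in a form that is continuous down to r = 0.\<close>
  define \<sigma> where "\<sigma> r = R * (r / R) powr (1 + \<alpha>)" for r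
  define k where "k r = R\<^sup>2 * (r / R) powr (2 + \<alpha>)" for r
  define W where "W r \<theta> = r\<^sup>2 * p \<theta> + k r * g \<theta>" for r \<theta>
  define Wr where "Wr r \<theta> = 2 * r * p \<theta> + (2 + \<alpha>) * \<sigma> r * g \<theta>" for r \<theta>
  define Wt where "Wt r \<theta> = r * p' \<theta> + \<sigma> r * g' \<theta>" for r \<theta>
  have k\<sigma>: "k r = r * \<sigma> r" if "0 \<le> r" for r
    using that R(1) by (cases "r = 0") (simp_all add: k_def \<sigma>_def powr_add power2_eq_square)
  have dk: "(k has_field_derivative (2 + \<alpha>) * \<sigma> r) (at r)" if "0 < r" for r
  proof -
    have "((\<lambda>r. (r / R) powr (2 + \<alpha>)) has_field_derivative ((2 + \<alpha>) * (r / R) powr (2 + \<alpha> - 1)) * (1 / R)) (at r)"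
      by (rule DERIV_chain2[OF has_real_derivative_powr]) (use that R in \<open>auto intro!: derivative_eq_intros\<close>)
    from DERIV_cmult[OF this, of "R\<^sup>2"] show ?thesis
      unfolding k_def by (rule DERIV_cong) (use R in \<open>simp add: \<sigma>_def field_simps power2_eq_square\<close>)
  qed
  have c\<sigma>: "continuous_on {0..} \<sigma>"
    unfolding \<sigma>_def using R \<alpha> by (intro continuous_intros continuous_on_powr') auto
  have cp: "continuous_on S p" for S using p(1) by (auto intro!: continuous_at_imp_continuous_on DERIV_isCont)
  have cp': "continuous_on S p'" for S using p(2) continuous_on_subset by blast
  have cg: "continuous_on S g" for S unfolding g_def using R by (intro continuous_intros cp) auto
  have cg': "continuous_on S g'" for S unfolding g'_def using R by (intro continuous_intros cp') auto
  have dg: "(g has_field_derivative g' \<theta>) (at \<theta>)" for \<theta>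
    unfolding g_def g'_def by (intro DERIV_diff has_field_derivative_prof p R)
  define w where "w x = (norm x)\<^sup>2 * p (arg x) + k (norm x) * (u ((R / norm x) *\<^sub>R x) / R\<^sup>2 - p (arg x))" for x
  have "sphere 0 R \<subseteq> ball (0::real^2) \<rho>" using R by auto
  note Cu = C1_on_zero_homogeneous[OF C1 this R(1)]
  have Cp: "C1_on (- {0}) (\<lambda>x. p (arg x))" by (rule C1_on_angular[OF p(1,2) pc])
  have Cw: "C1_on (- {0}) w"
  proof -
    have "C1_on (- {0}) (\<lambda>x::real^2. (norm x)\<^sup>2)"
      by (rule C1_on_radial[of _ "\<lambda>r. 2 * r"]) (auto intro!: derivative_eq_intros continuous_intros)
    moreover have "C1_on (- {0}) (\<lambda>x::real^2. k (norm x))"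
      by (rule C1_on_radial[OF dk]) (auto intro!: continuous_intros continuous_on_subset[OF c\<sigma>])
    moreover have "C1_on (- {0}) (\<lambda>x. u ((R / norm x) *\<^sub>R x) / R\<^sup>2)"
      using C1_on_cmult[OF Cu, of "1 / R\<^sup>2"] by simp
    ultimately show ?thesis unfolding w_def by (intro C1_on_add C1_on_mult C1_on_diff Cp)
  qed
  have W: "w (r *\<^sub>R er \<theta>) = W r \<theta>" if "0 < r" "- pi < \<theta>" "\<theta> < pi" for r \<theta>
    using that by (simp add: w_def W_def g_def arg_polar)
  have Wr: "((\<lambda>r. W r \<theta>) has_field_derivative Wr r \<theta>) (at r)" if "0 < r" for r \<theta>
    unfolding W_def Wr_def by (rule derivative_eq_intros dk[OF that] refl | simp)+
  have Wt: "(W r has_field_derivative r * Wt r \<theta>) (at \<theta>)" if "0 < r" for r \<theta>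
  proof -
    have "((\<lambda>\<theta>. r\<^sup>2 * p \<theta> + k r * g \<theta>) has_field_derivative r\<^sup>2 * p' \<theta> + k r * g' \<theta>) (at \<theta>)"
      by (intro DERIV_add DERIV_cmult p dg)
    then show ?thesis using k\<sigma>[of r] that unfolding W_def Wt_def by (simp add: algebra_simps power2_eq_square)
  qed
  have wb: "\<bar>w x\<bar> \<le> (norm x)\<^sup>2" if x: "x \<noteq> 0" "norm x \<le> R" for x
  proof -
    let ?n = "norm x"
    \<comment> \<open>The convex weight: on every ray the competitor interpolates between p and the
      trace profile, both of which are bounded by 1.\<close>
    define s where "s = (?n / R) powr \<alpha>"
    have s: "0 \<le> s" "s \<le> 1"
      using R \<alpha> x by (auto simp: s_def intro!: powr_le1)
    have k: "k ?n = ?n\<^sup>2 * s"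
      using x R by (simp add: k_def s_def powr_add power_divide)
    define c where "c = u ((R / ?n) *\<^sub>R x) / R\<^sup>2"
    have "\<bar>u ((R / ?n) *\<^sub>R x)\<bar> \<le> (norm ((R / ?n) *\<^sub>R x))\<^sup>2" using x R by (intro bound) auto
    then have c: "\<bar>c\<bar> \<le> 1" using x R by (simp add: c_def)
    have "w x = ?n\<^sup>2 * ((1 - s) * p (arg x) + s * c)" by (simp add: w_def k c_def algebra_simps)
    also have "\<bar>\<dots>\<bar> = ?n\<^sup>2 * \<bar>(1 - s) * p (arg x) + s * c\<bar>" by (simp add: abs_mult)
    also have "\<dots> \<le> ?n\<^sup>2 * ((1 - s) * 1 + s * 1)"
    proof (rule mult_left_mono)
      have "\<bar>(1 - s) * p (arg x) + s * c\<bar> \<le> (1 - s) * \<bar>p (arg x)\<bar> + s * \<bar>c\<bar>"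
        using s abs_triangle_ineq[of "(1 - s) * p (arg x)" "s * c"] by (simp add: abs_mult)
      also have "\<dots> \<le> (1 - s) * 1 + s * 1" using s c p(3) by (intro add_mono mult_left_mono) auto
      finally show "\<bar>(1 - s) * p (arg x) + s * c\<bar> \<le> (1 - s) * 1 + s * 1" .
    qed simp
    finally show ?thesis by simp
  qed
  let ?I = "\<lambda>f. integral {-pi..pi} f"
  define \<Theta> where "\<Theta> r = r * ?I (\<lambda>\<theta>. ur r \<theta> * (Wr r \<theta> - ur r \<theta>) + ut r \<theta> * (Wt r \<theta> - ut r \<theta>))" for r
  \<comment> \<open>The coefficient of \<eta>' in the tested inequality. It vanishes at 0 through
    the factor r and at \<open>R\<close> because w and u share their trace.\<close>
  define \<Xi> where "\<Xi> r = r * ?I (\<lambda>\<theta>. ur r \<theta> * (r\<^sup>2 * p \<theta> + r * \<sigma> r * g \<theta> - u (r *\<^sub>R er \<theta>)))" for r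
  have comp: "continuous_on ({0..R} \<times> T) (\<lambda>x. f (fst x))" if "continuous_on {0..} f" for f :: "real \<Rightarrow> real" and T :: "real set"
    by (rule continuous_on_compose2[OF that]) (auto intro!: continuous_intros)
  have comp': "continuous_on S (\<lambda>x. f (snd x))" if "continuous_on UNIV f" for f :: "real \<Rightarrow> real" and S :: "(real \<times> real) set"
    by (rule continuous_on_compose2[OF that]) (auto intro!: continuous_intros)
  note cint = continuous_intros comp[OF c\<sigma>] comp'[OF cp] comp'[OF cp'] comp'[OF cg] comp'[OF cg']
  have c\<Theta>: "continuous_on {0..R} \<Theta>"
    unfolding \<Theta>_def Wr_def Wt_def using R by (intro continuous_on_mult continuous_on_id continuous_on_integral_param cint) auto
  have c\<Xi>: "continuous_on {0..R} \<Xi>"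
    unfolding \<Xi>_def using R by (intro continuous_on_mult continuous_on_id continuous_on_integral_param cint) auto
  have WK: "W r \<theta> = r\<^sup>2 * p \<theta> + r * \<sigma> r * g \<theta>" if "0 \<le> r" for r \<theta> using k\<sigma>[OF that] by (simp add: W_def)
  have "0 \<le> integral {0..R} \<Theta>"
  proof (rule cutoff_limit[OF R(1) c\<Theta> c\<Xi>])
    show "\<Xi> 0 = 0" by (simp add: \<Xi>_def)
    have "R\<^sup>2 * p \<theta> + R * \<sigma> R * g \<theta> - u (R *\<^sub>R er \<theta>) = 0" for \<theta>
      using R by (simp add: \<sigma>_def g_def algebra_simps power2_eq_square)
    then show "\<Xi> R = 0" by (simp add: \<Xi>_def)
    fix \<eta> \<eta>' :: "real \<Rightarrow> real" and \<epsilon> :: real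
    assume \<eta>: "\<And>r. (\<eta> has_field_derivative \<eta>' r) (at r)" "continuous_on UNIV \<eta>'" "\<And>r. 0 \<le> \<eta> r \<and> \<eta> r \<le> 1"
      "0 < \<epsilon>" "\<And>r. r < \<epsilon> \<or> R - \<epsilon> < r \<Longrightarrow> \<eta> r = 0"
    have "0 \<le> integral {0..R} (\<lambda>r. r * ?I (\<lambda>\<theta>.
      ur r \<theta> * (\<eta>' r * (W r \<theta> - u (r *\<^sub>R er \<theta>)) + \<eta> r * (Wr r \<theta> - ur r \<theta>)) + ut r \<theta> * (\<eta> r * (Wt r \<theta> - ut r \<theta>))))"
      by (rule weak_annulus[OF R Cw wb W Wr Wt \<eta>])
    also have "\<dots> = integral {0..R} (\<lambda>r. \<eta> r * \<Theta> r + \<eta>' r * \<Xi> r)"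
    proof (rule integral_cong)
      fix r assume r: "r \<in> {0..R}"
      have i: "(\<lambda>\<theta>. ur r \<theta> * (Wr r \<theta> - ur r \<theta>) + ut r \<theta> * (Wt r \<theta> - ut r \<theta>)) integrable_on {-pi..pi}"
        "(\<lambda>\<theta>. ur r \<theta> * (r\<^sup>2 * p \<theta> + r * \<sigma> r * g \<theta> - u (r *\<^sub>R er \<theta>))) integrable_on {-pi..pi}"
        unfolding Wr_def Wt_def using r R
        by (intro integrable_continuous_interval continuous_intros cp cp' cg cg'; auto)+
      have "?I (\<lambda>\<theta>. ur r \<theta> * (\<eta>' r * (W r \<theta> - u (r *\<^sub>R er \<theta>)) + \<eta> r * (Wr r \<theta> - ur r \<theta>)) + ut r \<theta> * (\<eta> r * (Wt r \<theta> - ut r \<theta>)))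
        = ?I (\<lambda>\<theta>. \<eta> r * (ur r \<theta> * (Wr r \<theta> - ur r \<theta>) + ut r \<theta> * (Wt r \<theta> - ut r \<theta>))
          + \<eta>' r * (ur r \<theta> * (r\<^sup>2 * p \<theta> + r * \<sigma> r * g \<theta> - u (r *\<^sub>R er \<theta>))))"
        using r by (intro integral_cong) (simp add: WK algebra_simps)
      also have "\<dots> = \<eta> r * ?I (\<lambda>\<theta>. ur r \<theta> * (Wr r \<theta> - ur r \<theta>) + ut r \<theta> * (Wt r \<theta> - ut r \<theta>))
          + \<eta>' r * ?I (\<lambda>\<theta>. ur r \<theta> * (r\<^sup>2 * p \<theta> + r * \<sigma> r * g \<theta> - u (r *\<^sub>R er \<theta>)))"
        by (subst Henstock_Kurzweil_Integration.integral_add) (auto intro!: integrable_on_mult_right i)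
      finally show "r * ?I (\<lambda>\<theta>. ur r \<theta> * (\<eta>' r * (W r \<theta> - u (r *\<^sub>R er \<theta>)) + \<eta> r * (Wr r \<theta> - ur r \<theta>)) + ut r \<theta> * (\<eta> r * (Wt r \<theta> - ut r \<theta>)))
        = \<eta> r * \<Theta> r + \<eta>' r * \<Xi> r"
        unfolding \<Theta>_def \<Xi>_def by (simp only: distrib_left mult.left_commute)
    qed
    finally show "0 \<le> integral {0..R} (\<lambda>r. \<eta> r * \<Theta> r + \<eta>' r * \<Xi> r)" .
  qed
  define K0 where "K0 = ?I (\<lambda>\<theta>. 4 * (p \<theta>)\<^sup>2 + (p' \<theta>)\<^sup>2)"
  define K1 where "K1 = ?I (\<lambda>\<theta>. 2 * (2 + \<alpha>) * (p \<theta> * g \<theta>) + p' \<theta> * g' \<theta>)"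
  define K2 where "K2 = ?I (\<lambda>\<theta>. (2 + \<alpha>)\<^sup>2 * (g \<theta>)\<^sup>2 + (g' \<theta>)\<^sup>2)"
  define Y where "Y r = r * ?I (\<lambda>\<theta>. (ur r \<theta>)\<^sup>2 + (ut r \<theta>)\<^sup>2)" for r
  define X where "X r = r * (r\<^sup>2 * K0 + 2 * (r * \<sigma> r) * K1 + (\<sigma> r)\<^sup>2 * K2)" for r
  have cY: "continuous_on {0..R} Y"
    unfolding Y_def using R by (intro continuous_on_mult continuous_on_id continuous_on_integral_param cint) auto
  have X: "(X has_integral R ^ 4 * (K0 / 4 + 2 * K1 / (4 + \<alpha>) + K2 / (4 + 2 * \<alpha>))) {0..R}"
  proof -
    have "((\<lambda>r. R ^ 3 * (r / R) powr (3 + 0) * K0 + R ^ 3 * (r / R) powr (3 + \<alpha>) * (2 * K1) + R ^ 3 * (r / R) powr (3 + 2 * \<alpha>) * K2)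
      has_integral R ^ 4 / (4 + 0) * K0 + R ^ 4 / (4 + \<alpha>) * (2 * K1) + R ^ 4 / (4 + 2 * \<alpha>) * K2) {0..R}"
      using \<alpha> R by (intro has_integral_add has_integral_mult_left has_integral_powr_moment) auto
    also have "R ^ 4 / (4 + 0) * K0 + R ^ 4 / (4 + \<alpha>) * (2 * K1) + R ^ 4 / (4 + 2 * \<alpha>) * K2
      = R ^ 4 * (K0 / 4 + 2 * K1 / (4 + \<alpha>) + K2 / (4 + 2 * \<alpha>))"
      by (simp add: algebra_simps)
    finally show ?thesis
    proof (rule has_integral_eq[rotated])
      fix r assume r: "r \<in> {0..R}"
      show "R ^ 3 * (r / R) powr (3 + 0) * K0 + R ^ 3 * (r / R) powr (3 + \<alpha>) * (2 * K1) + R ^ 3 * (r / R) powr (3 + 2 * \<alpha>) * K2 = X r"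
      proof (cases "r = 0")
        case False
        define q where "q = (r / R) powr \<alpha>"
        have rR: "r / R > 0" using False r R by simp
        have e1: "(r / R) powr (3 + \<alpha>) = (r / R) ^ 3 * q"
          using rR by (simp add: powr_add q_def)
        have e2: "(r / R) powr (3 + 2 * \<alpha>) = (r / R) ^ 3 * q\<^sup>2"
        proof -
          have "3 + 2 * \<alpha> = 3 + \<alpha> + \<alpha>" by simp
          then have "(r / R) powr (3 + 2 * \<alpha>) = (r / R) powr 3 * q * q" by (simp only: powr_add q_def)
          moreover have "(r / R) powr 3 = (r / R) ^ 3" using rR by simp
          ultimately show ?thesis by (simp only: power2_eq_square mult.assoc)
        qed
        have e3: "(r / R) powr (3 + 0) = (r / R) ^ 3"
          using rR by simp
        have e4: "\<sigma> r = r * q"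
          using rR R r False by (simp add: \<sigma>_def q_def powr_add)
        have e5: "R ^ 3 * (r / R) ^ 3 = r ^ 3" using R by (simp add: power_divide)
        have key: "R ^ 3 * Z * K0 + R ^ 3 * (Z * q) * (2 * K1) + R ^ 3 * (Z * q\<^sup>2) * K2 = (R ^ 3 * Z) * (K0 + 2 * q * K1 + q\<^sup>2 * K2)" for Z
          by algebra
        have e6: "r ^ 3 * (K0 + 2 * q * K1 + q\<^sup>2 * K2) = r * (r\<^sup>2 * K0 + 2 * (r * (r * q)) * K1 + (r * q)\<^sup>2 * K2)"
          by algebra
        show ?thesis unfolding X_def e1 e2 e3 e4 unfolding key unfolding e5 by (rule e6)
      qed (simp add: X_def)
    qed
  qed
  have "integral {0..R} \<Theta> \<le> integral {0..R} (\<lambda>r. (1 / 2) * X r - (1 / 2) * Y r)"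
  proof (rule integral_le)
    show "\<Theta> integrable_on {0..R}" using c\<Theta> by (rule integrable_continuous_interval)
    show "(\<lambda>r. (1 / 2) * X r - (1 / 2) * Y r) integrable_on {0..R}"
      using X cY by (intro integrable_diff integrable_on_mult_right) (auto intro: integrable_continuous_interval)
    fix r assume r: "r \<in> {0..R}"
    have i: "(\<lambda>\<theta>. ur r \<theta> * (Wr r \<theta> - ur r \<theta>) + ut r \<theta> * (Wt r \<theta> - ut r \<theta>)) integrable_on {-pi..pi}"
      "(\<lambda>\<theta>. (Wr r \<theta>)\<^sup>2 + (Wt r \<theta>)\<^sup>2) integrable_on {-pi..pi}" "(\<lambda>\<theta>. (ur r \<theta>)\<^sup>2 + (ut r \<theta>)\<^sup>2) integrable_on {-pi..pi}"
      unfolding Wr_def Wt_def using r R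
      by (intro integrable_continuous_interval continuous_intros cp cp' cg cg'; auto)+
    have "?I (\<lambda>\<theta>. ur r \<theta> * (Wr r \<theta> - ur r \<theta>) + ut r \<theta> * (Wt r \<theta> - ut r \<theta>))
      \<le> ?I (\<lambda>\<theta>. (1 / 2) * ((Wr r \<theta>)\<^sup>2 + (Wt r \<theta>)\<^sup>2) - (1 / 2) * ((ur r \<theta>)\<^sup>2 + (ut r \<theta>)\<^sup>2))"
    proof (intro integral_le integrable_diff integrable_on_mult_right i)
      fix \<theta>
      show "ur r \<theta> * (Wr r \<theta> - ur r \<theta>) + ut r \<theta> * (Wt r \<theta> - ut r \<theta>)
        \<le> (1 / 2) * ((Wr r \<theta>)\<^sup>2 + (Wt r \<theta>)\<^sup>2) - (1 / 2) * ((ur r \<theta>)\<^sup>2 + (ut r \<theta>)\<^sup>2)"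
        using zero_le_power2[of "Wr r \<theta> - ur r \<theta>"] zero_le_power2[of "Wt r \<theta> - ut r \<theta>"]
        by (simp add: power2_eq_square algebra_simps)
    qed
    also have "\<dots> = (1 / 2) * ?I (\<lambda>\<theta>. (Wr r \<theta>)\<^sup>2 + (Wt r \<theta>)\<^sup>2) - (1 / 2) * ?I (\<lambda>\<theta>. (ur r \<theta>)\<^sup>2 + (ut r \<theta>)\<^sup>2)"
      using i by (subst Henstock_Kurzweil_Integration.integral_diff) (auto intro: integrable_on_mult_right)
    also have "?I (\<lambda>\<theta>. (Wr r \<theta>)\<^sup>2 + (Wt r \<theta>)\<^sup>2) = r\<^sup>2 * K0 + 2 * (r * \<sigma> r) * K1 + (\<sigma> r)\<^sup>2 * K2"
    proof -
      have "((\<lambda>\<theta>. r\<^sup>2 * (4 * (p \<theta>)\<^sup>2 + (p' \<theta>)\<^sup>2) + 2 * (r * \<sigma> r) * (2 * (2 + \<alpha>) * (p \<theta> * g \<theta>) + p' \<theta> * g' \<theta>)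
          + (\<sigma> r)\<^sup>2 * ((2 + \<alpha>)\<^sup>2 * (g \<theta>)\<^sup>2 + (g' \<theta>)\<^sup>2)) has_integral r\<^sup>2 * K0 + 2 * (r * \<sigma> r) * K1 + (\<sigma> r)\<^sup>2 * K2) {-pi..pi}"
        unfolding K0_def K1_def K2_def
        by (intro has_integral_add has_integral_mult_right integrable_integral integrable_continuous_interval continuous_intros cp cp' cg cg')
      moreover have "(\<lambda>\<theta>. (Wr r \<theta>)\<^sup>2 + (Wt r \<theta>)\<^sup>2) = (\<lambda>\<theta>. r\<^sup>2 * (4 * (p \<theta>)\<^sup>2 + (p' \<theta>)\<^sup>2) + 2 * (r * \<sigma> r) * (2 * (2 + \<alpha>) * (p \<theta> * g \<theta>) + p' \<theta> * g' \<theta>)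
          + (\<sigma> r)\<^sup>2 * ((2 + \<alpha>)\<^sup>2 * (g \<theta>)\<^sup>2 + (g' \<theta>)\<^sup>2))"
        by (rule ext) (simp add: Wr_def Wt_def power2_eq_square algebra_simps)
      ultimately show ?thesis by (simp add: integral_unique)
    qed
    finally have "?I (\<lambda>\<theta>. ur r \<theta> * (Wr r \<theta> - ur r \<theta>) + ut r \<theta> * (Wt r \<theta> - ut r \<theta>))
      \<le> (1 / 2) * (r\<^sup>2 * K0 + 2 * (r * \<sigma> r) * K1 + (\<sigma> r)\<^sup>2 * K2) - (1 / 2) * ?I (\<lambda>\<theta>. (ur r \<theta>)\<^sup>2 + (ut r \<theta>)\<^sup>2)" .
    from mult_left_mono[OF this, of r] r
    show "\<Theta> r \<le> (1 / 2) * X r - (1 / 2) * Y r" unfolding \<Theta>_def X_def Y_def by (simp add: algebra_simps)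
  qed
  also have "\<dots> = (1 / 2) * integral {0..R} X - (1 / 2) * integral {0..R} Y"
    using X cY by (subst Henstock_Kurzweil_Integration.integral_diff)
      (auto intro!: integrable_on_mult_right intro: integrable_continuous_interval)
  finally have "integral {0..R} Y \<le> integral {0..R} X" using \<open>0 \<le> integral {0..R} \<Theta>\<close> by simp
  also have "integral {0..R} X = R ^ 4 * (K0 / 4 + 2 * K1 / (4 + \<alpha>) + K2 / (4 + 2 * \<alpha>))"
    using X by (rule integral_unique)
  finally show ?thesis unfolding Y_def K0_def K1_def K2_def .
qed

end

section \<open>Decay of the Weiss energy\<close>

context conical_minimizer
begin

section \<open>The Weiss energy and its derivative\<close>

definition dirichlet :: "real \<Rightarrow> real" where
  "dirichlet R = integral {0..R} (\<lambda>r. r * integral {-pi..pi} (\<lambda>\<theta>. (ur r \<theta>)\<^sup>2 + (ut r \<theta>)\<^sup>2))"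

definition trace_norm :: "real \<Rightarrow> real" where
  "trace_norm R = integral {-pi..pi} (\<lambda>\<theta>. (u (R *\<^sub>R er \<theta>))\<^sup>2)"

text \<open>The Weiss energy of the rescalings, normalised to vanish at double cones.\<close>

definition weiss :: "real \<Rightarrow> real" where
  "weiss R = (dirichlet R - 2 * trace_norm R) / R ^ 4 + pi"

text \<open>\<open>flux r \<theta>\<close> is \<open>r\<close> times the radial derivative of \<open>prof r \<theta>\<close>.\<close>

abbreviation flux :: "real \<Rightarrow> real \<Rightarrow> real" where
  "flux r \<theta> \<equiv> ur r \<theta> / r - 2 * u (r *\<^sub>R er \<theta>) / r\<^sup>2"

definition sphere_energy :: "real \<Rightarrow> real" where
  "sphere_energy r = integral {-pi..pi} (\<lambda>\<theta>. (prof' r \<theta>)\<^sup>2 - 4 * (prof r \<theta>)\<^sup>2)"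

definition flux_norm :: "real \<Rightarrow> real" where
  "flux_norm r = integral {-pi..pi} (\<lambda>\<theta>. (flux r \<theta>)\<^sup>2)"

lemma has_field_derivative_dirichlet:
  assumes "0 < r" "r < \<rho>"
  shows "(dirichlet has_field_derivative r * integral {-pi..pi} (\<lambda>\<theta>. (ur r \<theta>)\<^sup>2 + (ut r \<theta>)\<^sup>2)) (at r)"
proof -
  define R where "R = (r + \<rho>) / 2"
  have R: "r < R" "R < \<rho>" using assms by (auto simp: R_def)
  have "continuous_on {0..R} (\<lambda>r. r * integral {-pi..pi} (\<lambda>\<theta>. (ur r \<theta>)\<^sup>2 + (ut r \<theta>)\<^sup>2))"
    using R by (intro continuous_on_mult continuous_on_id continuous_on_integral_param continuous_intros) auto
  from integral_has_real_derivative[OF this, of r]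
  have "(dirichlet has_field_derivative r * integral {-pi..pi} (\<lambda>\<theta>. (ur r \<theta>)\<^sup>2 + (ut r \<theta>)\<^sup>2)) (at r within {0..R})"
    using assms R by (simp add: dirichlet_def[abs_def])
  then show ?thesis using assms R by (simp add: at_within_Icc_at)
qed

lemma has_field_derivative_trace_norm:
  assumes "0 < r" "r < \<rho>"
  shows "(trace_norm has_field_derivative integral {-pi..pi} (\<lambda>\<theta>. 2 * (u (r *\<^sub>R er \<theta>) * ur r \<theta>))) (at r)"
proof -
  have "((\<lambda>R. integral (cbox (-pi) pi) (\<lambda>\<theta>. (u (R *\<^sub>R er \<theta>))\<^sup>2)) has_field_derivative
      integral (cbox (-pi) pi) (\<lambda>\<theta>. 2 * (u (r *\<^sub>R er \<theta>) * ur r \<theta>))) (at r within {0<..<\<rho>})"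
  proof (rule leibniz_rule_field_derivative)
    fix s \<theta> assume s: "s \<in> {0<..<\<rho>}"
    have "((\<lambda>s. u (s *\<^sub>R er \<theta>)) has_field_derivative ur s \<theta>) (at s within {0<..<\<rho>})"
      by (intro has_field_derivative_along_ray differentiable_polar) (use s in auto)
    then show "((\<lambda>s. (u (s *\<^sub>R er \<theta>))\<^sup>2) has_field_derivative 2 * (u (s *\<^sub>R er \<theta>) * ur s \<theta>)) (at s within {0<..<\<rho>})"
      by (auto intro!: derivative_eq_intros)
    show "(\<lambda>\<theta>. (u (s *\<^sub>R er \<theta>))\<^sup>2) integrable_on cbox (- pi) pi"
      by (intro integrable_continuous continuous_intros) (use s in auto)
  next
    show "continuous_on ({0<..<\<rho>} \<times> cbox (- pi) pi) (\<lambda>(x, t). 2 * (u (x *\<^sub>R er t) * ur x t))"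
      unfolding split_beta by (intro continuous_intros) auto
  qed (use assms in auto)
  then show ?thesis using assms by (simp add: trace_norm_def[abs_def] at_within_open[of r "{0<..<\<rho>}"])
qed

text \<open>Completing the square: the radial part of the Dirichlet density and the derivative of
  the trace term combine to the square of the flux, and the energy of the profile on the unit circle
  is left over.\<close>

lemma has_field_derivative_weiss:
  assumes r: "0 < r" "r < \<rho>"
  shows "(weiss has_field_derivative (4 * pi + sphere_energy r + flux_norm r - 4 * weiss r) / r) (at r)"
proof -
  let ?y = "r * integral {-pi..pi} (\<lambda>\<theta>. (ur r \<theta>)\<^sup>2 + (ut r \<theta>)\<^sup>2)"
  let ?h = "integral {-pi..pi} (\<lambda>\<theta>. 2 * (u (r *\<^sub>R er \<theta>) * ur r \<theta>))"
  let ?Z = "dirichlet r - 2 * trace_norm r"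
  have "((\<lambda>R. (dirichlet R - 2 * trace_norm R) / R ^ 4 + pi) has_field_derivative
      ((?y - 2 * ?h) * r ^ 4 - ?Z * (4 * r ^ 3)) / (r ^ 4 * r ^ 4) + 0) (at r)"
    by (intro DERIV_add DERIV_divide DERIV_diff DERIV_cmult has_field_derivative_dirichlet has_field_derivative_trace_norm r)
       (use r in \<open>auto intro!: derivative_eq_intros\<close>)
  moreover have "((?y - 2 * ?h) * r ^ 4 - ?Z * (4 * r ^ 3)) / (r ^ 4 * r ^ 4) + 0 = (4 * pi + (?y - 2 * ?h) / r ^ 3 - 4 * weiss r) / r"
    using r by (simp add: weiss_def field_simps power4_eq_xxxx power3_eq_cube)
  moreover have "(?y - 2 * ?h) / r ^ 3 = sphere_energy r + flux_norm r"
  proof -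
    have i: "(\<lambda>\<theta>. (ur r \<theta>)\<^sup>2 + (ut r \<theta>)\<^sup>2) integrable_on {-pi..pi}"
      "(\<lambda>\<theta>. 2 * (u (r *\<^sub>R er \<theta>) * ur r \<theta>)) integrable_on {-pi..pi}"
      "(\<lambda>\<theta>. (prof' r \<theta>)\<^sup>2 - 4 * (prof r \<theta>)\<^sup>2) integrable_on {-pi..pi}"
      "(\<lambda>\<theta>. (flux r \<theta>)\<^sup>2) integrable_on {-pi..pi}"
      by (intro integrable_continuous_interval continuous_intros; use r in auto)+
    have "((\<lambda>\<theta>. (r * ((ur r \<theta>)\<^sup>2 + (ut r \<theta>)\<^sup>2) - 2 * (2 * (u (r *\<^sub>R er \<theta>) * ur r \<theta>))) / r ^ 3) has_integral (?y - 2 * ?h) / r ^ 3) {-pi..pi}"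
      by (intro has_integral_divide has_integral_diff has_integral_mult_right integrable_integral i)
    moreover have "((\<lambda>\<theta>. ((prof' r \<theta>)\<^sup>2 - 4 * (prof r \<theta>)\<^sup>2) + (flux r \<theta>)\<^sup>2) has_integral sphere_energy r + flux_norm r) {-pi..pi}"
      unfolding sphere_energy_def flux_norm_def by (intro has_integral_add integrable_integral i)
    moreover have "(r * (a\<^sup>2 + b\<^sup>2) - 2 * (2 * (c * a))) / r ^ 3 = ((b / r)\<^sup>2 - 4 * (c / r\<^sup>2)\<^sup>2) + (a / r - 2 * c / r\<^sup>2)\<^sup>2" for a b c
      using r(1) by (simp add: field_simps power2_eq_square power3_eq_cube)
    ultimately show ?thesis by (simp only:) (rule has_integral_unique)
  qed
  ultimately show ?thesis by (simp add: weiss_def[abs_def] algebra_simps)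
qed

text \<open>Expansion about a cone profile: the constant terms cancel by
  \<open>cone_profile_energy\<close>, \<open>A\<close> collects the linear and \<open>Q\<close> the
  quadratic terms, and \<alpha>^2 N is the price for leaving degree 2. The gain lies in the
  denominators 4 + \<alpha> and 4 + 2 \<alpha> in place of 4.\<close>

lemma weiss_comparison:
  assumes R: "0 < R" "R < \<rho>" and \<alpha>: "0 \<le> \<alpha>" and ab: "separated l a b"
  defines "A \<equiv> integral {-pi..pi} (\<lambda>x. cone_profile' a b x * (prof' R x - cone_profile' a b x) - 4 * cone_profile a b x * (prof R x - cone_profile a b x))"
    and "Q \<equiv> integral {-pi..pi} (\<lambda>x. (prof' R x - cone_profile' a b x)\<^sup>2 - 4 * (prof R x - cone_profile a b x)\<^sup>2)"
    and "N \<equiv> integral {-pi..pi} (\<lambda>x. (prof R x - cone_profile a b x)\<^sup>2)"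
  shows "weiss R \<le> 2 * A / (4 + \<alpha>) + (Q + \<alpha>\<^sup>2 * N) / (4 + 2 * \<alpha>)" "sphere_energy R + 4 * pi = 2 * A + Q"
proof -
  let ?I = "\<lambda>f. integral {-pi..pi} f"
  define p where "p = cone_profile a b"
  define p' where "p' = cone_profile' a b"
  define g where "g \<theta> = prof R \<theta> - p \<theta>" for \<theta>
  define g' where "g' \<theta> = prof' R \<theta> - p' \<theta>" for \<theta>
  have s: "0 < l" "- pi + l \<le> a - pi / 4" "a + pi / 4 + 2 * l \<le> b - pi / 4" "b + pi / 4 \<le> pi - l"
    using ab by (auto simp: separated_def)
  have c: "continuous_on S p" "continuous_on S p'" for S
    by (auto simp: p_def p'_def intro: continuous_on_cone_profile continuous_on_cone_profile')
  have cg: "continuous_on S g" "continuous_on S g'" for S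
    unfolding g_def g'_def using R by (intro continuous_intros c; auto)+
  define P2 P2' PG PG' G2 G2' where "P2 = ?I (\<lambda>\<theta>. (p \<theta>)\<^sup>2)" and "P2' = ?I (\<lambda>\<theta>. (p' \<theta>)\<^sup>2)"
    and "PG = ?I (\<lambda>\<theta>. p \<theta> * g \<theta>)" and "PG' = ?I (\<lambda>\<theta>. p' \<theta> * g' \<theta>)"
    and "G2 = ?I (\<lambda>\<theta>. (g \<theta>)\<^sup>2)" and "G2' = ?I (\<lambda>\<theta>. (g' \<theta>)\<^sup>2)"
  have i: "((\<lambda>\<theta>. (p \<theta>)\<^sup>2) has_integral P2) {-pi..pi}" "((\<lambda>\<theta>. (p' \<theta>)\<^sup>2) has_integral P2') {-pi..pi}"
    "((\<lambda>\<theta>. p \<theta> * g \<theta>) has_integral PG) {-pi..pi}" "((\<lambda>\<theta>. p' \<theta> * g' \<theta>) has_integral PG') {-pi..pi}"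
    "((\<lambda>\<theta>. (g \<theta>)\<^sup>2) has_integral G2) {-pi..pi}" "((\<lambda>\<theta>. (g' \<theta>)\<^sup>2) has_integral G2') {-pi..pi}"
    unfolding P2_def P2'_def PG_def PG'_def G2_def G2'_def
    by (intro integrable_integral integrable_continuous_interval continuous_intros c cg)+
  have "P2' - 4 * P2 = - 4 * pi"
  proof -
    have "((\<lambda>\<theta>. (p' \<theta>)\<^sup>2 - 4 * (p \<theta>)\<^sup>2) has_integral P2' - 4 * P2) {-pi..pi}"
      by (intro has_integral_diff has_integral_mult_right i)
    then show ?thesis using cone_profile_energy[OF ab] by (simp add: p_def p'_def integral_unique)
  qed
  note energy = this
  have "((\<lambda>\<theta>. p' \<theta> * g' \<theta> - 4 * (p \<theta> * g \<theta>)) has_integral PG' - 4 * PG) {-pi..pi}"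
    by (intro has_integral_diff has_integral_mult_right i)
  then have A: "A = PG' - 4 * PG"
    unfolding A_def p_def p'_def g_def g'_def by (simp add: integral_unique mult.assoc)
  have "((\<lambda>\<theta>. (g' \<theta>)\<^sup>2 - 4 * (g \<theta>)\<^sup>2) has_integral G2' - 4 * G2) {-pi..pi}"
    by (intro has_integral_diff has_integral_mult_right i)
  then have Q: "Q = G2' - 4 * G2"
    unfolding Q_def p_def p'_def g_def g'_def by (simp add: integral_unique)
  have N: "N = G2" by (simp add: N_def G2_def g_def p_def)
  have prof: "prof R \<theta> = p \<theta> + g \<theta>" "prof' R \<theta> = p' \<theta> + g' \<theta>" for \<theta> by (simp_all add: g_def g'_def)
  have "((\<lambda>\<theta>. ((p' \<theta>)\<^sup>2 + 2 * (p' \<theta> * g' \<theta>) + (g' \<theta>)\<^sup>2) - 4 * ((p \<theta>)\<^sup>2 + 2 * (p \<theta> * g \<theta>) + (g \<theta>)\<^sup>2)) has_integral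
      (P2' + 2 * PG' + G2') - 4 * (P2 + 2 * PG + G2)) {-pi..pi}"
    by (intro has_integral_add has_integral_diff has_integral_mult_right i)
  moreover have "(\<lambda>\<theta>. ((p' \<theta>)\<^sup>2 + 2 * (p' \<theta> * g' \<theta>) + (g' \<theta>)\<^sup>2) - 4 * ((p \<theta>)\<^sup>2 + 2 * (p \<theta> * g \<theta>) + (g \<theta>)\<^sup>2))
     = (\<lambda>\<theta>. (prof' R \<theta>)\<^sup>2 - 4 * (prof R \<theta>)\<^sup>2)"
    unfolding prof by (simp add: power2_eq_square algebra_simps)
  ultimately have "sphere_energy R = (P2' + 2 * PG' + G2') - 4 * (P2 + 2 * PG + G2)"
    by (simp add: sphere_energy_def integral_unique)
  then show "sphere_energy R + 4 * pi = 2 * A + Q" using energy by (simp add: A Q)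
  have T: "trace_norm R = R ^ 4 * (P2 + 2 * PG + G2)"
  proof -
    have "((\<lambda>\<theta>. R ^ 4 * ((p \<theta>)\<^sup>2 + 2 * (p \<theta> * g \<theta>) + (g \<theta>)\<^sup>2)) has_integral R ^ 4 * (P2 + 2 * PG + G2)) {-pi..pi}"
      by (intro has_integral_add has_integral_mult_right i)
    moreover have "R ^ 4 * ((p \<theta>)\<^sup>2 + 2 * (p \<theta> * g \<theta>) + (g \<theta>)\<^sup>2) = (u (R *\<^sub>R er \<theta>))\<^sup>2" for \<theta>
    proof -
      have "u (R *\<^sub>R er \<theta>) = R\<^sup>2 * (p \<theta> + g \<theta>)" using R by (simp flip: prof)
      then show ?thesis by (simp add: power2_eq_square power4_eq_xxxx algebra_simps)
    qed
    ultimately show ?thesis by (simp add: trace_norm_def integral_unique)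
  qed
  have "dirichlet R \<le> R ^ 4 * (?I (\<lambda>\<theta>. 4 * (p \<theta>)\<^sup>2 + (p' \<theta>)\<^sup>2) / 4
      + 2 * ?I (\<lambda>\<theta>. 2 * (2 + \<alpha>) * (p \<theta> * g \<theta>) + p' \<theta> * g' \<theta>) / (4 + \<alpha>)
      + ?I (\<lambda>\<theta>. (2 + \<alpha>)\<^sup>2 * (g \<theta>)\<^sup>2 + (g' \<theta>)\<^sup>2) / (4 + 2 * \<alpha>))"
    unfolding dirichlet_def g_def g'_def
  proof (rule competitor[OF R \<alpha>, where ?\<theta>0.0 = "pi - l" and ?c0.0 = "- 1"])
    show "(p has_field_derivative p' \<theta>) (at \<theta>)" for \<theta> unfolding p_def p'_def by (rule has_field_derivative_cone_profile)
    show "\<bar>p \<theta>\<bar> \<le> 1" for \<theta> unfolding p_def by (rule abs_cone_profile_le[OF ab])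
    show "p \<theta> = - 1" if "pi - l \<le> \<bar>\<theta>\<bar>" "\<bar>\<theta>\<bar> \<le> pi" for \<theta>
    proof -
      have "\<theta> \<le> a - pi / 4 \<or> b + pi / 4 \<le> \<theta>" using that s by linarith
      then show ?thesis using cone_profile_pieces(1,3)[OF ab] by (auto simp: p_def)
    qed
    have "pi / 4 > 0" by simp
    then show "0 \<le> pi - l" using s by linarith
  qed (use s in \<open>auto intro: c\<close>)
  also have "?I (\<lambda>\<theta>. 4 * (p \<theta>)\<^sup>2 + (p' \<theta>)\<^sup>2) = 4 * P2 + P2'"
    by (intro integral_unique has_integral_add has_integral_mult_right i)
  also have "?I (\<lambda>\<theta>. 2 * (2 + \<alpha>) * (p \<theta> * g \<theta>) + p' \<theta> * g' \<theta>) = 2 * (2 + \<alpha>) * PG + PG'"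
    by (intro integral_unique has_integral_add has_integral_mult_right i)
  also have "?I (\<lambda>\<theta>. (2 + \<alpha>)\<^sup>2 * (g \<theta>)\<^sup>2 + (g' \<theta>)\<^sup>2) = (2 + \<alpha>)\<^sup>2 * G2 + G2'"
    by (intro integral_unique has_integral_add has_integral_mult_right i)
  finally have "dirichlet R / R ^ 4 \<le> (4 * P2 + P2') / 4 + 2 * (2 * (2 + \<alpha>) * PG + PG') / (4 + \<alpha>) + ((2 + \<alpha>)\<^sup>2 * G2 + G2') / (4 + 2 * \<alpha>)"
    using R by (simp add: pos_divide_le_eq mult.commute)
  moreover have "weiss R = dirichlet R / R ^ 4 - 2 * (P2 + 2 * PG + G2) + pi"
    using R by (simp add: weiss_def T diff_divide_distrib)
  moreover have "2 * (2 * (2 + \<alpha>) * PG + PG') / (4 + \<alpha>) - 4 * PG = 2 * A / (4 + \<alpha>)"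
    using \<alpha> by (simp add: A field_simps)
  moreover have "((2 + \<alpha>)\<^sup>2 * G2 + G2') / (4 + 2 * \<alpha>) - 2 * G2 = (Q + \<alpha>\<^sup>2 * N) / (4 + 2 * \<alpha>)"
    using \<alpha> by (simp add: Q N field_simps power2_eq_square)
  ultimately show "weiss R \<le> 2 * A / (4 + \<alpha>) + (Q + \<alpha>\<^sup>2 * N) / (4 + 2 * \<alpha>)"
    using energy by (simp add: add_divide_distrib)
qed

lemma flux_norm_nonneg:
  assumes "0 < r" "r < \<rho>"
  shows "0 \<le> flux_norm r"
  unfolding flux_norm_def
  by (intro integral_nonneg integrable_continuous_interval continuous_intros) (use assms in auto)

text \<open>The case \<alpha> = 0, where the competitor is the extension of the trace of degree
  2.\<close>

lemma weiss_le_sphere_energy: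
  assumes "0 < R" "R < \<rho>" "separated l a b"
  shows "4 * weiss R \<le> sphere_energy R + 4 * pi"
  using weiss_comparison[OF assms(1,2) order_refl assms(3)] by simp

text \<open>r times the derivative of the Weiss energy is the comparison deficit plus the squared
  norm of the flux, both nonnegative.\<close>

lemma weiss_mono:
  assumes "0 < r" "r \<le> R" "R < \<rho>" "separated l a b"
  shows "weiss r \<le> weiss R"
proof (rule DERIV_nonneg_imp_nondecreasing[OF assms(2)])
  fix s assume "r \<le> s" "s \<le> R"
  then have s: "0 < s" "s < \<rho>" using assms by auto
  have "0 \<le> (4 * pi + sphere_energy s + flux_norm s - 4 * weiss s) / s"
    using weiss_le_sphere_energy[OF s assms(4)] flux_norm_nonneg[OF s] s by simp
  then show "\<exists>y. (weiss has_field_derivative y) (at s) \<and> 0 \<le> y"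
    using has_field_derivative_weiss[OF s] by blast
qed

text \<open>After multiplication by 4 + \<alpha> / 2 the bound of \<open>weiss_comparison\<close>
  falls short of 2 A + Q by \<alpha> / (4 + 2 \<alpha>) times A (1 + \<alpha> / (4 + \<alpha>)) +
  3/2 Q - (4 + \<alpha> / 2) \<alpha> N. This is the origin of the weights in \<open>sel\<close>,
  where 5 stands for an upper bound of 4 + \<alpha> / 2.\<close>

lemma epiperimetric:
  assumes R: "0 < R" "R < \<rho>" and ab: "separated l a b" and \<alpha>: "0 < \<alpha>" "\<alpha> \<le> 1"
    and sel: "5 * \<alpha> * integral {-pi..pi} (\<lambda>x. (prof R x - cone_profile a b x)\<^sup>2)
        \<le> integral {-pi..pi} (\<lambda>x. cone_profile' a b x * (prof' R x - cone_profile' a b x) - 4 * cone_profile a b x * (prof R x - cone_profile a b x))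
          + 3 / 2 * integral {-pi..pi} (\<lambda>x. (prof' R x - cone_profile' a b x)\<^sup>2 - 4 * (prof R x - cone_profile a b x)\<^sup>2)"
  shows "(4 + \<alpha> / 2) * weiss R \<le> sphere_energy R + 4 * pi"
proof -
  define A where "A = integral {-pi..pi} (\<lambda>x. cone_profile' a b x * (prof' R x - cone_profile' a b x) - 4 * cone_profile a b x * (prof R x - cone_profile a b x))"
  define Q where "Q = integral {-pi..pi} (\<lambda>x. (prof' R x - cone_profile' a b x)\<^sup>2 - 4 * (prof R x - cone_profile a b x)\<^sup>2)"
  define N where "N = integral {-pi..pi} (\<lambda>x. (prof R x - cone_profile a b x)\<^sup>2)"
  have "0 \<le> A" unfolding A_def
    by (rule cone_profile_first_variation_nonneg[OF ab has_field_derivative_prof[OF R] continuous_on_prof'[OF R] abs_prof_le[OF R]])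
  have "0 \<le> N" unfolding N_def
    by (intro integral_nonneg integrable_continuous_interval continuous_intros continuous_on_cone_profile) (use R in auto)
  note cmp = weiss_comparison[OF R less_imp_le[OF \<alpha>(1)] ab, folded A_def Q_def N_def]
  have "(4 + \<alpha> / 2) * weiss R \<le> (4 + \<alpha> / 2) * (2 * A / (4 + \<alpha>) + (Q + \<alpha>\<^sup>2 * N) / (4 + 2 * \<alpha>))"
    using cmp(1) \<alpha> by (intro mult_left_mono) auto
  also have "\<dots> = 2 * A + Q - \<alpha> / (4 + 2 * \<alpha>) * (A * (1 + \<alpha> / (4 + \<alpha>)) + 3 / 2 * Q - (4 + \<alpha> / 2) * \<alpha> * N)"
  proof -
    have "4 + \<alpha> \<noteq> 0" "4 + 2 * \<alpha> \<noteq> 0" using \<alpha> by auto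
    then show ?thesis by (simp add: divide_simps) algebra
  qed
  also have "\<dots> \<le> 2 * A + Q"
  proof -
    have "A \<le> A * (1 + \<alpha> / (4 + \<alpha>))" using \<open>0 \<le> A\<close> \<alpha> by (simp add: distrib_left)
    moreover have "(4 + \<alpha> / 2) * \<alpha> * N \<le> 5 * \<alpha> * N" using \<open>0 \<le> N\<close> \<alpha> by (intro mult_right_mono) auto
    ultimately have "0 \<le> A * (1 + \<alpha> / (4 + \<alpha>)) + 3 / 2 * Q - (4 + \<alpha> / 2) * \<alpha> * N"
      using sel unfolding A_def[symmetric] Q_def[symmetric] N_def[symmetric] by linarith
    then show ?thesis using \<alpha> by simp
  qed
  finally show ?thesis using cmp(2) by simp
qed

text \<open>Cauchy--Schwarz for the radial derivative, with the weight \<open>r\<^sup>-\<^sup>\<beta>\<^sup>-\<^sup>1\<close> that makes the differential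
  inequality for the Weiss energy exact.\<close>

lemma prof_distance_le:
  assumes r: "0 < r1" "r1 < r2" "r2 < \<rho>" and \<beta>: "0 < \<beta>" and nonneg: "0 \<le> weiss r1"
    and epi: "\<And>r. r1 \<le> r \<Longrightarrow> r \<le> r2 \<Longrightarrow> (4 + \<beta>) * weiss r \<le> sphere_energy r + 4 * pi"
  shows "integral {-pi..pi} (\<lambda>\<theta>. (prof r2 \<theta> - prof r1 \<theta>)\<^sup>2) \<le> weiss r2 / \<beta>"
proof -
  define k where "k r = r powr (- \<beta> - 1) * flux_norm r" for r
  define b where "b r = r powr (- \<beta>) * weiss r" for r
  have cv: "continuous_on {r1..r2} flux_norm"
    unfolding flux_norm_def[abs_def] using r by (intro continuous_on_integral_param continuous_intros) auto
  have ck: "continuous_on {r1..r2} k"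
    unfolding k_def using r by (intro continuous_intros cv) auto
  have db: "(b has_field_derivative r powr (- \<beta> - 1) * (4 * pi + sphere_energy r + flux_norm r - (4 + \<beta>) * weiss r)) (at r)"
    if "r1 \<le> r" "r \<le> r2" for r
  proof -
    have r': "0 < r" "r < \<rho>" using that r by auto
    have "(b has_field_derivative (- \<beta> * r powr (- \<beta> - 1)) * weiss r + (4 * pi + sphere_energy r + flux_norm r - 4 * weiss r) / r * r powr (- \<beta>)) (at r)"
      unfolding b_def by (intro DERIV_mult has_real_derivative_powr has_field_derivative_weiss r')
    also have "r powr (- \<beta>) = r * r powr (- \<beta> - 1)" using r' by (simp add: powr_mult_base)
    also have "(- \<beta> * X) * w + (s - 4 * w) / r * (r * X) = X * (s - (4 + \<beta>) * w)" for X w s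
    proof -
      have "(s - 4 * w) / r * (r * X) = (s - 4 * w) * X" using r' by simp
      then show ?thesis by (simp add: algebra_simps)
    qed
    finally show ?thesis .
  qed
  \<comment> \<open>The hypothesis \<open>epi\<close> makes the derivative of \<open>b\<close> at
    least \<open>k\<close>; afterwards \<open>b r1\<close> is discarded because the Weiss energy at
    \<open>r1\<close> is nonnegative.\<close>
  have Ik: "integral {r1..r2} k \<le> b r2 - b r1"
  proof -
    define \<Phi> where "\<Phi> r = integral {r1..r} k" for r
    have d\<Phi>: "(\<Phi> has_field_derivative k r) (at r within {r1..r2})" if "r \<in> {r1..r2}" for r
      unfolding \<Phi>_def by (rule integral_has_real_derivative[OF ck that])
    have "b r1 - \<Phi> r1 \<le> b r2 - \<Phi> r2"
    proof (rule DERIV_nonneg_imp_increasing_open[OF less_imp_le[OF r(2)]])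
      fix s assume s: "r1 < s" "s < r2"
      then have "(\<Phi> has_field_derivative k s) (at s)" using d\<Phi>[of s] by (simp add: at_within_Icc_at)
      from DERIV_diff[OF db this]
      have "((\<lambda>r. b r - \<Phi> r) has_field_derivative s powr (- \<beta> - 1) * (4 * pi + sphere_energy s + flux_norm s - (4 + \<beta>) * weiss s) - k s) (at s)"
        using s by simp
      moreover have "s powr (- \<beta> - 1) * (4 * pi + sphere_energy s + flux_norm s - (4 + \<beta>) * weiss s) - k s
        = s powr (- \<beta> - 1) * (4 * pi + sphere_energy s - (4 + \<beta>) * weiss s)"
        by (simp add: k_def algebra_simps)
      moreover have "0 \<le> s powr (- \<beta> - 1) * (4 * pi + sphere_energy s - (4 + \<beta>) * weiss s)"
        using epi[of s] s by (intro mult_nonneg_nonneg) auto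
      ultimately show "\<exists>y. ((\<lambda>r. b r - \<Phi> r) has_field_derivative y) (at s) \<and> 0 \<le> y" by metis
    next
      have "continuous_on {r1..r2} b"
        using db by (intro continuous_at_imp_continuous_on ballI DERIV_isCont) auto
      then show "continuous_on {r1..r2} (\<lambda>r. b r - \<Phi> r)"
        by (intro continuous_intros DERIV_continuous_on[OF d\<Phi>])
    qed
    then show ?thesis by (simp add: \<Phi>_def)
  qed
  also have "\<dots> \<le> r2 powr (- \<beta>) * weiss r2" using nonneg by (simp add: b_def)
  finally have Ik: "integral {r1..r2} k \<le> r2 powr (- \<beta>) * weiss r2" .
  have Iw: "((\<lambda>r. r powr (\<beta> - 1)) has_integral r2 powr \<beta> / \<beta> - r1 powr \<beta> / \<beta>) {r1..r2}"
  proof (rule has_integral_FTC)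
    fix s assume "s \<in> {r1..r2}"
    then have "s > 0" using r by simp
    from DERIV_cdivide[OF has_real_derivative_powr[OF this, of \<beta>], of \<beta>]
    show "((\<lambda>r. r powr \<beta> / \<beta>) has_field_derivative s powr (\<beta> - 1)) (at s)" using \<beta> by simp
  qed (use r in simp)
  have pw: "r1 powr \<beta> < r2 powr \<beta>" using r \<beta> by (intro powr_less_mono2) auto
  define m where "m \<theta> = integral {r1..r2} (\<lambda>r. r powr (- \<beta> - 1) * (flux r \<theta>)\<^sup>2)" for \<theta>
  have cint2: "continuous_on ({r1..r2} \<times> {-pi..pi}) (\<lambda>x. fst x powr (- \<beta> - 1) * (flux (fst x) (snd x))\<^sup>2)"
    using r by (intro continuous_intros) auto
  have pointwise: "(prof r2 \<theta> - prof r1 \<theta>)\<^sup>2 \<le> m \<theta> * (r2 powr \<beta> / \<beta>)" for \<theta>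
  proof -
    have "((\<lambda>r. flux r \<theta> / r) has_integral prof r2 \<theta> - prof r1 \<theta>) {r1..r2}"
    proof (rule has_integral_FTC)
      fix s assume s: "s \<in> {r1..r2}"
      have "((\<lambda>s. u (s *\<^sub>R er \<theta>)) has_field_derivative ur s \<theta>) (at s)"
        by (intro has_field_derivative_along_ray differentiable_polar) (use s r in auto)
      then have "((\<lambda>s. u (s *\<^sub>R er \<theta>) / s\<^sup>2) has_field_derivative (ur s \<theta> * s\<^sup>2 - u (s *\<^sub>R er \<theta>) * (2 * s)) / (s\<^sup>2 * s\<^sup>2)) (at s)"
        using s r by (auto intro!: derivative_eq_intros)
      then show "((\<lambda>r. prof r \<theta>) has_field_derivative flux s \<theta> / s) (at s)"
        by (rule DERIV_cong) (use s r in \<open>simp add: field_simps power2_eq_square\<close>)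
    qed (use r in simp)
    then have "prof r2 \<theta> - prof r1 \<theta> = integral {r1..r2} (\<lambda>r. flux r \<theta> / r)" by (simp add: integral_unique)
    \<comment> \<open>The factor 1 / r is split so that the square of one part is the weight in
      \<open>k\<close>, while the square of the other, r^(\<beta> - 1), has integral at most
      r2^\<beta> / \<beta>.\<close>
    also have "\<dots> = integral {r1..r2} (\<lambda>r. (r powr ((- \<beta> - 1) / 2) * flux r \<theta>) * r powr ((\<beta> - 1) / 2))"
    proof (rule integral_cong)
      fix s assume "s \<in> {r1..r2}"
      then have "s > 0" using r by simp
      have "(- \<beta> - 1) / 2 + (\<beta> - 1) / 2 = - 1" by (simp add: field_simps)
      then have "s powr ((- \<beta> - 1) / 2) * s powr ((\<beta> - 1) / 2) = s powr (- 1)"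
        by (simp only: powr_add[symmetric])
      also have "\<dots> = 1 / s" using \<open>s > 0\<close> by (simp add: powr_minus_divide)
      finally have "F / s = (s powr ((- \<beta> - 1) / 2) * s powr ((\<beta> - 1) / 2)) * F" for F by simp
      also have "(A * B) * F = (A * F) * B" for A B F :: real by simp
      finally show "flux s \<theta> / s = (s powr ((- \<beta> - 1) / 2) * flux s \<theta>) * s powr ((\<beta> - 1) / 2)" .
    qed
    finally have "(prof r2 \<theta> - prof r1 \<theta>)\<^sup>2 = (integral {r1..r2} (\<lambda>r. (r powr ((- \<beta> - 1) / 2) * flux r \<theta>) * r powr ((\<beta> - 1) / 2)))\<^sup>2"
      by simp
    also have "\<dots> \<le> integral {r1..r2} (\<lambda>r. (r powr ((- \<beta> - 1) / 2) * flux r \<theta>)\<^sup>2) * integral {r1..r2} (\<lambda>r. (r powr ((\<beta> - 1) / 2))\<^sup>2)"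
    proof (rule integral_Cauchy_Schwarz)
      have "integral {r1..r2} (\<lambda>r. (r powr ((\<beta> - 1) / 2))\<^sup>2) = r2 powr \<beta> / \<beta> - r1 powr \<beta> / \<beta>"
        using Iw by (simp add: power2_eq_square integral_unique flip: powr_add)
      then show "0 < integral {r1..r2} (\<lambda>r. (r powr ((\<beta> - 1) / 2))\<^sup>2)"
        using pw \<beta> by (simp flip: diff_divide_distrib)
    qed (use r in \<open>auto intro!: continuous_intros\<close>)
    also have "integral {r1..r2} (\<lambda>r. (r powr ((\<beta> - 1) / 2))\<^sup>2) = r2 powr \<beta> / \<beta> - r1 powr \<beta> / \<beta>"
      using Iw by (simp add: power2_eq_square integral_unique flip: powr_add)
    also have "integral {r1..r2} (\<lambda>r. (r powr ((- \<beta> - 1) / 2) * flux r \<theta>)\<^sup>2) = m \<theta>"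
    proof -
      have "(s powr ((- \<beta> - 1) / 2))\<^sup>2 = s powr (- \<beta> - 1)" for s
        by (simp add: power2_eq_square flip: powr_add)
      then show ?thesis by (simp add: m_def power_mult_distrib)
    qed
    also have "m \<theta> * (r2 powr \<beta> / \<beta> - r1 powr \<beta> / \<beta>) \<le> m \<theta> * (r2 powr \<beta> / \<beta>)"
    proof (rule mult_left_mono)
      show "0 \<le> m \<theta>" unfolding m_def
        by (intro integral_nonneg integrable_continuous_interval continuous_intros) (use r in auto)
    qed (use \<beta> in simp)
    finally show ?thesis .
  qed
  \<comment> \<open>Exchanging the integrals turns the pointwise bounds, integrated over the angle,
    into the flux norm that the Weiss energy controls.\<close>
  have swap: "integral {-pi..pi} m = integral {r1..r2} k"
  proof -
    have "integral {r1..r2} (\<lambda>r. integral {-pi..pi} (\<lambda>\<theta>. r powr (- \<beta> - 1) * (flux r \<theta>)\<^sup>2)) = integral {-pi..pi} m"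
      unfolding m_def using cint2
      by (subst integral_swap_continuous[of r1 "-pi" r2 pi, simplified]) (auto simp: split_beta cbox_Pair_eq)
    then show ?thesis by (simp add: k_def[abs_def] flux_norm_def)
  qed
  have cm: "continuous_on {-pi..pi} m"
    unfolding m_def using r by (intro continuous_on_integral_param continuous_intros) auto
  have "integral {-pi..pi} (\<lambda>\<theta>. (prof r2 \<theta> - prof r1 \<theta>)\<^sup>2) \<le> integral {-pi..pi} (\<lambda>\<theta>. m \<theta> * (r2 powr \<beta> / \<beta>))"
    by (intro integral_le integrable_continuous_interval continuous_intros cm pointwise) (use r in auto)
  also have "\<dots> = integral {r1..r2} k * (r2 powr \<beta> / \<beta>)" by (simp add: swap)
  also have "\<dots> \<le> (r2 powr (- \<beta>) * weiss r2) * (r2 powr \<beta> / \<beta>)"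
    using Ik \<beta> by (intro mult_right_mono) auto
  also have "\<dots> = weiss r2 / \<beta>"
  proof -
    have "r2 powr (- \<beta>) * r2 powr \<beta> = 1" using r by (simp flip: powr_add)
    then show ?thesis by (simp add: mult.assoc mult.left_commute[of "weiss r2"])
  qed
  finally show ?thesis .
qed

text \<open>While the squared distance n to the cone is at most \<delta>, the inequality
  \<open>epi\<close> limits the drift of the profile by W / \<beta>, which is too little to carry n
  up to \<delta>. Once all small radii are covered, comparison with \<open>R j\<close> for large j
  bounds n by 2 W / \<beta>.\<close>

lemma prof_converges:
  assumes sep: "separated l a b" and \<delta>: "0 < \<delta>" and \<beta>: "0 < \<beta>"
    and epi: "\<And>r. 0 < r \<Longrightarrow> r < \<rho> \<Longrightarrow> integral {-pi..pi} (\<lambda>\<theta>. (prof r \<theta> - cone_profile a b \<theta>)\<^sup>2) \<le> \<delta> \<Longrightarrow>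
      (4 + \<beta>) * weiss r \<le> sphere_energy r + 4 * pi"
    and R: "filterlim R (at_right 0) sequentially"
    and w0: "(\<lambda>j. weiss (R j)) \<longlonglongrightarrow> 0"
    and n0: "(\<lambda>j. integral {-pi..pi} (\<lambda>\<theta>. (prof (R j) \<theta> - cone_profile a b \<theta>)\<^sup>2)) \<longlonglongrightarrow> 0"
  shows "((\<lambda>r. integral {-pi..pi} (\<lambda>\<theta>. (prof r \<theta> - cone_profile a b \<theta>)\<^sup>2)) \<longlongrightarrow> 0) (at_right 0)"
proof -
  define n where "n r = integral {-pi..pi} (\<lambda>\<theta>. (prof r \<theta> - cone_profile a b \<theta>)\<^sup>2)" for r
  have n0: "(\<lambda>j. n (R j)) \<longlonglongrightarrow> 0" using n0 by (simp add: n_def)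
  have Rev: "\<forall>\<^sub>F j in sequentially. 0 < R j \<and> R j < c" if "0 < c" for c
  proof -
    have "\<forall>\<^sub>F j in sequentially. R j \<in> {0<..} \<and> R j \<noteq> 0" "R \<longlonglongrightarrow> 0"
      using R by (auto simp: filterlim_at)
    from this(1) order_tendstoD(2)[OF this(2) that] show ?thesis by eventually_elim auto
  qed
  have ci: "(\<lambda>\<theta>. (prof r \<theta> - cone_profile a b \<theta>)\<^sup>2) integrable_on {-pi..pi}"
    "(\<lambda>\<theta>. (prof r \<theta> - prof s \<theta>)\<^sup>2) integrable_on {-pi..pi}" if "0 < r" "r < \<rho>" "0 < s" "s < \<rho>" for r s
    by (intro integrable_continuous_interval continuous_intros continuous_on_cone_profile; use that in auto)+
  have n_nonneg: "0 \<le> n r" if "0 < r" "r < \<rho>" for r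
    unfolding n_def by (intro integral_nonneg ci[OF that that]) auto
  have tri: "n r \<le> 2 * n s + 2 * e" if "0 < r" "r < \<rho>" "0 < s" "s < \<rho>"
    and e: "integral {-pi..pi} (\<lambda>\<theta>. (prof r \<theta> - prof s \<theta>)\<^sup>2) \<le> e" for r s e
  proof -
    have "n r \<le> integral {-pi..pi} (\<lambda>\<theta>. 2 * (prof s \<theta> - cone_profile a b \<theta>)\<^sup>2 + 2 * (prof r \<theta> - prof s \<theta>)\<^sup>2)"
      unfolding n_def
    proof (rule integral_le)
      fix \<theta>
      show "(prof r \<theta> - cone_profile a b \<theta>)\<^sup>2 \<le> 2 * (prof s \<theta> - cone_profile a b \<theta>)\<^sup>2 + 2 * (prof r \<theta> - prof s \<theta>)\<^sup>2"
        using norm_add_squared_le[of "prof s \<theta> - cone_profile a b \<theta>" "prof r \<theta> - prof s \<theta>"] by simp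
    qed (use ci that in \<open>auto intro!: integrable_add integrable_on_mult_right\<close>)
    also have "\<dots> = 2 * n s + 2 * integral {-pi..pi} (\<lambda>\<theta>. (prof r \<theta> - prof s \<theta>)\<^sup>2)"
      unfolding n_def using ci that
      by (subst Henstock_Kurzweil_Integration.integral_add) (auto intro!: integrable_on_mult_right)
    finally show ?thesis using e by simp
  qed
  \<comment> \<open>By monotonicity the value at r bounds the values at all smaller
    \<open>R j\<close>, and these tend to 0.\<close>
  have nonneg: "0 \<le> weiss r" if r: "0 < r" "r < \<rho>" for r
  proof (rule tendsto_upperbound[OF w0])
    show "\<forall>\<^sub>F j in sequentially. weiss (R j) \<le> weiss r"
      using Rev[OF r(1)] by eventually_elim (use weiss_mono[OF _ _ r(2) sep] in auto)
  qed simp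
  have "\<forall>\<^sub>F j in sequentially. 2 * n (R j) + 2 * (weiss (R j) / \<beta>) < \<delta>"
  proof -
    have "(\<lambda>j. 2 * n (R j) + 2 * (weiss (R j) / \<beta>)) \<longlonglongrightarrow> 2 * 0 + 2 * (0 / \<beta>)"
      by (intro tendsto_intros n0 w0) (use \<beta> in auto)
    then show ?thesis using \<delta> by (auto dest: order_tendstoD(2)[of _ _ _ \<delta>])
  qed
  then have "\<forall>\<^sub>F j in sequentially. 2 * n (R j) + 2 * (weiss (R j) / \<beta>) < \<delta> \<and> 0 < R j \<and> R j < \<rho>"
    using Rev[OF \<rho>] by eventually_elim auto
  then obtain j where j: "2 * n (R j) + 2 * (weiss (R j) / \<beta>) < \<delta>" "0 < R j" "R j < \<rho>"
    using eventually_happens[of _ sequentially] by auto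
  \<comment> \<open>A starting radius at which distance and possible drift, each doubled by the
    squared triangle inequality, sum to less than \<delta>.\<close>
  define r2 where "r2 = R j"
  have r2: "0 < r2" "r2 < \<rho>" "2 * n r2 + 2 * (weiss r2 / \<beta>) < \<delta>" using j by (auto simp: r2_def)
  have n2: "n r2 < \<delta>"
  proof -
    have "0 \<le> weiss r2 / \<beta>" using nonneg[OF r2(1,2)] \<beta> by simp
    then show ?thesis using r2(3) n_nonneg[OF r2(1,2)] by linarith
  qed
  have cn: "continuous_on {0<..<\<rho>} n"
    unfolding n_def[abs_def]
    by (intro continuous_on_integral_param continuous_intros continuous_on_compose2[OF continuous_on_cone_profile[of UNIV]]) auto
  have small: "n r \<le> \<delta>" if r: "0 < r" "r \<le> r2" for r
  proof (rule ccontr)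
    assume "\<not> n r \<le> \<delta>"
    then have nr: "\<delta> < n r" by simp
    have cn': "continuous_on {s..r2} n" if "r \<le> s" for s
      by (rule continuous_on_subset[OF cn]) (use that r r2 in auto)
    \<comment> \<open>The largest element s of this compact set is the first radius, coming down
      from \<open>r2\<close>, at which the level \<delta> is reached. Between s and
      \<open>r2\<close> the distance stays at most \<delta>, so the drift estimate applies and
      contradicts n s = \<delta>.\<close>
    define S where "S = {s \<in> {r..r2}. n s = \<delta>}"
    have "\<exists>s. r \<le> s \<and> s \<le> r2 \<and> n s = \<delta>"
      by (rule IVT2') (use nr n2 r cn' in auto)
    then have "S \<noteq> {}" by (auto simp: S_def)
    moreover have "compact S"
    proof -
      have "S = {r..r2} \<inter> n -` {\<delta>}" by (auto simp: S_def)
      then have "closed S" using continuous_closed_preimage[OF cn'[OF order_refl], of "{\<delta>}"] by simp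
      moreover have "bounded S" by (rule bounded_subset[OF bounded_closed_interval[of r r2]]) (auto simp: S_def)
      ultimately show ?thesis by (simp add: compact_eq_bounded_closed)
    qed
    ultimately obtain s where s: "s \<in> S" "\<And>t. t \<in> S \<Longrightarrow> t \<le> s"
      using compact_attains_sup[of S] by blast
    have s': "r \<le> s" "s \<le> r2" "n s = \<delta>" using s(1) by (auto simp: S_def)
    have "s < r2" using s' n2 by (cases "s = r2") auto
    have le: "n t \<le> \<delta>" if "s \<le> t" "t \<le> r2" for t
    proof (rule ccontr)
      assume "\<not> n t \<le> \<delta>"
      then have "\<exists>x. t \<le> x \<and> x \<le> r2 \<and> n x = \<delta>"
        by (intro IVT2') (use n2 that s' cn' in auto)
      then obtain x where x: "t \<le> x" "x \<le> r2" "n x = \<delta>" by blast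
      then have "x \<in> S" using that s' by (auto simp: S_def)
      then have "x \<le> s" by (rule s(2))
      then have "t = s" using x that by simp
      then show False using s' \<open>\<not> n t \<le> \<delta>\<close> by simp
    qed
    have d: "integral {-pi..pi} (\<lambda>\<theta>. (prof r2 \<theta> - prof s \<theta>)\<^sup>2) \<le> weiss r2 / \<beta>"
    proof (rule prof_distance_le)
      show "(4 + \<beta>) * weiss t \<le> sphere_energy t + 4 * pi" if "s \<le> t" "t \<le> r2" for t
        using le[OF that] that s' r r2 by (intro epi) (auto simp: n_def)
    qed (use s' r r2 \<beta> \<open>s < r2\<close> nonneg in auto)
    have "n s \<le> 2 * n r2 + 2 * (weiss r2 / \<beta>)"
      by (rule tri) (use s' r r2 d in \<open>auto simp: power2_commute\<close>)
    then show False using s' r2 by simp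
  qed
  \<comment> \<open>The triangle inequality with \<open>R j\<close> in place of the smaller radius,
    where n (R j) disappears in the limit.\<close>
  have bound_n: "n r \<le> 2 * (weiss r / \<beta>)" if r: "0 < r" "r < r2" for r
  proof (rule tendsto_lowerbound)
    show "(\<lambda>j. 2 * n (R j) + 2 * (weiss r / \<beta>)) \<longlonglongrightarrow> 2 * (weiss r / \<beta>)"
      using tendsto_add[OF tendsto_mult_left[OF n0, of 2] tendsto_const] by simp
    show "\<forall>\<^sub>F j in sequentially. n r \<le> 2 * n (R j) + 2 * (weiss r / \<beta>)"
      using Rev[OF r(1)]
    proof eventually_elim
      case (elim i)
      have "integral {-pi..pi} (\<lambda>\<theta>. (prof r \<theta> - prof (R i) \<theta>)\<^sup>2) \<le> weiss r / \<beta>"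
      proof (rule prof_distance_le)
        show "(4 + \<beta>) * weiss t \<le> sphere_energy t + 4 * pi" if "R i \<le> t" "t \<le> r" for t
          using small[of t] that elim r r2 by (intro epi) (auto simp: n_def)
      qed (use elim r r2 \<beta> nonneg in auto)
      then show ?case by (intro tri) (use elim r r2 in auto)
    qed
  qed simp
  have "(weiss \<longlongrightarrow> 0) (at_right 0)"
  proof (rule tendstoI)
    fix e :: real assume "e > 0"
    have "\<forall>\<^sub>F j in sequentially. weiss (R j) < e \<and> 0 < R j \<and> R j < \<rho>"
      using order_tendstoD(2)[OF w0 \<open>e > 0\<close>] Rev[OF \<rho>] by eventually_elim auto
    then obtain i where i: "weiss (R i) < e" "0 < R i" "R i < \<rho>"
      using eventually_happens[of _ sequentially] by auto
    show "\<forall>\<^sub>F r in at_right 0. dist (weiss r) 0 < e"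
      unfolding eventually_at_right_field
    proof (intro exI[of _ "R i"] conjI allI impI i)
      fix r assume "0 < r" "r < R i"
      then show "dist (weiss r) 0 < e"
        using weiss_mono[of r "R i" l a b] nonneg[of r] i sep by (simp add: dist_real_def)
    qed
  qed
  then have "((\<lambda>r. 2 * (weiss r / \<beta>)) \<longlongrightarrow> 2 * (0 / \<beta>)) (at_right 0)"
    by (intro tendsto_intros) (use \<beta> in auto)
  then have lim: "((\<lambda>r. 2 * (weiss r / \<beta>)) \<longlongrightarrow> 0) (at_right 0)" by simp
  have "(n \<longlongrightarrow> 0) (at_right 0)"
  proof (rule tendsto_sandwich[OF _ _ tendsto_const lim])
    show "\<forall>\<^sub>F r in at_right 0. 0 \<le> n r"
      unfolding eventually_at_right_field using r2 n_nonneg by (intro exI[of _ r2]) auto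
    show "\<forall>\<^sub>F r in at_right 0. n r \<le> 2 * (weiss r / \<beta>)"
      unfolding eventually_at_right_field using r2 bound_n by (intro exI[of _ r2]) auto
  qed
  then show ?thesis by (simp add: n_def[abs_def])
qed

end

section \<open>Uniqueness of the blow-up\<close>

lemma C1_holder_imp_C1_on:
  assumes f: "f \<in> C1_holder \<gamma> S" and \<gamma>: "0 < \<gamma>"
  shows "C1_on S f"
proof -
  obtain M where M: "\<And>x y. x \<in> S \<Longrightarrow> y \<in> S \<Longrightarrow> norm (gradient f x - gradient f y) \<le> M * dist x y powr \<gamma>"
    and d: "\<And>x. x \<in> S \<Longrightarrow> f differentiable (at x)"
    using f by (auto simp: C1_holder_def)
  have "continuous_on S (gradient f)"
    unfolding continuous_on_def
  proof
    fix x assume x: "x \<in> S"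
    have "((\<lambda>y. M * dist x y powr \<gamma>) \<longlongrightarrow> M * 0) (at x within S)"
    proof (intro tendsto_mult tendsto_const tendsto_zero_powrI)
      show "((\<lambda>y. dist x y) \<longlongrightarrow> 0) (at x within S)"
        using tendsto_dist[OF tendsto_const[of x] tendsto_ident_at[of x S]] by simp
    qed (use \<gamma> in auto)
    then have lim: "((\<lambda>y. M * dist x y powr \<gamma>) \<longlongrightarrow> 0) (at x within S)" by simp
    have "((\<lambda>y. gradient f x - gradient f y) \<longlongrightarrow> 0) (at x within S)"
    proof (rule Lim_null_comparison[OF _ lim])
      show "\<forall>\<^sub>F y in at x within S. norm (gradient f x - gradient f y) \<le> M * dist x y powr \<gamma>"
        unfolding eventually_at_filter by (rule always_eventually) (simp add: M x)
    qed
    from tendsto_diff[OF tendsto_const[of "gradient f x"] this]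
    show "(gradient f \<longlongrightarrow> gradient f x) (at x within S)" by simp
  qed
  then show ?thesis using d by (simp add: C1_on_def)
qed

lemma rescaling_has_derivative:
  assumes "0 < s" "u differentiable (at (s *\<^sub>R x))"
  shows "(rescaling u s has_derivative (\<lambda>h. (1 / s) *\<^sub>R gradient u (s *\<^sub>R x) \<bullet> h)) (at x)"
proof -
  have "((\<lambda>x. s *\<^sub>R x) has_derivative (\<lambda>h. s *\<^sub>R h)) (at x)" by (auto intro!: derivative_eq_intros)
  from has_derivative_compose[OF this has_derivative_gradient[OF assms(2)]]
  have "((\<lambda>x. (1 / s\<^sup>2) * u (s *\<^sub>R x)) has_derivative (\<lambda>h. (1 / s\<^sup>2) * (gradient u (s *\<^sub>R x) \<bullet> (s *\<^sub>R h)))) (at x)"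
    by (rule has_derivative_mult_right)
  then show ?thesis
    unfolding rescaling_def[abs_def] using assms(1) by (simp add: power2_eq_square)
qed

lemma C1_on_rescaling:
  fixes u :: "'a::euclidean_space \<Rightarrow> real"
  assumes s: "0 < s" and f: "C1_on (ball 0 1) (rescaling u s)"
  shows "C1_on (ball 0 s) u"
proof (rule C1_onI)
  let ?g = "rescaling u s"
  have b: "(1 / s) *\<^sub>R x \<in> ball 0 1" if "x \<in> ball 0 s" for x :: 'a
    using that s by (simp add: dist_norm field_simps)
  show "(u has_derivative (\<lambda>h. s *\<^sub>R gradient ?g ((1 / s) *\<^sub>R x) \<bullet> h)) (at x)" if x: "x \<in> ball 0 s" for x
  proof -
    have "((\<lambda>x. (1 / s) *\<^sub>R x) has_derivative (\<lambda>h. (1 / s) *\<^sub>R h)) (at x)" by (auto intro!: derivative_eq_intros)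
    moreover have "?g differentiable (at ((1 / s) *\<^sub>R x))" using f b[OF x] by (simp add: C1_on_def)
    ultimately have "((\<lambda>x. s\<^sup>2 * ?g ((1 / s) *\<^sub>R x)) has_derivative (\<lambda>h. s\<^sup>2 * (gradient ?g ((1 / s) *\<^sub>R x) \<bullet> ((1 / s) *\<^sub>R h)))) (at x)"
      by (intro has_derivative_mult_right has_derivative_compose[OF _ has_derivative_gradient])
    moreover have "(\<lambda>x. s\<^sup>2 * ?g ((1 / s) *\<^sub>R x)) = u" using s by (auto simp: rescaling_def fun_eq_iff)
    ultimately show ?thesis using s by (simp add: power2_eq_square)
  qed
  have "continuous_on (ball 0 1) (gradient ?g)" using f by (simp add: C1_on_def)
  then have "continuous_on (ball 0 s) (\<lambda>x. gradient ?g ((1 / s) *\<^sub>R x))"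
    by (rule continuous_on_compose2) (use b in \<open>auto intro!: continuous_intros\<close>)
  then show "continuous_on (ball 0 s) (\<lambda>x. s *\<^sub>R gradient ?g ((1 / s) *\<^sub>R x))" by (intro continuous_intros)
qed

text \<open>Each of the three suprema must be known to be finite before it bounds its terms, and
  nonnegative before it may be dropped from the sum; membership of \<open>f\<close> and
  \<open>g\<close> in \<open>C1_holder\<close> supplies the finiteness.\<close>

lemma C1_holder_norm_bounds:
  fixes f g :: "'a::euclidean_space \<Rightarrow> real"
  assumes f: "f \<in> C1_holder \<gamma> S" and g: "g \<in> C1_holder \<gamma> S" and x: "x \<in> S"
  shows "\<bar>f x - g x\<bar> \<le> C1_holder_norm \<gamma> S (\<lambda>x. f x - g x)"
    "norm (gradient f x - gradient g x) \<le> C1_holder_norm \<gamma> S (\<lambda>x. f x - g x)"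
proof -
  obtain M where M: "\<And>x. x \<in> S \<Longrightarrow> \<bar>f x\<bar> \<le> M" "\<And>x. x \<in> S \<Longrightarrow> norm (gradient f x) \<le> M"
    "\<And>x y. x \<in> S \<Longrightarrow> y \<in> S \<Longrightarrow> norm (gradient f x - gradient f y) \<le> M * dist x y powr \<gamma>"
    and df: "\<And>x. x \<in> S \<Longrightarrow> f differentiable (at x)"
    using f by (auto simp: C1_holder_def)
  obtain M' where M': "\<And>x. x \<in> S \<Longrightarrow> \<bar>g x\<bar> \<le> M'" "\<And>x. x \<in> S \<Longrightarrow> norm (gradient g x) \<le> M'"
    "\<And>x y. x \<in> S \<Longrightarrow> y \<in> S \<Longrightarrow> norm (gradient g x - gradient g y) \<le> M' * dist x y powr \<gamma>"
    and dg: "\<And>x. x \<in> S \<Longrightarrow> g differentiable (at x)"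
    using g by (auto simp: C1_holder_def)
  have pos: "0 \<le> M" "0 \<le> M'" using M(1)[OF x] M'(1)[OF x] by auto
  let ?d = "\<lambda>x. f x - g x"
  have G: "gradient ?d y = gradient f y - gradient g y" if "y \<in> S" for y
    using gradient_diff[OF df dg] that by blast
  let ?q = "\<lambda>p. norm (gradient ?d (fst p) - gradient ?d (snd p)) / dist (fst p) (snd p) powr \<gamma>"
  have b1: "bdd_above ((\<lambda>x. \<bar>?d x\<bar>) ` S)"
    by (rule bdd_aboveI2[of _ _ "M + M'"]) (use M(1) M'(1) in \<open>smt (verit)\<close>)
  have b2: "bdd_above ((\<lambda>x. norm (gradient ?d x)) ` S)"
    by (rule bdd_aboveI2[of _ _ "M + M'"])
       (simp add: G, meson M(2) M'(2) add_mono norm_triangle_ineq4 order_trans)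
  have b3: "bdd_above (?q ` (S \<times> S))"
  proof (rule bdd_aboveI2[of _ _ "M + M'"])
    fix p assume "p \<in> S \<times> S"
    then obtain y z where p: "p = (y, z)" "y \<in> S" "z \<in> S" by auto
    show "?q p \<le> M + M'"
    proof (cases "y = z")
      case False
      have "norm (gradient ?d y - gradient ?d z) = norm ((gradient f y - gradient f z) - (gradient g y - gradient g z))"
        using p by (simp add: G algebra_simps)
      also have "\<dots> \<le> M * dist y z powr \<gamma> + M' * dist y z powr \<gamma>"
        using M(3)[OF p(2,3)] M'(3)[OF p(2,3)] norm_triangle_ineq4 by (smt (verit))
      finally show ?thesis using False p by (simp add: divide_le_eq distrib_right)
    qed (use p pos in simp)
  qed
  have S1: "\<bar>?d x\<bar> \<le> (SUP x\<in>S. \<bar>?d x\<bar>)" by (rule cSUP_upper[OF x b1])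
  have S2: "norm (gradient ?d x) \<le> (SUP x\<in>S. norm (gradient ?d x))" by (rule cSUP_upper[OF x b2])
  \<comment> \<open>A diagonal pair contributes 0 / 0 = 0, hence the supremum is
    nonnegative.\<close>
  have "?q (x, x) \<le> (SUP p\<in>S \<times> S. ?q p)" by (rule cSUP_upper[OF _ b3]) (use x in auto)
  then have S3: "0 \<le> (SUP p\<in>S \<times> S. ?q p)" by simp
  have N: "C1_holder_norm \<gamma> S ?d = (SUP x\<in>S. \<bar>?d x\<bar>) + (SUP x\<in>S. norm (gradient ?d x)) + (SUP p\<in>S \<times> S. ?q p)"
    by (simp add: C1_holder_norm_def split_beta)
  show "\<bar>f x - g x\<bar> \<le> C1_holder_norm \<gamma> S ?d"
    using S1 S2 S3 N norm_ge_zero[of "gradient ?d x"] by linarith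
  show "norm (gradient f x - gradient g x) \<le> C1_holder_norm \<gamma> S ?d"
    using S1 S2 S3 N G[OF x] abs_ge_zero[of "?d x"] by simp
qed

text \<open>\<open>a\<close> and \<open>b\<close> are the midpoints of the zones -pi - \<phi>2 \<le>
  2 \<theta> \<le> -\<phi>2 and \<phi>1 \<le> 2 \<theta> \<le> pi + \<phi>1, where the double cone
  passes from one obstacle to the other. The terms of \<open>l\<close> are the lengths of the outer
  contact zones and half the length of the middle one.\<close>

lemma double_cone_eq_profile:
  assumes "0 < \<phi>1" "\<phi>1 < pi" "0 < \<phi>2" "\<phi>2 < pi"
  defines "l \<equiv> min (min ((pi - \<phi>2) / 2) ((pi - \<phi>1) / 2)) ((\<phi>1 + \<phi>2) / 4)"
    and "a \<equiv> - \<phi>2 / 2 - pi / 4" and "b \<equiv> \<phi>1 / 2 + pi / 4"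
  shows "separated l a b" "double_cone \<phi>1 \<phi>2 x = (norm x)\<^sup>2 * cone_profile a b (arg x)"
proof -
  have l: "l \<le> (pi - \<phi>2) / 2" "l \<le> (pi - \<phi>1) / 2" "l \<le> (\<phi>1 + \<phi>2) / 4"
    unfolding l_def by (meson min.cobounded1 min.cobounded2 order_trans)+
  have "0 < l" unfolding l_def using assms(1-4) by (simp only: min_less_iff_conj) simp
  then show sep: "separated l a b"
    unfolding separated_def a_def b_def using l \<open>0 < l\<close> by (simp add: field_simps)
  define \<theta> where "\<theta> = arg x"
  have \<theta>: "Arg (Complex (x $ 1) (x $ 2)) = \<theta>" by (simp add: \<theta>_def arg_def)
  note p = cone_profile_pieces[OF sep, of \<theta>]
  have e: "a + pi / 4 = - \<phi>2 / 2" "b - pi / 4 = \<phi>1 / 2" "a - pi / 4 = - \<phi>2 / 2 - pi / 2" "b + pi / 4 = \<phi>1 / 2 + pi / 2"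
    by (simp_all add: a_def b_def field_simps)
  consider (1) "- \<phi>2 \<le> 2 * \<theta>" "2 * \<theta> \<le> \<phi>1"
    | (2) "\<not> (- \<phi>2 \<le> 2 * \<theta> \<and> 2 * \<theta> \<le> \<phi>1)" "\<phi>1 \<le> 2 * \<theta>" "2 * \<theta> \<le> pi + \<phi>1"
    | (3) "\<not> (- \<phi>2 \<le> 2 * \<theta> \<and> 2 * \<theta> \<le> \<phi>1)" "\<not> (\<phi>1 \<le> 2 * \<theta> \<and> 2 * \<theta> \<le> pi + \<phi>1)" "- pi - \<phi>2 \<le> 2 * \<theta>" "2 * \<theta> \<le> - \<phi>2"
    | (4) "\<not> (- \<phi>2 \<le> 2 * \<theta> \<and> 2 * \<theta> \<le> \<phi>1)" "\<not> (\<phi>1 \<le> 2 * \<theta> \<and> 2 * \<theta> \<le> pi + \<phi>1)" "\<not> (- pi - \<phi>2 \<le> 2 * \<theta> \<and> 2 * \<theta> \<le> - \<phi>2)"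
    by blast
  then show "double_cone \<phi>1 \<phi>2 x = (norm x)\<^sup>2 * cone_profile a b (arg x)"
  proof cases
    case 1
    then have "cone_profile a b \<theta> = 1" by (intro p(5)) (simp_all add: e)
    then show ?thesis using 1 by (simp add: double_cone_def \<theta> \<theta>_def[symmetric])
  next
    case 2
    then have "cone_profile a b \<theta> = sin (2 * (b - \<theta>))" by (intro p(9)) (simp_all add: e)
    also have "2 * (b - \<theta>) = pi / 2 - (2 * \<theta> - \<phi>1)" by (simp add: b_def algebra_simps)
    also have "sin (pi / 2 - (2 * \<theta> - \<phi>1)) = cos (2 * \<theta> - \<phi>1)" by (simp add: cos_sin_eq)
    finally show ?thesis unfolding double_cone_def Let_def \<theta> \<theta>_def[symmetric] using 2 by (simp only: if_True if_False simp_thms)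
  next
    case 3
    then have "cone_profile a b \<theta> = sin (2 * (\<theta> - a))" by (intro p(7)) (simp_all add: e)
    also have "2 * (\<theta> - a) = (2 * \<theta> + \<phi>2) + pi / 2" by (simp add: a_def algebra_simps)
    also have "sin ((2 * \<theta> + \<phi>2) + pi / 2) = cos (2 * \<theta> + \<phi>2)"
      by (simp only: sin_add[of _ "pi / 2"] cos_pi_half sin_pi_half mult_zero_right mult_1_right add_0)
    finally show ?thesis unfolding double_cone_def Let_def \<theta> \<theta>_def[symmetric] using 3 by (simp only: if_True if_False simp_thms)
  next
    case 4
    have "\<theta> \<le> a - pi / 4 \<or> b + pi / 4 \<le> \<theta>" unfolding e using 4 assms(1-4) by auto
    then have "cone_profile a b \<theta> = - 1" using p(1,3) by blast
    then show ?thesis unfolding double_cone_def Let_def \<theta> \<theta>_def[symmetric] using 4 by (simp only: if_True if_False simp_thms)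
  qed
qed

text \<open>The part of the ball where the inequality fails is open by continuity and negligible by
  hypothesis, hence empty.\<close>

lemma AE_lebesgue_on_ball_imp:
  fixes P :: "'a::euclidean_space \<Rightarrow> bool"
  assumes \<Omega>: "open \<Omega>" "ball 0 r \<subseteq> \<Omega>" and ae: "AE x in lebesgue_on \<Omega>. f x \<le> g x"
    and c: "continuous_on (ball 0 r) f" "continuous_on (ball 0 r) g" and x: "x \<in> ball 0 r"
  shows "f x \<le> (g x :: real)"
proof -
  have "AE x in lebesgue. x \<in> \<Omega> \<longrightarrow> f x \<le> g x"
    using ae \<Omega>(1) by (subst (asm) AE_restrict_space_iff) auto
  then obtain N where N: "negligible N" "{x. \<not> (x \<in> \<Omega> \<longrightarrow> f x \<le> g x)} \<subseteq> N"
    unfolding eventually_ae_filter_negligible by blast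
  define T where "T = {x \<in> ball 0 r. g x < f x}"
  obtain A where "open A" "A \<inter> ball 0 r = {x \<in> ball 0 r. g x < f x}"
    using open_Collect_less_Int[OF c(2,1)] by blast
  then have "open T" unfolding T_def by (metis open_Int open_ball)
  moreover have "negligible T"   proof (rule negligible_subset[OF N(1)], rule subsetI)
    fix y assume "y \<in> T"
    then have "y \<in> \<Omega>" "\<not> f y \<le> g y" using \<Omega>(2) by (auto simp: T_def)
    then show "y \<in> N" using N(2) by blast
  qed
  ultimately have "T = {}" using open_not_negligible by blast
  then show ?thesis using x by (force simp: T_def)
qed


text \<open>The bound is asked for only inside the interval, since it will be derived from polar
  formulas valid between -pi and pi; altering the integrand at two points is harmless.\<close>

lemma abs_integral_diff_le:
  fixes f g :: "real \<Rightarrow> real"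
  assumes "f integrable_on {s..t}" "g integrable_on {s..t}" "s \<le> t"
    and "\<And>x. s < x \<Longrightarrow> x < t \<Longrightarrow> \<bar>f x - g x\<bar> \<le> e" "0 \<le> e"
  shows "\<bar>integral {s..t} f - integral {s..t} g\<bar> \<le> (t - s) * e"
proof -
  define h where "h x = (if s < x \<and> x < t then f x - g x else 0)" for x
  have d: "(\<lambda>x. f x - g x) integrable_on {s..t}" using assms by (intro integrable_diff)
  have hi: "h integrable_on {s..t}"
    by (rule integrable_spike_finite[OF _ _ d, of "{s, t}"]) (auto simp: h_def)
  have "integral {s..t} f - integral {s..t} g = integral {s..t} (\<lambda>x. f x - g x)"
    using assms by (simp add: Henstock_Kurzweil_Integration.integral_diff)
  also have "\<dots> = integral {s..t} h" by (rule integral_cong_open) (simp add: h_def)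
  finally have eq: "integral {s..t} f - integral {s..t} g = integral {s..t} h" .
  have "norm (integral {s..t} h) \<le> integral {s..t} (\<lambda>x. e)"
    by (rule integral_norm_bound_integral[OF hi]) (use assms in \<open>auto simp: h_def\<close>)
  then show ?thesis using eq assms(3) by (simp add: mult.commute)
qed

lemma abs_cone_profile'_le: "\<bar>cone_profile' a b x\<bar> \<le> 4"
  using abs_csin'_le[of "2 * (x - a)"] abs_csin'_le[of "2 * (b - x)"]
  unfolding cone_profile'_def by linarith

lemma abs_square_diff: "\<bar>x\<^sup>2 - y\<^sup>2\<bar> = \<bar>x - y\<bar> * \<bar>x + y\<bar>" for x y :: real
  by (simp add: power2_eq_square square_diff_square_factored abs_mult mult.commute)

lemma abs_square_diff_le:
  fixes x y :: real
  assumes "\<bar>x - y\<bar> \<le> d" "\<bar>y\<bar> \<le> k"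
  shows "\<bar>x\<^sup>2 - y\<^sup>2\<bar> \<le> d * (d + 2 * k)"
proof -
  have "\<bar>x\<^sup>2 - y\<^sup>2\<bar> = \<bar>x - y\<bar> * \<bar>x + y\<bar>" by (rule abs_square_diff)
  also have "\<dots> \<le> d * (d + 2 * k)" using assms by (intro mult_mono) linarith+
  finally show ?thesis .
qed

lemma C1_on_cone:
  assumes "separated l a b"
  shows "C1_on (- {0}) (\<lambda>x. (norm x)\<^sup>2 * cone_profile a b (arg x))"
proof (rule C1_on_mult)
  show "C1_on (- {0}) (\<lambda>x::real^2. (norm x)\<^sup>2)"
    by (rule C1_on_radial[of _ "\<lambda>r. 2 * r"]) (auto intro!: derivative_eq_intros continuous_intros)
  have s: "0 < l" "- pi + l \<le> a - pi / 4" "a + pi / 4 + 2 * l \<le> b - pi / 4" "b + pi / 4 \<le> pi - l"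
    using assms by (auto simp: separated_def)
  show "C1_on (- {0}) (\<lambda>x. cone_profile a b (arg x))"
  proof (rule C1_on_angular[OF has_field_derivative_cone_profile continuous_on_cone_profile'])
    show "cone_profile a b \<theta> = - 1" if "pi - l \<le> \<bar>\<theta>\<bar>" "\<bar>\<theta>\<bar> \<le> pi" for \<theta>
    proof -
      have "\<theta> \<le> a - pi / 4 \<or> b + pi / 4 \<le> \<theta>" using that s by linarith
      then show ?thesis using cone_profile_pieces(1,3)[OF assms] by auto
    qed
    have "pi / 4 > 0" by simp
    then show "0 \<le> pi - l" using s by linarith
  qed (use s in simp)
qed

text \<open>Away from the origin the cone is C1; at the origin the factor |x|^2 absorbs the jump of
  the angle.\<close>

lemma continuous_on_cone:
  assumes "separated l a b"
  shows "continuous_on UNIV (\<lambda>x. (norm x)\<^sup>2 * cone_profile a b (arg x))"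
proof -
  let ?\<mu> = "\<lambda>x. (norm x)\<^sup>2 * cone_profile a b (arg x)"
  have "isCont ?\<mu> x" for x
  proof (cases "x = 0")
    case False
    then show ?thesis
      using C1_on_continuous_on[OF C1_on_cone[OF assms]] continuous_on_eq_continuous_at[of "- {0}" ?\<mu>] by auto
  next
    case True
    have "((\<lambda>x::real^2. (norm x)\<^sup>2) \<longlongrightarrow> (norm (0::real^2))\<^sup>2) (at 0)" by (intro tendsto_intros)
    then have "(?\<mu> \<longlongrightarrow> 0) (at 0)"
      by (intro Lim_null_comparison[of ?\<mu> "\<lambda>x. (norm x)\<^sup>2"])
         (auto simp: abs_mult intro!: always_eventually mult_left_le abs_cone_profile_le[OF assms])
    then show ?thesis using True by (simp add: isCont_def)
  qed
  then show ?thesis by (auto intro: continuous_at_imp_continuous_on)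
qed

lemma gradient_cone_polar:
  assumes "separated l a b" "0 < r" "- pi < \<theta>" "\<theta> < pi"
  defines "\<mu> \<equiv> \<lambda>x. (norm x)\<^sup>2 * cone_profile a b (arg x)"
  shows "gradient \<mu> (r *\<^sub>R er \<theta>) \<bullet> er \<theta> = 2 * r * cone_profile a b \<theta>"
    "gradient \<mu> (r *\<^sub>R er \<theta>) \<bullet> et \<theta> = r * cone_profile' a b \<theta>"
proof -
  have "r *\<^sub>R er \<theta> \<noteq> 0" using assms(2) norm_er(1)[of \<theta>] by (metis norm_zero scaleR_eq_0_iff less_irrefl zero_neq_one)
  then have d: "\<mu> differentiable (at (r *\<^sub>R er \<theta>))"
    using C1_on_cone[OF assms(1)] by (simp add: C1_on_def \<mu>_def)
  have \<mu>: "\<mu> (s *\<^sub>R er t) = s\<^sup>2 * cone_profile a b t" if "0 < s" "- pi < t" "t < pi" for s t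
    using that by (simp add: \<mu>_def arg_polar)
  have "((\<lambda>s. s\<^sup>2 * cone_profile a b \<theta>) has_field_derivative 2 * r * cone_profile a b \<theta>) (at r)"
    by (auto intro!: derivative_eq_intros)
  then have "((\<lambda>s. \<mu> (s *\<^sub>R er \<theta>)) has_field_derivative 2 * r * cone_profile a b \<theta>) (at r)"
    by (rule has_field_derivative_transform_within_open[of _ _ _ "{0<..}"]) (use assms(2-4) \<mu> in auto)
  then show "gradient \<mu> (r *\<^sub>R er \<theta>) \<bullet> er \<theta> = 2 * r * cone_profile a b \<theta>"
    using DERIV_unique has_field_derivative_along_ray[OF d] by blast
  have "((\<lambda>t. r\<^sup>2 * cone_profile a b t) has_field_derivative r\<^sup>2 * cone_profile' a b \<theta>) (at \<theta>)"
    by (intro DERIV_cmult has_field_derivative_cone_profile)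
  then have "((\<lambda>t. \<mu> (r *\<^sub>R er t)) has_field_derivative r\<^sup>2 * cone_profile' a b \<theta>) (at \<theta>)"
    by (rule has_field_derivative_transform_within_open[of _ _ _ "{-pi<..<pi}"]) (use assms(2-4) \<mu> in auto)
  then have "r * (gradient \<mu> (r *\<^sub>R er \<theta>) \<bullet> et \<theta>) = r\<^sup>2 * cone_profile' a b \<theta>"
    using DERIV_unique has_field_derivative_along_circle[OF d] by blast
  then show "gradient \<mu> (r *\<^sub>R er \<theta>) \<bullet> et \<theta> = r * cone_profile' a b \<theta>"
    using assms(2) by (simp add: power2_eq_square)
qed

context conical_minimizer
begin

text \<open>Closeness is known on the open unit ball, so energy and trace are evaluated at half the
  radius, inside that ball. The gradients control the Dirichlet part, the values the trace
  part.\<close>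

lemma close_to_cone:
  assumes sep: "separated l a b" and s: "0 < s" "s < \<rho>" and e: "0 \<le> e" "e \<le> 1"
  defines "\<mu> \<equiv> \<lambda>x. (norm x)\<^sup>2 * cone_profile a b (arg x)"
  assumes close: "\<And>x. x \<in> ball 0 1 \<Longrightarrow> \<bar>rescaling u s x - \<mu> x\<bar> \<le> e"
    "\<And>x. x \<in> ball 0 1 \<Longrightarrow> norm (gradient (rescaling u s) x - gradient \<mu> x) \<le> e"
  shows "\<bar>weiss (s / 2)\<bar> \<le> 88 * pi * e"
    "integral {-pi..pi} (\<lambda>\<theta>. (prof (s / 2) \<theta> - cone_profile a b \<theta>)\<^sup>2) \<le> 32 * pi * e"
proof -
  define R where "R = s / 2"
  have R: "0 < R" "R < \<rho>" "s = 2 * R" using s by (auto simp: R_def)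
  define p where "p = cone_profile a b"
  define p' where "p' = cone_profile' a b"
  have c: "continuous_on S p" "continuous_on S p'" for S
    by (auto simp: p_def p'_def intro: continuous_on_cone_profile continuous_on_cone_profile')
  have pb: "\<bar>p \<theta>\<bar> \<le> 1" "\<bar>p' \<theta>\<bar> \<le> 4" for \<theta>
    using abs_cone_profile_le[OF sep] abs_cone_profile'_le by (auto simp: p_def p'_def)
  \<comment> \<open>The factor 4 is 1 / |x|^2 at |x| = 1/2.\<close>
  have prof: "\<bar>prof R \<theta> - p \<theta>\<bar> \<le> 4 * e" if \<theta>: "- pi < \<theta>" "\<theta> < pi" for \<theta>
  proof -
    let ?x = "(1 / 2) *\<^sub>R er \<theta>"
    have "?x \<in> ball 0 1" by simp
    then have "\<bar>rescaling u s ?x - \<mu> ?x\<bar> \<le> e" by (rule close)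
    moreover have "prof R \<theta> = 4 * rescaling u s ?x" using R by (simp add: rescaling_def power2_eq_square)
    moreover have "p \<theta> = 4 * \<mu> ?x" using \<theta> by (simp add: \<mu>_def p_def arg_polar power2_eq_square)
    ultimately show ?thesis by (simp add: abs_le_iff)
  qed
  have i: "(\<lambda>\<theta>. (prof R \<theta> - p \<theta>)\<^sup>2) integrable_on {-pi..pi}" "(\<lambda>\<theta>. (prof R \<theta>)\<^sup>2) integrable_on {-pi..pi}"
    "(\<lambda>\<theta>. (p \<theta>)\<^sup>2) integrable_on {-pi..pi}" "(\<lambda>\<theta>. (p' \<theta>)\<^sup>2) integrable_on {-pi..pi}"
    "(\<lambda>\<theta>. 4 * (p \<theta>)\<^sup>2 + (p' \<theta>)\<^sup>2) integrable_on {-pi..pi}"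
    by (intro integrable_continuous_interval continuous_intros c; use R in auto)+
  have "\<bar>integral {-pi..pi} (\<lambda>\<theta>. (prof R \<theta> - p \<theta>)\<^sup>2) - integral {-pi..pi} (\<lambda>\<theta>. 0)\<bar> \<le> (pi - (- pi)) * (16 * e)"
  proof (rule abs_integral_diff_le[OF i(1)])
    fix \<theta> assume "- pi < \<theta>" "\<theta> < pi"
    then have "\<bar>(prof R \<theta> - p \<theta>)\<^sup>2\<bar> \<le> (4 * e)\<^sup>2" using power_mono[OF prof[of \<theta>] abs_ge_zero, of 2] by simp
    also have "\<dots> \<le> 16 * e" using e by (simp add: power2_eq_square mult_left_le)
    finally show "\<bar>(prof R \<theta> - p \<theta>)\<^sup>2 - 0\<bar> \<le> 16 * e" by simp
  qed (use e in auto)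
  then have "\<bar>integral {-pi..pi} (\<lambda>\<theta>. (prof R \<theta> - p \<theta>)\<^sup>2)\<bar> \<le> 32 * pi * e" by simp
  then show "integral {-pi..pi} (\<lambda>\<theta>. (prof (s / 2) \<theta> - cone_profile a b \<theta>)\<^sup>2) \<le> 32 * pi * e"
    unfolding R_def p_def by (simp only: abs_le_iff)
  define K where "K = integral {-pi..pi} (\<lambda>\<theta>. 4 * (p \<theta>)\<^sup>2 + (p' \<theta>)\<^sup>2)"
  define P where "P = integral {-pi..pi} (\<lambda>\<theta>. (p \<theta>)\<^sup>2)"
  have KP: "K = 8 * P - 4 * pi"
  proof -
    have "integral {-pi..pi} (\<lambda>\<theta>. (p' \<theta>)\<^sup>2 - 4 * (p \<theta>)\<^sup>2) = - 4 * pi"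
      unfolding p_def p'_def by (rule cone_profile_energy[OF sep])
    then have "integral {-pi..pi} (\<lambda>\<theta>. (p' \<theta>)\<^sup>2) - 4 * P = - 4 * pi"
      unfolding P_def using i by (subst (asm) Henstock_Kurzweil_Integration.integral_diff) (auto intro: integrable_on_mult_right)
    moreover have "K = 4 * P + integral {-pi..pi} (\<lambda>\<theta>. (p' \<theta>)\<^sup>2)"
      unfolding K_def P_def using i by (subst Henstock_Kurzweil_Integration.integral_add) (auto intro: integrable_on_mult_right)
    ultimately show ?thesis by simp
  qed
  have T: "\<bar>trace_norm R / R ^ 4 - P\<bar> \<le> 16 * pi * e"
  proof -
    have "trace_norm R / R ^ 4 = integral {-pi..pi} (\<lambda>\<theta>. (prof R \<theta>)\<^sup>2)"
    proof -
      have "(\<lambda>\<theta>. (prof R \<theta>)\<^sup>2) = (\<lambda>\<theta>. (u (R *\<^sub>R er \<theta>))\<^sup>2 / R ^ 4)"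
        by (simp add: power_divide flip: power_mult)
      then show ?thesis by (simp add: trace_norm_def)
    qed
    moreover have "\<bar>integral {-pi..pi} (\<lambda>\<theta>. (prof R \<theta>)\<^sup>2) - integral {-pi..pi} (\<lambda>\<theta>. (p \<theta>)\<^sup>2)\<bar> \<le> (pi - (- pi)) * (8 * e)"
    proof (rule abs_integral_diff_le[OF i(2,3)])
      fix \<theta> assume \<theta>: "- pi < \<theta>" "\<theta> < pi"
      have "\<bar>(prof R \<theta>)\<^sup>2 - (p \<theta>)\<^sup>2\<bar> = \<bar>prof R \<theta> - p \<theta>\<bar> * \<bar>prof R \<theta> + p \<theta>\<bar>"
        by (rule abs_square_diff)
      also have "\<dots> \<le> (4 * e) * 2"
      proof (intro mult_mono prof[OF \<theta>])
        show "\<bar>prof R \<theta> + p \<theta>\<bar> \<le> 2" using pb(1)[of \<theta>] abs_prof_le[OF R(1,2), of \<theta>] by linarith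
      qed (use e in auto)
      finally show "\<bar>(prof R \<theta>)\<^sup>2 - (p \<theta>)\<^sup>2\<bar> \<le> 8 * e" by simp
    qed (use e in auto)
    ultimately show ?thesis by (simp add: P_def)
  qed
  \<comment> \<open>The radial and tangential components differ from those of the cone by at most s
    e, and the latter are at most 2 s and 4 s. The squares then differ by at most 2 (s e)^2 + 12 s^2
    e \<le> 14 s^2 e in total, and integration over the angle contributes 2 pi.\<close>
  have inner: "\<bar>integral {-pi..pi} (\<lambda>\<theta>. (ur r \<theta>)\<^sup>2 + (ut r \<theta>)\<^sup>2) - r\<^sup>2 * K\<bar> \<le> 28 * pi * s\<^sup>2 * e" if r: "0 < r" "r < R" for r
  proof -
    have eq: "r\<^sup>2 * K = integral {-pi..pi} (\<lambda>\<theta>. r\<^sup>2 * (4 * (p \<theta>)\<^sup>2 + (p' \<theta>)\<^sup>2))"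
      unfolding K_def by simp
    have "\<bar>integral {-pi..pi} (\<lambda>\<theta>. (ur r \<theta>)\<^sup>2 + (ut r \<theta>)\<^sup>2) - integral {-pi..pi} (\<lambda>\<theta>. r\<^sup>2 * (4 * (p \<theta>)\<^sup>2 + (p' \<theta>)\<^sup>2))\<bar>
      \<le> (pi - (- pi)) * (14 * s\<^sup>2 * e)"
    proof (rule abs_integral_diff_le)
      show "(\<lambda>\<theta>. (ur r \<theta>)\<^sup>2 + (ut r \<theta>)\<^sup>2) integrable_on {-pi..pi}"
        by (intro integrable_continuous_interval continuous_intros) (use r R in auto)
      show "(\<lambda>\<theta>. r\<^sup>2 * (4 * (p \<theta>)\<^sup>2 + (p' \<theta>)\<^sup>2)) integrable_on {-pi..pi}"
        by (intro integrable_continuous_interval continuous_intros c)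
      fix \<theta> assume \<theta>: "- pi < \<theta>" "\<theta> < pi"
      let ?x = "(r / s) *\<^sub>R er \<theta>"
      have rs: "0 < r / s" "r / s < 1" "r \<le> s" using r R by auto
      have sx: "s *\<^sub>R ?x = r *\<^sub>R er \<theta>" using s by simp
      have "u differentiable (at (s *\<^sub>R ?x))" unfolding sx by (rule differentiable_polar) (use r R in auto)
      from gradient_eqI[OF rescaling_has_derivative[OF s(1) this]]
      have G: "gradient u (r *\<^sub>R er \<theta>) = s *\<^sub>R gradient (rescaling u s) ?x" unfolding sx using s by simp
      have n: "norm (gradient (rescaling u s) ?x - gradient \<mu> ?x) \<le> e"
        by (rule close) (use rs in auto)
      have comp: "\<bar>(gradient (rescaling u s) ?x - gradient \<mu> ?x) \<bullet> v\<bar> \<le> e" if "norm v = 1" for v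
        using Cauchy_Schwarz_ineq2[of "gradient (rescaling u s) ?x - gradient \<mu> ?x" v] n that by simp
      note gp = gradient_cone_polar[OF sep rs(1) \<theta>, folded \<mu>_def p_def p'_def]
      have "\<bar>ur r \<theta> - 2 * r * p \<theta>\<bar> = s * \<bar>(gradient (rescaling u s) ?x - gradient \<mu> ?x) \<bullet> er \<theta>\<bar>"
      proof -
        have "ur r \<theta> - 2 * r * p \<theta> = s * ((gradient (rescaling u s) ?x - gradient \<mu> ?x) \<bullet> er \<theta>)"
          unfolding G inner_diff_left gp using s by (simp add: algebra_simps)
        then show ?thesis using s by (simp add: abs_mult)
      qed
      also have "\<dots> \<le> s * e" using comp[of "er \<theta>"] s by (intro mult_left_mono) auto
      finally have "\<bar>(ur r \<theta>)\<^sup>2 - (2 * r * p \<theta>)\<^sup>2\<bar> \<le> (s * e) * (s * e + 2 * (2 * s))"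
      proof (rule abs_square_diff_le)
        have "r * \<bar>p \<theta>\<bar> \<le> s * 1" using rs r pb by (intro mult_mono) auto
        then show "\<bar>2 * r * p \<theta>\<bar> \<le> 2 * s" using r by (simp add: abs_mult)
      qed
      moreover have "\<bar>ut r \<theta> - r * p' \<theta>\<bar> \<le> s * e"
      proof -
        have "ut r \<theta> - r * p' \<theta> = s * ((gradient (rescaling u s) ?x - gradient \<mu> ?x) \<bullet> et \<theta>)"
          unfolding G inner_diff_left gp using s by (simp add: algebra_simps)
        then have "\<bar>ut r \<theta> - r * p' \<theta>\<bar> = s * \<bar>(gradient (rescaling u s) ?x - gradient \<mu> ?x) \<bullet> et \<theta>\<bar>"
          using s by (simp add: abs_mult)
        also have "\<dots> \<le> s * e" using comp[of "et \<theta>"] s by (intro mult_left_mono) auto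
        finally show ?thesis .
      qed
      then have "\<bar>(ut r \<theta>)\<^sup>2 - (r * p' \<theta>)\<^sup>2\<bar> \<le> (s * e) * (s * e + 2 * (s * 4))"
      proof (rule abs_square_diff_le)
        show "\<bar>r * p' \<theta>\<bar> \<le> s * 4" unfolding abs_mult using rs r pb by (intro mult_mono) auto
      qed
      moreover have "(s * e) * (s * e + 2 * (2 * s)) + (s * e) * (s * e + 2 * (s * 4)) \<le> 14 * s\<^sup>2 * e"
      proof -
        have "e * e \<le> e * 1" using e by (intro mult_left_mono) auto
        then have "s\<^sup>2 * (2 * (e * e) + 12 * e) \<le> s\<^sup>2 * (14 * e)" by (intro mult_left_mono) auto
        then show ?thesis by (simp add: power2_eq_square algebra_simps)
      qed
      moreover have "(2 * r * p \<theta>)\<^sup>2 + (r * p' \<theta>)\<^sup>2 = r\<^sup>2 * (4 * (p \<theta>)\<^sup>2 + (p' \<theta>)\<^sup>2)"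
        by (simp add: power2_eq_square algebra_simps)
      ultimately show "\<bar>((ur r \<theta>)\<^sup>2 + (ut r \<theta>)\<^sup>2) - r\<^sup>2 * (4 * (p \<theta>)\<^sup>2 + (p' \<theta>)\<^sup>2)\<bar> \<le> 14 * s\<^sup>2 * e"
        by linarith
    qed (use e in auto)
    then show ?thesis unfolding eq by (rule order_trans) simp
  qed
  \<comment> \<open>Integrating 28 pi s^2 e r from 0 to R = s / 2 gives 56 pi e R^4.\<close>
  have Y: "\<bar>dirichlet R / R ^ 4 - K / 4\<bar> \<le> 56 * pi * e"
  proof -
    have cont: "continuous_on {0..R} (\<lambda>r. r * integral {-pi..pi} (\<lambda>\<theta>. (ur r \<theta>)\<^sup>2 + (ut r \<theta>)\<^sup>2))"
      using R by (intro continuous_on_mult continuous_on_id continuous_on_integral_param continuous_intros) auto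
    have c3: "((\<lambda>r. r ^ 3 * K) has_integral (R ^ 4 / 4) * K - (0 ^ 4 / 4) * K) {0..R}"
      by (rule has_integral_FTC) (use R in \<open>auto intro!: derivative_eq_intros\<close>)
    have d: "(\<lambda>r. r * integral {-pi..pi} (\<lambda>\<theta>. (ur r \<theta>)\<^sup>2 + (ut r \<theta>)\<^sup>2) - r ^ 3 * K) integrable_on {0..R}"
      using cont c3 by (intro integrable_diff) (auto intro: integrable_continuous_interval)
    have c1: "((\<lambda>r. r * (28 * pi * s\<^sup>2 * e)) has_integral (R\<^sup>2 / 2) * (28 * pi * s\<^sup>2 * e) - (0\<^sup>2 / 2) * (28 * pi * s\<^sup>2 * e)) {0..R}"
      by (rule has_integral_FTC) (use R in \<open>auto intro!: derivative_eq_intros\<close>)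
    have "norm (integral {0..R} (\<lambda>r. r * integral {-pi..pi} (\<lambda>\<theta>. (ur r \<theta>)\<^sup>2 + (ut r \<theta>)\<^sup>2) - r ^ 3 * K))
      \<le> integral {0..R} (\<lambda>r. r * (28 * pi * s\<^sup>2 * e))"
    proof (subst (1 2) integral_open_interval_real, rule integral_norm_bound_integral)
      show "(\<lambda>r. r * integral {-pi..pi} (\<lambda>\<theta>. (ur r \<theta>)\<^sup>2 + (ut r \<theta>)\<^sup>2) - r ^ 3 * K) integrable_on {0<..<R}"
        using d by (simp add: integrable_on_Icc_iff_Ioo)
      show "(\<lambda>r. r * (28 * pi * s\<^sup>2 * e)) integrable_on {0<..<R}"
        using c1 by (auto simp flip: integrable_on_Icc_iff_Ioo)
      fix r assume "r \<in> {0<..<R}"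
      then have r: "0 < r" "r < R" by auto
      have "r * integral {-pi..pi} (\<lambda>\<theta>. (ur r \<theta>)\<^sup>2 + (ut r \<theta>)\<^sup>2) - r ^ 3 * K
        = r * (integral {-pi..pi} (\<lambda>\<theta>. (ur r \<theta>)\<^sup>2 + (ut r \<theta>)\<^sup>2) - r\<^sup>2 * K)"
        by (simp add: power2_eq_square power3_eq_cube algebra_simps)
      also have "norm \<dots> = r * \<bar>integral {-pi..pi} (\<lambda>\<theta>. (ur r \<theta>)\<^sup>2 + (ut r \<theta>)\<^sup>2) - r\<^sup>2 * K\<bar>"
        using r by (simp add: abs_mult)
      also have "\<dots> \<le> r * (28 * pi * s\<^sup>2 * e)" using inner[OF r] r by (intro mult_left_mono) auto
      finally show "norm (r * integral {-pi..pi} (\<lambda>\<theta>. (ur r \<theta>)\<^sup>2 + (ut r \<theta>)\<^sup>2) - r ^ 3 * K) \<le> r * (28 * pi * s\<^sup>2 * e)" .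
    qed
    also have "\<dots> = R ^ 4 * (56 * pi * e)"
      using integral_unique[OF c1] by (simp add: R(3) power2_eq_square power4_eq_xxxx)
    also have "integral {0..R} (\<lambda>r. r * integral {-pi..pi} (\<lambda>\<theta>. (ur r \<theta>)\<^sup>2 + (ut r \<theta>)\<^sup>2) - r ^ 3 * K) = dirichlet R - R ^ 4 * (K / 4)"
    proof -
      have "((\<lambda>r. r * integral {-pi..pi} (\<lambda>\<theta>. (ur r \<theta>)\<^sup>2 + (ut r \<theta>)\<^sup>2)) has_integral dirichlet R) {0..R}"
        unfolding dirichlet_def by (intro integrable_integral integrable_continuous_interval cont)
      from has_integral_diff[OF this c3] show ?thesis by (simp add: integral_unique)
    qed
    finally have "\<bar>dirichlet R - R ^ 4 * (K / 4)\<bar> \<le> R ^ 4 * (56 * pi * e)" by simp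
    moreover have "dirichlet R - R ^ 4 * (K / 4) = R ^ 4 * (dirichlet R / R ^ 4 - K / 4)"
      using R by (simp add: right_diff_distrib)
    ultimately have "R ^ 4 * \<bar>dirichlet R / R ^ 4 - K / 4\<bar> \<le> R ^ 4 * (56 * pi * e)"
      using R by (simp add: abs_mult)
    then show ?thesis using R by (simp del: times_divide_eq_right)
  qed
  \<comment> \<open>The summand pi cancels against the cone values, as K / 4 - 2 P = - pi; the
    errors add up to 88 = 56 + 2 times 16.\<close>
  have "weiss R = (dirichlet R / R ^ 4 - K / 4) - 2 * (trace_norm R / R ^ 4 - P)"
    by (simp add: weiss_def KP diff_divide_distrib)
  moreover have "\<bar>X - 2 * Z\<bar> \<le> 88 * q" if "\<bar>X\<bar> \<le> 56 * q" "\<bar>Z\<bar> \<le> 16 * q" for X Z q :: real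
    using that by linarith
  ultimately have "\<bar>weiss R\<bar> \<le> 88 * (pi * e)" using Y T by (simp only: mult.assoc)
  then have "\<bar>weiss R\<bar> \<le> 88 * pi * e" by simp
  then show "\<bar>weiss (s / 2)\<bar> \<le> 88 * pi * e" by (simp add: R_def)
qed

text \<open>In polar coordinates the squared L2 distance on the unit disc is the integral over t in
  [0, 1] of t^5 times the squared profile distance at radius r t, and all these radii are at most
  r.\<close>

lemma L2_convergence:
  assumes sep: "separated l a b"
    and n: "((\<lambda>r. integral {-pi..pi} (\<lambda>\<theta>. (prof r \<theta> - cone_profile a b \<theta>)\<^sup>2)) \<longlongrightarrow> 0) (at_right 0)"
  shows "tendsto_L2 (ball 0 1) (rescaling u) (\<lambda>x. (norm x)\<^sup>2 * cone_profile a b (arg x)) (at_right 0)"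
proof -
  let ?\<mu> = "\<lambda>x. (norm x)\<^sup>2 * cone_profile a b (arg x)"
  have ball: "ball (0::real^2) 1 \<in> sets lebesgue" by simp
  have lint: "integrable (lebesgue_on (ball 0 1)) f" "(\<integral>x. f x \<partial>lebesgue_on (ball 0 1)) = integral (cball 0 1) f"
    if f: "continuous_on (cball 0 1) f" for f :: "real^2 \<Rightarrow> real"
  proof -
    have "integrable lborel (\<lambda>x. indicator (cball 0 1) x *\<^sub>R f x)"
      using f by (intro borel_integrable_compact) auto
    then have "integrable lebesgue (\<lambda>x. indicator (cball 0 1) x *\<^sub>R f x)"
      using integrable_completion by blast
    then have "f absolutely_integrable_on cball 0 1" by (simp add: set_integrable_def)
    then have "f absolutely_integrable_on ball 0 1"
      by (rule set_integrable_subset) auto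
    then show i: "integrable (lebesgue_on (ball 0 1)) f"
      by (simp add: integrable_restrict_space set_integrable_def)
    have "(\<integral>x. f x \<partial>lebesgue_on (ball 0 1)) = integral (ball 0 1) f"
      by (rule lebesgue_integral_eq_integral[OF i ball])
    also have "\<dots> = integral (cball 0 1) f"
    proof (rule integral_spike_set)
      show "negligible {x \<in> ball 0 1 - cball 0 1. f x \<noteq> 0}" by (rule negligible_subset[of "{}"]) auto
      show "negligible {x \<in> cball 0 1 - ball 0 1. f x \<noteq> 0}"
        by (rule negligible_subset[OF negligible_sphere[of 0 1]]) auto
    qed
    finally show "(\<integral>x. f x \<partial>lebesgue_on (ball 0 1)) = integral (cball 0 1) f" .
  qed
  have L2: "L2_on (ball 0 1) f" if f: "continuous_on (cball 0 1) f" for f :: "real^2 \<Rightarrow> real"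
  proof -
    have "f \<in> borel_measurable (lebesgue_on (ball 0 1))"
      by (rule continuous_imp_measurable_on_sets_lebesgue) (auto intro: continuous_on_subset[OF f])
    moreover have "integrable (lebesgue_on (ball 0 1)) (\<lambda>x. (norm (f x))\<^sup>2)"
      by (rule lint) (intro continuous_intros f)
    ultimately show ?thesis by (simp add: L2_on_def)
  qed
  have c\<mu>: "continuous_on (cball 0 1) ?\<mu>" by (rule continuous_on_subset[OF continuous_on_cone[OF sep]]) simp
  have cr: "continuous_on (cball 0 1) (rescaling u r)" if r: "0 < r" "r < \<rho>" for r
  proof -
    have "r * norm x < \<rho>" if "norm x \<le> 1" for x :: "real^2"
    proof -
      have "r * norm x \<le> r * 1" using that r by (intro mult_left_mono) auto
      then show ?thesis using r by linarith
    qed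
    then have "continuous_on (cball 0 1) (\<lambda>x. u (r *\<^sub>R x))"
      by (intro continuous_on_compose2[OF C1_on_continuous_on[OF C1]] continuous_intros) (use r in auto)
    then show ?thesis unfolding rescaling_def[abs_def] using r by (intro continuous_intros) auto
  qed
  have "((\<lambda>r. \<integral>x. (norm (rescaling u r x - ?\<mu> x))\<^sup>2 \<partial>lebesgue_on (ball 0 1)) \<longlongrightarrow> 0) (at_right 0)"
  proof (rule tendstoI)
    fix e :: real assume "e > 0"
    have "\<forall>\<^sub>F r in at_right 0. dist (integral {-pi..pi} (\<lambda>\<theta>. (prof r \<theta> - cone_profile a b \<theta>)\<^sup>2)) 0 < e / 2"
      using tendstoD[OF n, of "e / 2"] \<open>e > 0\<close> by simp
    then obtain d where d: "0 < d" "\<And>r. 0 < r \<Longrightarrow> r < d \<Longrightarrow> \<bar>integral {-pi..pi} (\<lambda>\<theta>. (prof r \<theta> - cone_profile a b \<theta>)\<^sup>2)\<bar> < e / 2"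
      unfolding eventually_at_right_field by auto
    show "\<forall>\<^sub>F r in at_right 0. dist (\<integral>x. (norm (rescaling u r x - ?\<mu> x))\<^sup>2 \<partial>lebesgue_on (ball 0 1)) 0 < e"
      unfolding eventually_at_right_field
    proof (intro exI[of _ "min d \<rho>"] conjI allI impI)
      fix r assume "0 < r" "r < min d \<rho>"
      then have r: "0 < r" "r < d" "r < \<rho>" by auto
      let ?F = "\<lambda>x. (norm (rescaling u r x - ?\<mu> x))\<^sup>2"
      have cF: "continuous_on (cball 0 1) ?F" by (intro continuous_intros cr r c\<mu>)
      have cpol: "continuous_on {0..1} (\<lambda>t. t * integral {-pi..pi} (\<lambda>\<theta>. ?F (t *\<^sub>R er \<theta>)))"
        by (intro continuous_on_mult continuous_on_id continuous_on_integral_param continuous_on_compose2[OF cF] continuous_intros) auto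
      have "(\<integral>x. ?F x \<partial>lebesgue_on (ball 0 1)) = integral (cball 0 1) ?F" by (rule lint[OF cF])
      also have "\<dots> = integral {0..1} (\<lambda>t. t * integral {-pi..pi} (\<lambda>\<theta>. ?F (t *\<^sub>R er \<theta>)))"
        by (rule integral_cball_polar[OF cF]) simp
      also have "\<dots> \<le> integral {0..1::real} (\<lambda>t. e / 2)"
      proof (rule integral_le)
        fix t :: real assume t: "t \<in> {0..1}"
        show "t * integral {-pi..pi} (\<lambda>\<theta>. ?F (t *\<^sub>R er \<theta>)) \<le> e / 2"
        proof (cases "t = 0")
          case False
          then have t: "0 < t" "t \<le> 1" using t by auto
          have rt: "0 < r * t" "r * t \<le> r" using r t by (auto simp: mult_left_le)
          have "integral {-pi..pi} (\<lambda>\<theta>. ?F (t *\<^sub>R er \<theta>)) = integral {-pi..pi} (\<lambda>\<theta>. t ^ 4 * (prof (r * t) \<theta> - cone_profile a b \<theta>)\<^sup>2)"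
          proof (rule integral_cong_open)
            fix \<theta> assume "- pi < \<theta>" "\<theta> < pi"
            then have "rescaling u r (t *\<^sub>R er \<theta>) - ?\<mu> (t *\<^sub>R er \<theta>) = t\<^sup>2 * (prof (r * t) \<theta> - cone_profile a b \<theta>)"
              using t r by (simp add: rescaling_def arg_polar power_mult_distrib right_diff_distrib)
            then show "?F (t *\<^sub>R er \<theta>) = t ^ 4 * (prof (r * t) \<theta> - cone_profile a b \<theta>)\<^sup>2"
              by (simp only: real_norm_def power2_abs power_mult_distrib) simp
          qed
          also have "\<dots> = t ^ 4 * integral {-pi..pi} (\<lambda>\<theta>. (prof (r * t) \<theta> - cone_profile a b \<theta>)\<^sup>2)" by simp
          finally have "t * integral {-pi..pi} (\<lambda>\<theta>. ?F (t *\<^sub>R er \<theta>)) = t ^ 5 * integral {-pi..pi} (\<lambda>\<theta>. (prof (r * t) \<theta> - cone_profile a b \<theta>)\<^sup>2)"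
            by (simp add: eval_nat_numeral)
          also have "\<dots> \<le> 1 * (e / 2)"
            using d(2)[of "r * t"] rt r t \<open>e > 0\<close>
            by (intro order_trans[OF mult_left_mono[of _ "e / 2"] mult_right_mono] power_le_one) auto
          finally show ?thesis by simp
        qed (use \<open>e > 0\<close> in simp)
      next
        show "(\<lambda>t. t * integral {-pi..pi} (\<lambda>\<theta>. ?F (t *\<^sub>R er \<theta>))) integrable_on {0..1}"
          by (rule integrable_continuous_interval[OF cpol])
      qed auto
      also have "\<dots> < e" using \<open>e > 0\<close> by simp
      finally show "dist (\<integral>x. ?F x \<partial>lebesgue_on (ball 0 1)) 0 < e" by (simp add: integral_nonneg_AE)
    qed (use d(1) \<rho> in simp)
  qed
  moreover have "\<forall>\<^sub>F r in at_right 0. L2_on (ball 0 1) (rescaling u r)"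
    unfolding eventually_at_right_field using \<rho> L2[OF cr] by (intro exI[of _ \<rho>]) auto
  ultimately show ?thesis using L2[OF c\<mu>] by (simp add: tendsto_L2_def)
qed

end

text \<open>Passage from the minimisation problem to the locale: the obstacle bounds, known almost
  everywhere, hold pointwise by continuity, and the weak gradient in the variational inequality is
  exchanged for the classical one on the ball.\<close>

lemma double_obstacle_conical_minimizer:
  fixes u :: "real^2 \<Rightarrow> real"
  assumes \<Omega>: "open \<Omega>" and u: "double_obstacle_solution \<Omega> (\<lambda>x. - (x $ 1)\<^sup>2 - (x $ 2)\<^sup>2) (\<lambda>x. (x $ 1)\<^sup>2 + (x $ 2)\<^sup>2) u"
    and \<rho>: "0 < \<rho>" "ball 0 \<rho> \<subseteq> \<Omega>" and C1: "C1_on (ball 0 \<rho>) u"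
  shows "conical_minimizer u \<rho>"
proof
  obtain g where "u \<in> admissible \<Omega> (\<lambda>x. - (x $ 1)\<^sup>2 - (x $ 2)\<^sup>2) (\<lambda>x. (x $ 1)\<^sup>2 + (x $ 2)\<^sup>2) g"
    using u by (auto simp: double_obstacle_solution_def)
  then obtain G where G: "has_W12_gradient \<Omega> u G"
    and ae: "AE x in lebesgue_on \<Omega>. - (x $ 1)\<^sup>2 - (x $ 2)\<^sup>2 \<le> u x \<and> u x \<le> (x $ 1)\<^sup>2 + (x $ 2)\<^sup>2"
    by (auto simp: admissible_def W12_def)
  have ae': "AE x in lebesgue_on \<Omega>. \<bar>u x\<bar> \<le> (norm x)\<^sup>2"
    using ae by eventually_elim (auto simp: norm_squared_real2 abs_le_iff)
  show "\<bar>u x\<bar> \<le> (norm x)\<^sup>2" if "x \<in> ball 0 \<rho>" for x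
    by (rule AE_lebesgue_on_ball_imp[OF \<Omega> \<rho>(2) ae' _ _ that]) (intro continuous_intros C1_on_continuous_on[OF C1])+
  show "0 \<le> (\<integral>x. gradient u x \<bullet> gradient \<zeta> x \<partial>lebesgue_on (ball 0 \<rho>))"
    if \<zeta>: "C1_on UNIV \<zeta>" "compact K" "K \<subseteq> ball 0 \<rho>" "\<And>x. x \<notin> K \<Longrightarrow> \<zeta> x = 0"
      and bd: "\<And>x. x \<in> ball 0 \<rho> \<Longrightarrow> \<bar>u x + \<zeta> x\<bar> \<le> (norm x)\<^sup>2" for \<zeta> K
  proof -
    have K: "K \<subseteq> \<Omega>" using \<zeta>(3) \<rho>(2) by simp
    have "AE x in lebesgue_on \<Omega>. - (x $ 1)\<^sup>2 - (x $ 2)\<^sup>2 \<le> u x + \<zeta> x \<and> u x + \<zeta> x \<le> (x $ 1)\<^sup>2 + (x $ 2)\<^sup>2"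
      using ae
    proof eventually_elim
      case (elim x)
      show ?case
      proof (cases "x \<in> K")
        case True
        then have "\<bar>u x + \<zeta> x\<bar> \<le> (norm x)\<^sup>2" using \<zeta>(3) by (intro bd) auto
        then show ?thesis unfolding norm_squared_real2 by linarith
      qed (use elim \<zeta>(4) in simp)
    qed
    from double_obstacle_weak_inequality[OF \<Omega> u G \<zeta>(1,2) K _ this]
    have "0 \<le> (\<integral>x. G x \<bullet> gradient \<zeta> x \<partial>lebesgue_on \<Omega>)" using \<zeta>(4) by blast
    also have "\<dots> = (\<integral>x. gradient u x \<bullet> gradient \<zeta> x \<partial>lebesgue_on (ball 0 \<rho>))"
      by (rule weak_gradient_eq_gradient[OF \<Omega> G open_ball \<rho>(2) C1 \<zeta>])
    finally show ?thesis .
  qed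
qed (use \<rho> C1 in auto)

theorem corollary4p9:
  fixes \<Omega> :: "(real^2) set" and u :: "real^2 \<Rightarrow> real" and \<phi>1 \<phi>2 \<gamma> :: real
  assumes "open \<Omega>" and "0 \<in> \<Omega>"
    and "double_obstacle_solution \<Omega>
           (\<lambda>x. - (x $ 1)\<^sup>2 - (x $ 2)\<^sup>2) (\<lambda>x. (x $ 1)\<^sup>2 + (x $ 2)\<^sup>2) u"
    and "0 < \<phi>1" and "\<phi>1 < pi" and "0 < \<phi>2" and "\<phi>2 < pi"
    and "0 < \<gamma>" and "\<gamma> < 1"
    and "is_blowup_at_0 \<gamma> u (double_cone \<phi>1 \<phi>2)"
  shows "tendsto_L2 (ball 0 1) (rescaling u) (double_cone \<phi>1 \<phi>2) (at_right 0)"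
proof -
  define a where "a = - \<phi>2 / 2 - pi / 4"
  define b where "b = \<phi>1 / 2 + pi / 4"
  define l where "l = min (min ((pi - \<phi>2) / 2) ((pi - \<phi>1) / 2)) ((\<phi>1 + \<phi>2) / 4)"
  define \<mu> where "\<mu> = (\<lambda>x. (norm x)\<^sup>2 * cone_profile a b (arg x))"
  note dc = double_cone_eq_profile[OF assms(4-7), folded a_def b_def l_def]
  have sep: "separated l a b" by (rule dc(1))
  have \<mu>: "double_cone \<phi>1 \<phi>2 = \<mu>" by (auto simp: \<mu>_def dc(2))
  obtain r :: "nat \<Rightarrow> real" where r: "filterlim r (at_right 0) sequentially"
    and lim: "tendsto_C1_holder \<gamma> (ball 0 1) (\<lambda>j. rescaling u (r j)) \<mu> sequentially"
    using assms(10) unfolding is_blowup_at_0_def \<mu> by blast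
  have r0: "\<forall>\<^sub>F j in sequentially. 0 < r j" and rlim: "r \<longlonglongrightarrow> 0"
    using r by (auto simp: filterlim_at elim: eventually_mono)
  have H\<mu>: "\<mu> \<in> C1_holder \<gamma> (ball 0 1)" and Hr: "\<forall>\<^sub>F j in sequentially. rescaling u (r j) \<in> C1_holder \<gamma> (ball 0 1)"
    and norm0: "(\<lambda>j. C1_holder_norm \<gamma> (ball 0 1) (\<lambda>x. rescaling u (r j) x - \<mu> x)) \<longlonglongrightarrow> 0"
    using lim by (auto simp: tendsto_C1_holder_def)
  \<comment> \<open>One rescaling that is C1 on the unit ball suffices to make \<open>u\<close>
    itself C1 on the ball of radius \<open>r i\<close>.\<close>
  obtain i where i: "0 < r i" "rescaling u (r i) \<in> C1_holder \<gamma> (ball 0 1)"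
    using eventually_happens[OF eventually_conj[OF r0 Hr]] by auto
  obtain d where d: "0 < d" "ball 0 d \<subseteq> \<Omega>" using assms(1,2) openE by blast
  define \<rho> where "\<rho> = min (r i) d"
  have \<rho>: "0 < \<rho>" "ball 0 \<rho> \<subseteq> \<Omega>" using i d by (auto simp: \<rho>_def)
  have "C1_on (ball 0 \<rho>) u"
    by (rule C1_on_subset[OF C1_on_rescaling[OF i(1) C1_holder_imp_C1_on[OF i(2) assms(8)]]]) (auto simp: \<rho>_def)
  then interpret conical_minimizer u \<rho>
    by (rule double_obstacle_conical_minimizer[OF assms(1,3) \<rho>])
  obtain \<delta> \<alpha> where \<delta>: "\<delta> > 0" "0 < \<alpha>" "\<alpha> \<le> 1"
    and sel: "\<And>c c'. (\<And>x. (c has_field_derivative c' x) (at x)) \<Longrightarrow> continuous_on UNIV c' \<Longrightarrow>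
      (\<And>x. x \<in> {-pi..pi} \<Longrightarrow> \<bar>c x\<bar> \<le> 1) \<Longrightarrow>
      integral {-pi..pi} (\<lambda>x. (c x - cone_profile a b x)\<^sup>2) \<le> \<delta>\<^sup>2 \<Longrightarrow>
      \<exists>a b. separated (l / 2) a b \<and>
        5 * \<alpha> * integral {-pi..pi} (\<lambda>x. (c x - cone_profile a b x)\<^sup>2)
        \<le> integral {-pi..pi} (\<lambda>x. cone_profile' a b x * (c' x - cone_profile' a b x) - 4 * cone_profile a b x * (c x - cone_profile a b x))
          + 3 / 2 * integral {-pi..pi} (\<lambda>x. (c' x - cone_profile' a b x)\<^sup>2 - 4 * (c x - cone_profile a b x)\<^sup>2)"
    apply (rule cone_profile_selection[OF sep])
    subgoal premises prems for \<delta> \<alpha> by (rule prems(1)[OF prems(2-4)]) (rule prems(5))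
    done
  \<comment> \<open>The centres of the selected profile may vary with the radius \<open>s\<close>,
    while smallness is always measured from the fixed limit cone.\<close>
  have epi: "(4 + \<alpha> / 2) * weiss s \<le> sphere_energy s + 4 * pi"
    if s: "0 < s" "s < \<rho>" and "integral {-pi..pi} (\<lambda>\<theta>. (prof s \<theta> - cone_profile a b \<theta>)\<^sup>2) \<le> \<delta>\<^sup>2" for s
    using sel[OF has_field_derivative_prof[OF s] continuous_on_prof'[OF s] abs_prof_le[OF s] that(3)]
      epiperimetric[OF s _ \<delta>(2,3)] by blast
  \<comment> \<open>Half radii, because \<open>close_to_cone\<close> controls the energy at
    \<open>r j / 2\<close>.\<close>
  have R: "filterlim (\<lambda>j. r j / 2) (at_right 0) sequentially"
    using r0 tendsto_divide[OF rlim tendsto_const[of 2]] by (auto simp: filterlim_at elim: eventually_mono)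
  have close: "\<forall>\<^sub>F j in sequentially. \<bar>weiss (r j / 2)\<bar> \<le> 88 * pi * e \<and>
      integral {-pi..pi} (\<lambda>\<theta>. (prof (r j / 2) \<theta> - cone_profile a b \<theta>)\<^sup>2) \<le> 32 * pi * e"
    if e: "0 < e" "e \<le> 1" for e
  proof -
    have "\<forall>\<^sub>F j in sequentially. C1_holder_norm \<gamma> (ball 0 1) (\<lambda>x. rescaling u (r j) x - \<mu> x) < e"
      by (rule order_tendstoD(2)[OF norm0 e(1)])
    moreover have "\<forall>\<^sub>F j in sequentially. r j < \<rho>" by (rule order_tendstoD(2)[OF rlim \<rho>(1)])
    ultimately show ?thesis using Hr r0
    proof eventually_elim
      case (elim j)
      have "\<bar>rescaling u (r j) x - \<mu> x\<bar> \<le> e" "norm (gradient (rescaling u (r j)) x - gradient \<mu> x) \<le> e"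
        if "x \<in> ball 0 1" for x
        using C1_holder_norm_bounds[OF elim(3) H\<mu> that] elim(1) by auto
      then show ?case
        using close_to_cone[OF sep elim(4,2) less_imp_le[OF e(1)] e(2)] unfolding \<mu>_def by auto
    qed
  qed
  have to0: "f \<longlonglongrightarrow> 0" if f: "\<And>e. 0 < e \<Longrightarrow> e \<le> 1 \<Longrightarrow> \<forall>\<^sub>F j in sequentially. \<bar>f j\<bar> \<le> C * e" and C: "0 < C"
    for f :: "nat \<Rightarrow> real" and C
  proof (rule tendstoI)
    fix e :: real assume "e > 0"
    define e' where "e' = min 1 (e / (2 * C))"
    have e': "0 < e'" "e' \<le> 1" using \<open>e > 0\<close> C by (auto simp: e'_def)
    have "C * e' \<le> C * (e / (2 * C))" using C by (intro mult_left_mono) (auto simp: e'_def)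
    also have "\<dots> < e" using C \<open>e > 0\<close> by simp
    finally show "\<forall>\<^sub>F j in sequentially. dist (f j) 0 < e"
      using f[OF e'] by (auto simp: dist_real_def elim!: eventually_mono)
  qed
  have "(\<lambda>j. weiss (r j / 2)) \<longlonglongrightarrow> 0"
  proof (rule to0[of _ "88 * pi"])
    fix e :: real assume "0 < e" "e \<le> 1"
    from close[OF this] show "\<forall>\<^sub>F j in sequentially. \<bar>weiss (r j / 2)\<bar> \<le> 88 * pi * e"
      by eventually_elim simp
  qed simp
  moreover have "(\<lambda>j. integral {-pi..pi} (\<lambda>\<theta>. (prof (r j / 2) \<theta> - cone_profile a b \<theta>)\<^sup>2)) \<longlonglongrightarrow> 0"
  proof (rule to0[of _ "32 * pi"])
    fix e :: real assume e: "0 < e" "e \<le> 1"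
    have "\<forall>\<^sub>F j in sequentially. r j < \<rho>" by (rule order_tendstoD(2)[OF rlim \<rho>(1)])
    with close[OF e] r0 show "\<forall>\<^sub>F j in sequentially. \<bar>integral {-pi..pi} (\<lambda>\<theta>. (prof (r j / 2) \<theta> - cone_profile a b \<theta>)\<^sup>2)\<bar> \<le> 32 * pi * e"
    proof eventually_elim
      case (elim j)
      have "0 \<le> integral {-pi..pi} (\<lambda>\<theta>. (prof (r j / 2) \<theta> - cone_profile a b \<theta>)\<^sup>2)"
        by (intro integral_nonneg integrable_continuous_interval continuous_intros continuous_on_cone_profile) (use elim in auto)
      then show ?case using elim by simp
    qed
  qed simp
  ultimately have "((\<lambda>r. integral {-pi..pi} (\<lambda>\<theta>. (prof r \<theta> - cone_profile a b \<theta>)\<^sup>2)) \<longlongrightarrow> 0) (at_right 0)"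
    using prof_converges[OF sep, of "\<delta>\<^sup>2" "\<alpha> / 2"] epi R \<delta> by simp
  then show ?thesis unfolding \<mu> \<mu>_def by (rule L2_convergence[OF sep])
qed

end
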